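(* Let $G$ be a graph with the maximum second largest eigenvalue $\lambda_2$ among all outerplanar connected graphs on $n$ vertices. If $n$ is odd, then $$G\in\begin{cases}\mathcal I\big(P_1\vee P_{\frac{n-1}{2}-1},\,P_1\vee P_{\frac{n-1}{2}-1}\big),&\text{when } n\ne13;\\ \mathcal I(H,H),&\text{when } n=13,\end{cases}$$ where $H$ is the graph on $6$ vertices obtained from $P_1\vee P_4$ by adding a new vertex and joining it to the two vertices of degree $3$ in $P_1\vee P_4$. If $n$ is even, then $$G\in\mathcal E(H_1,H_2)\quad\text{and}\quad \lambda_2(G)=\rho\big(P_1\vee P_{\frac n2-1}\big)-o(1),$$ where $H_1$ and $H_2$ are some edge-maximal outerplanar graphs, each on $\frac n2$ vertices (and $o(1)$ is as $n\to\infty$).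
   Context: Graphs are finite and simple; $\lambda_2(G)$ is the second largest adjacency eigenvalue (with multiplicity) and $\rho(G)$ is the largest one. $P_m$ is the path on $m$ vertices ($P_0$ is the empty graph), and $A\vee B$ is the join of disjoint graphs $A$ and $B$. An outerplanar graph is edge-maximal if adding any non-edge yields a graph that is not outerplanar. For disjoint graphs $A,B$: $\mathcal I(A,B)$ is the family of connected graphs obtained from the disjoint union of $A$ and $B$ by adding one new vertex and joining it to some vertices of $A$ and some vertices of $B$; $\mathcal E(A,B)$ is the family of graphs obtained from the disjoint union of $A$ and $B$ by adding one new edge between a vertex of $A$ and a vertex of $B$. *)

theory Defs
  imports
    "HOL-Analysis.Analysis"
    "HOL-Library.Landau_Symbols"
    "Graph_Theory.Graph_Theory"
    "Jordan_Normal_Form.Char_Poly"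
begin

text \<open>
  Finite simple graphs are the pair digraphs \<open>G\<close> with \<open>pair_graph G\<close> (finite, loop-free,
  symmetric): an undirected edge \<open>uv\<close> is the pair of arcs \<open>(u, v)\<close>, \<open>(v, u)\<close>.
\<close>

section \<open>Adjacency eigenvalues\<close>

definition adj_matrix :: "'a pair_pre_digraph \<Rightarrow> 'a list \<Rightarrow> real mat" where
  "adj_matrix G xs = Matrix.mat (length xs) (length xs)
     (\<lambda>(i, j). if (xs ! i, xs ! j) \<in> parcs G then 1 else 0)"

text \<open>
  The eigenvalues with multiplicity, as the multiset of roots of the characteristic polynomial;
  the chosen enumeration of the vertices does not matter, since a different one yields a
  permutation-similar matrix. The matrix is real symmetric, so no eigenvalue is lost by
  taking real roots only.
\<close>
definition adj_spectrum :: "'a pair_pre_digraph \<Rightarrow> real multiset" where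
  "adj_spectrum G =
     proots (char_poly (adj_matrix G (SOME xs. distinct xs \<and> set xs = pverts G)))"

definition eigenvalues_desc :: "'a pair_pre_digraph \<Rightarrow> real list" where
  "eigenvalues_desc G = rev (sorted_list_of_multiset (adj_spectrum G))"

text \<open>Meaningful for graphs with at least one, respectively two, vertices.\<close>

definition rho :: "'a pair_pre_digraph \<Rightarrow> real" where
  "rho G = eigenvalues_desc G ! 0"

definition lambda2 :: "'a pair_pre_digraph \<Rightarrow> real" where
  "lambda2 G = eigenvalues_desc G ! 1"

section \<open>Outerplanar graphs\<close>

text \<open>
  A plane drawing of \<open>G\<close>: vertices are distinct points, edges are simple arcs joining their
  endpoints and passing through no other vertex, and two different edges meet at most in the
  images of common endpoints. The two arcs of an undirected edge are drawn on the same curve.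
\<close>
definition plane_drawing ::
    "'a pair_pre_digraph \<Rightarrow> ('a \<Rightarrow> complex) \<Rightarrow> ('a \<times> 'a \<Rightarrow> real \<Rightarrow> complex) \<Rightarrow> bool" where
  "plane_drawing G p \<gamma> \<longleftrightarrow>
     inj_on p (pverts G) \<and>
     (\<forall>(u, v) \<in> parcs G.
        arc (\<gamma> (u, v)) \<and> pathstart (\<gamma> (u, v)) = p u \<and> pathfinish (\<gamma> (u, v)) = p v \<and>
        \<gamma> (v, u) = reversepath (\<gamma> (u, v)) \<and>
        path_image (\<gamma> (u, v)) \<inter> p ` pverts G = {p u, p v}) \<and>
     (\<forall>(u, v) \<in> parcs G. \<forall>(x, y) \<in> parcs G. {u, v} \<noteq> {x, y} \<longrightarrow>
        path_image (\<gamma> (u, v)) \<inter> path_image (\<gamma> (x, y)) \<subseteq> p ` ({u, v} \<inter> {x, y}))"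

definition drawing_points ::
    "'a pair_pre_digraph \<Rightarrow> ('a \<Rightarrow> complex) \<Rightarrow> ('a \<times> 'a \<Rightarrow> real \<Rightarrow> complex) \<Rightarrow> complex set" where
  "drawing_points G p \<gamma> = p ` pverts G \<union> (\<Union>e \<in> parcs G. path_image (\<gamma> e))"

text \<open>
  \<open>outside\<close> of the (compact) set of drawn points is the unbounded component of its complement,
  i.e. the outer face.
\<close>
definition outerplanar :: "'a pair_pre_digraph \<Rightarrow> bool" where
  "outerplanar G \<longleftrightarrow> (\<exists>p \<gamma>. plane_drawing G p \<gamma> \<and>
     (\<forall>v \<in> pverts G. p v \<in> frontier (outside (drawing_points G p \<gamma>))))"

definition add_edge :: "'a \<Rightarrow> 'a \<Rightarrow> 'a pair_pre_digraph \<Rightarrow> 'a pair_pre_digraph" where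
  "add_edge u v G = \<lparr> pverts = pverts G, parcs = parcs G \<union> {(u, v), (v, u)} \<rparr>"

definition edge_maximal_outerplanar :: "'a pair_pre_digraph \<Rightarrow> bool" where
  "edge_maximal_outerplanar G \<longleftrightarrow> pair_graph G \<and> outerplanar G \<and>
     (\<forall>u \<in> pverts G. \<forall>v \<in> pverts G. u \<noteq> v \<and> (u, v) \<notin> parcs G \<longrightarrow>
        \<not> outerplanar (add_edge u v G))"

text \<open>The name \<open>connected\<close> alone is ambiguous with topological connectedness.\<close>
definition connected_outerplanar_on :: "nat \<Rightarrow> 'a pair_pre_digraph \<Rightarrow> bool" where
  "connected_outerplanar_on n G \<longleftrightarrow> pair_graph G \<and> card (pverts G) = n \<and>
     Digraph_Component.connected (with_proj G) \<and> outerplanar G"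

text \<open>
  The competitors range over the same vertex type as \<open>G\<close>; as \<open>G\<close> has \<open>n\<close> vertices, every
  \<open>n\<close>-vertex graph has an isomorphic copy there.
\<close>
definition lambda2_extremal :: "nat \<Rightarrow> 'a pair_pre_digraph \<Rightarrow> bool" where
  "lambda2_extremal n G \<longleftrightarrow> connected_outerplanar_on n G \<and>
     (\<forall>G' :: 'a pair_pre_digraph. connected_outerplanar_on n G' \<longrightarrow> lambda2 G' \<le> lambda2 G)"

section \<open>The graphs and families in the statement\<close>

definition path_graph :: "nat \<Rightarrow> nat pair_pre_digraph" where
  "path_graph m = \<lparr> pverts = {..<m},
     parcs = {(i, j). i < m \<and> j < m \<and> (j = Suc i \<or> i = Suc j)} \<rparr>"

text \<open>The sum type makes the two graphs disjoint.\<close>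
definition graph_join ::
    "'a pair_pre_digraph \<Rightarrow> 'b pair_pre_digraph \<Rightarrow> ('a + 'b) pair_pre_digraph" where
  "graph_join A B = \<lparr> pverts = pverts A <+> pverts B,
     parcs = map_prod Inl Inl ` parcs A \<union> map_prod Inr Inr ` parcs B \<union>
             (Inl ` pverts A) \<times> (Inr ` pverts B) \<union> (Inr ` pverts B) \<times> (Inl ` pverts A) \<rparr>"

text \<open>The new vertex is \<open>None\<close>, joined to exactly the vertices in \<open>S\<close>.\<close>
definition add_vertex :: "'a set \<Rightarrow> 'a pair_pre_digraph \<Rightarrow> 'a option pair_pre_digraph" where
  "add_vertex S G = \<lparr> pverts = insert None (Some ` pverts G),
     parcs = map_prod Some Some ` parcs G \<union> {None} \<times> (Some ` S) \<union> (Some ` S) \<times> {None} \<rparr>"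

definition graph_H :: "(nat + nat) option pair_pre_digraph" where
  "graph_H = (let F = graph_join (path_graph 1) (path_graph 4) in
     add_vertex {v \<in> pverts F. out_degree (with_proj F) v = 3} F)"

text \<open>
  The two families are closed under isomorphism: \<open>A'\<close> and \<open>B'\<close> are disjoint copies of \<open>A\<close>
  and \<open>B\<close>, so that \<open>A\<close> and \<open>B\<close> themselves need not be disjoint, and may even be equal.
\<close>
definition family_I ::
    "'a pair_pre_digraph \<Rightarrow> 'b pair_pre_digraph \<Rightarrow> 'c pair_pre_digraph set" where
  "family_I A B = {G. Digraph_Component.connected (with_proj G) \<and>
     (\<exists>A' B' w S T.
        digraph_iso (with_proj A) (with_proj A') \<and> digraph_iso (with_proj B) (with_proj B') \<and>
        pverts A' \<inter> pverts B' = {} \<and> w \<notin> pverts A' \<union> pverts B' \<and>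
        S \<subseteq> pverts A' \<and> T \<subseteq> pverts B' \<and>
        G = \<lparr> pverts = insert w (pverts A' \<union> pverts B'),
              parcs = parcs A' \<union> parcs B' \<union> {w} \<times> (S \<union> T) \<union> (S \<union> T) \<times> {w} \<rparr>)}"

definition family_E ::
    "'a pair_pre_digraph \<Rightarrow> 'b pair_pre_digraph \<Rightarrow> 'c pair_pre_digraph set" where
  "family_E A B = {G. \<exists>A' B' a b.
     digraph_iso (with_proj A) (with_proj A') \<and> digraph_iso (with_proj B) (with_proj B') \<and>
     pverts A' \<inter> pverts B' = {} \<and> a \<in> pverts A' \<and> b \<in> pverts B' \<and>
     G = add_edge a b \<lparr> pverts = pverts A' \<union> pverts B', parcs = parcs A' \<union> parcs B' \<rparr>}"

end

theory Submission
  imports Defs "HOL-Complex_Analysis.Winding_Numbers"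
begin

text \<open>
  A graph is outerplanar iff its vertices have a circular order in which no two edges cross: a drawing
  with all vertices on the outer face excludes \<open>K\<^sub>4\<close> and subdivisions of \<open>K\<^sub>2\<^sub>,\<^sub>3\<close>, by the theta curve
  theorem, and the exclusion of these gives the order. Conversely a noncrossing order is drawn with
  straight chords on a parabola.

  Let \<open>rmax k\<close> be the largest spectral radius of an outerplanar graph on \<open>k\<close> vertices. It is attained
  by triangulated polygons only. Among these the fan \<open>P\<^sub>1 \<or> P\<^sub>k\<^sub>-\<^sub>1\<close> wins unless \<open>k = 6\<close>, where the hexagon
  with an inner triangle wins. For large \<open>k\<close> this follows by comparing the eigenvector of a triangulation
  with an explicit test vector of the fan; for small \<open>k\<close> all triangulations are enumerated.

  Let \<open>x\<close> be an eigenvector of \<open>\<lambda>\<^sub>2\<close> with positive part \<open>P\<close> and negative part \<open>N\<close>. The Rayleigh quotient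
  of \<open>x\<close> on \<open>P\<close> is at least \<open>\<lambda>\<^sub>2\<close>, so \<open>\<lambda>\<^sub>2 \<le> rmax |P|\<close>, and likewise for \<open>N\<close>. If \<open>n = 2m + 1\<close>, two optimal
  graphs on \<open>m\<close> vertices joined through a new vertex show that \<open>\<lambda>\<^sub>2 \<ge> rmax m\<close> for an extremal graph, which
  forces \<open>|P| = |N| = m\<close>, a single zero of \<open>x\<close>, no edges between \<open>P\<close> and \<open>N\<close>, and optimal graphs on both.
  If \<open>n = 2m\<close>, two optimal graphs on \<open>m - 1\<close> vertices joined by a path give \<open>\<lambda>\<^sub>2 > rmax (m - 1)\<close>, which
  forces \<open>|P| = |N| = m\<close> and both parts connected; deleting one of several edges between them, or adding an edge
  inside one of them, would raise \<open>\<lambda>\<^sub>2\<close>. The error term follows from \<open>1 + \<surd>(k - 2) < rmax k \<le> 1 + \<surd>k\<close>.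
\<close>

section \<open>Triangulated polygons and fans\<close>

text \<open>The delicate point is the comparison with the fan, since near-fans have radii that
  differ from it only in lower-order terms. Scale a Perron vector to 1 at its largest entry and call
  that vertex the hub. Then \<open>\<rho>\<^sup>2\<close> is the weighted number of 2-walks from the
  hub; it is at most \<open>q + 2 * \<rho> - x 1 - x q\<close>, with a loss of at least
  \<open>1 - 4 / \<rho>\<close> if some vertex is not adjacent to the hub. The entries next to the
  hub along the polygon are bounded below by the recurrence that the fan's own test vector solves,
  with an error of order \<open>t ^ d\<close> for a hub of degree \<open>d\<close>. So the loss has
  to beat only this error, which it does once \<open>\<rho>\<close> exceeds 4 by a little. Spectral
  facts enter through quadratic forms alone: upper bounds on \<open>lambda2\<close> come from the
  form on an induced part, lower bounds from a plane of test vectors. Between the two sign parts the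
  product of the entries of an edge is negative, which is why deleting such an edge raises
  \<open>lambda2\<close>.\<close>

text \<open>Triangulations of the convex polygon with vertices \<open>i\<close>, ...,
  \<open>j\<close>; each edge is stored once, as an increasing pair. \<open>k\<close> is the apex of
  the triangle on the base edge \<open>(i, j)\<close>, and a single edge counts as a degenerate
  polygon.\<close>

inductive tri :: "nat \<Rightarrow> nat \<Rightarrow> (nat \<times> nat) set \<Rightarrow> bool" where
  tri_edge: "tri i (Suc i) {(i, Suc i)}"
| tri_node: "tri i k E1 \<Longrightarrow> tri k j E2 \<Longrightarrow> tri i j (insert (i, j) (E1 \<union> E2))"

definition nb :: "('a \<times> 'a) set \<Rightarrow> 'a \<Rightarrow> 'a set" where
  "nb E v = {w. (v, w) \<in> E \<or> (w, v) \<in> E}"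

lemma tri_bounds:
  assumes "tri i j E"
  shows "i < j" "(a, b) \<in> E \<Longrightarrow> i \<le> a \<and> a < b \<and> b \<le> j" "(i, j) \<in> E" "finite E"
  using assms
proof -
  have "i < j \<and> (\<forall>a b. (a, b) \<in> E \<longrightarrow> i \<le> a \<and> a < b \<and> b \<le> j) \<and> (i, j) \<in> E \<and> finite E"
    using assms by (induction rule: tri.induct) force+
  then show "i < j" "(a, b) \<in> E \<Longrightarrow> i \<le> a \<and> a < b \<and> b \<le> j" "(i, j) \<in> E" "finite E"
    by blast+
qed

lemma tri_path: "tri i j E \<Longrightarrow> i \<le> a \<Longrightarrow> a < j \<Longrightarrow> (a, Suc a) \<in> E"
proof (induction rule: tri.induct)
  case (tri_node i k E1 j E2)
  then show ?case by (cases "a < k") auto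
qed auto

text \<open>With \<open>n = j - i + 1\<close> vertices this is the familiar
  \<open>2 * n - 3\<close>, sides included. As it is the same for all triangulations of a polygon,
  it later shows that a rotated triangulation is again a triangulation.\<close>

lemma tri_card: "tri i j E \<Longrightarrow> card E = 2 * (j - i) - 1"
proof (induction rule: tri.induct)
  case (tri_node i k E1 j E2)
  note b1 = tri_bounds[OF tri_node(1)] and b2 = tri_bounds[OF tri_node(2)]
  have "E1 \<inter> E2 = {}" "(i, j) \<notin> E1 \<union> E2" using b1(1,2) b2(1,2) by fastforce+
  then have "card (insert (i, j) (E1 \<union> E2)) = Suc (card E1 + card E2)"
    using b1(4) b2(4) by (simp add: card_Un_disjoint)
  then show ?case using tri_node(3,4) b1(1) b2(1) by linarith
qed auto

lemma tri_noncrossing: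
  "tri i j E \<Longrightarrow> (a, c) \<in> E \<Longrightarrow> (b, d) \<in> E \<Longrightarrow> a < b \<Longrightarrow> b < c \<Longrightarrow> c < d \<Longrightarrow> False"
proof (induction arbitrary: a b c d rule: tri.induct)
  case (tri_node i k E1 j E2)
  note b1 = tri_bounds[OF tri_node(1)] and b2 = tri_bounds[OF tri_node(2)]
  have "(a, c) \<noteq> (i, j)" "(b, d) \<noteq> (i, j)"
    using b1(1,2) b2(1,2) tri_node(5-) by fastforce+
  with tri_node(5,6) have "(a, c) \<in> E1 \<union> E2" "(b, d) \<in> E1 \<union> E2" by auto
  moreover have "\<not> ((a, c) \<in> E1 \<and> (b, d) \<in> E2)" "\<not> ((a, c) \<in> E2 \<and> (b, d) \<in> E1)"
    using b1(2) b2(2) tri_node(7-) by fastforce+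
  ultimately show ?case using tri_node(3,4,7-) by blast
qed auto

lemma nb_tri_sub: "tri i j E \<Longrightarrow> nb E v \<subseteq> {i..j} - {v}"
  unfolding nb_def using tri_bounds(2) by fastforce

lemma finite_nb_tri: "tri i j E \<Longrightarrow> finite (nb E v)"
  by (rule finite_subset[OF nb_tri_sub]) auto

lemma nb_node:
  assumes "tri i k E1" "tri k j E2"
  defines "E \<equiv> insert (i, j) (E1 \<union> E2)"
  shows "nb E i = insert j (nb E1 i)" "j \<notin> nb E1 i"
    and "nb E j = insert i (nb E2 j)" "i \<notin> nb E2 j"
    and "nb E k = nb E1 k \<union> nb E2 k" "nb E1 k \<inter> nb E2 k = {}"
    and "v < k \<Longrightarrow> v \<noteq> i \<Longrightarrow> nb E v = nb E1 v" "k < v \<Longrightarrow> v \<noteq> j \<Longrightarrow> nb E v = nb E2 v"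
proof -
  note b1 = tri_bounds[OF assms(1)] and b2 = tri_bounds[OF assms(2)]
  have *: "nb E v = {w. (v, w) = (i, j) \<or> (w, v) = (i, j)} \<union> nb E1 v \<union> nb E2 v" for v
    unfolding nb_def E_def by auto
  have 1: "nb E2 v = {}" if "v < k" for v unfolding nb_def using b2(2) that by fastforce
  have 2: "nb E1 v = {}" if "k < v" for v unfolding nb_def using b1(2) that by fastforce
  show "nb E i = insert j (nb E1 i)" using *[of i] 1[OF b1(1)] b1(1) b2(1) by auto
  show "nb E j = insert i (nb E2 j)" using *[of j] 2[OF b2(1)] b1(1) b2(1) by auto
  show "j \<notin> nb E1 i" "i \<notin> nb E2 j"
    using nb_tri_sub[OF assms(1), of i] nb_tri_sub[OF assms(2), of j] b1(1) b2(1) by auto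
  show "nb E k = nb E1 k \<union> nb E2 k" using *[of k] b1(1) b2(1) by auto
  show "nb E1 k \<inter> nb E2 k = {}"
    using nb_tri_sub[OF assms(1), of k] nb_tri_sub[OF assms(2), of k] by force
  show "v < k \<Longrightarrow> v \<noteq> i \<Longrightarrow> nb E v = nb E1 v" using *[of v] 1[of v] b2(1) by auto
  show "k < v \<Longrightarrow> v \<noteq> j \<Longrightarrow> nb E v = nb E2 v" using *[of v] 2[of v] b1(1) by auto
qed

section \<open>Weighted 2-walks from a vertex of a triangulation\<close>

lemma sum_le_card:
  fixes x :: "'a \<Rightarrow> real"
  shows "finite A \<Longrightarrow> (\<And>v. v \<in> A \<Longrightarrow> x v \<le> 1) \<Longrightarrow> sum x A \<le> card A"
  using sum_bounded_above[of A x 1] by simp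

text \<open>Either \<open>i\<close> misses \<open>i + 2\<close>, a loss of a whole unit, or the
  chord \<open>(i, i + 2)\<close> cuts off \<open>i + 1\<close>, which then has only two neighbours,
  so that its eigenvalue equation gives \<open>x (Suc i) \<le> 2 / \<rho>\<close>.\<close>

lemma fan_sum_left:
  assumes t: "tri i j E" and x: "\<And>v. 0 \<le> x v" "\<And>v. x v \<le> 1" and \<rho>: "\<rho> > (0::real)"
    and eig: "\<And>v. i < v \<Longrightarrow> v < j \<Longrightarrow> \<rho> * x v = sum x (nb E v)" and ij: "Suc i < j"
  shows "sum x (nb E i - {j}) \<le> real (j - i - 1) - (1 - 2 / \<rho>)"
proof (cases "(i, i + 2) \<in> E")
  case True
  have "nb E (Suc i) \<subseteq> {i, i + 2}"
  proof
    fix w assume "w \<in> nb E (Suc i)"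
    then consider "(Suc i, w) \<in> E" | "(w, Suc i) \<in> E" unfolding nb_def by auto
    then show "w \<in> {i, i + 2}"
    proof cases
      case 1
      then have "w \<ge> i + 2" using tri_bounds(2)[OF t] by fastforce
      moreover have "\<not> w > i + 2" using tri_noncrossing[OF t True 1] by auto
      ultimately show ?thesis by auto
    next
      case 2
      then show ?thesis using tri_bounds(2)[OF t 2] by auto
    qed
  qed
  then have "sum x (nb E (Suc i)) \<le> x i + x (i + 2)"
    using sum_mono2[of "{i, i+2}" "nb E (Suc i)" x] x(1) by auto
  then have "\<rho> * x (Suc i) \<le> 2" using eig[of "Suc i"] ij x(2)[of i] x(2)[of "i+2"] by auto
  then have 1: "x (Suc i) \<le> 2 / \<rho>" using \<rho> by (simp add: field_simps)
  have "nb E i - {j} \<subseteq> insert (Suc i) {i + 2..<j}" using nb_tri_sub[OF t, of i] by fastforce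
  then have "sum x (nb E i - {j}) \<le> sum x (insert (Suc i) {i + 2..<j})"
    using x(1) by (intro sum_mono2) auto
  also have "\<dots> = x (Suc i) + sum x {i + 2..<j}" by (subst sum.insert) auto
  also have "\<dots> \<le> 2 / \<rho> + real (card {i + 2..<j})" using 1 sum_le_card[of "{i + 2..<j}" x] x(2) by (simp del: card_atLeastLessThan)
  finally show ?thesis using ij by (simp add: of_nat_diff)
next
  case False
  then have "i + 2 < j" using ij tri_bounds(3)[OF t] by (cases "i + 2 = j") auto
  have "nb E i - {j} \<subseteq> {i<..<j} - {i + 2}"
  proof
    fix w assume w: "w \<in> nb E i - {j}"
    then have "w \<in> {i..j} - {i}" using nb_tri_sub[OF t, of i] by auto
    moreover have "w \<noteq> i + 2" using w False tri_bounds(2)[OF t] unfolding nb_def by fastforce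
    ultimately show "w \<in> {i<..<j} - {i + 2}" using w by auto
  qed
  then have "sum x (nb E i - {j}) \<le> sum x ({i<..<j} - {i + 2})" using x(1) by (intro sum_mono2) auto
  also have "\<dots> \<le> real (card ({i<..<j} - {i + 2}))" using x(2) by (intro sum_le_card) auto
  also have "\<dots> = real (j - i - 1) - 1" using \<open>i + 2 < j\<close> by (simp add: of_nat_diff)
  finally have "sum x (nb E i - {j}) \<le> real (j - i - 1) - 1" .
  moreover have "0 \<le> 2 / \<rho>" using \<rho> by simp
  ultimately show ?thesis by linarith
qed

text \<open>Mirror image of \<open>fan_sum_left\<close>; the vertex that may be cut off is
  \<open>j - 1\<close>.\<close>

lemma fan_sum_right:
  assumes t: "tri i j E" and x: "\<And>v. 0 \<le> x v" "\<And>v. x v \<le> 1" and \<rho>: "\<rho> > (0::real)"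
    and eig: "\<And>v. i < v \<Longrightarrow> v < j \<Longrightarrow> \<rho> * x v = sum x (nb E v)" and ij: "Suc i < j"
  shows "sum x (nb E j - {i}) \<le> real (j - i - 1) - (1 - 2 / \<rho>)"
proof (cases "(j - 2, j) \<in> E")
  case True
  have "nb E (j - 1) \<subseteq> {j, j - 2}"
  proof
    fix w assume "w \<in> nb E (j - 1)"
    then consider "(j - 1, w) \<in> E" | "(w, j - 1) \<in> E" unfolding nb_def by auto
    then show "w \<in> {j, j - 2}"
    proof cases
      case 1
      then show ?thesis using tri_bounds(2)[OF t 1] by auto
    next
      case 2
      then have "w \<le> j - 2" using tri_bounds(2)[OF t 2] ij by auto
      moreover have "\<not> w < j - 2"
      proof
        assume "w < j - 2"
        moreover have "j - 2 < j - 1" "j - 1 < j" using ij by linarith+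
        ultimately show False using tri_noncrossing[OF t 2 True] by blast
      qed
      ultimately show ?thesis by auto
    qed
  qed
  then have "sum x (nb E (j - 1)) \<le> x j + x (j - 2)"
    using sum_mono2[of "{j, j - 2}" "nb E (j - 1)" x] x(1) ij by auto
  then have "\<rho> * x (j - 1) \<le> 2" using eig[of "j - 1"] ij x(2)[of j] x(2)[of "j - 2"] by auto
  then have 1: "x (j - 1) \<le> 2 / \<rho>" using \<rho> by (simp add: field_simps)
  have "nb E j - {i} \<subseteq> insert (j - 1) {i<..<j - 1}" using nb_tri_sub[OF t, of j] ij by fastforce
  then have "sum x (nb E j - {i}) \<le> sum x (insert (j - 1) {i<..<j - 1})"
    using x(1) by (intro sum_mono2) auto
  also have "\<dots> = x (j - 1) + sum x {i<..<j - 1}" by (subst sum.insert) auto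
  also have "\<dots> \<le> 2 / \<rho> + real (card {i<..<j - 1})" using 1 sum_le_card[of "{i<..<j - 1}" x] x(2) by (simp del: card_greaterThanLessThan)
  finally show ?thesis using ij by (simp add: of_nat_diff)
next
  case False
  then have "i < j - 2" using ij tri_bounds(3)[OF t] by (cases "i = j - 2") auto
  have "nb E j - {i} \<subseteq> {i<..<j} - {j - 2}"
  proof
    fix w assume w: "w \<in> nb E j - {i}"
    then have "w \<in> {i..j} - {j}" using nb_tri_sub[OF t, of j] by auto
    moreover have "w \<noteq> j - 2" using w False tri_bounds(2)[OF t] unfolding nb_def by fastforce
    ultimately show "w \<in> {i<..<j} - {j - 2}" using w by auto
  qed
  then have "sum x (nb E j - {i}) \<le> sum x ({i<..<j} - {j - 2})" using x(1) by (intro sum_mono2) auto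
  also have "\<dots> \<le> real (card ({i<..<j} - {j - 2}))" using x(2) by (intro sum_le_card) auto
  also have "\<dots> = real (j - i - 1) - 1" using \<open>i < j - 2\<close> by (simp add: of_nat_diff)
  finally have "sum x (nb E j - {i}) \<le> real (j - i - 1) - 1" .
  moreover have "0 \<le> 2 / \<rho>" using \<rho> by simp
  ultimately show ?thesis by linarith
qed

text \<open>The apex over \<open>(i, j)\<close> separates the two neighbourhoods: that of
  \<open>i\<close> reaches up to the apex, that of \<open>j\<close> starts there. Only the apex is
  counted twice.\<close>

lemma card_nb_ends:
  assumes "tri i j E" "Suc i < j"
  shows "card (nb E i - {j}) + card (nb E j - {i}) \<le> j - i"
  using assms(1)
proof (cases rule: tri.cases)
  case (tri_node k E1 E2)
  note n = nb_node[OF tri_node(2,3), folded tri_node(1)]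
  note b1 = tri_bounds[OF tri_node(2)] and b2 = tri_bounds[OF tri_node(3)]
  have "nb E i - {j} \<subseteq> {i<..k}" "nb E j - {i} \<subseteq> {k..<j}"
    using nb_tri_sub[OF tri_node(2), of i] nb_tri_sub[OF tri_node(3), of j] n(1,3) by auto
  then have "card (nb E i - {j}) \<le> card {i<..k}" "card (nb E j - {i}) \<le> card {k..<j}"
    by (auto intro!: card_mono simp del: card_greaterThanAtMost card_atLeastLessThan)
  then show ?thesis using b1(1) b2(1) by simp
qed (use assms in auto)

text \<open>A lobe is the part of a triangulation behind an edge \<open>(i, j)\<close> whose ends
  are both adjacent to a hub outside it. The apex \<open>c\<close> is seen from both ends, so the
  trivial bound is \<open>j - i\<close>, one too many. The saving comes from the sides
  \<open>(i, c)\<close> and \<open>(c, j)\<close>: twice \<open>1 - 2 / \<rho>\<close> if both are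
  proper lobes, otherwise also from the smallness of \<open>x c\<close> itself.\<close>

lemma tri_lobe:
  assumes t: "tri i j E" and x: "\<And>v. 0 \<le> x v" "\<And>v. x v \<le> 1" and \<rho>: "\<rho> \<ge> (4::real)"
    and eig: "\<And>v. i < v \<Longrightarrow> v < j \<Longrightarrow> \<rho> * x v = sum x (nb E v)" and ij: "Suc i < j"
  shows "sum x (nb E i - {j}) + sum x (nb E j - {i}) \<le> real (j - i - 1) - (1 - 4 / \<rho>)"
  using t
proof (cases rule: tri.cases)
  case (tri_node c E1 E2)
  note t1 = tri_node(2) and t2 = tri_node(3)
  note n = nb_node[OF t1 t2, folded tri_node(1)]
  note b1 = tri_bounds[OF t1] and b2 = tri_bounds[OF t2]
  have \<rho>0: "\<rho> > 0" using \<rho> by simp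
  have eig1: "\<rho> * x v = sum x (nb E1 v)" if "i < v" "v < c" for v using eig[of v] n(7)[of v] that b2 by auto
  have eig2: "\<rho> * x v = sum x (nb E2 v)" if "c < v" "v < j" for v using eig[of v] n(8)[of v] that b1 by auto
  have cE: "c \<in> nb E1 i" "c \<in> nb E2 j" "i \<in> nb E1 c" "j \<in> nb E2 c" using b1(3) b2(3) by (auto simp: nb_def)
  have S1: "sum x (nb E i - {j}) = x c + sum x (nb E1 i - {c})"
    using n(1,2) cE sum.remove[OF finite_nb_tri[OF t1] cE(1), of x] by auto
  have S2: "sum x (nb E j - {i}) = x c + sum x (nb E2 j - {c})"
    using n(3,4) cE sum.remove[OF finite_nb_tri[OF t2] cE(2), of x] by auto
  have "\<rho> * x c = sum x (nb E1 c) + sum x (nb E2 c)"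
    using eig[of c] b1(1) b2(1) n(5,6) finite_nb_tri[OF t1, of c] finite_nb_tri[OF t2, of c]
    by (simp add: sum.union_disjoint)
  also have "sum x (nb E1 c) = x i + sum x (nb E1 c - {i})"
    using sum.remove[OF finite_nb_tri[OF t1] cE(3), of x] by auto
  also have "sum x (nb E2 c) = x j + sum x (nb E2 c - {j})"
    using sum.remove[OF finite_nb_tri[OF t2] cE(4), of x] by auto
  finally have "\<rho> * x c = x i + sum x (nb E1 c - {i}) + (x j + sum x (nb E2 c - {j}))" .
  moreover have "sum x (nb E1 c - {i}) \<le> card (nb E1 c - {i})" "sum x (nb E2 c - {j}) \<le> card (nb E2 c - {j})"
    using finite_nb_tri[OF t1, of c] finite_nb_tri[OF t2, of c] x(2) by (auto intro!: sum_le_card)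
  ultimately have xc: "\<rho> * x c \<le> 2 + real (card (nb E1 c - {i})) + real (card (nb E2 c - {j}))"
    using x(2)[of i] x(2)[of j] by linarith
  have E1s: "nb E1 i - {c} = {}" "nb E1 c - {i} = {}" if "c = Suc i"
    using nb_tri_sub[OF t1, of i] nb_tri_sub[OF t1, of c] that by fastforce+
  have E2s: "nb E2 c - {j} = {}" "nb E2 j - {c} = {}" if "j = Suc c"
    using nb_tri_sub[OF t2, of c] nb_tri_sub[OF t2, of j] that by fastforce+
  have d4: "4 / \<rho> \<le> 1" using \<rho> by simp
  \<comment> \<open>Only one side is proper, of length \<open>k\<close>; \<open>Na\<close> counts
    the inner neighbours of its end and \<open>Nc\<close> those of \<open>c\<close>. They compete by
    \<open>card_nb_ends\<close>: if \<open>Na\<close> is \<open>k - 1\<close> or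
    \<open>k - 2\<close>, few are left for \<open>c\<close>, so \<open>x c\<close> is at most
    \<open>3 / \<rho>\<close> or \<open>4 / \<rho>\<close>; for smaller \<open>Na\<close> the
    trivial bound on \<open>R\<close> suffices.\<close>
  have one_sided: "2 * x c + R \<le> real k - (1 - 4 / \<rho>)"
    if R: "R \<le> real (k - 1) - (1 - 2 / \<rho>)" "R \<le> real Na" and "Na \<le> k - 1" and N: "Na + Nc \<le> k" and k: "k \<ge> 2"
      and c: "\<rho> * x c \<le> 2 + real Nc" for R k Na Nc
  proof -
    have xc: "x c \<le> (2 + real Nc) / \<rho>" using c \<rho>0 by (simp add: field_simps)
    consider "Na = k - 1" | "Na = k - 2" | "Na + 3 \<le> k" using \<open>Na \<le> k - 1\<close> k by linarith
    then show ?thesis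
    proof cases
      case 1
      then have "Nc \<le> 1" using N k by simp
      then have "(2 + real Nc) / \<rho> \<le> 3 / \<rho>" using \<rho>0 by (intro divide_right_mono) auto
      then show ?thesis using R(1) xc d4 k by (simp add: of_nat_diff)
    next
      case 2
      then have "Nc \<le> 2" using N k by simp
      then have "(2 + real Nc) / \<rho> \<le> 4 / \<rho>" using \<rho>0 by (intro divide_right_mono) auto
      then show ?thesis using R(2) xc d4 k 2 by (simp add: of_nat_diff)
    next
      case 3
      then have "real Na \<le> real k - 3" by simp
      moreover have "0 \<le> 4 / \<rho>" using \<rho>0 by simp
      ultimately show ?thesis using R(2) x(2)[of c] by linarith
    qed
  qed
  have k: "j - i - 1 = (c - i - 1) + (j - c - 1) + 1" using b1(1) b2(1) by simp
  consider "c = Suc i" "j = Suc c" | "Suc i < c" "Suc c < j" | "Suc i < c" "j = Suc c" | "c = Suc i" "Suc c < j"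
    using b1(1) b2(1) by linarith
  then show ?thesis
  proof cases
    case 1
    then have "\<rho> * x c \<le> 2" using xc unfolding E1s(2)[OF 1(1)] E2s(1)[OF 1(2)] by simp
    then have "x c \<le> 2 / \<rho>" using \<rho>0 by (simp add: field_simps)
    then show ?thesis unfolding S1 S2 E1s(1)[OF 1(1)] E2s(2)[OF 1(2)] using 1 by simp
  next
    case 2
    have "sum x (nb E1 i - {c}) \<le> real (c - i - 1) - (1 - 2 / \<rho>)"
      by (rule fan_sum_left[OF t1 x \<rho>0 eig1 2(1)])
    moreover have "sum x (nb E2 j - {c}) \<le> real (j - c - 1) - (1 - 2 / \<rho>)"
      by (rule fan_sum_right[OF t2 x \<rho>0 eig2 2(2)])
    ultimately show ?thesis unfolding S1 S2 k using x(2)[of c] by simp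
  next
    case 3
    have f: "finite (nb E1 i - {c})" using finite_nb_tri[OF t1] by simp
    have "nb E1 i - {c} \<subseteq> {i<..<c}" using nb_tri_sub[OF t1, of i] by fastforce
    then have "card (nb E1 i - {c}) \<le> c - i - 1" using card_mono[of "{i<..<c}"] by force
    then have Na: "card (nb E1 i - {c}) \<le> (c - i) - 1" by simp
    have c: "\<rho> * x c \<le> 2 + real (card (nb E1 c - {i}))" using xc E2s[OF 3(2)] by simp
    have k2: "2 \<le> c - i" using 3(1) by simp
    have "2 * x c + sum x (nb E1 i - {c}) \<le> real (c - i) - (1 - 4 / \<rho>)"
      by (rule one_sided[OF fan_sum_left[OF t1 x \<rho>0 eig1 3(1)] sum_le_card[OF f x(2)] Na card_nb_ends[OF t1 3(1)] k2 c])
    moreover have "j - i - 1 = c - i" using 3 by simp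
    ultimately show ?thesis unfolding S1 S2 E2s(2)[OF 3(2)] by simp
  next
    case 4
    have f: "finite (nb E2 j - {c})" using finite_nb_tri[OF t2] by simp
    have "nb E2 j - {c} \<subseteq> {c<..<j}" using nb_tri_sub[OF t2, of j] by fastforce
    then have "card (nb E2 j - {c}) \<le> j - c - 1" using card_mono[of "{c<..<j}"] by force
    then have Na: "card (nb E2 j - {c}) \<le> (j - c) - 1" by simp
    have c: "\<rho> * x c \<le> 2 + real (card (nb E2 c - {j}))" using xc E1s[OF 4(1)] by simp
    have k2: "2 \<le> j - c" using 4(2) by simp
    have N: "card (nb E2 j - {c}) + card (nb E2 c - {j}) \<le> j - c" using card_nb_ends[OF t2 4(2)] by simp
    have "2 * x c + sum x (nb E2 j - {c}) \<le> real (j - c) - (1 - 4 / \<rho>)"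
      by (rule one_sided[OF fan_sum_right[OF t2 x \<rho>0 eig2 4(2)] sum_le_card[OF f x(2)] Na N k2 c])
    moreover have "j - i - 1 = j - c" using 4 by simp
    ultimately show ?thesis unfolding S1 S2 E1s(1)[OF 4(1)] by simp
  qed
qed (use ij in auto)

text \<open>For the fan with \<open>x i = 1\<close> this is an equality: every rim vertex sees
  \<open>i\<close>, and each is seen from two rim neighbours, except the two end vertices. The
  induction removes the last triangle \<open>(i, k, j)\<close> at \<open>i\<close>; behind
  \<open>(k, j)\<close> there is a single edge or a lobe, and a lobe pays for the loss.\<close>

lemma tri_two_walks:
  assumes t: "tri i j E" and x: "\<And>v. 0 \<le> x v" "\<And>v. x v \<le> 1" and \<rho>: "\<rho> \<ge> (4::real)"
    and eig: "\<And>v. i < v \<Longrightarrow> v < j \<Longrightarrow> \<rho> * x v = sum x (nb E v)"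
  shows "(\<Sum>v\<in>nb E i. sum x (nb E v)) \<le>
    real (j - i) + 2 * sum x (nb E i) - x (Suc i) - x j - (if nb E i = {i<..j} then 0 else 1 - 4 / \<rho>)"
  using t eig
proof (induction rule: tri.induct)
  case (tri_edge i)
  have "nb {(i, Suc i)} i = {Suc i}" "nb {(i, Suc i)} (Suc i) = {i}" by (auto simp: nb_def)
  moreover have "{i<..Suc i} = {Suc i}" by auto
  ultimately show ?case using x(2)[of i] by simp
next
  case (tri_node i k E1 j E2)
  let ?E = "insert (i, j) (E1 \<union> E2)"
  note t1 = tri_node(1) and t2 = tri_node(2)
  note n = nb_node[OF t1 t2]
  note b1 = tri_bounds[OF t1] and b2 = tri_bounds[OF t2]
  have \<rho>0: "\<rho> > 0" using \<rho> by simp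
  have eig1: "\<rho> * x v = sum x (nb E1 v)" if "i < v" "v < k" for v using tri_node(5)[of v] n(7)[of v] that b2 by auto
  have eig2: "\<rho> * x v = sum x (nb E2 v)" if "k < v" "v < j" for v using tri_node(5)[of v] n(8)[of v] that b1 by auto
  have IH: "(\<Sum>v\<in>nb E1 i. sum x (nb E1 v)) \<le> real (k - i) + 2 * sum x (nb E1 i) - x (Suc i) - x k
      - (if nb E1 i = {i<..k} then 0 else 1 - 4 / \<rho>)"
    by (rule tri_node(3)) (rule eig1)
  have kE: "k \<in> nb E1 i" "k \<in> nb E2 j" "i \<in> nb E1 k" "j \<in> nb E2 k" using b1(3) b2(3) by (auto simp: nb_def)
  note f1 = finite_nb_tri[OF t1] and f2 = finite_nb_tri[OF t2]
  let ?S = "sum x (nb E2 k - {j}) + sum x (nb E2 j - {k})"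
  have "(\<Sum>v\<in>nb ?E i. sum x (nb ?E v)) = sum x (nb ?E j) + (\<Sum>v\<in>nb E1 i. sum x (nb ?E v))"
    using n(1,2) f1 by (simp add: sum.insert)
  also have "(\<Sum>v\<in>nb E1 i. sum x (nb ?E v)) = sum x (nb ?E k) + (\<Sum>v\<in>nb E1 i - {k}. sum x (nb ?E v))"
    by (rule sum.remove[OF f1 kE(1)])
  also have "(\<Sum>v\<in>nb E1 i - {k}. sum x (nb ?E v)) = (\<Sum>v\<in>nb E1 i - {k}. sum x (nb E1 v))"
  proof (rule sum.cong[OF refl])
    fix v assume "v \<in> nb E1 i - {k}"
    then have "i < v" "v < k" using nb_tri_sub[OF t1, of i] by fastforce+
    then show "sum x (nb ?E v) = sum x (nb E1 v)" using n(7)[of v] by simp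
  qed
  also have "sum x (nb ?E k) = sum x (nb E1 k) + sum x (nb E2 k)"
    using n(5,6) f1 f2 by (simp add: sum.union_disjoint)
  also have "sum x (nb E2 k) = x j + sum x (nb E2 k - {j})" by (rule sum.remove[OF f2 kE(4)])
  also have "sum x (nb ?E j) = x i + (x k + sum x (nb E2 j - {k}))"
    using n(3,4) f2 sum.remove[OF f2 kE(2), of x] by (simp add: sum.insert)
  finally have P: "(\<Sum>v\<in>nb ?E i. sum x (nb ?E v)) = x i + x k + x j + ?S + (\<Sum>v\<in>nb E1 i. sum x (nb E1 v))"
    using sum.remove[OF f1 kE(1), of "\<lambda>v. sum x (nb E1 v)"] by simp
  have N: "sum x (nb ?E i) = x j + sum x (nb E1 i)" using n(1,2) f1 by (simp add: sum.insert)
  have m: "real (j - i) = real (k - i) + real (j - k)" using b1(1) b2(1) by (simp add: of_nat_diff)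
  have d4: "4 / \<rho> \<le> 1" using \<rho> by simp
  show ?case
  proof (cases "j = Suc k")
    case True
    then have "nb E2 k - {j} = {}" "nb E2 j - {k} = {}"
      using nb_tri_sub[OF t2, of k] nb_tri_sub[OF t2, of j] by fastforce+
    then have S: "?S = 0" by (simp only: sum.empty)
    have "{i<..j} = insert j {i<..k}" "j \<notin> {i<..k}" using True b1(1) by auto
    then have "nb ?E i = {i<..j} \<longleftrightarrow> nb E1 i = {i<..k}"
      using n(1,2) by (metis insert_ident)
    moreover have "real (j - k) = 1" using True by simp
    ultimately have "(if nb ?E i = {i<..j} then 0 else 1 - 4 / \<rho>) = (if nb E1 i = {i<..k} then 0 else 1 - 4 / \<rho>)"
      "real (j - k) = 1" by simp_all
    then show ?thesis using IH P N S m x(2)[of i] by linarith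
  next
    case False
    then have kj: "Suc k < j" using b2(1) by simp
    have "?S \<le> real (j - k - 1) - (1 - 4 / \<rho>)" by (rule tri_lobe[OF t2 x \<rho> eig2 kj])
    then have "?S \<le> real (j - k) - 1 - (1 - 4 / \<rho>)" using kj by (simp add: of_nat_diff)
    moreover have "nb ?E i \<noteq> {i<..j}"
    proof
      assume "nb ?E i = {i<..j}"
      then have "Suc k \<in> nb ?E i" using kj b1(1) by simp
      then show False using n(1) nb_tri_sub[OF t1, of i] kj by auto
    qed
    then have "(if nb ?E i = {i<..j} then 0 else 1 - 4 / \<rho>) = 1 - 4 / \<rho>" by (rule if_not_P)
    \<comment> \<open>A loss collected earlier is discarded, as one lobe already pays for everything
      that is claimed.\<close>
    moreover have "(\<Sum>v\<in>nb E1 i. sum x (nb E1 v)) \<le> real (k - i) + 2 * sum x (nb E1 i) - x (Suc i) - x k"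
      using IH d4 by (simp split: if_splits)
    moreover have "?S \<le> real (j - k) - 1 - (1 - 4 / \<rho>)" by fact
    ultimately show ?thesis using P N m x(2)[of i] by linarith
  qed
qed

text \<open>Consecutive triangles at \<open>i\<close> share an edge, so the neighbours of
  \<open>i\<close> in increasing order form a path, the link of \<open>i\<close>. For the hub this
  path takes the place of the rim of a fan.\<close>

lemma tri_nb_list:
  "tri i j E \<Longrightarrow> \<exists>vs. distinct vs \<and> set vs = nb E i \<and> vs \<noteq> [] \<and> vs ! 0 = Suc i \<and> last vs = j \<and>
     (\<forall>s. Suc s < length vs \<longrightarrow> (vs ! s, vs ! Suc s) \<in> E)"
proof (induction rule: tri.induct)
  case (tri_edge i)
  show ?case by (rule exI[of _ "[Suc i]"]) (auto simp: nb_def)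
next
  case (tri_node i k E1 j E2)
  note n = nb_node[OF tri_node(1,2)]
  obtain vs where vs: "distinct vs" "set vs = nb E1 i" "vs \<noteq> []" "vs ! 0 = Suc i" "last vs = k"
     "\<And>s. Suc s < length vs \<Longrightarrow> (vs ! s, vs ! Suc s) \<in> E1" using tri_node(3) by blast
  have "(k, j) \<in> E2" using tri_bounds(3)[OF tri_node(2)] .
  have "((vs @ [j]) ! s, (vs @ [j]) ! Suc s) \<in> insert (i, j) (E1 \<union> E2)" if s: "Suc s < length (vs @ [j])" for s
  proof (cases "Suc s < length vs")
    case True
    then show ?thesis using vs(6)[OF True] by (simp add: nth_append)
  next
    case False
    then have l: "Suc s = length vs" using s by simp
    then have "vs ! s = k" using vs(3,5) by (simp add: last_conv_nth flip: l)
    then show ?thesis using l \<open>(k, j) \<in> E2\<close> by (simp add: nth_append)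
  qed
  then show ?case using vs n(1,2) by (intro exI[of _ "vs @ [j]"]) (auto simp: nth_append)
qed

text \<open>At an interior minimum \<open>m\<close> the step inequality gives
  \<open>2 * m \<le> \<rho> * m\<close>, so \<open>m\<close> cannot be negative.\<close>

lemma discrete_min_principle:
  fixes a :: "nat \<Rightarrow> real"
  assumes \<rho>: "\<rho> > 2" and ends: "0 \<le> a 0" "0 \<le> a (Suc d)"
    and step: "\<And>i. 1 \<le> i \<Longrightarrow> i \<le> d \<Longrightarrow> a (i - 1) + a (Suc i) \<le> \<rho> * a i" and "i \<le> Suc d"
  shows "0 \<le> a i"
proof -
  define m where "m = Min (a ` {..Suc d})"
  have "m \<in> a ` {..Suc d}" unfolding m_def by (rule Min_in) auto
  then obtain k where k: "k \<le> Suc d" "a k = m" by auto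
  have le: "m \<le> a i" if "i \<le> Suc d" for i unfolding m_def using that by (intro Min_le) auto
  have "0 \<le> m"
  proof (cases "k = 0 \<or> k = Suc d")
    case True
    then show ?thesis using k ends by auto
  next
    case False
    then have "a (k - 1) + a (Suc k) \<le> \<rho> * m" "m \<le> a (k - 1)" "m \<le> a (Suc k)"
      using step[of k] le[of "k - 1"] le[of "Suc k"] k by auto
    then have "2 * m \<le> \<rho> * m" by linarith
    then have "0 \<le> (\<rho> - 2) * m" by (simp add: algebra_simps)
    then show ?thesis using \<rho> by (simp add: zero_le_mult_iff)
  qed
  then show ?thesis using le[OF \<open>i \<le> Suc d\<close>] by simp
qed

text \<open>Along the link of the hub, \<open>x\<close> is a supersolution of
  \<open>\<rho> * y i = 1 + y (i - 1) + y (Suc i)\<close>, because further neighbours only add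
  nonnegative terms. The explicit solution \<open>g\<close> has nonpositive boundary values, so the
  minimum principle keeps it below \<open>x\<close>.\<close>

lemma hub_path_lower:
  assumes E: "tri 0 q E" and x: "\<And>v. 0 \<le> x v" "x 0 = (1::real)" and \<rho>: "\<rho> > 2"
    and eig: "\<And>v. 1 \<le> v \<Longrightarrow> v \<le> q \<Longrightarrow> \<rho> * x v = sum x (nb E v)"
    and t: "0 < t" "t * t + 1 = \<rho> * t"
  shows "(1 - t - t ^ card (nb E 0)) / (\<rho> - 2) \<le> x 1"
    and "(1 - t - t ^ card (nb E 0)) / (\<rho> - 2) \<le> x q"
proof -
  obtain vs where vs: "distinct vs" "set vs = nb E 0" "vs \<noteq> []" "vs ! 0 = 1" "last vs = q"
     "\<And>s. Suc s < length vs \<Longrightarrow> (vs ! s, vs ! Suc s) \<in> E" using tri_nb_list[OF E] by auto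
  define d where "d = card (nb E 0)"
  have d: "length vs = d" unfolding d_def using vs(1,2) distinct_card by metis
  have d1: "1 \<le> d" using vs(3) d by (cases vs) auto
  \<comment> \<open>The constant solution of the recurrence,
    \<open>\<rho> * \<kappa> = 1 + 2 * \<kappa>\<close>; powers of \<open>t\<close> and their mirror
    images solve the homogeneous one.\<close>
  define \<kappa> where "\<kappa> = 1 / (\<rho> - 2)"
  have \<kappa>: "0 < \<kappa>" "\<rho> * \<kappa> = 1 + 2 * \<kappa>" using \<rho> by (auto simp: \<kappa>_def field_simps)
  \<comment> \<open>Positions 1 to \<open>d\<close> follow the link; the value 0 at positions 0 and
    \<open>d + 1\<close> is the boundary condition.\<close>
  define y where "y i = (if 1 \<le> i \<and> i \<le> d then x (vs ! (i - 1)) else 0)" for i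
  define g where "g i = \<kappa> * (1 - t ^ i - t ^ (Suc d - i))" for i
  have y0: "0 \<le> y i" for i using x(1) by (simp add: y_def)
  have ystep: "1 + y (i - 1) + y (Suc i) \<le> \<rho> * y i" if i: "1 \<le> i" "i \<le> d" for i
  proof -
    let ?v = "vs ! (i - 1)"
    have v: "?v \<in> nb E 0" using i d vs(2) by (metis nth_mem diff_less less_le_trans less_numeral_extra(1))
    then have vr: "1 \<le> ?v" "?v \<le> q" using nb_tri_sub[OF E, of 0] by auto
    have inj: "vs ! a = vs ! b \<longleftrightarrow> a = b" if "a < d" "b < d" for a b
      using that vs(1) d by (simp add: nth_eq_iff_index_eq)
    have nz: "vs ! a \<noteq> 0" if "a < d" for a
      using that vs(2) d nb_tri_sub[OF E, of 0] nth_mem[of a vs] by auto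
    define A where "A = (if 1 < i then {vs ! (i - 2)} else {})"
    define B where "B = (if i < d then {vs ! i} else {})"
    have A: "sum x A = y (i - 1)" unfolding A_def y_def using i by (auto simp: numeral_2_eq_2)
    have B: "sum x B = y (Suc i)" unfolding B_def y_def using i by auto
    have dis: "0 \<notin> A" "0 \<notin> B" "A \<inter> B = {}"
      unfolding A_def B_def using i nz inj by (auto split: if_splits)
    have sub: "insert 0 (A \<union> B) \<subseteq> nb E ?v"
    proof -
      have "0 \<in> nb E ?v" using v by (auto simp: nb_def)
      moreover have "A \<subseteq> nb E ?v"
      proof (cases "1 < i")
        case True
        then have "Suc (i - 2) = i - 1" "Suc (i - 2) < length vs" using i d by simp_all
        then show ?thesis using vs(6)[of "i - 2"] by (auto simp: A_def nb_def)
      qed (simp add: A_def)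
      moreover have "B \<subseteq> nb E ?v" unfolding B_def using vs(6)[of "i - 1"] i d by (auto simp: nb_def)
      ultimately show ?thesis by auto
    qed
    have "1 + (y (i - 1) + y (Suc i)) = sum x (insert 0 (A \<union> B))"
      using dis A B x(2) by (simp add: A_def B_def sum.union_disjoint)
    also have "\<dots> \<le> sum x (nb E ?v)" using sub finite_nb_tri[OF E] x(1) by (intro sum_mono2) auto
    also have "\<dots> = \<rho> * x ?v" using eig[OF vr] by simp
    finally show ?thesis using i by (simp add: y_def)
  qed
  have gstep: "\<rho> * g i = 1 + g (i - 1) + g (Suc i)" if i: "1 \<le> i" "i \<le> d" for i
  proof -
    obtain a b where a: "i = Suc a" and b: "d = i + b" using i by (metis le_Suc_ex plus_1_eq_Suc)
    have "\<rho> * t ^ Suc s = t ^ s + t ^ Suc (Suc s)" for s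
      using arg_cong[OF t(2), of "\<lambda>z. z * t ^ s"] by (simp add: algebra_simps)
    from this[of a] this[of b] show ?thesis
      unfolding g_def using \<kappa>(2) a b by (simp add: algebra_simps)
  qed
  have "0 \<le> y i - g i" if "i \<le> Suc d" for i
  proof (rule discrete_min_principle[OF \<rho> _ _ _ that, where a = "\<lambda>i. y i - g i"])
    show "0 \<le> y 0 - g 0" using \<kappa> t(1) by (simp add: y_def g_def)
    show "0 \<le> y (Suc d) - g (Suc d)" using \<kappa> t(1) by (simp add: y_def g_def)
    show "y (j - 1) - g (j - 1) + (y (Suc j) - g (Suc j)) \<le> \<rho> * (y j - g j)" if "1 \<le> j" "j \<le> d" for j
      using ystep[OF that] gstep[OF that] by (simp add: algebra_simps)
  qed
  from this[of 1] this[of d] have "g 1 \<le> y 1" "g d \<le> y d" using d1 by auto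
  moreover have "y 1 = x 1" "y d = x q"
    using d1 vs(3,4,5) d by (auto simp: y_def last_conv_nth)
  moreover have "g 1 = (1 - t - t ^ d) / (\<rho> - 2)" "g d = (1 - t - t ^ d) / (\<rho> - 2)"
    using d1 by (auto simp: g_def \<kappa>_def field_simps)
  ultimately show "(1 - t - t ^ card (nb E 0)) / (\<rho> - 2) \<le> x 1"
    "(1 - t - t ^ card (nb E 0)) / (\<rho> - 2) \<le> x q" unfolding d_def by simp_all
qed

text \<open>The form \<open>x\<^sup>T A x\<close> if \<open>R\<close> is the symmetric arc set of a
  graph with adjacency matrix \<open>A\<close>; every undirected edge contributes twice.\<close>

definition qf :: "('a \<times> 'a) set \<Rightarrow> ('a \<Rightarrow> real) \<Rightarrow> real" where
  "qf R x = (\<Sum>(u, v)\<in>R. x u * x v)"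

lemma qf_eq:
  assumes "finite V" "R \<subseteq> V \<times> V"
  shows "qf R x = (\<Sum>v\<in>V. x v * sum x (R `` {v}))"
proof -
  have "(\<Sum>v\<in>V. x v * sum x (R `` {v})) = (\<Sum>v\<in>V. \<Sum>w\<in>R `` {v}. x v * x w)"
    by (simp add: sum_distrib_left)
  also have "\<dots> = (\<Sum>(v, w)\<in>(SIGMA v:V. R `` {v}). x v * x w)"
    using assms by (intro sum.Sigma) (auto intro: finite_subset)
  also have "(SIGMA v:V. R `` {v}) = R" using assms by auto
  finally show ?thesis by (simp add: qf_def)
qed

definition sy :: "('a \<times> 'a) set \<Rightarrow> ('a \<times> 'a) set" where "sy E = E \<union> E\<inverse>"

lemma Image_sy: "sy E `` {v} = nb E v" by (auto simp: sy_def nb_def)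

lemma sy_tri_sub: "tri i j E \<Longrightarrow> sy E \<subseteq> {i..j} \<times> {i..j}"
  unfolding sy_def using tri_bounds(2) by fastforce

text \<open>Hub 0 and rim path 1, ..., \<open>q\<close>, that is
  \<open>P\<^sub>1 \<or> P\<^sub>q\<close>.\<close>

definition fan_edges :: "nat \<Rightarrow> (nat \<times> nat) set" where
  "fan_edges q = {(a, b). a < b \<and> b \<le> q \<and> (a = 0 \<or> b = Suc a)}"

lemma tri_fan: "1 \<le> q \<Longrightarrow> tri 0 q (fan_edges q)"
proof (induction q rule: nat_induct_at_least)
  case base
  have "fan_edges 1 = {(0, Suc 0)}" by (auto simp: fan_edges_def)
  then show ?case using tri_edge[of 0] by simp
next
  case (Suc q)
  have "fan_edges (Suc q) = insert (0, Suc q) (fan_edges q \<union> {(q, Suc q)})"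
    using Suc by (auto simp: fan_edges_def)
  then show ?case using tri_node[OF Suc.IH tri_edge[of q]] by simp
qed

text \<open>The apex over \<open>(0, q)\<close> must be \<open>q - 1\<close>, since the vertex after
  the apex would otherwise be hidden from 0. So a single edge lies behind it, and the induction
  hypothesis covers the rest.\<close>

lemma tri_dominated_fan: "tri i q E \<Longrightarrow> i = 0 \<Longrightarrow> nb E 0 = {0<..q} \<Longrightarrow> E = fan_edges q"
proof (induction rule: tri.induct)
  case (tri_edge i)
  then show ?case by (auto simp: fan_edges_def)
next
  case (tri_node i k E1 j E2)
  note n = nb_node[OF tri_node(1,2)]
  note b1 = tri_bounds[OF tri_node(1)] and b2 = tri_bounds[OF tri_node(2)]
  have s: "nb E1 0 \<subseteq> {0<..k}" using nb_tri_sub[OF tri_node(1), of 0] tri_node(5) by auto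
  have e: "insert j (nb E1 0) = {0<..j}" using n(1) tri_node(5,6) by simp
  have jk: "j = Suc k"
  proof (rule ccontr)
    assume "j \<noteq> Suc k"
    then have "Suc k \<in> insert j (nb E1 0)" "Suc k \<noteq> j" using e b2(1) by auto
    then show False using s by auto
  qed
  have "{0<..j} = insert j {0<..k}" "j \<notin> {0<..k}" using jk by auto
  then have "nb E1 0 = {0<..k}" using e n(2) tri_node(5) by (metis insert_ident)
  then have E1: "E1 = fan_edges k" using tri_node by simp
  have E2: "E2 = {(k, Suc k)}" using tri_node(2) unfolding jk
  proof (cases rule: tri.cases)
    case (tri_node k' E1' E2')
    then show ?thesis using tri_bounds(1)[OF tri_node(2)] tri_bounds(1)[OF tri_node(3)] by simp
  qed auto
  have "fan_edges (Suc k) = insert (0, Suc k) (fan_edges k \<union> {(k, Suc k)})"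
    using b1(1) by (auto simp: fan_edges_def)
  then show ?case using E1 E2 jk tri_node(5) by simp
qed

section \<open>Rayleigh quotients on the fan\<close>

lemma nb_fan:
  assumes "1 \<le> q"
  shows "nb (fan_edges q) 0 = {1..q}"
    "1 \<le> v \<Longrightarrow> v \<le> q \<Longrightarrow> nb (fan_edges q) v =
      insert 0 ((if 1 < v then {v - 1} else {}) \<union> (if v < q then {Suc v} else {}))"
  using assms by (auto simp: nb_def fan_edges_def split: if_splits)

text \<open>\<open>t\<close> is the smaller root of \<open>t\<^sup>2 - \<rho> * t + 1\<close>. At
  \<open>\<rho> = 5/2\<close> the roots are 1/2 and 2, and the smaller root decreases in
  \<open>\<rho>\<close>.\<close>

lemma ex_recip_sum:
  fixes \<rho> :: real
  assumes "5/2 \<le> \<rho>"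
  obtains t where "0 < t" "t \<le> 1/2" "t * t + 1 = \<rho> * t"
proof -
  define s where "s = sqrt (\<rho>\<^sup>2 - 4)"
  have "(5/2)\<^sup>2 \<le> \<rho>\<^sup>2" using assms by (intro power_mono) auto
  then have nn: "0 \<le> \<rho>\<^sup>2 - 4" by (simp add: power2_eq_square)
  have s2: "s\<^sup>2 = \<rho>\<^sup>2 - 4" unfolding s_def by (rule real_sqrt_pow2[OF nn])
  have s0: "0 \<le> s" unfolding s_def by (rule real_sqrt_ge_zero[OF nn])
  have "s\<^sup>2 < \<rho>\<^sup>2" unfolding s2 by simp
  then have "s < \<rho>" by (rule power2_less_imp_less) (use assms in simp)
  moreover have "\<rho> - 1 \<le> s"
  proof (rule power2_le_imp_le[OF _ s0])
    show "(\<rho> - 1)\<^sup>2 \<le> s\<^sup>2" unfolding s2 using assms by (simp add: power2_eq_square algebra_simps)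
  qed
  moreover have "((\<rho> - s) / 2) * ((\<rho> - s) / 2) + 1 = \<rho> * ((\<rho> - s) / 2)"
  proof -
    have "((\<rho> - s) / 2) * ((\<rho> - s) / 2) + 1 - \<rho> * ((\<rho> - s) / 2) = (s\<^sup>2 - (\<rho>\<^sup>2 - 4)) / 4"
      by (simp add: power2_eq_square field_simps)
    then show ?thesis unfolding s2 by simp
  qed
  ultimately show ?thesis by (intro that[of "(\<rho> - s) / 2"]) auto
qed

text \<open>The test vector is 1 at the hub and solves the eigenvalue equation on the path exactly, with slightly
  negative boundary values; the roots of \<open>t\<^sup>2 + 1 = \<rho> t\<close> govern that recurrence.\<close>

lemma fan_quad_lower:
  assumes q: "1 \<le> q" and \<rho>: "\<rho> > 2" and t: "0 < t" "t \<le> 1/2" "t * t + 1 = \<rho> * t"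
    and ineq: "\<rho> * (\<rho> - 2) \<le> real q - 2 * (t / (1 - t))"
  obtains z where "\<rho> * (\<Sum>v\<le>q. (z v)\<^sup>2) < qf (sy (fan_edges q)) z"
proof -
  define \<kappa> where "\<kappa> = 1 / (\<rho> - 2)"
  have \<kappa>: "0 < \<kappa>" "\<rho> * \<kappa> = 1 + 2 * \<kappa>" using \<rho> by (auto simp: \<kappa>_def field_simps)
  define g where "g i = \<kappa> * (1 - t ^ i - t ^ (Suc q - i))" for i
  define z where "z i = (if i = 0 then 1 else g i)" for i
  let ?F = "fan_edges q"
  have gstep: "\<rho> * g i = 1 + g (i - 1) + g (Suc i)" if i: "1 \<le> i" "i \<le> q" for i
  proof -
    obtain a b where a: "i = Suc a" and b: "q = i + b" using i by (metis le_Suc_ex plus_1_eq_Suc)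
    have "\<rho> * t ^ Suc s = t ^ s + t ^ Suc (Suc s)" for s
      using arg_cong[OF t(3), of "\<lambda>z. z * t ^ s"] by (simp add: algebra_simps)
    from this[of a] this[of b] show ?thesis
      unfolding g_def using \<kappa>(2) a b by (simp add: algebra_simps)
  qed
  have g0: "g 0 \<le> 0" "g (Suc q) \<le> 0" using \<kappa> t by (auto simp: g_def mult_le_0_iff)
  have gpos: "0 \<le> g i" if "1 \<le> i" "i \<le> q" for i
  proof -
    have "t ^ i \<le> t ^ 1" "t ^ (Suc q - i) \<le> t ^ 1" using that t by (intro power_decreasing; simp)+
    then show ?thesis using \<kappa> t(2) by (simp add: g_def)
  qed
  have nbr: "\<rho> * z v \<le> sum z (nb ?F v)" if v: "1 \<le> v" "v \<le> q" for v
  proof -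
    have "sum z (nb ?F v) = 1 + (if 1 < v then g (v - 1) else 0) + (if v < q then g (Suc v) else 0)"
      unfolding nb_fan(2)[OF q v] using v by (auto simp: z_def)
    moreover have "g (v - 1) \<le> (if 1 < v then g (v - 1) else 0)"
    proof (cases "1 < v")
      case False
      then have "v - 1 = 0" using v by simp
      then show ?thesis using g0(1) False by simp
    qed simp
    moreover have "g (Suc v) \<le> (if v < q then g (Suc v) else 0)"
    proof (cases "v < q")
      case False
      then have "v = q" using v by simp
      then show ?thesis using g0(2) False by simp
    qed simp
    ultimately show ?thesis using gstep[OF v] v by (simp add: z_def)
  qed
  have geo: "(1 - t) * (\<Sum>i=1..q. t ^ i) = t - t * t ^ q"
  proof (induction q)
    case (Suc q)
    have "(1 - t) * (\<Sum>i=1..Suc q. t ^ i) = (1 - t) * (\<Sum>i=1..q. t ^ i) + (1 - t) * t ^ Suc q"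
      by (simp add: ring_distribs)
    also have "\<dots> = t - t * t ^ q + (1 - t) * t ^ Suc q" unfolding Suc ..
    also have "\<dots> = t - t * t ^ Suc q" by (simp add: algebra_simps)
    finally show ?case .
  qed simp
  have "(\<Sum>i=1..q. t ^ i) = (t - t * t ^ q) / (1 - t)" using geo t by (simp add: field_simps)
  also have "\<dots> < t / (1 - t)" using t by (intro divide_strict_right_mono) auto
  finally have geo2: "(\<Sum>i=1..q. t ^ i) < t / (1 - t)" .
  have refl: "(\<Sum>i=1..q. t ^ (Suc q - i)) = (\<Sum>i=1..q. t ^ i)"
    by (rule sum.reindex_bij_witness[of _ "\<lambda>i. Suc q - i" "\<lambda>i. Suc q - i"]) auto
  have "sum z (nb ?F 0) = (\<Sum>i=1..q. g i)"
    unfolding nb_fan(1)[OF q] by (rule sum.cong) (auto simp: z_def)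
  also have "\<dots> = \<kappa> * (\<Sum>i=1..q. 1 - t ^ i - t ^ (Suc q - i))" by (simp add: g_def sum_distrib_left)
  also have "(\<Sum>i=1..q. 1 - t ^ i - t ^ (Suc q - i)) = real q - 2 * (\<Sum>i=1..q. t ^ i)"
    using refl by (simp add: sum_subtractf)
  finally have "sum z (nb ?F 0) = \<kappa> * (real q - 2 * (\<Sum>i=1..q. t ^ i))" .
  moreover have "\<kappa> * (\<rho> * (\<rho> - 2)) < \<kappa> * (real q - 2 * (\<Sum>i=1..q. t ^ i))"
    using ineq geo2 \<kappa>(1) by simp
  moreover have "\<kappa> * (\<rho> * (\<rho> - 2)) = \<rho>" using \<rho> by (simp add: \<kappa>_def)
  \<comment> \<open>Strictness arises only here, at the hub: the finite geometric sum stays strictly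
    below \<open>t / (1 - t)\<close>.\<close>
  ultimately have hub: "\<rho> * z 0 < sum z (nb ?F 0)" by (simp add: z_def)
  have split: "{..q} = insert 0 {1..q}" by auto
  have "qf (sy ?F) z = (\<Sum>v\<le>q. z v * sum z (nb ?F v))"
    using qf_eq[of "{..q}" "sy ?F" z] sy_tri_sub[OF tri_fan[OF q]] by (simp add: Image_sy atLeast0AtMost)
  also have "\<dots> = z 0 * sum z (nb ?F 0) + (\<Sum>v=1..q. z v * sum z (nb ?F v))" unfolding split by simp
  also have "\<dots> > z 0 * (\<rho> * z 0) + (\<Sum>v=1..q. z v * (\<rho> * z v))"
  proof (rule add_less_le_mono)
    show "z 0 * (\<rho> * z 0) < z 0 * sum z (nb ?F 0)" using hub by (simp add: z_def)
    show "(\<Sum>v=1..q. z v * (\<rho> * z v)) \<le> (\<Sum>v=1..q. z v * sum z (nb ?F v))"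
      using nbr gpos by (intro sum_mono mult_left_mono) (auto simp: z_def)
  qed
  also have "z 0 * (\<rho> * z 0) + (\<Sum>v=1..q. z v * (\<rho> * z v)) = (\<Sum>v\<le>q. z v * (\<rho> * z v))"
    unfolding split by simp
  also have "\<dots> = \<rho> * (\<Sum>v\<le>q. (z v)\<^sup>2)"
    by (simp add: sum_distrib_left power2_eq_square mult_ac)
  finally show ?thesis by (rule that)
qed

text \<open>AM-GM on every edge, with weight \<open>y\<close> on the spokes and 1 on the rim. The
  choice \<open>y = 1 / (c - 2)\<close> balances the coefficient \<open>q * y\<close> of the hub
  against \<open>1 / y + 2\<close> of a rim vertex: both equal \<open>c\<close>, a root of
  \<open>c * (c - 2) = q\<close>.\<close>

lemma fan_quad_upper:
  assumes q: "1 \<le> q"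
  shows "qf (sy (fan_edges q)) x \<le> (1 + sqrt (real q + 1)) * (\<Sum>v\<le>q. (x v)\<^sup>2)"
proof -
  define c where "c = 1 + sqrt (real q + 1)"
  define y where "y = 1 / (c - 2)"
  have "sqrt 1 < sqrt (real q + 1)" using q by (intro real_sqrt_less_mono) auto
  then have c2: "c > 2" by (simp add: c_def)
  have cc: "c * (c - 2) = real q" by (simp add: c_def algebra_simps)
  have y: "y > 0" "1 + 2 * y = c * y" "real q * y = c" using c2 cc by (auto simp: y_def field_simps)
  have am: "2 * (a * b) \<le> w * a\<^sup>2 + b\<^sup>2 / w" if "w > 0" for a b w :: real
  proof -
    have "0 \<le> (w * a - b)\<^sup>2 / w" using that by simp
    also have "\<dots> = w * a\<^sup>2 + b\<^sup>2 / w - 2 * (a * b)" using that by (simp add: power2_eq_square field_simps)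
    finally show ?thesis by simp
  qed
  have dec: "fan_edges q = (\<lambda>i. (0, i)) ` {1..q} \<union> (\<lambda>i. (i, Suc i)) ` {1..<q}"
  proof (rule equalityI; rule subsetI)
    fix e assume "e \<in> fan_edges q"
    then obtain a b where e: "e = (a, b)" "a < b" "b \<le> q" "a = 0 \<or> b = Suc a"
      by (auto simp: fan_edges_def)
    then show "e \<in> (\<lambda>i. (0, i)) ` {1..q} \<union> (\<lambda>i. (i, Suc i)) ` {1..<q}" by (cases "a = 0") auto
  qed (auto simp: fan_edges_def)
  have fin: "finite (fan_edges q)" unfolding dec by auto
  have dis: "fan_edges q \<inter> (fan_edges q)\<inverse> = {}" by (auto simp: fan_edges_def)
  have "(\<Sum>(u, v)\<in>(fan_edges q)\<inverse>. x u * x v) = (\<Sum>(u, v)\<in>fan_edges q. x u * x v)"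
    by (rule sum.reindex_bij_witness[of _ prod.swap prod.swap]) (auto simp: mult.commute)
  then have "qf (sy (fan_edges q)) x = 2 * (\<Sum>(u, v)\<in>fan_edges q. x u * x v)"
    unfolding qf_def sy_def using fin dis by (simp add: sum.union_disjoint)
  also have "(\<Sum>(u, v)\<in>fan_edges q. x u * x v) = (\<Sum>i=1..q. x 0 * x i) + (\<Sum>i=1..<q. x i * x (Suc i))"
    unfolding dec by (subst sum.union_disjoint) (auto simp: sum.reindex inj_on_def)
  also have "2 * \<dots> = (\<Sum>i=1..q. 2 * (x 0 * x i)) + (\<Sum>i=1..<q. 2 * (x i * x (Suc i)))"
    by (simp add: sum_distrib_left algebra_simps)
  also have "\<dots> \<le> (\<Sum>i=1..q. y * (x 0)\<^sup>2 + (x i)\<^sup>2 / y) + (\<Sum>i=1..<q. (x i)\<^sup>2 + (x (Suc i))\<^sup>2)"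
    using am[OF y(1), of "x 0"] am[of 1] by (intro add_mono sum_mono) auto
  also have "\<dots> = c * (x 0)\<^sup>2 + (\<Sum>i=1..q. (x i)\<^sup>2) / y + ((\<Sum>i=1..<q. (x i)\<^sup>2) + (\<Sum>i=1..<q. (x (Suc i))\<^sup>2))"
    using y(3) by (simp add: sum.distrib sum_divide_distrib)
  also have "(\<Sum>i=1..<q. (x i)\<^sup>2) \<le> (\<Sum>i=1..q. (x i)\<^sup>2)" by (intro sum_mono2) auto
  also have "(\<Sum>i=1..<q. (x (Suc i))\<^sup>2) = (\<Sum>i\<in>Suc ` {1..<q}. (x i)\<^sup>2)"
    using sum.reindex[of Suc "{1..<q}" "\<lambda>i. (x i)\<^sup>2"] by (simp only: inj_Suc comp_def)
  also have "\<dots> \<le> (\<Sum>i=1..q. (x i)\<^sup>2)" by (intro sum_mono2) auto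
  also have "c * (x 0)\<^sup>2 + (\<Sum>i=1..q. (x i)\<^sup>2) / y + ((\<Sum>i=1..q. (x i)\<^sup>2) + (\<Sum>i=1..q. (x i)\<^sup>2))
     = c * (x 0)\<^sup>2 + (1 / y + 2) * (\<Sum>i=1..q. (x i)\<^sup>2)" by (simp add: algebra_simps)
  also have "1 / y + 2 = c" using y by (simp add: field_simps)
  also have "c * (x 0)\<^sup>2 + c * (\<Sum>i=1..q. (x i)\<^sup>2) = c * (\<Sum>v\<in>insert 0 {1..q}. (x v)\<^sup>2)"
    by (simp add: algebra_simps)
  also have "insert 0 {1..q} = {..q}" by auto
  finally show ?thesis by (simp add: c_def)
qed

text \<open>If \<open>\<rho>\<close> is not too small, the 2-walk count and the lower bounds at 1
  and \<open>q\<close> combine to \<open>\<rho> * (\<rho> - 2) \<le> q - 2 * (t / (1 - t))\<close>,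
  which is the very hypothesis under which \<open>fan_quad_lower\<close> lets the fan beat
  \<open>\<rho>\<close>.\<close>

lemma nonfan_hub_bound:
  assumes q: "9 \<le> q" and E: "tri 0 q E" and nf: "nb E 0 \<noteq> {0<..q}"
    and x: "\<And>v. 0 \<le> x v" "\<And>v. x v \<le> 1" "x 0 = (1::real)"
    and eig: "\<And>v. v \<le> q \<Longrightarrow> \<rho> * x v = sum x (nb E v)"
  obtains z where "\<rho> * (\<Sum>v\<le>q. (z v)\<^sup>2) < qf (sy (fan_edges q)) z"
proof (cases "\<rho> \<le> (101/25)")
  \<comment> \<open>For \<open>9 \<le> q\<close> the fan itself exceeds 101/25, which settles small
    \<open>\<rho>\<close>. In the other case the constant keeps \<open>1 - 4 / \<rho>\<close> away
    from 0.\<close>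
  case True
  obtain t :: real where t: "0 < t" "t \<le> 1/2" "t * t + 1 = (101/25) * t" by (rule ex_recip_sum[of "(101/25)"]) auto
  have "t / (1 - t) \<le> (37/100)"
  proof -
    \<comment> \<open>27/100 and 377/100 add up to 101/25, so
      \<open>(t - 27/100) * (377/100 - t)\<close> is \<open>101/25 * t - t * t\<close> minus a
      constant above 1, hence negative.\<close>
    have "t \<le> (27/100)"
    proof (rule ccontr)
      assume "\<not> t \<le> (27/100)"
      then have "0 \<le> (t - (27/100)) * ((377/100) - t)" using t(2) by (intro mult_nonneg_nonneg) auto
      moreover have "(t - (27/100)) * ((377/100) - t) = (101/25) * t - t * t - (10179/10000)" by (simp add: field_simps)
      ultimately show False using t(3) by linarith
    qed
    then show ?thesis using t by (simp add: divide_le_eq)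
  qed
  then have "(101/25) * ((101/25) - 2) \<le> real q - 2 * (t / (1 - t))" using q by simp
  then obtain z where "(101/25) * (\<Sum>v\<le>q. (z v)\<^sup>2) < qf (sy (fan_edges q)) z"
    using fan_quad_lower[of q "(101/25)" t] q t by auto
  moreover have "\<rho> * (\<Sum>v\<le>q. (z v)\<^sup>2) \<le> (101/25) * (\<Sum>v\<le>q. (z v)\<^sup>2)"
    using True by (intro mult_right_mono sum_nonneg) auto
  ultimately show ?thesis by (intro that[of z]) linarith
next
  case False
  then have \<rho>: "\<rho> > (101/25)" by simp
  obtain t where t: "0 < t" "t \<le> 1/2" "t * t + 1 = \<rho> * t" using \<rho> by (rule_tac ex_recip_sum[of \<rho>]) auto
  define d where "d = card (nb E 0)"
  have S: "sum x (nb E 0) = \<rho>" using eig[of 0] x(3) by simp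
  moreover have "sum x (nb E 0) \<le> d" unfolding d_def using finite_nb_tri[OF E] x(2) by (rule sum_le_card)
  ultimately have "4 < real d" using \<rho> by linarith
  then have d: "5 \<le> d" by simp
  have "\<rho> * \<rho> = (\<Sum>v\<in>nb E 0. \<rho> * x v)" using S by (simp add: sum_distrib_left[symmetric])
  also have "\<dots> = (\<Sum>v\<in>nb E 0. sum x (nb E v))"
    using nb_tri_sub[OF E, of 0] by (intro sum.cong eig) auto
  also have "\<dots> \<le> real q + 2 * \<rho> - x 1 - x q - (1 - 4 / \<rho>)"
  proof -
    have "4 \<le> \<rho>" using \<rho> by simp
    from tri_two_walks[where x = x, OF E x(1,2) this] eig nf S show ?thesis by simp
  qed
  finally have 1: "\<rho> * (\<rho> - 2) \<le> real q - x 1 - x q - (1 - 4 / \<rho>)" by (simp add: algebra_simps)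
  have lo: "(1 - t - t ^ d) / (\<rho> - 2) \<le> x 1" "(1 - t - t ^ d) / (\<rho> - 2) \<le> x q"
    using hub_path_lower[OF E x(1,3) _ eig t(1,3)] \<rho> d_def by auto
  have r2: "(1 - t) * (1 - t) = (\<rho> - 2) * t" using t(3) by (simp add: algebra_simps)
  have tau: "(1 - t) / (\<rho> - 2) = t / (1 - t)" using r2 t \<rho> by (simp add: field_simps)
  have "t * (\<rho> - t) = 1" using t(3) by (simp add: algebra_simps)
  have t3: "t \<le> (3/10)"
  proof (rule ccontr)
    assume "\<not> t \<le> (3/10)"
    then have "(3/10) * (7/2) < t * (\<rho> - t)" using \<rho> t(2) by (intro mult_strict_mono) auto
    then show False using \<open>t * (\<rho> - t) = 1\<close> by simp
  qed
  \<comment> \<open>The error \<open>2 * (t ^ d / (\<rho> - 2))\<close> is at most 1/400, whereas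
    the loss \<open>1 - 4 / \<rho>\<close> is at least 1/101.\<close>
  have "t ^ d \<le> t ^ 5" using d t by (intro power_decreasing) auto
  also have "\<dots> \<le> (3/10) ^ 5" using t t3 by (intro power_mono) auto
  also have "\<dots> \<le> 1 / 400" by (simp add: eval_nat_numeral)
  finally have "t ^ d / (\<rho> - 2) \<le> (1 / 400) / 2" using \<rho> t by (intro frac_le) auto
  moreover have "4 / \<rho> \<le> 4 / (101/25)" using \<rho> by (intro divide_left_mono) auto
  ultimately have "2 * (t ^ d / (\<rho> - 2)) \<le> 1 - 4 / \<rho>" by simp
  moreover have "(1 - t - t ^ d) / (\<rho> - 2) = t / (1 - t) - t ^ d / (\<rho> - 2)"
    using tau by (simp add: diff_divide_distrib)
  ultimately have "\<rho> * (\<rho> - 2) \<le> real q - 2 * (t / (1 - t))" using 1 lo by linarith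
  then show ?thesis using fan_quad_lower[of q \<rho> t] q \<rho> t that by auto
qed

section \<open>Extending and rotating triangulations\<close>

definition noncross :: "(nat \<times> nat) set \<Rightarrow> bool" where
  "noncross E \<longleftrightarrow> (\<forall>a b c d. (a, c) \<in> E \<longrightarrow> (b, d) \<in> E \<longrightarrow> a < b \<longrightarrow> b < c \<longrightarrow> \<not> c < d)"

lemma tri_noncross: "tri i j E \<Longrightarrow> noncross E"
  unfolding noncross_def using tri_noncrossing by blast

lemma noncross_mono: "noncross E \<Longrightarrow> F \<subseteq> E \<Longrightarrow> noncross F"
  unfolding noncross_def by blast

text \<open>The apex \<open>k\<close> is the largest neighbour of \<open>i\<close> below
  \<open>j\<close>, or \<open>Suc i\<close> if there is none. An edge passing over \<open>k\<close>
  cannot start at \<open>i\<close>, by this choice, and an edge starting between \<open>i\<close>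
  and \<open>k\<close> would cross \<open>(i, k)\<close>. So apart from \<open>(i, j)\<close> all of
  \<open>E\<close> splits at \<open>k\<close>.\<close>

lemma tri_extend:
  "i < j \<Longrightarrow> (\<And>a b. (a, b) \<in> E \<Longrightarrow> i \<le> a \<and> a < b \<and> b \<le> j) \<Longrightarrow> noncross E \<Longrightarrow> \<exists>T. E \<subseteq> T \<and> tri i j T"
proof (induction "j - i" arbitrary: i j E rule: less_induct)
  case less
  show ?case
  proof (cases "j = Suc i")
    case True
    then have "E \<subseteq> {(i, Suc i)}" using less.prems(2) by fastforce
    then show ?thesis using tri_edge[of i] True by blast
  next
    case False
    define K where "K = {k. (i, k) \<in> E \<and> k < j} \<union> {Suc i}"
    define k where "k = Max K"
    have fin: "finite K" unfolding K_def by simp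
    then have "k \<in> K" unfolding k_def by (rule Max_in) (simp add: K_def)
    then have k: "i < k" "k < j" "k = Suc i \<or> (i, k) \<in> E"
      using less.prems(1) less.prems(2) False unfolding K_def by force+
    have kmax: "w \<le> k" if "(i, w) \<in> E" "w < j" for w
      unfolding k_def using that fin by (intro Max_ge) (auto simp: K_def)
    define E1 where "E1 = {(a, b) \<in> E. b \<le> k}"
    define E2 where "E2 = {(a, b) \<in> E. k \<le> a}"
    have "\<exists>T. E1 \<subseteq> T \<and> tri i k T"
    proof (rule less.hyps)
      show "i \<le> a \<and> a < b \<and> b \<le> k" if "(a, b) \<in> E1" for a b using that less.prems(2) by (auto simp: E1_def)
      show "noncross E1" by (rule noncross_mono[OF less.prems(3)]) (auto simp: E1_def)
    qed (use k in auto)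
    moreover have "\<exists>T. E2 \<subseteq> T \<and> tri k j T"
    proof (rule less.hyps)
      show "k \<le> a \<and> a < b \<and> b \<le> j" if "(a, b) \<in> E2" for a b using that less.prems(2) by (auto simp: E2_def)
      show "noncross E2" by (rule noncross_mono[OF less.prems(3)]) (auto simp: E2_def)
    qed (use k in auto)
    moreover have "E \<subseteq> insert (i, j) (E1 \<union> E2)"
    proof (rule subsetI, rule ccontr)
      fix e assume e: "e \<in> E" "e \<notin> insert (i, j) (E1 \<union> E2)"
      obtain a b where "e = (a, b)" by fastforce
      with e have ab: "(a, b) \<in> E" "(a, b) \<notin> E2" "(a, b) \<notin> E1" "\<not> (a = i \<and> b = j)" by auto
      then have "a < k" "k < b" by (auto simp: E1_def E2_def)
      moreover have "a \<noteq> i" using kmax[of b] ab less.prems(2)[OF ab(1)] \<open>k < b\<close> by force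
      moreover have "i \<le> a" using less.prems(2)[OF ab(1)] by simp
      ultimately show False using k(3) less.prems(3) ab(1) unfolding noncross_def by force
    qed
    ultimately obtain T1 T2 where "E1 \<subseteq> T1" "tri i k T1" "E2 \<subseteq> T2" "tri k j T2"
      "E \<subseteq> insert (i, j) (E1 \<union> E2)" by blast
    then show ?thesis using tri_node[of i k T1 j T2] by (intro exI[of _ "insert (i, j) (T1 \<union> T2)"]) auto
  qed
qed

text \<open>Relabelling of the polygon that sends \<open>v + 1\<close> to \<open>v\<close> and 0 to
  \<open>q\<close>; edges at 0 are turned round to remain increasing pairs.\<close>

definition rotate_edges :: "nat \<Rightarrow> (nat \<times> nat) set \<Rightarrow> (nat \<times> nat) set" where
  "rotate_edges q E = {(a, b). (Suc a, Suc b) \<in> E \<or> b = q \<and> (0, Suc a) \<in> E}"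

text \<open>The rotated set is noncrossing and hence extends to a triangulation; it already has as
  many edges as any triangulation, so the extension adds nothing.\<close>

lemma tri_rotate:
  assumes E: "tri 0 q E"
  shows "tri 0 q (rotate_edges q E)"
proof -
  note b = tri_bounds(2)[OF E]
  have q: "0 < q" using tri_bounds(1)[OF E] .
  have nc: "noncross (rotate_edges q E)" unfolding noncross_def
  proof (intro allI impI notI)
    fix a b' c d assume h: "(a, c) \<in> rotate_edges q E" "(b', d) \<in> rotate_edges q E" "a < b'" "b' < c" "c < d"
    have "d \<le> q" using h(2) b unfolding rotate_edges_def by fastforce
    then have 1: "(Suc a, Suc c) \<in> E" using h unfolding rotate_edges_def by auto
    from h(2) consider "(Suc b', Suc d) \<in> E" | "(0, Suc b') \<in> E" unfolding rotate_edges_def by auto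
    then show False
    proof cases
      case 1
      then show ?thesis using tri_noncrossing[OF E \<open>(Suc a, Suc c) \<in> E\<close> 1] h by simp
    next
      case 2
      then show ?thesis using tri_noncrossing[OF E 2 \<open>(Suc a, Suc c) \<in> E\<close>] h by simp
    qed
  qed
  have bd: "0 \<le> a \<and> a < c \<and> c \<le> q" if "(a, c) \<in> rotate_edges q E" for a c
    using that b unfolding rotate_edges_def by fastforce
  obtain T where T: "rotate_edges q E \<subseteq> T" "tri 0 q T" using tri_extend[OF q bd nc] by blast
  have "bij_betw (\<lambda>(a, b). if a = 0 then (b - 1, q) else (a - 1, b - 1)) E (rotate_edges q E)"
    unfolding bij_betw_def
  proof
    show "inj_on (\<lambda>(a, b). if a = 0 then (b - 1, q) else (a - 1, b - 1)) E"
    proof (rule inj_onI, clarify)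
      fix a b' c d assume h: "(a, b') \<in> E" "(c, d) \<in> E"
        "(if a = 0 then (b' - 1, q) else (a - 1, b' - 1)) = (if c = 0 then (d - 1, q) else (c - 1, d - 1))"
      show "a = c \<and> b' = d" using b[OF h(1)] b[OF h(2)] h(3) by (auto split: if_splits)
    qed
    show "(\<lambda>(a, b). if a = 0 then (b - 1, q) else (a - 1, b - 1)) ` E = rotate_edges q E"
    proof (rule equalityI; rule subsetI)
      fix e assume "e \<in> (\<lambda>(a, b). if a = 0 then (b - 1, q) else (a - 1, b - 1)) ` E"
      then show "e \<in> rotate_edges q E" using b unfolding rotate_edges_def by (force split: if_splits)
    next
      fix e assume "e \<in> rotate_edges q E"
      then obtain a c where e: "e = (a, c)" and "(Suc a, Suc c) \<in> E \<or> c = q \<and> (0, Suc a) \<in> E"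
        unfolding rotate_edges_def by auto
      then show "e \<in> (\<lambda>(a, b). if a = 0 then (b - 1, q) else (a - 1, b - 1)) ` E"
      proof (elim disjE conjE)
        assume "(Suc a, Suc c) \<in> E"
        then show ?thesis by (rule rev_image_eqI) (simp add: e)
      next
        assume "c = q" "(0, Suc a) \<in> E"
        then show ?thesis by (intro rev_image_eqI[of "(0, Suc a)"]) (simp_all add: e)
      qed
    qed
  qed
  then have "card (rotate_edges q E) = card T"
    using tri_card[OF E] tri_card[OF T(2)] bij_betw_same_card by fastforce
  then have "rotate_edges q E = T" using T(1) tri_bounds(4)[OF T(2)] by (metis card_subset_eq)
  then show ?thesis using T(2) by simp
qed

lemma nb_rotate:
  assumes E: "tri 0 q E" and "v \<le> q" "w \<le> q"
  shows "w \<in> nb (rotate_edges q E) v \<longleftrightarrow> (if w = q then 0 else Suc w) \<in> nb E (if v = q then 0 else Suc v)"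
proof -
  note b = tri_bounds(2)[OF E]
  have "(0, 0) \<notin> E" "(Suc w, 0) \<notin> E" "(Suc v, 0) \<notin> E" "(Suc q, x) \<notin> E" "(x, Suc q) \<notin> E" for x
    using b by fastforce+
  then show ?thesis using assms(2,3) unfolding nb_def rotate_edges_def by auto
qed

text \<open>Makes any vertex the vertex 0, where the hub estimates expect the hub.\<close>

lemma tri_rotate_to:
  "tri 0 q E \<Longrightarrow> u \<le> q \<Longrightarrow> \<exists>E' h. tri 0 q E' \<and> bij_betw h {..q} {..q} \<and> h 0 = u \<and>
     (\<forall>v\<le>q. \<forall>w\<le>q. w \<in> nb E' v \<longleftrightarrow> h w \<in> nb E (h v))"
proof (induction u arbitrary: E)
  case 0
  then show ?case by (intro exI[of _ E] exI[of _ id]) (auto simp: bij_betw_def)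
next
  case (Suc u)
  let ?g = "\<lambda>v. if v = q then 0 else Suc v"
  obtain E' h where E': "tri 0 q E'" "bij_betw h {..q} {..q}" "h 0 = u"
    and nb: "\<And>v w. v \<le> q \<Longrightarrow> w \<le> q \<Longrightarrow> w \<in> nb E' v \<longleftrightarrow> h w \<in> nb (rotate_edges q E) (h v)"
    using Suc.IH[OF tri_rotate[OF Suc.prems(1)]] Suc.prems(2) by auto
  have g: "bij_betw ?g {..q} {..q}"
    by (rule bij_betw_byWitness[where f' = "\<lambda>v. if v = 0 then q else v - 1"]) (auto split: if_splits)
  have "h v \<le> q" if "v \<le> q" for v using E'(2) that by (auto simp: bij_betw_def)
  then have "w \<in> nb E' v \<longleftrightarrow> (?g \<circ> h) w \<in> nb E ((?g \<circ> h) v)" if "v \<le> q" "w \<le> q" for v w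
    using nb[OF that] nb_rotate[OF Suc.prems(1), of "h v" "h w"] that by auto
  then show ?case using E' Suc.prems(2) bij_betw_trans[OF E'(2) g]
    by (intro exI[of _ E'] exI[of _ "?g \<circ> h"]) (auto simp: comp_def)
qed

lemma nb_rotated:
  assumes E: "tri 0 q E" and E': "tri 0 q E'" and h: "bij_betw h {..q} {..q}"
    and nb: "\<forall>v\<le>q. \<forall>w\<le>q. w \<in> nb E' v \<longleftrightarrow> h w \<in> nb E (h v)" and v: "v \<le> q"
  shows "nb E (h v) = h ` nb E' v" "inj_on h (nb E' v)"
proof -
  have s: "nb E' v \<subseteq> {..q}" "nb E (h v) \<subseteq> {..q}"
    using nb_tri_sub[OF E, of "h v"] nb_tri_sub[OF E', of v] by auto
  show "inj_on h (nb E' v)" using h s(1) by (auto simp: bij_betw_def intro: inj_on_subset)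
  show "nb E (h v) = h ` nb E' v"
  proof
    show "h ` nb E' v \<subseteq> nb E (h v)" using s(1) nb v by auto
    show "nb E (h v) \<subseteq> h ` nb E' v"
    proof
      fix y assume y: "y \<in> nb E (h v)"
      then obtain w where "w \<le> q" "y = h w" using s(2) h by (force simp: bij_betw_def)
      then show "y \<in> h ` nb E' v" using nb v y by auto
    qed
  qed
qed

definition dominated :: "nat \<Rightarrow> (nat \<times> nat) set \<Rightarrow> bool" where
  "dominated q E \<longleftrightarrow> (\<exists>u\<le>q. nb E u = {..q} - {u})"

lemma dominated_iso_fan:
  assumes E: "tri 0 q E" and "dominated q E"
  obtains h where "bij_betw h {..q} {..q}"
    "\<And>v w. v \<le> q \<Longrightarrow> w \<le> q \<Longrightarrow> (v, w) \<in> sy (fan_edges q) \<longleftrightarrow> (h v, h w) \<in> sy E"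
proof -
  obtain u where u: "u \<le> q" "nb E u = {..q} - {u}" using assms(2) by (auto simp: dominated_def)
  obtain E' h where E': "tri 0 q E'" and h: "bij_betw h {..q} {..q}" "h 0 = u"
    and nb: "\<And>v w. v \<le> q \<Longrightarrow> w \<le> q \<Longrightarrow> w \<in> nb E' v \<longleftrightarrow> h w \<in> nb E (h v)"
    using tri_rotate_to[OF E u(1)] by blast
  have "nb E' 0 = {0<..q}"
  proof (rule equalityI; rule subsetI)
    fix w assume "w \<in> nb E' 0"
    then show "w \<in> {0<..q}" using nb_tri_sub[OF E', of 0] by auto
  next
    fix w assume w: "w \<in> {0<..q}"
    then have "h w \<noteq> h 0" "h w \<le> q" using h(1) by (auto simp: bij_betw_def inj_on_def)
    then show "w \<in> nb E' 0" using nb[of 0 w] w u h(2) by auto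
  qed
  then have "E' = fan_edges q" using tri_dominated_fan[OF E'] by simp
  then show ?thesis using h nb by (intro that[of h]) (auto simp flip: Image_sy simp: Image_def)
qed

definition eigt :: "nat \<Rightarrow> (nat \<times> nat) set \<Rightarrow> real \<Rightarrow> (nat \<Rightarrow> real) \<Rightarrow> bool" where
  "eigt q E \<rho> x \<longleftrightarrow> (\<forall>v\<le>q. 0 \<le> x v) \<and> (\<exists>v\<le>q. x v \<noteq> 0) \<and> (\<forall>v\<le>q. \<rho> * x v = sum x (nb E v))"

text \<open>Scaling the vector to maximum 1 and rotating a largest entry to position 0 produces the
  normal form that \<open>nonfan_hub_bound\<close> assumes.\<close>

lemma large_not_dominated_below_fan:
  assumes q: "9 \<le> q" and E: "tri 0 q E" and x: "eigt q E \<rho> x" and nd: "\<not> dominated q E"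
  obtains z where "\<rho> * (\<Sum>v\<le>q. (z v)\<^sup>2) < qf (sy (fan_edges q)) z"
proof -
  define M where "M = Max (x ` {..q})"
  have "M \<in> x ` {..q}" unfolding M_def by (rule Max_in) auto
  then obtain u where u: "u \<le> q" "x u = M" by auto
  have le: "x v \<le> M" if "v \<le> q" for v unfolding M_def using that by (intro Max_ge) auto
  obtain v where "v \<le> q" "0 \<le> x v" "x v \<noteq> 0" using x by (auto simp: eigt_def)
  then have M: "M > 0" using le[of v] by simp
  obtain E' h where E': "tri 0 q E'" and h: "bij_betw h {..q} {..q}" "h 0 = u"
    and nb: "\<forall>v\<le>q. \<forall>w\<le>q. w \<in> nb E' v \<longleftrightarrow> h w \<in> nb E (h v)"
    using tri_rotate_to[OF E u(1)] by blast
  note nbr = nb_rotated[OF E E' h(1) nb]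
  have hq: "h v \<le> q" if "v \<le> q" for v using h(1) that by (auto simp: bij_betw_def)
  define y where "y v = (if v \<le> q then x (h v) / M else 0)" for v
  have y: "0 \<le> y v" "y v \<le> 1" for v
    using x hq[of v] le[of "h v"] M by (auto simp: y_def eigt_def)
  have y0: "y 0 = 1" using h(2) u M by (simp add: y_def)
  have eig: "\<rho> * y v = sum y (nb E' v)" if v: "v \<le> q" for v
  proof -
    have s: "nb E' v \<subseteq> {..q}" using nb_tri_sub[OF E', of v] by auto
    have "sum y (nb E' v) = (\<Sum>w\<in>nb E' v. x (h w) / M)" using s by (intro sum.cong) (auto simp: y_def)
    also have "\<dots> = sum x (nb E (h v)) / M"
      unfolding nbr(1)[OF v] by (simp add: sum.reindex[OF nbr(2)[OF v]] sum_divide_distrib)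
    also have "sum x (nb E (h v)) = \<rho> * x (h v)" using x hq[OF v] by (simp add: eigt_def)
    finally show ?thesis using v by (simp add: y_def)
  qed
  have "nb E' 0 \<noteq> {0<..q}"
  proof
    assume "nb E' 0 = {0<..q}"
    then have "nb E u = h ` {0<..q}" using nbr(1)[of 0] h(2) by simp
    also have "{0<..q} = {..q} - {0}" by auto
    also have "h ` ({..q} - {0}) = {..q} - {u}"
      using h by (auto simp: bij_betw_def inj_on_image_set_diff[of h "{..q}"])
    finally show False using nd u(1) by (auto simp: dominated_def)
  qed
  from nonfan_hub_bound[where x = y, OF q E' this y y0] eig show ?thesis using that by blast
qed

section \<open>Small triangulations\<close>

text \<open>The first argument is recursion fuel, for which \<open>j - i\<close> is enough;
  \<open>k\<close> runs over the apexes as in \<open>tri\<close>.\<close>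

primrec tri_list :: "nat \<Rightarrow> nat \<Rightarrow> nat \<Rightarrow> (nat \<times> nat) list list" where
  "tri_list 0 i j = []"
| "tri_list (Suc n) i j = (if j = Suc i then [[(i, j)]] else
     concat (map (\<lambda>k. concat (map (\<lambda>A. map (\<lambda>B. (i, j) # A @ B) (tri_list n k j)) (tri_list n i k))) [Suc i..<j]))"

lemma tri_list_complete: "tri i j E \<Longrightarrow> j - i \<le> n \<Longrightarrow> \<exists>es\<in>set (tri_list n i j). set es = E"
proof (induction arbitrary: n rule: tri.induct)
  case (tri_edge i)
  then show ?case by (cases n) auto
next
  case (tri_node i k E1 j E2)
  note b1 = tri_bounds(1)[OF tri_node(1)] and b2 = tri_bounds(1)[OF tri_node(2)]
  obtain m where n: "n = Suc m" using tri_node(5) b1 b2 by (cases n) auto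
  have "k - i \<le> m" "j - k \<le> m" using tri_node(5) b1 b2 n by linarith+
  then obtain A B where A: "A \<in> set (tri_list m i k)" "set A = E1"
    and B: "B \<in> set (tri_list m k j)" "set B = E2" using tri_node(3,4) by blast
  have "(i, j) # A @ B \<in> set (tri_list n i j)" using A(1) B(1) b1 b2 n
    by (auto simp: Suc_le_eq intro!: bexI[of _ k] bexI[of _ A])
  then show ?case using A(2) B(2) by (intro bexI[of _ "(i, j) # A @ B"]) auto
qed

lemma tri_list_sound: "i < j \<Longrightarrow> es \<in> set (tri_list n i j) \<Longrightarrow> tri i j (set es) \<and> distinct es"
proof (induction n arbitrary: i j es)
  case (Suc n)
  show ?case
  proof (cases "j = Suc i")
    case True
    then show ?thesis using Suc.prems tri_edge[of i] by auto
  next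
    case False
    then obtain k A B where k: "i < k" "k < j" and A: "A \<in> set (tri_list n i k)"
      and B: "B \<in> set (tri_list n k j)" and es: "es = (i, j) # A @ B" using Suc.prems
      by (auto simp: Suc_le_eq)
    from Suc.IH[OF k(1) A] Suc.IH[OF k(2) B]
    have t: "tri i k (set A)" "tri k j (set B)" "distinct A" "distinct B" by auto
    have "(i, j) \<notin> set A \<union> set B" "set A \<inter> set B = {}"
      using tri_bounds(2)[OF t(1)] tri_bounds(2)[OF t(2)] k by fastforce+
    then show ?thesis using tri_node[OF t(1,2)] t(3,4) es by simp
  qed
qed simp

section \<open>Certified upper bounds on spectral radii\<close>

definition nb_step :: "nat \<Rightarrow> (nat \<times> nat) list \<Rightarrow> int list \<Rightarrow> int list" where
  "nb_step q es z = map (\<lambda>v. sum_list (map (\<lambda>(a, b). if a = v then z ! b else if b = v then z ! a else 0) es)) [0..<Suc q]"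

text \<open>The iterated matrix is \<open>I + A\<close>, which has the eigenvectors of
  \<open>A\<close>; the shift keeps entries positive and raises the negative eigenvalues, so that
  they disturb the iteration less.\<close>

primrec nb_iter :: "nat \<Rightarrow> nat \<Rightarrow> (nat \<times> nat) list \<Rightarrow> int list \<Rightarrow> int list" where
  "nb_iter 0 q es z = z"
| "nb_iter (Suc n) q es z = nb_iter n q es (map2 (+) z (nb_step q es z))"

text \<open>Integer form of the Collatz-Wielandt test: the ratio is cross-multiplied, so evaluation
  stays within \<open>int\<close>.\<close>

definition ratio_le :: "int \<Rightarrow> int \<Rightarrow> int list \<Rightarrow> int list \<Rightarrow> bool" where
  "ratio_le p d z w = list_all2 (\<lambda>a b. 0 < a \<and> d * b \<le> p * a) z w"

definition check_vec :: "int \<Rightarrow> int \<Rightarrow> nat \<Rightarrow> (nat \<times> nat) list \<Rightarrow> int list \<Rightarrow> bool" where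
  "check_vec p d q es z = ratio_le p d z (nb_step q es z)"

text \<open>A positive vector \<open>z\<close> with \<open>d A z \<le> p z\<close> bounds the spectral radius of \<open>A\<close> by \<open>p / d\<close>; good vectors come from
  a few steps of power iteration. The bounds \<open>p / d\<close> used below lie between the largest and the
  second largest spectral radius of a triangulation.\<close>

definition check_tri :: "nat \<Rightarrow> int \<Rightarrow> int \<Rightarrow> (nat \<times> nat) list \<Rightarrow> bool" where
  "check_tri q p d es = check_vec p d q es (nb_iter 3 q es (replicate (Suc q) 1))"

definition check_hexagon :: "(nat \<times> nat) list \<Rightarrow> bool" where
  "check_hexagon es = check_vec 323 100 5 es (nb_iter 5 5 es (replicate 6 1))"

text \<open>One step on the all-ones vector lists the degrees.\<close>

definition check_dom :: "nat \<Rightarrow> (nat \<times> nat) list \<Rightarrow> bool" where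
  "check_dom q es = list_ex (\<lambda>d. d = int q) (nb_step q es (replicate (Suc q) 1))"

text \<open>The two triangulations of the hexagon with an inner triangle, as enumerated by \<open>tri_list\<close>.\<close>

definition sun_list :: "(nat \<times> nat) list" where
  "sun_list = [(0,5), (0,4), (0,2), (0,1), (1,2), (2,4), (2,3), (3,4), (4,5)]"

definition sun_list' :: "(nat \<times> nat) list" where
  "sun_list' = [(0,5), (0,1), (1,5), (1,3), (1,2), (2,3), (3,5), (3,4), (4,5)]"

text \<open>Named so that \<open>code_simp\<close> evaluates them on concrete lists only: under a lambda it would
  unfold them symbolically.\<close>

definition check_fan :: "nat \<Rightarrow> int \<Rightarrow> int \<Rightarrow> (nat \<times> nat) list \<Rightarrow> bool" where
  "check_fan q p d es \<longleftrightarrow> check_dom q es \<or> check_tri q p d es"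

definition check_sun :: "(nat \<times> nat) list \<Rightarrow> bool" where
  "check_sun es \<longleftrightarrow> check_hexagon es \<or> es = sun_list \<or> es = sun_list'"

abbreviation sun :: "(nat \<times> nat) set" where "sun \<equiv> set sun_list"

abbreviation sun' :: "(nat \<times> nat) set" where "sun' \<equiv> set sun_list'"

lemma tri_sum:
  assumes t: "tri 0 q (set es)" and es: "distinct es"
  shows "(\<Sum>w\<in>nb (set es) v. f w) = sum_list (map (\<lambda>(a, b). if a = v then f b else if b = v then f a else (0::int)) es)"
proof -
  let ?E = "set es" let ?F = "\<lambda>(a, b). if a = v then f b else if b = v then f a else (0::int)"
  have "sum_list (map ?F es) = sum ?F ?E" using es by (rule sum_list_distinct_conv_sum_set)
  also have "\<dots> = sum ?F {(a, b) \<in> ?E. a = v \<or> b = v}"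
    by (rule sum.mono_neutral_right) (auto split: if_splits)
  also have "\<dots> = sum f (nb ?E v)"
    using tri_bounds(2)[OF t]
    by (intro sum.reindex_bij_witness[of _ "\<lambda>w. if v < w then (v, w) else (w, v)" "\<lambda>(a, b). if a = v then b else a"])
       (auto simp: nb_def split: if_splits, fastforce+)
  finally show ?thesis ..
qed

lemma nb_step_nth:
  assumes "tri 0 q (set es)" "distinct es" "v \<le> q"
  shows "nb_step q es z ! v = (\<Sum>w\<in>nb (set es) v. z ! w)"
proof -
  have e: "[0..<Suc q] ! v = v" using assms(3) nth_upt[of 0 v "Suc q"] by (simp del: upt_Suc)
  have "v < length [0..<Suc q]" using assms(3) by simp
  then show ?thesis unfolding nb_step_def tri_sum[OF assms(1,2)] by (simp only: nth_map e)
qed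

lemma check_dom_dominated:
  assumes t: "tri 0 q (set es)" "distinct es" and c: "check_dom q es"
  shows "dominated q (set es)"
proof -
  obtain v where v: "v \<le> q" "nb_step q es (replicate (Suc q) 1) ! v = int q"
  proof -
    have "length (nb_step q es (replicate (Suc q) 1)) = Suc q" by (simp add: nb_step_def del: upt_Suc)
    moreover have "int q \<in> set (nb_step q es (replicate (Suc q) 1))"
      using c unfolding check_dom_def list_ex_iff by metis
    ultimately show ?thesis using that by (metis in_set_conv_nth less_Suc_eq_le)
  qed
  have s: "nb (set es) v \<subseteq> {..q} - {v}" using nb_tri_sub[OF t(1), of v] by auto
  then have "(\<Sum>w\<in>nb (set es) v. replicate (Suc q) 1 ! w) = (\<Sum>w\<in>nb (set es) v. (1::int))"
    by (intro sum.cong refl nth_replicate) auto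
  then have "card (nb (set es) v) = q" using v(2) nb_step_nth[OF t v(1)] by simp
  then have "nb (set es) v = {..q} - {v}" using s v(1) by (intro card_subset_eq) auto
  then show ?thesis using v(1) by (auto simp: dominated_def)
qed

lemma length_nb_iter: "length z = Suc q \<Longrightarrow> length (nb_iter n q es z) = Suc q"
  by (induction n arbitrary: z) (auto simp: nb_step_def simp del: upt_Suc)

text \<open>Collatz-Wielandt by double counting: as \<open>A\<close> is symmetric, \<open>\<rho> *
  (x \<bullet> y) = A x \<bullet> y = x \<bullet> A y \<le> (p / d) * (x \<bullet> y)\<close>, and
  \<open>x \<bullet> y\<close> is positive because \<open>y\<close> is.\<close>

lemma check_vec_bound:
  assumes t: "tri 0 q (set es)" "distinct es" and c: "check_vec p d q es z" and l: "length z = Suc q" and d: "0 < d"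
    and x: "eigt q (set es) \<rho> x"
  shows "\<rho> \<le> p / d"
proof -
  define y where "y v = real_of_int (z ! v)" for v
  have "ratio_le p d z (nb_step q es z)" using c by (simp add: check_vec_def)
  then have *: "0 < z ! v \<and> d * nb_step q es z ! v \<le> p * z ! v" if "v \<le> q" for v
    using that l unfolding ratio_le_def list_all2_conv_all_nth by auto
  have y: "0 < y v" "d * sum y (nb (set es) v) \<le> p * y v" if "v \<le> q" for v
  proof -
    show "0 < y v" using *[OF that] by (simp add: y_def)
    have "real_of_int (d * (\<Sum>w\<in>nb (set es) v. z ! w)) \<le> real_of_int (p * z ! v)"
      using *[OF that] unfolding nb_step_nth[OF t that, of z] of_int_le_iff by simp
    then show "d * sum y (nb (set es) v) \<le> p * y v" by (simp add: y_def)
  qed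
  have swap: "(\<Sum>v\<le>q. sum x (nb (set es) v) * y v) = (\<Sum>v\<le>q. x v * sum y (nb (set es) v))"
  proof -
    have n: "nb (set es) v = {w\<in>{..q}. w \<in> nb (set es) v}" for v using nb_tri_sub[OF t(1), of v] by auto
    have nn: "(\<Sum>w\<in>nb (set es) v. f w) = (\<Sum>w\<le>q. if w \<in> nb (set es) v then f w else 0)" for v and f :: "nat \<Rightarrow> real"
      unfolding sum.inter_filter[OF finite_atMost, symmetric] by (rule sum.cong[OF n refl])
    have "(\<Sum>v\<le>q. sum x (nb (set es) v) * y v) = (\<Sum>v\<le>q. \<Sum>w\<le>q. if w \<in> nb (set es) v then x w * y v else 0)"
      unfolding sum_distrib_right[of x] nn by (intro sum.cong refl) (auto simp: sum_distrib_right intro!: sum.cong)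
    also have "\<dots> = (\<Sum>w\<le>q. \<Sum>v\<le>q. if w \<in> nb (set es) v then x w * y v else 0)" by (rule sum.swap)
    also have "\<dots> = (\<Sum>w\<le>q. \<Sum>v\<le>q. if v \<in> nb (set es) w then x w * y v else 0)"
      by (intro sum.cong refl) (auto simp: nb_def)
    also have "\<dots> = (\<Sum>v\<le>q. x v * sum y (nb (set es) v))"
      unfolding nn by (intro sum.cong refl) (auto simp: sum_distrib_left intro!: sum.cong)
    finally show ?thesis .
  qed
  have "d * (\<rho> * (\<Sum>v\<le>q. x v * y v)) = d * (\<Sum>v\<le>q. sum x (nb (set es) v) * y v)"
  proof -
    have "\<rho> * (x v * y v) = sum x (nb (set es) v) * y v" if "v \<le> q" for v
      using x that by (simp add: eigt_def flip: mult.assoc)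
    then have "\<rho> * (\<Sum>v\<le>q. x v * y v) = (\<Sum>v\<le>q. sum x (nb (set es) v) * y v)"
      unfolding sum_distrib_left by (intro sum.cong) auto
    then show ?thesis by simp
  qed
  also have "\<dots> = (\<Sum>v\<le>q. x v * (d * sum y (nb (set es) v)))"
    unfolding swap by (simp add: sum_distrib_left mult_ac)
  also have "\<dots> \<le> (\<Sum>v\<le>q. x v * (p * y v))"
    using y(2) x by (intro sum_mono mult_left_mono) (auto simp: eigt_def)
  also have "\<dots> = p * (\<Sum>v\<le>q. x v * y v)" by (simp add: sum_distrib_left mult_ac)
  finally have "(d * \<rho>) * (\<Sum>v\<le>q. x v * y v) \<le> p * (\<Sum>v\<le>q. x v * y v)" by (simp add: mult_ac)
  moreover have "0 < (\<Sum>v\<le>q. x v * y v)"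
  proof -
    obtain u where "u \<le> q" "0 < x u" using x by (metis eigt_def less_eq_real_def)
    moreover have "0 \<le> x v * y v" if "v \<le> q" for v using x y(1)[OF that] that by (simp add: eigt_def)
    ultimately show ?thesis using y(1)[of u] by (intro sum_pos2[of _ u]) auto
  qed
  ultimately show ?thesis using d by (simp add: field_simps)
qed

lemma check_tri_bound:
  assumes t: "tri 0 q (set es)" "distinct es" and c: "check_tri q p d es" and d: "0 < d"
    and x: "eigt q (set es) \<rho> x"
  shows "\<rho> \<le> p / d"
proof (rule check_vec_bound[OF t _ _ d x])
  show "check_vec p d q es (nb_iter 3 q es (replicate (Suc q) 1))" using c by (simp only: check_tri_def)
  show "length (nb_iter 3 q es (replicate (Suc q) 1)) = Suc q" by (rule length_nb_iter) simp
qed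

lemma check_hexagon_bound:
  assumes t: "tri 0 5 (set es)" "distinct es" and c: "check_hexagon es" and x: "eigt 5 (set es) \<rho> x"
  shows "\<rho> \<le> 323 / 100"
proof -
  have "length (nb_iter 5 5 es (replicate 6 1)) = Suc 5" by (rule length_nb_iter) simp
  from check_vec_bound[OF t c[unfolded check_hexagon_def] this _ x] show ?thesis by simp
qed

text \<open>Polygons with at most five vertices have only fan triangulations.\<close>

lemma check_small:
  "list_all (check_dom 1) (tri_list 1 0 1)" "list_all (check_dom 2) (tri_list 2 0 2)"
  "list_all (check_dom 3) (tri_list 3 0 3)" "list_all (check_dom 4) (tri_list 4 0 4)"
  by code_simp+

text \<open>Only the two triangulations with an inner triangle exceed 323/100: their radius is
  \<open>1 + sqrt 5\<close>, about 3.236.\<close>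

lemma check_6: "list_all check_sun (tri_list 5 0 5)"
  by code_simp

lemma check_7: "list_all (check_fan 6 3455 1000) (tri_list 6 0 6)"
  by code_simp

lemma check_8: "list_all (check_fan 7 366 100) (tri_list 7 0 7)"
  by code_simp

lemma check_9: "list_all (check_fan 8 384 100) (tri_list 8 0 8)"
  by code_simp

lemma tri_small_dominated:
  assumes q: "1 \<le> q" "q \<le> 4" and E: "tri 0 q E"
  shows "dominated q E"
proof -
  obtain es where es: "es \<in> set (tri_list q 0 q)" "set es = E" using tri_list_complete[OF E] by force
  consider "q = 1" | "q = 2" | "q = 3" | "q = 4" using q by linarith
  then have "check_dom q es" using check_small es(1) by cases (auto simp only: list_all_iff)
  moreover have "tri 0 q (set es)" "distinct es" using tri_list_sound[OF _ es(1)] q by auto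
  ultimately show ?thesis using check_dom_dominated es(2) by blast
qed

text \<open>Replaces the irrational root \<open>t\<close> by a rational \<open>s\<close>. The
  condition \<open>s * (c - s) \<ge> 1\<close> places \<open>s\<close> between the roots
  \<open>t\<close> and \<open>c - t\<close>, whence
  \<open>t / (1 - t) \<le> s / (1 - s)\<close>.\<close>

lemma fan_quad_lower_at:
  assumes q: "1 \<le> q" and c: "5/2 \<le> c" and s: "0 < s" "s < 1" "s * (c - s) \<ge> 1" "1/2 < c - s"
    and i: "c * (c - 2) \<le> real q - 2 * (s / (1 - s))" and \<rho>: "\<rho> \<le> c"
  shows "\<exists>z. \<rho> * (\<Sum>v\<le>q. (z v)\<^sup>2) < qf (sy (fan_edges q)) z"
proof -
  obtain t where t: "0 < t" "t \<le> 1/2" "t * t + 1 = c * t" using ex_recip_sum[OF c] by metis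
  have "0 \<le> s * (c - s) - 1" using s(3) by simp
  also have "\<dots> = (s - t) * ((c - s) - t)" using t(3) by (simp add: algebra_simps)
  finally have "t \<le> s" using t(2) s(4) by (simp add: zero_le_mult_iff)
  then have "t / (1 - t) \<le> s / (1 - s)" using t s(1,2) by (intro frac_le) auto
  then have "c * (c - 2) \<le> real q - 2 * (t / (1 - t))" using i by linarith
  then obtain z where "c * (\<Sum>v\<le>q. (z v)\<^sup>2) < qf (sy (fan_edges q)) z"
    using fan_quad_lower[OF q _ t] c by auto
  moreover have "\<rho> * (\<Sum>v\<le>q. (z v)\<^sup>2) \<le> c * (\<Sum>v\<le>q. (z v)\<^sup>2)"
    using \<rho> by (intro mult_right_mono sum_nonneg) auto
  ultimately show ?thesis by (intro exI[of _ z]) linarith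
qed

lemma not_dominated_below_fan:
  assumes q: "1 \<le> q" "q \<noteq> 5" and E: "tri 0 q E" and x: "eigt q E \<rho> x" and nd: "\<not> dominated q E"
  shows "\<exists>z. \<rho> * (\<Sum>v\<le>q. (z v)\<^sup>2) < qf (sy (fan_edges q)) z"
proof -
  obtain es where es: "es \<in> set (tri_list q 0 q)" "set es = E" using tri_list_complete[OF E] by force
  have t: "tri 0 q (set es)" "distinct es" using tri_list_sound[OF _ es(1)] q by auto
  have ncd: "\<not> check_dom q es" using check_dom_dominated[OF t] nd unfolding es(2) by metis
  have bound: "\<rho> \<le> p / d" if "check_tri q p d es" "0 < d" for p d
    using check_tri_bound[OF t that] x es(2) by simp
  consider "q \<le> 4" | "q = 6" | "q = 7" | "q = 8" | "9 \<le> q" using q by linarith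
  then show ?thesis
  proof cases
    case 1
    then show ?thesis using tri_small_dominated[OF q(1) _ E] nd by simp
  next
    case 2
    then have "check_tri q 3455 1000 es" using check_7 es(1) ncd by (auto simp only: list_all_iff check_fan_def)
    then have "\<rho> \<le> 691/200" using bound by fastforce
    \<comment> \<open>327/1000 lies a little above the smaller root for \<open>c = 691/200\<close>;
      the values of \<open>s\<close> in the next two cases are found in the same way.\<close>
    then show ?thesis by (rule fan_quad_lower_at[where s = "327/1000", OF q(1), rotated 6]) (simp_all add: 2)
  next
    case 3
    then have "check_tri q 366 100 es" using check_8 es(1) ncd by (auto simp only: list_all_iff check_fan_def)
    then have "\<rho> \<le> 183/50" using bound by fastforce
    then show ?thesis by (rule fan_quad_lower_at[where s = "31/100", OF q(1), rotated 6]) (simp_all add: 3)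
  next
    case 4
    then have "check_tri q 384 100 es" using check_9 es(1) ncd by (auto simp only: list_all_iff check_fan_def)
    then have "\<rho> \<le> 96/25" using bound by fastforce
    then show ?thesis by (rule fan_quad_lower_at[where s = "3/10", OF q(1), rotated 6]) (simp_all add: 4)
  next
    case 5
    then show ?thesis using large_not_dominated_below_fan[OF _ E x nd] by metis
  qed
qed

lemma not_sun_below_sun:
  assumes E: "tri 0 5 E" and x: "eigt 5 E \<rho> x" and ns: "E \<noteq> sun" "E \<noteq> sun'"
  obtains z where "\<rho> * (\<Sum>v\<le>5. (z v)\<^sup>2) < qf (sy sun) z"
proof -
  obtain es where es: "es \<in> set (tri_list 5 0 5)" "set es = E" using tri_list_complete[OF E] by force
  have t: "tri 0 5 (set es)" "distinct es" using tri_list_sound[OF _ es(1)] by auto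
  have "es \<noteq> sun_list" "es \<noteq> sun_list'" using es(2) ns by auto
  then have "check_hexagon es" using check_6 es(1) by (auto simp only: list_all_iff check_sun_def)
  then have \<rho>: "\<rho> \<le> 323/100" using check_hexagon_bound[OF t _ x[folded es(2)]] by simp
  \<comment> \<open>In the Perron vector of the sun the entries at inner and outer vertices are in
    the golden ratio. The approximation 8 : 5 gives the quotient 864 / 267, which exceeds 323 /
    100.\<close>
  let ?z = "\<lambda>v::nat. if even v then 8 else 5 :: real"
  let ?L = "sun_list @ map prod.swap sun_list"
  have "sy sun = set ?L" by (auto simp: sy_def)
  moreover have "distinct ?L" by (simp add: sun_list_def)
  ultimately have "qf (sy sun) ?z = (\<Sum>(u, v)\<leftarrow>?L. ?z u * ?z v)"
    unfolding qf_def by (simp only: sum.distinct_set_conv_list)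
  also have "\<dots> = 864" by (simp add: sun_list_def)
  finally have "qf (sy sun) ?z = 864" .
  moreover have "{..5::nat} = {0,1,2,3,4,5}" by auto
  then have n: "(\<Sum>v\<le>5. (?z v)\<^sup>2) = 267" by simp
  moreover have "\<rho> * 267 < 864" using \<rho> by simp
  ultimately show ?thesis by (intro that[of ?z]) (simp only: n)
qed

section \<open>Theta curves in the plane\<close>

lemma connected_meets_inside:
  fixes S :: "'a::real_normed_vector set"
  assumes "topological_space_class.connected C" "C \<inter> S = {}" "z \<in> C" "z \<in> inside S"
  shows "C \<subseteq> inside S"
proof
  fix y assume "y \<in> C"
  then have "connected_component (- S) z y"
    unfolding connected_component_def using assms by (intro exI[of _ C]) auto
  then show "y \<in> inside S" using inside_same_component assms(4) by blast
qed

text \<open>Suppose that \<open>c3\<close> misses the inside of \<open>c1\<close> and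
  \<open>c2\<close>, and let \<open>z\<close> be a point there. The winding number of that loop
  around \<open>z\<close> is nonzero and is the difference of those of the loops through
  \<open>c3\<close>, so \<open>z\<close> is inside one of the latter. This loop then encloses the
  whole inside of \<open>c1\<close> and \<open>c2\<close>, and with it the remaining arc on its
  frontier.\<close>

lemma theta_inside:
  fixes c1 c2 c3 :: "real \<Rightarrow> complex"
  assumes "Path_Connected.arc c1" "Path_Connected.arc c2" "Path_Connected.arc c3" and ab: "a \<noteq> b"
    and e1: "pathstart c1 = a" "pathfinish c1 = b" and e2: "pathstart c2 = a" "pathfinish c2 = b"
    and e3: "pathstart c3 = a" "pathfinish c3 = b"
    and i12: "path_image c1 \<inter> path_image c2 = {a, b}" and i13: "path_image c1 \<inter> path_image c3 = {a, b}"
    and i23: "path_image c2 \<inter> path_image c3 = {a, b}"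
  shows "path_image c1 - {a, b} \<subseteq> inside (path_image c2 \<union> path_image c3) \<or>
    path_image c2 - {a, b} \<subseteq> inside (path_image c1 \<union> path_image c3) \<or>
    path_image c3 - {a, b} \<subseteq> inside (path_image c1 \<union> path_image c2)"
proof -
  let ?I = "\<lambda>c d. inside (path_image c \<union> path_image d)"
  have loop: "simple_path (c +++ reversepath d)" "pathfinish (c +++ reversepath d) = pathstart (c +++ reversepath d)"
    "path_image (c +++ reversepath d) = path_image c \<union> path_image d"
    if "Path_Connected.arc c" "Path_Connected.arc d" "pathstart c = a" "pathfinish c = b" "pathstart d = a" "pathfinish d = b"
      "path_image c \<inter> path_image d = {a, b}" for c d :: "real \<Rightarrow> complex"
    using that by (auto intro!: simple_path_join_loop arc_reversepath simp: path_image_join)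
  note l12 = loop[OF assms(1,2) e1 e2 i12] and l13 = loop[OF assms(1,3) e1 e3 i13] and l23 = loop[OF assms(2,3) e2 e3 i23]
  note J12 = Jordan_inside_outside[OF l12(1,2), unfolded l12(3)]
    and J13 = Jordan_inside_outside[OF l13(1,2), unfolded l13(3)]
    and J23 = Jordan_inside_outside[OF l23(1,2), unfolded l23(3)]
  have co12: "topological_space_class.connected (?I c1 c2)" and ne12: "?I c1 c2 \<noteq> {}"
    and fr12: "frontier (?I c1 c2) = path_image c1 \<union> path_image c2"
    using J12 by - (elim conjE, assumption)+
  have fr13: "frontier (?I c1 c3) = path_image c1 \<union> path_image c3" using J13 by (elim conjE)
  have fr23: "frontier (?I c2 c3) = path_image c2 \<union> path_image c3" using J23 by (elim conjE)
  have con: "topological_space_class.connected (path_image c - {a, b})" if "Path_Connected.arc c" "pathstart c = a" "pathfinish c = b" for c :: "real \<Rightarrow> complex"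
    using connected_simple_path_endless[OF arc_imp_simple_path[OF that(1)]] that by simp
  show ?thesis
  proof (cases "path_image c3 \<inter> ?I c1 c2 = {}")
    case False
    then obtain z where z: "z \<in> path_image c3" "z \<in> ?I c1 c2" by blast
    moreover have "z \<notin> {a, b}"
      using z(2) i12 inside_no_overlap[of "path_image c1 \<union> path_image c2"] by blast
    ultimately have "path_image c3 - {a, b} \<subseteq> ?I c1 c2"
      using i13 i23 by (intro connected_meets_inside[of _ _ z] con assms e3) blast+
    then show ?thesis by simp
  next
    case True
    obtain z where z: "z \<in> ?I c1 c2" using ne12 by blast
    have no12: "?I c1 c2 \<inter> (path_image c1 \<union> path_image c2) = {}" by simp
    have nz: "z \<notin> path_image c1" "z \<notin> path_image c2" "z \<notin> path_image c3" using z no12 True by blast+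
    \<comment> \<open>\<open>c\<close> is the arc whose loop with \<open>c3\<close> encloses
      \<open>z\<close>, and \<open>d\<close> is the other one of \<open>c1\<close> and
      \<open>c2\<close>.\<close>
    have sub: "path_image d - {a, b} \<subseteq> ?I c c3"
      if c: "z \<in> ?I c c3" "path_image c \<subseteq> path_image c1 \<union> path_image c2" "path_image d \<subseteq> path_image c1 \<union> path_image c2"
        "path_image c \<inter> path_image d = {a, b}" "path_image d \<inter> path_image c3 = {a, b}"
        "frontier (?I c c3) = path_image c \<union> path_image c3" for c d
    proof -
      have "?I c1 c2 \<inter> (path_image c \<union> path_image c3) = {}" using no12 True c(2) by blast
      from connected_meets_inside[OF co12 this z c(1)] have "?I c1 c2 \<subseteq> ?I c c3" .
      then have "closure (?I c1 c2) \<subseteq> closure (?I c c3)" by (rule closure_mono)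
      moreover have "path_image d \<subseteq> closure (?I c1 c2)" using c(3) unfolding closure_Un_frontier fr12 by blast
      moreover have "closure (?I c c3) = ?I c c3 \<union> (path_image c \<union> path_image c3)"
        unfolding closure_Un_frontier c(6) ..
      ultimately show ?thesis using c(4,5) by blast
    qed
    have "z \<in> ?I c1 c3 \<or> z \<in> ?I c2 c3"
    proof (rule ccontr)
      assume "\<not> ?thesis"
      then have o: "z \<in> outside (path_image c1 \<union> path_image c3)" "z \<in> outside (path_image c2 \<union> path_image c3)"
        using nz inside_Un_outside[of "path_image c1 \<union> path_image c3"] inside_Un_outside[of "path_image c2 \<union> path_image c3"]
        by blast+
      have wj: "winding_number (c +++ reversepath d) z = winding_number c z - winding_number d z"
        if "Path_Connected.arc c" "Path_Connected.arc d" "pathfinish c = pathfinish d" "z \<notin> path_image c" "z \<notin> path_image d" for c d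
        using that by (simp add: winding_number_join winding_number_reversepath arc_imp_path)
      have "winding_number (c1 +++ reversepath c3) z = 0" "winding_number (c2 +++ reversepath c3) z = 0"
        using o l13 l23 by (auto intro!: winding_number_zero_in_outside simple_path_imp_path)
      then have "winding_number c1 z - winding_number c3 z = 0" "winding_number c2 z - winding_number c3 z = 0"
        using wj[of c1 c3] wj[of c2 c3] assms e1 e2 e3 nz by simp_all
      then have "winding_number (c1 +++ reversepath c2) z = 0"
        using wj[of c1 c2] assms e1 e2 nz by simp
      moreover have "norm (winding_number (c1 +++ reversepath c2) z) = 1"
        using simple_closed_path_norm_winding_number_inside[OF l12(1)] z l12(3) by simp
      ultimately show False by simp
    qed
    then show ?thesis
    proof
      assume "z \<in> ?I c1 c3"
      then have "path_image c2 - {a, b} \<subseteq> ?I c1 c3" using i12 i23 fr13 by (intro sub) auto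
      then show ?thesis by simp
    next
      assume "z \<in> ?I c2 c3"
      then have "path_image c1 - {a, b} \<subseteq> ?I c2 c3" using i12 i13 fr23 by (intro sub) auto
      then show ?thesis by simp
    qed
  qed
qed

text \<open>\<open>outside\<close> is antitone, so a frontier point of the outer face is a limit of
  points outside the smaller set \<open>S\<close>; the open set \<open>inside S\<close> contains no
  such limit.\<close>

lemma frontier_outside_not_inside:
  fixes S :: "'a::real_normed_vector set"
  assumes "v \<in> frontier (outside D)" "S \<subseteq> D" "closed S"
  shows "v \<notin> inside S"
proof
  assume "v \<in> inside S"
  moreover have "v \<in> closure (outside S)"
    using assms(1) closure_mono[OF outside_mono[OF assms(2)]] by (auto simp: frontier_def)
  moreover have "open (inside S)" using open_inside[OF assms(3)] .
  ultimately have "inside S \<inter> outside S \<noteq> {}" using open_Int_closure_eq_empty by blast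
  then show False by simp
qed

section \<open>Paths as vertex lists and their curves in a drawing\<close>

definition path_edges :: "'a list \<Rightarrow> ('a \<times> 'a) set" where
  "path_edges xs = set (zip xs (tl xs))"

definition simple_vpath :: "('a \<times> 'a) set \<Rightarrow> 'a list \<Rightarrow> bool" where
  "simple_vpath R xs \<longleftrightarrow> distinct xs \<and> successively (\<lambda>u v. (u, v) \<in> R) xs"

lemma path_edges_Cons2: "path_edges (u # v # xs) = insert (u, v) (path_edges (v # xs))"
  by (simp add: path_edges_def)

lemma path_edges_sub: "(u, v) \<in> path_edges xs \<Longrightarrow> u \<in> set xs \<and> v \<in> set xs"
  unfolding path_edges_def by (metis in_set_zipE list.set_sel(2) tl_Nil)

lemma path_edges_simple: "simple_vpath R xs \<Longrightarrow> (u, v) \<in> path_edges xs \<Longrightarrow> (u, v) \<in> R"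
proof (induction xs rule: induct_list012)
  case (3 x y zs)
  then show ?case by (auto simp: simple_vpath_def path_edges_Cons2)
qed (auto simp: path_edges_def)

lemma path_edges_distinct: "distinct xs \<Longrightarrow> (u, v) \<in> path_edges xs \<Longrightarrow> u \<noteq> v"
proof (induction xs rule: induct_list012)
  case (3 x y zs)
  then show ?case by (auto simp: path_edges_Cons2)
qed (auto simp: path_edges_def)

lemma path_edges_covers:
  "2 \<le> length xs \<Longrightarrow> x \<in> set xs \<Longrightarrow> \<exists>e\<in>path_edges xs. x = fst e \<or> x = snd e"
proof (induction xs rule: induct_list012)
  case (3 u v zs)
  then show ?case by (cases zs) (auto simp: path_edges_Cons2)
qed auto

text \<open>Lets a path with inner vertices be compared with the direct edge between the same ends:
  they share no edge, so their curves meet only at the ends.\<close>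

lemma path_edges_ends:
  assumes "distinct (a # P @ [b])" "P \<noteq> []" "(u, v) \<in> path_edges (a # P @ [b])"
  shows "{u, v} \<noteq> {a, b}"
proof
  assume uv: "{u, v} = {a, b}"
  obtain p P' where P: "P = p # P'" using assms(2) by (cases P) auto
  have "(u, v) = (a, p) \<or> (u, v) \<in> path_edges (p # P' @ [b])"
    using assms(3) by (simp add: P path_edges_Cons2)
  then show False
  proof
    assume "(u, v) = (a, p)"
    then show False using uv assms(1) P by auto
  next
    assume "(u, v) \<in> path_edges (p # P' @ [b])"
    then have "u \<in> set (p # P' @ [b])" "v \<in> set (p # P' @ [b])" using path_edges_sub by fast+
    moreover have "a = u \<or> a = v" using uv by auto
    ultimately have "a \<in> set (p # P' @ [b])" by metis
    then show False using assms(1) P by auto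
  qed
qed

locale drawn_graph = pair_graph G for G :: "'a pair_pre_digraph" +
  fixes p :: "'a \<Rightarrow> complex" and \<gamma> :: "'a \<times> 'a \<Rightarrow> real \<Rightarrow> complex"
  assumes drawing: "plane_drawing G p \<gamma>"
    and outer: "\<And>v. v \<in> pverts G \<Longrightarrow> p v \<in> frontier (outside (drawing_points G p \<gamma>))"
begin

definition curve :: "'a list \<Rightarrow> complex set" where
  "curve xs = (\<Union>e\<in>path_edges xs. path_image (\<gamma> e))"

lemma edge_arc:
  assumes "(u, v) \<in> parcs G"
  shows "Path_Connected.arc (\<gamma> (u, v))" "pathstart (\<gamma> (u, v)) = p u" "pathfinish (\<gamma> (u, v)) = p v"
    "path_image (\<gamma> (u, v)) \<inter> p ` pverts G = {p u, p v}" "path_image (\<gamma> (v, u)) = path_image (\<gamma> (u, v))"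
proof -
  have "\<forall>e\<in>parcs G. case e of (u, v) \<Rightarrow>
        Path_Connected.arc (\<gamma> (u, v)) \<and> pathstart (\<gamma> (u, v)) = p u \<and> pathfinish (\<gamma> (u, v)) = p v \<and>
        \<gamma> (v, u) = reversepath (\<gamma> (u, v)) \<and>
        path_image (\<gamma> (u, v)) \<inter> p ` pverts G = {p u, p v}"
    using drawing unfolding plane_drawing_def by blast
  from bspec[OF this assms] show "Path_Connected.arc (\<gamma> (u, v))" "pathstart (\<gamma> (u, v)) = p u"
    "pathfinish (\<gamma> (u, v)) = p v" "path_image (\<gamma> (u, v)) \<inter> p ` pverts G = {p u, p v}"
    "path_image (\<gamma> (v, u)) = path_image (\<gamma> (u, v))" by (simp_all only: prod.case path_image_reversepath)
qed

lemma edge_inter: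
  assumes "(u, v) \<in> parcs G" "(x, y) \<in> parcs G" "{u, v} \<noteq> {x, y}"
  shows "path_image (\<gamma> (u, v)) \<inter> path_image (\<gamma> (x, y)) \<subseteq> p ` ({u, v} \<inter> {x, y})"
proof -
  have "\<forall>e\<in>parcs G. case e of (u, v) \<Rightarrow> \<forall>f\<in>parcs G. case f of (x, y) \<Rightarrow> {u, v} \<noteq> {x, y} \<longrightarrow>
        path_image (\<gamma> (u, v)) \<inter> path_image (\<gamma> (x, y)) \<subseteq> p ` ({u, v} \<inter> {x, y})"
    using drawing unfolding plane_drawing_def by blast
  from bspec[OF this assms(1)] have "\<forall>f\<in>parcs G. case f of (x, y) \<Rightarrow> {u, v} \<noteq> {x, y} \<longrightarrow>
        path_image (\<gamma> (u, v)) \<inter> path_image (\<gamma> (x, y)) \<subseteq> p ` ({u, v} \<inter> {x, y})" by simp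
  from bspec[OF this assms(2)] show ?thesis using assms(3) by simp
qed

lemma inj_p: "inj_on p (pverts G)"
  using drawing unfolding plane_drawing_def by blast

lemma simple_vpath_sub: "simple_vpath (parcs G) xs \<Longrightarrow> 2 \<le> length xs \<Longrightarrow> set xs \<subseteq> pverts G"
proof
  fix x assume s: "simple_vpath (parcs G) xs" "2 \<le> length xs" and x: "x \<in> set xs"
  obtain u v where e: "(u, v) \<in> path_edges xs" "x = u \<or> x = v" using path_edges_covers[OF s(2) x] by auto
  have "(u, v) \<in> parcs G" by (rule path_edges_simple[OF s(1) e(1)])
  then show "x \<in> pverts G" using e(2) in_arcsD1 in_arcsD2 by blast
qed

lemma curve_sub: "simple_vpath (parcs G) xs \<Longrightarrow> curve xs \<subseteq> drawing_points G p \<gamma>"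
proof -
  assume s: "simple_vpath (parcs G) xs"
  have "path_edges xs \<subseteq> parcs G" using path_edges_simple[OF s] by auto
  then show ?thesis unfolding curve_def drawing_points_def by blast
qed

lemma vertex_in_curve:
  assumes "simple_vpath (parcs G) xs" "2 \<le> length xs" "v \<in> set xs"
  shows "p v \<in> curve xs"
proof -
  obtain u w where e: "(u, w) \<in> path_edges xs" "v = u \<or> v = w" using path_edges_covers[OF assms(2,3)] by auto
  have "(u, w) \<in> parcs G" by (rule path_edges_simple[OF assms(1) e(1)])
  then have "p v \<in> path_image (\<gamma> (u, w))"
    using e(2) edge_arc(2,3)[of u w] pathstart_in_path_image[of "\<gamma> (u, w)"] pathfinish_in_path_image[of "\<gamma> (u, w)"]
    by auto
  then show ?thesis using e(1) unfolding curve_def by blast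
qed

lemma curve_inter:
  assumes "simple_vpath (parcs G) xs" "simple_vpath (parcs G) ys"
    and "\<And>u v x y. (u, v) \<in> path_edges xs \<Longrightarrow> (x, y) \<in> path_edges ys \<Longrightarrow> {u, v} \<noteq> {x, y}"
  shows "curve xs \<inter> curve ys \<subseteq> p ` (set xs \<inter> set ys)"
proof
  fix z assume "z \<in> curve xs \<inter> curve ys"
  then obtain u v x y where e: "(u, v) \<in> path_edges xs" "(x, y) \<in> path_edges ys"
    "z \<in> path_image (\<gamma> (u, v)) \<inter> path_image (\<gamma> (x, y))" unfolding curve_def by auto
  then have "z \<in> p ` ({u, v} \<inter> {x, y})"
    using edge_inter[OF path_edges_simple[OF assms(1) e(1)] path_edges_simple[OF assms(2) e(2)] assms(3)[OF e(1,2)]] by blast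
  moreover have "{u, v} \<inter> {x, y} \<subseteq> set xs \<inter> set ys"
    using path_edges_sub[OF e(1)] path_edges_sub[OF e(2)] by auto
  ultimately show "z \<in> p ` (set xs \<inter> set ys)" by blast
qed

lemma curve_arc:
  "simple_vpath (parcs G) xs \<Longrightarrow> 2 \<le> length xs \<Longrightarrow>
    \<exists>g. Path_Connected.arc g \<and> pathstart g = p (hd xs) \<and> pathfinish g = p (last xs) \<and> path_image g = curve xs"
proof (induction xs rule: induct_list012)
  case (3 u v zs)
  have uv: "(u, v) \<in> parcs G" using 3(3) by (simp add: simple_vpath_def)
  have c: "curve (u # v # zs) = path_image (\<gamma> (u, v)) \<union> curve (v # zs)"
    by (simp add: curve_def path_edges_Cons2)
  show ?case
  proof (cases zs)
    case Nil
    then show ?thesis using edge_arc[OF uv] c by (intro exI[of _ "\<gamma> (u, v)"]) (simp add: curve_def path_edges_def)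
  next
    case (Cons w ws)
    have s: "simple_vpath (parcs G) (v # zs)" using 3(3) by (simp add: simple_vpath_def)
    then obtain g where g: "Path_Connected.arc g" "pathstart g = p v" "pathfinish g = p (last (v # zs))" "path_image g = curve (v # zs)"
      using 3(2) Cons by auto
    have uv': "simple_vpath (parcs G) [u, v]" using uv 3(3) by (auto simp: simple_vpath_def)
    have "curve [u, v] \<inter> curve (v # zs) \<subseteq> p ` (set [u, v] \<inter> set (v # zs))"
    proof (rule curve_inter[OF uv' s])
      fix a b x y assume "(a, b) \<in> path_edges [u, v]" "(x, y) \<in> path_edges (v # zs)"
      then have "a = u" "x \<in> set (v # zs)" "y \<in> set (v # zs)"
        using path_edges_sub[of x y "v # zs"] by (simp_all add: path_edges_def)
      then show "{a, b} \<noteq> {x, y}" using 3(3) by (auto simp: simple_vpath_def doubleton_eq_iff)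
    qed
    also have "set [u, v] \<inter> set (v # zs) = {v}" using 3(3) by (auto simp: simple_vpath_def)
    finally have "path_image (\<gamma> (u, v)) \<inter> path_image g \<subseteq> {pathstart g}"
      using g by (simp add: curve_def path_edges_def)
    then have "Path_Connected.arc (\<gamma> (u, v) +++ g)" using edge_arc[OF uv] g by (intro arc_join) auto
    then show ?thesis using edge_arc[OF uv] g c Cons
      by (intro exI[of _ "\<gamma> (u, v) +++ g"]) (simp add: path_image_join)
  qed
qed auto

lemma closed_curve: "simple_vpath (parcs G) xs \<Longrightarrow> 2 \<le> length xs \<Longrightarrow> closed (curve xs)"
  using curve_arc[of xs] by (metis arc_imp_path closed_path_image)

lemma outer_not_inside:
  assumes "v \<in> pverts G" "simple_vpath (parcs G) xs" "2 \<le> length xs"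
    "simple_vpath (parcs G) ys" "2 \<le> length ys"
  shows "p v \<notin> inside (curve xs \<union> curve ys)"
  using assms by (intro frontier_outside_not_inside[OF outer] closed_Un closed_curve Un_least curve_sub)

text \<open>Of three internally disjoint paths between two vertices, one runs inside the other two; as
  all vertices lie on the outer face, that path has no inner vertex.\<close>

lemma theta_curves:
  assumes P: "simple_vpath (parcs G) (a # P @ [b])" and Q: "simple_vpath (parcs G) (a # Q @ [b])"
    and S: "simple_vpath (parcs G) (a # S @ [b])"
    and PQ: "P \<noteq> []" "Q \<noteq> []" and disj: "set P \<inter> set Q = {}" "set P \<inter> set S = {}" "set Q \<inter> set S = {}"
  shows "S = []" "curve (a # S @ [b]) - {p a, p b} \<subseteq> inside (curve (a # P @ [b]) \<union> curve (a # Q @ [b]))"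
proof -
  let ?P = "a # P @ [b]" and ?Q = "a # Q @ [b]" and ?S = "a # S @ [b]"
  have vs: "set ?P \<subseteq> pverts G" "set ?Q \<subseteq> pverts G" "set ?S \<subseteq> pverts G"
    using simple_vpath_sub[OF P] simple_vpath_sub[OF Q] simple_vpath_sub[OF S] by auto
  have ab: "p a \<noteq> p b" using inj_p vs(1) P by (auto simp: inj_on_def simple_vpath_def)
  have int: "curve (a # X @ [b]) \<inter> curve (a # Y @ [b]) = {p a, p b}"
    if X: "simple_vpath (parcs G) (a # X @ [b])" "X \<noteq> []" and Y: "simple_vpath (parcs G) (a # Y @ [b])"
      and d: "set X \<inter> set Y = {}" for X Y
  proof
    have ed: "{u, v} \<noteq> {x, y}" if "(u, v) \<in> path_edges (a # X @ [b])" "(x, y) \<in> path_edges (a # Y @ [b])" for u v x y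
    proof
      assume e: "{u, v} = {x, y}"
      have "{u, v} \<subseteq> set (a # X @ [b])" "{x, y} \<subseteq> set (a # Y @ [b])"
        using path_edges_sub[OF that(1)] path_edges_sub[OF that(2)] by simp_all
      then have "{u, v} \<subseteq> set (a # X @ [b]) \<inter> set (a # Y @ [b])" using e by auto
      then have "{u, v} \<subseteq> {a, b}" using d by auto
      moreover have "u \<noteq> v" using path_edges_distinct[OF _ that(1)] X(1) by (auto simp: simple_vpath_def)
      ultimately have "{u, v} = {a, b}" by auto
      then show False using path_edges_ends[OF _ X(2) that(1)] X(1) by (auto simp: simple_vpath_def)
    qed
    have "curve (a # X @ [b]) \<inter> curve (a # Y @ [b]) \<subseteq> p ` (set (a # X @ [b]) \<inter> set (a # Y @ [b]))"
      by (rule curve_inter[OF X(1) Y ed])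
    also have "set (a # X @ [b]) \<inter> set (a # Y @ [b]) = {a, b}" using d by auto
    finally show "curve (a # X @ [b]) \<inter> curve (a # Y @ [b]) \<subseteq> {p a, p b}" by simp
    show "{p a, p b} \<subseteq> curve (a # X @ [b]) \<inter> curve (a # Y @ [b])"
      using vertex_in_curve[OF X(1)] vertex_in_curve[OF Y] by auto
  qed
  have len: "2 \<le> length ?P" "2 \<le> length ?Q" "2 \<le> length ?S" by auto
  obtain g1 where g1: "Path_Connected.arc g1" "pathstart g1 = p a" "pathfinish g1 = p b" "path_image g1 = curve ?P"
    using curve_arc[OF P len(1)] by auto
  obtain g2 where g2: "Path_Connected.arc g2" "pathstart g2 = p a" "pathfinish g2 = p b" "path_image g2 = curve ?Q"
    using curve_arc[OF Q len(2)] by auto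
  obtain g3 where g3: "Path_Connected.arc g3" "pathstart g3 = p a" "pathfinish g3 = p b" "path_image g3 = curve ?S"
    using curve_arc[OF S len(3)] by auto
  have th: "curve ?P - {p a, p b} \<subseteq> inside (curve ?Q \<union> curve ?S) \<or>
     curve ?Q - {p a, p b} \<subseteq> inside (curve ?P \<union> curve ?S) \<or>
     curve ?S - {p a, p b} \<subseteq> inside (curve ?P \<union> curve ?Q)"
    using theta_inside[OF g1(1) g2(1) g3(1) ab g1(2,3) g2(2,3) g3(2,3)]
      int[OF P PQ(1) Q disj(1)] int[OF P PQ(1) S disj(2)] int[OF Q PQ(2) S disj(3)] g1(4) g2(4) g3(4) by simp
  have no: "\<not> curve (a # X @ [b]) - {p a, p b} \<subseteq> inside (curve Y \<union> curve Z)"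
    if X: "simple_vpath (parcs G) (a # X @ [b])" "X \<noteq> []" and YZ: "simple_vpath (parcs G) Y" "2 \<le> length Y"
      "simple_vpath (parcs G) Z" "2 \<le> length Z" for X Y Z
  proof
    assume s: "curve (a # X @ [b]) - {p a, p b} \<subseteq> inside (curve Y \<union> curve Z)"
    obtain v where v: "v \<in> set X" using X(2) by (cases X) auto
    have vG: "set (a # X @ [b]) \<subseteq> pverts G" using simple_vpath_sub[OF X(1)] by auto
    have "p v \<noteq> p a" "p v \<noteq> p b"
      using inj_onD[OF inj_p, of v a] inj_onD[OF inj_p, of v b] v vG X(1) by (auto simp: simple_vpath_def)
    moreover have "p v \<in> curve (a # X @ [b])" using vertex_in_curve[OF X(1)] v by auto
    ultimately have "p v \<in> inside (curve Y \<union> curve Z)" using s by auto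
    then show False using outer_not_inside[OF _ YZ] v vG by auto
  qed
  show i: "curve ?S - {p a, p b} \<subseteq> inside (curve ?P \<union> curve ?Q)"
    using th no[OF P PQ(1) Q len(2) S len(3)] no[OF Q PQ(2) P len(1) S len(3)] by blast
  show "S = []" using no[OF S _ P len(1) Q len(2)] i by blast
qed

text \<open>Both diagonals of the cycle \<open>a b c d\<close> run inside it, by
  \<open>theta_curves\<close>. The diagonal \<open>ac\<close> splits this inside in two;
  \<open>bd\<close> avoids \<open>ac\<close> and so stays in one of the regions, which then encloses
  the end of \<open>bd\<close> on the other side of \<open>ac\<close>. But that end is a vertex on
  the outer face.\<close>

lemma no_K4:
  assumes "distinct [a, b, c, d]" "{(a, b), (b, c), (c, d), (a, d), (a, c), (b, d)} \<subseteq> parcs G"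
  shows False
proof -
  have sym: "(y, x) \<in> parcs G" if "(x, y) \<in> parcs G" for x y using that arcs_symmetric by blast
  note e = assms(2)
  have sv: "simple_vpath (parcs G) [a, b, c]" "simple_vpath (parcs G) [a, d, c]" "simple_vpath (parcs G) [a, c]"
    "simple_vpath (parcs G) [b, a, d]" "simple_vpath (parcs G) [b, c, d]" "simple_vpath (parcs G) [b, d]"
    using assms sym unfolding simple_vpath_def by auto
  have vG: "a \<in> pverts G" "b \<in> pverts G" "c \<in> pverts G" "d \<in> pverts G"
    using e in_arcsD1 in_arcsD2 by blast+
  note pe = path_edges_Cons2 path_edges_def
  have cu: "curve [a, b, c] = path_image (\<gamma> (a, b)) \<union> path_image (\<gamma> (b, c))"
    "curve [a, d, c] = path_image (\<gamma> (a, d)) \<union> path_image (\<gamma> (c, d))"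
    "curve [b, a, d] = path_image (\<gamma> (a, b)) \<union> path_image (\<gamma> (a, d))"
    "curve [b, c, d] = path_image (\<gamma> (b, c)) \<union> path_image (\<gamma> (c, d))"
    "curve [a, c] = path_image (\<gamma> (a, c))" "curve [b, d] = path_image (\<gamma> (b, d))"
    using edge_arc(5)[of c d] edge_arc(5)[of a b] e unfolding curve_def pe by auto
  have ac: "curve [a, c] - {p a, p c} \<subseteq> inside (curve [a, b, c] \<union> curve [a, d, c])"
    using theta_curves(2)[of a "[b]" c "[d]" "[]"] sv assms(1) by auto
  have "curve [b, d] - {p b, p d} \<subseteq> inside (curve [b, a, d] \<union> curve [b, c, d])"
    using theta_curves(2)[of b "[a]" d "[c]" "[]"] sv assms(1) by auto
  also have "curve [b, a, d] \<union> curve [b, c, d] = curve [a, b, c] \<union> curve [a, d, c]" unfolding cu by auto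
  finally have bd: "curve [b, d] - {p b, p d} \<subseteq> inside (curve [a, b, c] \<union> curve [a, d, c])" .
  have pne: "p x \<noteq> p y" if "x \<noteq> y" "x \<in> {a, b, c, d}" "y \<in> {a, b, c, d}" for x y
    using that vG inj_onD[OF inj_p, of x y] by blast
  obtain g1 where g1: "Path_Connected.arc g1" "pathstart g1 = p a" "pathfinish g1 = p c" "path_image g1 = curve [a, b, c]"
    using curve_arc[OF sv(1)] by auto
  obtain g2 where g2: "Path_Connected.arc g2" "pathstart g2 = p a" "pathfinish g2 = p c" "path_image g2 = curve [a, d, c]"
    using curve_arc[OF sv(2)] by auto
  obtain g3 where g3: "Path_Connected.arc g3" "pathstart g3 = p a" "pathfinish g3 = p c" "path_image g3 = curve [a, c]"
    using curve_arc[OF sv(3)] by auto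
  obtain g where g: "Path_Connected.arc g" "pathstart g = p b" "pathfinish g = p d" "path_image g = curve [b, d]"
    using curve_arc[OF sv(6)] by auto
  have ei: "path_image (\<gamma> (u, v)) \<inter> path_image (\<gamma> (x, y)) \<subseteq> p ` ({u, v} \<inter> {x, y})"
    if "(u, v) \<in> parcs G" "(x, y) \<in> parcs G" "{u, v} \<noteq> {x, y}" for u v x y using edge_inter that .
  have ii: "path_image (\<gamma> (a, b)) \<inter> path_image (\<gamma> (a, d)) \<subseteq> {p a}"
    "path_image (\<gamma> (a, b)) \<inter> path_image (\<gamma> (c, d)) \<subseteq> {}"
    "path_image (\<gamma> (b, c)) \<inter> path_image (\<gamma> (a, d)) \<subseteq> {}"
    "path_image (\<gamma> (b, c)) \<inter> path_image (\<gamma> (c, d)) \<subseteq> {p c}"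
    "path_image (\<gamma> (a, b)) \<inter> path_image (\<gamma> (a, c)) \<subseteq> {p a}"
    "path_image (\<gamma> (b, c)) \<inter> path_image (\<gamma> (a, c)) \<subseteq> {p c}"
    "path_image (\<gamma> (a, d)) \<inter> path_image (\<gamma> (a, c)) \<subseteq> {p a}"
    "path_image (\<gamma> (c, d)) \<inter> path_image (\<gamma> (a, c)) \<subseteq> {p c}"
    "path_image (\<gamma> (b, d)) \<inter> path_image (\<gamma> (a, c)) \<subseteq> {}"
    "path_image (\<gamma> (b, d)) \<inter> path_image (\<gamma> (a, b)) \<subseteq> {p b}"
    "path_image (\<gamma> (b, d)) \<inter> path_image (\<gamma> (b, c)) \<subseteq> {p b}"
    "path_image (\<gamma> (b, d)) \<inter> path_image (\<gamma> (a, d)) \<subseteq> {p d}"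
    "path_image (\<gamma> (b, d)) \<inter> path_image (\<gamma> (c, d)) \<subseteq> {p d}"
    using ei[of a b a d] ei[of a b c d] ei[of b c a d] ei[of b c c d] ei[of a b a c] ei[of b c a c]
      ei[of a d a c] ei[of c d a c] ei[of b d a c] ei[of b d a b] ei[of b d b c] ei[of b d a d] ei[of b d c d]
      e assms(1) by (auto simp: doubleton_eq_iff Int_insert_left)
  have ends: "p a \<in> curve [a, b, c]" "p c \<in> curve [a, b, c]" "p a \<in> curve [a, d, c]" "p c \<in> curve [a, d, c]"
    "p a \<in> curve [a, c]" "p c \<in> curve [a, c]" "p b \<in> curve [b, d]" "p d \<in> curve [b, d]"
    using vertex_in_curve[OF sv(1)] vertex_in_curve[OF sv(2)] vertex_in_curve[OF sv(3)] vertex_in_curve[OF sv(6)] by auto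
  have I: "path_image g1 \<inter> path_image g2 = {p a, p c}" "path_image g1 \<inter> path_image g3 = {p a, p c}"
    "path_image g2 \<inter> path_image g3 = {p a, p c}"
    unfolding g1(4) g2(4) g3(4) using ii ends unfolding cu by blast+
  have "curve [a, c] - {p a, p c} \<noteq> {}"
    using arc_simple_path g3 by (metis simple_path_imp_arc simple_path_endless nonempty_simple_path_endless)
  then have ne: "path_image g3 \<inter> inside (path_image g1 \<union> path_image g2) \<noteq> {}"
    unfolding g1(4) g2(4) g3(4) using ac by blast
  obtain split: "inside (curve [a, b, c] \<union> curve [a, c]) \<union> inside (curve [a, d, c] \<union> curve [a, c]) \<union>
           (curve [a, c] - {p a, p c}) = inside (curve [a, b, c] \<union> curve [a, d, c])"
    using split_inside_simple_closed_curve[OF arc_imp_simple_path[OF g1(1)] g1(2,3) arc_imp_simple_path[OF g2(1)] g2(2,3)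
      arc_imp_simple_path[OF g3(1)] g3(2,3) pne[of a c] I ne] assms(1) unfolding g1(4) g2(4) g3(4) by auto
  have img: "path_image g = g ` {0..1}" by (simp add: path_image_def)
  have inj: "inj_on g {0..1}" using g(1) by (rule arc_imp_inj_on)
  have cont: "continuous_on {0..1} g" using arc_imp_path[OF g(1)] by (simp add: Path_Connected.path_def)
  have g01: "g 0 = p b" "g 1 = p d" using g by (auto simp: pathstart_def pathfinish_def)
  \<comment> \<open>An inner point of the arc \<open>bd\<close> decides in which of the two regions
    the arc runs.\<close>
  have mid: "g (1/2) \<in> curve [b, d]" "g (1/2) \<noteq> p b" "g (1/2) \<noteq> p d"
    using inj_onD[OF inj, of "1/2" 0] inj_onD[OF inj, of "1/2" 1] g01 g(4) img by auto
  have "g (1/2) \<notin> curve [a, c]" using ii(9) mid(1) unfolding cu by blast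
  then have "g (1/2) \<in> inside (curve [a, b, c] \<union> curve [a, c]) \<or> g (1/2) \<in> inside (curve [a, d, c] \<union> curve [a, c])"
    using bd mid split by blast
  then show False
  proof
    assume h: "g (1/2) \<in> inside (curve [a, b, c] \<union> curve [a, c])"
    \<comment> \<open>Only the end \<open>p b\<close>, which lies on the boundary of this region, is
      removed: \<open>C\<close> is still connected, avoids the boundary and contains
      \<open>p d\<close>.\<close>
    define C where "C = g ` {0<..1}"
    have cC: "topological_space_class.connected C" unfolding C_def by (intro connected_continuous_image continuous_on_subset[OF cont]) auto
    have "p b \<notin> C" unfolding C_def using inj_onD[OF inj, of _ 0] g01(1) by force
    moreover have "C \<subseteq> path_image (\<gamma> (b, d))" unfolding C_def using img g(4) cu(6) by auto
    ultimately have "C \<inter> (curve [a, b, c] \<union> curve [a, c]) = {}"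
      using ii(9,10,11) unfolding cu by blast
    with cC have "C \<subseteq> inside (curve [a, b, c] \<union> curve [a, c])"
      using h by (intro connected_meets_inside[of _ _ "g (1/2)"]) (auto simp: C_def)
    moreover have "p d \<in> C" unfolding C_def g01(2)[symmetric] by (rule imageI) simp
    ultimately have "p d \<in> inside (curve [a, b, c] \<union> curve [a, c])" by (rule subsetD)
    then show False using outer_not_inside[OF vG(4) sv(1) _ sv(3)] by simp
  next
    assume h: "g (1/2) \<in> inside (curve [a, d, c] \<union> curve [a, c])"
    define C where "C = g ` {0..<1}"
    have cC: "topological_space_class.connected C" unfolding C_def by (intro connected_continuous_image continuous_on_subset[OF cont]) auto
    have "p d \<notin> C" unfolding C_def using inj_onD[OF inj, of _ 1] g01(2) by force
    moreover have "C \<subseteq> path_image (\<gamma> (b, d))" unfolding C_def using img g(4) cu(6) by auto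
    ultimately have "C \<inter> (curve [a, d, c] \<union> curve [a, c]) = {}"
      using ii(9,12,13) unfolding cu by blast
    with cC have "C \<subseteq> inside (curve [a, d, c] \<union> curve [a, c])"
      using h by (intro connected_meets_inside[of _ _ "g (1/2)"]) (auto simp: C_def)
    moreover have "p b \<in> C" unfolding C_def g01(1)[symmetric] by (rule imageI) simp
    ultimately have "p b \<in> inside (curve [a, d, c] \<union> curve [a, c])" by (rule subsetD)
    then show False using outer_not_inside[OF vG(2) sv(2) _ sv(3)] by simp
  qed
qed

end

section \<open>Outerplanar graphs and noncrossing orders\<close>

text \<open>A list of the vertices is a circular order in which no two edges cross.\<close>

definition ncl :: "('a \<times> 'a) set \<Rightarrow> 'a list \<Rightarrow> bool" where
  "ncl R xs \<longleftrightarrow> distinct xs \<and> (\<forall>i j k l. i < j \<longrightarrow> j < k \<longrightarrow> k < l \<longrightarrow> l < length xs \<longrightarrow>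
     (xs ! i, xs ! k) \<in> R \<longrightarrow> (xs ! j, xs ! l) \<notin> R)"

text \<open>The two halves of Chartrand and Harary's condition: no subdivided $K_{2,3}$ and no $K_4$.\<close>

definition theta_free :: "('a \<times> 'a) set \<Rightarrow> bool" where
  "theta_free R \<longleftrightarrow> \<not> (\<exists>a b P Q S. simple_vpath R (a # P @ [b]) \<and> simple_vpath R (a # Q @ [b]) \<and>
     simple_vpath R (a # S @ [b]) \<and> P \<noteq> [] \<and> Q \<noteq> [] \<and> S \<noteq> [] \<and>
     set P \<inter> set Q = {} \<and> set P \<inter> set S = {} \<and> set Q \<inter> set S = {})"

definition K4_free :: "('a \<times> 'a) set \<Rightarrow> bool" where
  "K4_free R \<longleftrightarrow> \<not> (\<exists>a b c d. distinct [a, b, c, d] \<and>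
     {(a, b), (b, c), (c, d), (a, d), (a, c), (b, d)} \<subseteq> R)"

lemma simple_vpath_mono: "simple_vpath R xs \<Longrightarrow> R \<subseteq> R' \<Longrightarrow> simple_vpath R' xs"
  unfolding simple_vpath_def by (auto intro: successively_mono)

lemma theta_freeD:
  assumes "theta_free R" "simple_vpath R (a # P @ [b])" "simple_vpath R (a # Q @ [b])"
    "simple_vpath R (a # S @ [b])" "P \<noteq> []" "Q \<noteq> []" "S \<noteq> []"
    "set P \<inter> set Q = {}" "set P \<inter> set S = {}" "set Q \<inter> set S = {}"
  shows False
  using assms unfolding theta_free_def by blast

lemma theta_free_mono:
  assumes "theta_free R'" "R \<subseteq> R'"
  shows "theta_free R"
  unfolding theta_free_def
proof
  assume "\<exists>a b P Q S. simple_vpath R (a # P @ [b]) \<and> simple_vpath R (a # Q @ [b]) \<and>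
     simple_vpath R (a # S @ [b]) \<and> P \<noteq> [] \<and> Q \<noteq> [] \<and> S \<noteq> [] \<and>
     set P \<inter> set Q = {} \<and> set P \<inter> set S = {} \<and> set Q \<inter> set S = {}"
  then obtain a b P Q S where "simple_vpath R (a # P @ [b])" "simple_vpath R (a # Q @ [b])"
     "simple_vpath R (a # S @ [b])" "P \<noteq> []" "Q \<noteq> []" "S \<noteq> []"
     "set P \<inter> set Q = {}" "set P \<inter> set S = {}" "set Q \<inter> set S = {}" by blast
  with simple_vpath_mono[OF _ assms(2)] show False by (intro theta_freeD[OF assms(1)])
qed

lemma K4_free_mono: "K4_free R' \<Longrightarrow> R \<subseteq> R' \<Longrightarrow> K4_free R"
  unfolding K4_free_def by (meson subset_trans)

text \<open>A crossing that uses the moved vertex \<open>x\<close> is also a crossing when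
  \<open>x\<close> is read first; the two edges exchange their places and one is reversed, hence the
  symmetry of \<open>R\<close>.\<close>

lemma ncl_rotate1:
  assumes sym: "sym R" and n: "ncl R (x # xs)"
  shows "ncl R (xs @ [x])"
  unfolding ncl_def
proof (intro conjI allI impI notI)
  show "distinct (xs @ [x])" using n by (auto simp: ncl_def)
  fix i j k l assume h: "i < j" "j < k" "k < l" "l < length (xs @ [x])"
    "((xs @ [x]) ! i, (xs @ [x]) ! k) \<in> R" "((xs @ [x]) ! j, (xs @ [x]) ! l) \<in> R"
  have *: "(xs @ [x]) ! m = (x # xs) ! Suc m" if "m < length xs" for m using that by (simp add: nth_append)
  have nc: "((x # xs) ! b, (x # xs) ! d) \<notin> R"
    if "a < b" "b < c" "c < d" "d < length (x # xs)" "((x # xs) ! a, (x # xs) ! c) \<in> R" for a b c d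
    using n that unfolding ncl_def by blast
  show False
  proof (cases "l < length xs")
    case True
    then show ?thesis using nc[of "Suc i" "Suc j" "Suc k" "Suc l"] h *[of i] *[of j] *[of k] *[of l] by simp
  next
    case False
    then have l: "l = length xs" using h by simp
    then have "(xs ! j, x) \<in> R" using h(6) *[of j] h(1-4) by (simp add: nth_append)
    then have "((x # xs) ! 0, (x # xs) ! Suc j) \<in> R" using symD[OF sym] by simp
    then show ?thesis using nc[of 0 "Suc i" "Suc j" "Suc k"] h *[of i] *[of k] l by simp
  qed
qed

lemma ncl_rotate: "sym R \<Longrightarrow> ncl R (xs @ ys) \<Longrightarrow> ncl R (ys @ xs)"
proof (induction xs arbitrary: ys)
  case (Cons x xs)
  then have "ncl R ((xs @ ys) @ [x])" by (intro ncl_rotate1) auto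
  then show ?case using Cons.IH[of "ys @ [x]"] Cons.prems(1) by simp
qed simp

lemma ncl_subset_edges: "ncl R xs \<Longrightarrow> R' \<inter> set xs \<times> set xs \<subseteq> R \<Longrightarrow> ncl R' xs"
  unfolding ncl_def by (meson IntI SigmaI less_trans nth_mem subsetD)

text \<open>The overlap \<open>ws\<close> is a cut vertex, or empty.\<close>

lemma ncl_append:
  assumes n1: "ncl R xs" and n2: "ncl R ys" and last: "ys = ws @ zs" "length ws \<le> 1" "xs = vs @ ws"
    and dis: "set xs \<inter> set zs = {}" and no: "R \<inter> set vs \<times> set zs = {}" and sym: "sym R"
  shows "ncl R (vs @ ys)"
  unfolding ncl_def
proof (intro conjI allI impI notI)
  show "distinct (vs @ ys)" using n1 n2 dis last by (auto simp: ncl_def)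
  fix i j k l assume h: "i < j" "j < k" "k < l" "l < length (vs @ ys)"
    "((vs @ ys) ! i, (vs @ ys) ! k) \<in> R" "((vs @ ys) ! j, (vs @ ys) ! l) \<in> R"
  let ?z = "vs @ ys"
  have z1: "?z ! m = xs ! m" if "m < length xs" for m
    using that last by (auto simp: nth_append)
  have z2: "?z ! (length vs + m) = ys ! m" for m by (simp add: nth_append)
  have cross: "(?z ! a, ?z ! b) \<notin> R" if "a < length vs" "length xs \<le> b" "b < length ?z" for a b
  proof -
    have "?z ! a \<in> set vs" using that by (simp add: nth_append)
    moreover have "?z ! b = zs ! (b - length xs)" using that last by (auto simp: nth_append)
    then have "?z ! b \<in> set zs" using that last by auto
    ultimately show ?thesis using no by auto
  qed
  have lx: "length xs \<le> Suc (length vs)" using last by simp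
  have lv: "length vs \<le> length xs" using last by simp
  consider "l < length xs" | "length vs \<le> i" | "i < length vs" "length xs \<le> l" by linarith
  then show False
  proof cases
    case 1
    then have "(xs ! i, xs ! k) \<in> R" "(xs ! j, xs ! l) \<in> R" using h z1 by auto
    then show ?thesis using n1 h 1 unfolding ncl_def by blast
  next
    case 2
    define m where "m = length vs"
    have "?z ! i = ys ! (i - m)" "?z ! j = ys ! (j - m)" "?z ! k = ys ! (k - m)" "?z ! l = ys ! (l - m)"
      using 2 h by (auto simp: nth_append m_def)
    then have "(ys ! (i - m), ys ! (k - m)) \<in> R" "(ys ! (j - m), ys ! (l - m)) \<in> R" using h by auto
    moreover have "i - m < j - m" "j - m < k - m" "k - m < l - m" "l - m < length ys" using 2 h by (auto simp: m_def)
    ultimately show ?thesis using n2 unfolding ncl_def by blast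
  next
    case 3
    have "k < length xs" using cross[OF 3(1), of k] h by force
    moreover have "\<not> j < length vs" using cross[of j l] 3(2) h by auto
    ultimately show ?thesis using lx h(2) by simp
  qed
qed

section \<open>Cycles, crossing chords and Hamiltonicity\<close>

text \<open>An edge run back and forth counts as a cycle of length 2, which gives the search for a
  longest cycle a starting point.\<close>

definition cyc :: "('a \<times> 'a) set \<Rightarrow> 'a list \<Rightarrow> bool" where
  "cyc R C \<longleftrightarrow> 2 \<le> length C \<and> simple_vpath R C \<and> (last C, hd C) \<in> R"

lemma cyc_rotate1: "cyc R (x # xs) \<Longrightarrow> cyc R (xs @ [x])"
  unfolding cyc_def simple_vpath_def
  by (cases xs) (auto simp: successively_append_iff successively_Cons hd_append split: if_splits)

lemma cyc_rotate: "cyc R (xs @ ys) \<Longrightarrow> cyc R (ys @ xs)"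
proof (induction xs arbitrary: ys)
  case (Cons x xs)
  then have "cyc R ((xs @ ys) @ [x])" by (intro cyc_rotate1) auto
  then show ?case using Cons.IH[of "ys @ [x]"] by simp
qed simp

lemma simple_vpath_rev: "sym R \<Longrightarrow> simple_vpath R (rev xs) \<longleftrightarrow> simple_vpath R xs"
proof -
  assume sym: "sym R"
  have "(\<lambda>x y. (y, x) \<in> R) = (\<lambda>x y. (x, y) \<in> R)"
    by (intro ext iffI) (erule symD[OF sym])+
  then show ?thesis unfolding simple_vpath_def distinct_rev successively_rev by (simp only:)
qed

lemma simple_vpath_append:
  "simple_vpath R (xs @ ys) \<longleftrightarrow> simple_vpath R xs \<and> simple_vpath R ys \<and> set xs \<inter> set ys = {} \<and>
     (xs = [] \<or> ys = [] \<or> (last xs, hd ys) \<in> R)"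
  unfolding simple_vpath_def by (auto simp: successively_append_iff)

lemma simple_vpath_Cons:
  "simple_vpath R (x # xs) \<longleftrightarrow> simple_vpath R xs \<and> x \<notin> set xs \<and> (xs = [] \<or> (x, hd xs) \<in> R)"
  unfolding simple_vpath_def by (auto simp: successively_Cons)

lemma simple_vpath_Nil: "simple_vpath R []" by (simp add: simple_vpath_def)

lemma simple_vpath_appendD:
  "simple_vpath R (xs @ ys) \<Longrightarrow> simple_vpath R xs" "simple_vpath R (xs @ ys) \<Longrightarrow> simple_vpath R ys"
  by (simp_all add: simple_vpath_append)

lemma simple_vpath_ends:
  assumes "simple_vpath R Y" "Y \<noteq> []" "a \<notin> set Y" "b \<notin> set Y" "a \<noteq> b" "(a, hd Y) \<in> R" "(last Y, b) \<in> R"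
  shows "simple_vpath R (a # Y @ [b])"
  using assms by (simp add: simple_vpath_Cons simple_vpath_append simple_vpath_Nil)

text \<open>A vertex between \<open>a\<close> and \<open>b\<close> would give three internally
  disjoint paths from \<open>a\<close> to \<open>b\<close>: along \<open>P\<close>, backwards
  through \<open>T\<close> to \<open>d\<close> and over the chord \<open>bd\<close>, and over the
  chord \<open>ac\<close> and backwards through \<open>Q\<close>.\<close>

lemma crossing_chords_gap:
  assumes sym: "sym R" and th: "theta_free R" and C: "cyc R (a # P @ b # Q @ c # S @ d # T)"
    and ch: "(a, c) \<in> R" "(b, d) \<in> R"
  shows "P = []"
proof (rule ccontr)
  assume P: "P \<noteq> []"
  have s: "simple_vpath R (a # P @ b # Q @ c # S @ d # T)" "(last (d # T), a) \<in> R"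
    using C by (auto simp: cyc_def)
  have sr: "simple_vpath R (d # T)" "simple_vpath R (b # Q @ [c])" "simple_vpath R (a # P @ [b])"
    using simple_vpath_appendD[of R "a # P @ b # Q @ c # S" "d # T"] simple_vpath_appendD[of R "a # P" "b # Q @ c # S @ d # T"]
      simple_vpath_appendD[of R "b # Q @ [c]" "S @ d # T"] simple_vpath_appendD[of R "a # P @ [b]" "Q @ c # S @ d # T"] s(1)
    by simp_all
  have dist: "distinct (a # P @ b # Q @ c # S @ d # T)" using s(1) by (simp add: simple_vpath_def)
  have 1: "simple_vpath R (a # rev (d # T) @ [b])"
  proof (rule simple_vpath_ends)
    show "simple_vpath R (rev (d # T))" using sr(1) simple_vpath_rev[OF sym] by blast
    show "(a, hd (rev (d # T))) \<in> R" using symD[OF sym s(2)] unfolding hd_rev .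
    show "(last (rev (d # T)), b) \<in> R" using symD[OF sym ch(2)] by simp
  qed (use dist in auto)
  have 2: "simple_vpath R (a # (c # rev Q) @ [b])"
  proof -
    have "rev (b # Q @ [c]) = (c # rev Q) @ [b]" by simp
    then have "simple_vpath R ((c # rev Q) @ [b])" using sr(2) simple_vpath_rev[OF sym] by metis
    then show ?thesis unfolding simple_vpath_Cons using dist ch(1) by (auto simp: simple_vpath_Cons)
  qed
  have "set P \<inter> set (rev (d # T)) = {}" "set P \<inter> set (c # rev Q) = {}" "set (rev (d # T)) \<inter> set (c # rev Q) = {}"
    using s(1) by (auto simp: simple_vpath_def)
  then show False using P by (intro theta_freeD[OF th sr(3) 1 2]) auto
qed

text \<open>Rotating the cycle brings each of the four gaps between the ends of two crossing chords
  into the position of \<open>crossing_chords_gap\<close>. With all gaps empty, the four ends span a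
  \<open>K4\<close>.\<close>

lemma hamiltonian_cycle_ncl:
  assumes sym: "sym R" and th: "theta_free R" and K4: "K4_free R" and C: "cyc R xs"
  shows "ncl R xs"
  unfolding ncl_def
proof (intro conjI allI impI notI)
  show "distinct xs" using C by (simp add: cyc_def simple_vpath_def)
  fix i j k l assume h: "i < j" "j < k" "k < l" "l < length xs" "(xs ! i, xs ! k) \<in> R" "(xs ! j, xs ! l) \<in> R"
  define A where "A = take i xs"
  define P where "P = take (j - Suc i) (drop (Suc i) xs)"
  define Q where "Q = take (k - Suc j) (drop (Suc j) xs)"
  define S where "S = take (l - Suc k) (drop (Suc k) xs)"
  define T where "T = drop (Suc l) xs"
  let ?a = "xs ! i" and ?b = "xs ! j" and ?c = "xs ! k" and ?d = "xs ! l"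
  have step: "drop (Suc m) xs = take (n - Suc m) (drop (Suc m) xs) @ xs ! n # drop (Suc n) xs"
    if "m < n" "n < length xs" for m n
  proof -
    have "drop (Suc m) xs = take (n - Suc m) (drop (Suc m) xs) @ drop (n - Suc m) (drop (Suc m) xs)" by (simp only: append_take_drop_id)
    also have "drop (n - Suc m) (drop (Suc m) xs) = drop n xs" using that by simp
    also have "drop n xs = xs ! n # drop (Suc n) xs" using that by (simp add: Cons_nth_drop_Suc)
    finally show ?thesis .
  qed
  have "xs = A @ ?a # drop (Suc i) xs" using h by (simp add: A_def id_take_nth_drop)
  also have "drop (Suc i) xs = P @ ?b # drop (Suc j) xs" unfolding P_def using h by (intro step) auto
  also have "drop (Suc j) xs = Q @ ?c # drop (Suc k) xs" unfolding Q_def using h by (intro step) auto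
  also have "drop (Suc k) xs = S @ ?d # T" unfolding S_def T_def using h by (intro step) auto
  finally have xs: "xs = A @ ?a # P @ ?b # Q @ ?c # S @ ?d # T" .
  let ?T = "T @ A"
  have C1: "cyc R (?a # P @ ?b # Q @ ?c # S @ ?d # ?T)"
    using cyc_rotate[of R A "?a # P @ ?b # Q @ ?c # S @ ?d # T"] C xs by simp
  have C2: "cyc R (?b # Q @ ?c # S @ ?d # ?T @ ?a # P)" using cyc_rotate[of R "?a # P" "?b # Q @ ?c # S @ ?d # ?T"] C1 by simp
  have C3: "cyc R (?c # S @ ?d # ?T @ ?a # P @ ?b # Q)" using cyc_rotate[of R "?b # Q" "?c # S @ ?d # ?T @ ?a # P"] C2 by simp
  have C4: "cyc R (?d # ?T @ ?a # P @ ?b # Q @ ?c # S)" using cyc_rotate[of R "?c # S" "?d # ?T @ ?a # P @ ?b # Q"] C3 by simp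
  have ca: "(?c, ?a) \<in> R" "(?d, ?b) \<in> R" using h(5,6) by (auto intro: symD[OF sym])
  have e: "P = []" "Q = []" "S = []" "?T = []"
    using crossing_chords_gap[OF sym th C1 h(5,6)] crossing_chords_gap[OF sym th C2 h(6) ca(1)]
      crossing_chords_gap[OF sym th C3 ca] crossing_chords_gap[OF sym th C4 ca(2) h(5)] by auto
  have "cyc R [?a, ?b, ?c, ?d]" using C1 e by simp
  then have "distinct [?a, ?b, ?c, ?d]" "{(?a, ?b), (?b, ?c), (?c, ?d), (?a, ?d), (?a, ?c), (?b, ?d)} \<subseteq> R"
    using h(5,6) by (auto simp: cyc_def simple_vpath_def intro: symD[OF sym])
  then show False using K4 unfolding K4_free_def by blast
qed

lemma reachable_vpath:
  assumes "(v, w) \<in> (R \<inter> W \<times> W)\<^sup>*" "v \<in> W"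
  shows "\<exists>ps. simple_vpath R ps \<and> ps \<noteq> [] \<and> hd ps = v \<and> last ps = w \<and> set ps \<subseteq> W"
  using assms
proof (induction rule: rtrancl_induct)
  case base
  then show ?case by (intro exI[of _ "[v]"]) (simp add: simple_vpath_def)
next
  case (step y z)
  then obtain ps where ps: "simple_vpath R ps" "ps \<noteq> []" "hd ps = v" "last ps = y" "set ps \<subseteq> W" by auto
  show ?case
  proof (cases "z \<in> set ps")
    case True
    then obtain as bs where as: "ps = as @ z # bs" by (meson split_list)
    then have "simple_vpath R (as @ [z])" using ps(1) by (auto simp: simple_vpath_append simple_vpath_Cons simple_vpath_Nil)
    then show ?thesis using ps as by (intro exI[of _ "as @ [z]"]) (auto simp: hd_append)
  next
    case False
    then have "simple_vpath R (ps @ [z])" using ps(1,4) step(2) unfolding simple_vpath_append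
      by (simp add: simple_vpath_def)
    then show ?thesis using ps step by (intro exI[of _ "ps @ [z]"]) auto
  qed
qed

text \<open>Take a longest cycle. Since no vertex separates the graph, a missed vertex lies on a
  path \<open>E\<close> off the cycle that attaches to it at two vertices \<open>y\<close> and
  \<open>z\<close>. If these are consecutive, the cycle can be lengthened through \<open>E\<close>;
  otherwise \<open>E\<close> and the two arcs of the cycle form a theta.\<close>

lemma two_connected_hamiltonian:
  assumes sym: "sym R" and irr: "irrefl R" and th: "theta_free R" and fin: "finite V" and card: "3 \<le> card V"
    and RV: "R \<subseteq> V \<times> V"
    and conn: "\<And>u X. u \<in> V \<Longrightarrow> X \<subseteq> V - {u} \<Longrightarrow> X \<noteq> {} \<Longrightarrow> V - X - {u} \<noteq> {} \<Longrightarrow>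
        \<exists>x\<in>X. \<exists>y\<in>V - X - {u}. (x, y) \<in> R"
  shows "\<exists>C. cyc R C \<and> set C = V"
proof -
  have setV: "set C \<subseteq> V" if "cyc R C" for C
  proof
    fix x assume "x \<in> set C"
    then obtain u v where "(u, v) \<in> path_edges C" "x = u \<or> x = v"
      using path_edges_covers[of C x] \<open>cyc R C\<close> unfolding cyc_def by fastforce
    then show "x \<in> V" using path_edges_simple[of R C u v] \<open>cyc R C\<close> RV by (auto simp: cyc_def)
  qed
  obtain a where a: "a \<in> V" using card by fastforce
  obtain b where b: "b \<in> V" "b \<noteq> a" using card a
    by (metis One_nat_def Suc_leD card.empty card_Suc_eq_finite card_le_Suc0_iff_eq fin not_less_eq_eq numeral_3_eq_3)
  have "{a, b} \<noteq> V" using card b by auto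
  then obtain c where c: "c \<in> V" "c \<notin> {a, b}" using a b by blast
  obtain x y where xy: "(x, y) \<in> R" using conn[of c "{a}"] a b c by blast
  then have "x \<noteq> y" using irr by (auto simp: irrefl_def)
  then have cyc2: "cyc R [x, y]" using xy symD[OF sym xy] by (auto simp: cyc_def simple_vpath_def)
  have len: "length C \<le> card V" if "cyc R C" for C
    using card_mono[OF fin setV[OF that]] that by (simp add: cyc_def simple_vpath_def distinct_card)
  have "\<exists>C. cyc R C \<and> (\<forall>D. cyc R D \<longrightarrow> length D \<le> length C)"
    using ex_has_greatest_nat[of "cyc R" "[x, y]" length "Suc (card V)"] cyc2 len by (auto simp: less_Suc_eq_le)
  then obtain C where C: "cyc R C" and max: "\<And>D. cyc R D \<Longrightarrow> length D \<le> length C" by blast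
  have "set C = V"
  proof (rule ccontr)
    assume "set C \<noteq> V"
    then have ne: "V - set C \<noteq> {}" using setV[OF C] by auto
    obtain c0 c1 C' where C': "C = c0 # c1 # C'" using C by (cases C; cases "tl C") (auto simp: cyc_def)
    have "c0 \<noteq> c1" using C C' by (auto simp: cyc_def simple_vpath_def)
    have "\<exists>v\<in>V - set C. \<exists>y\<in>V - (V - set C) - {c0}. (v, y) \<in> R"
      using conn[of c0 "V - set C"] ne setV[OF C] C' \<open>c0 \<noteq> c1\<close> by auto
    then obtain v y where v: "v \<in> V" "v \<notin> set C" and y: "y \<in> set C" and vy: "(v, y) \<in> R" by blast
    define W where "W = V - set C"
    define X where "X = {w. (v, w) \<in> (R \<inter> W \<times> W)\<^sup>*}"
    have vW: "v \<in> W" using v by (simp add: W_def)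
    have XW: "X \<subseteq> W"
    proof
      fix w assume "w \<in> X"
      then have "(v, w) \<in> (R \<inter> W \<times> W)\<^sup>*" by (simp add: X_def)
      then show "w \<in> W" using vW by (cases rule: rtrancl.cases) auto
    qed
    \<comment> \<open>\<open>X\<close> is the component of \<open>v\<close> off the cycle. As
      \<open>y\<close> is no cut vertex, some edge leaves \<open>X\<close> towards a vertex
      \<open>z\<close> other than \<open>y\<close>, and such a \<open>z\<close> lies on the
      cycle.\<close>
    have "\<exists>x\<in>X. \<exists>z\<in>V - X - {y}. (x, z) \<in> R"
    proof (rule conn)
      show "y \<in> V" "X \<subseteq> V - {y}" using y setV[OF C] XW by (auto simp: W_def)
      show "X \<noteq> {}" by (auto simp: X_def)
      have "c0 \<in> V - X" "c1 \<in> V - X" using XW setV[OF C] C' by (auto simp: W_def)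
      then show "V - X - {y} \<noteq> {}" using \<open>c0 \<noteq> c1\<close> by blast
    qed
    then obtain x z where x: "x \<in> X" and z: "z \<in> V" "z \<notin> X" "z \<noteq> y" and xz: "(x, z) \<in> R" by blast
    have zC: "z \<in> set C"
    proof (rule ccontr)
      assume "z \<notin> set C"
      then have "(x, z) \<in> R \<inter> W \<times> W" using z xz x XW by (auto simp: W_def)
      then show False using x z(2) unfolding X_def by (meson mem_Collect_eq rtrancl.rtrancl_into_rtrancl)
    qed
    obtain E where E: "simple_vpath R E" "E \<noteq> []" "hd E = v" "last E = x" "set E \<subseteq> W"
      using reachable_vpath[of v x R W] x vW unfolding X_def by auto
    have EC: "set E \<inter> set C = {}" using E(5) by (auto simp: W_def)
    obtain as bs where "C = as @ y # bs" using y by (meson split_list)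
    then have Cy: "cyc R (y # bs @ as)" "set (y # bs @ as) = set C" "length (y # bs @ as) = length C"
      using cyc_rotate[of R as "y # bs"] C by auto
    then obtain P S where PS: "bs @ as = P @ z # S" using zC z(3) by (metis set_ConsD split_list)
    have D: "cyc R (y # P @ z # S)" "set (y # P @ z # S) = set C" "length (y # P @ z # S) = length C"
      using Cy PS by auto
    have sD: "simple_vpath R (y # P @ z # S)" "(last (z # S), y) \<in> R" using D(1) by (auto simp: cyc_def)
    have Ed: "set E \<inter> set (y # P @ z # S) = {}" using EC D(2) by simp
    have sE: "(y, hd E) \<in> R" "(last E, z) \<in> R" "(hd E, y) \<in> R" "(z, last E) \<in> R"
      using E vy xz symD[OF sym vy] symD[OF sym xz] by auto
    have revE: "simple_vpath R (rev E)" "hd (rev E) = last E" "last (rev E) = hd E" "rev E \<noteq> []"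
      using E simple_vpath_rev[OF sym, of E] by (auto simp: hd_rev last_rev)
    note simps = simple_vpath_append simple_vpath_Cons simple_vpath_Nil
    show False
    proof (cases "P = [] \<or> S = []")
      case True
      then show False
      proof
        assume P: "P = []"
        have "cyc R (y # E @ z # S)" unfolding cyc_def
          using sD Ed E(1,2) sE P by (auto simp: simps)
        then show False using max[of "y # E @ z # S"] D(3) P E(2) by (cases E) auto
      next
        assume S: "S = []"
        have "cyc R (y # P @ z # rev E)" unfolding cyc_def
          using sD Ed revE sE S by (auto simp: simps hd_append)
        then show False using max[of "y # P @ z # rev E"] D(3) S E(2) by (cases E) auto
      qed
    next
      case False
      have dist: "distinct (y # P @ z # S)" using sD(1) by (simp add: simple_vpath_def)
      have p1: "simple_vpath R (y # P @ [z])" using simple_vpath_appendD(1)[of R "y # P @ [z]" S] sD(1) by simp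
      have p2: "simple_vpath R (y # E @ [z])"
        by (rule simple_vpath_ends[OF E(1,2) _ _ _ sE(1,2)]) (use Ed dist in auto)
      have "simple_vpath R (z # S)" using simple_vpath_appendD(2)[of R "y # P" "z # S"] sD(1) by simp
      then have "simple_vpath R (rev (z # S))" using simple_vpath_rev[OF sym] by metis
      moreover have "hd (rev S) = last (z # S)" using False by (simp add: hd_rev)
      ultimately have p3: "simple_vpath R (y # rev S @ [z])"
        unfolding simple_vpath_Cons using dist False symD[OF sym sD(2)] by (auto simp: hd_append)
      have "set P \<inter> set E = {}" "set P \<inter> set (rev S) = {}" "set E \<inter> set (rev S) = {}"
        using Ed sD(1) by (auto simp: simple_vpath_def)
      then show False using False E(2) by (intro theta_freeD[OF th p1 p2 p3]) auto
    qed
  qed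
  then show ?thesis using C by blast
qed

text \<open>Without a cut vertex a Hamiltonian cycle provides the order. Otherwise \<open>u\<close>
  separates \<open>X\<close> from the rest \<open>Z\<close>; by induction both sides with
  \<open>u\<close> have orders, and these are rotated so that \<open>u\<close> is last in one and
  first in the other and glued there.\<close>

theorem theta_K4_free_ncl:
  assumes "finite V" "sym R" "irrefl R" "R \<subseteq> V \<times> V" "theta_free R" "K4_free R"
  shows "\<exists>xs. set xs = V \<and> ncl R xs"
  using assms
proof (induction "card V" arbitrary: V R rule: less_induct)
  case less
  note fin = less.prems(1) and sym = less.prems(2) and irr = less.prems(3) and RV = less.prems(4)
    and th = less.prems(5) and K4 = less.prems(6)
  show ?case
  proof (cases "card V < 3")
    case True
    obtain xs where xs: "set xs = V" "distinct xs" using finite_distinct_list[OF fin] by blast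
    then have "ncl R xs" using True by (auto simp: ncl_def distinct_card[symmetric])
    then show ?thesis using xs by blast
  next
    case card: False
    show ?thesis
    proof (cases "\<forall>u X. u \<in> V \<longrightarrow> X \<subseteq> V - {u} \<longrightarrow> X \<noteq> {} \<longrightarrow> V - X - {u} \<noteq> {} \<longrightarrow>
        (\<exists>x\<in>X. \<exists>y\<in>V - X - {u}. (x, y) \<in> R)")
      case True
      then obtain C where "cyc R C" "set C = V"
        using two_connected_hamiltonian[OF sym irr th fin _ RV] card by force
      then show ?thesis using hamiltonian_cycle_ncl[OF sym th K4] by blast
    next
      case False
      then obtain u X where u: "u \<in> V" and X: "X \<subseteq> V - {u}" "X \<noteq> {}" and Y: "V - X - {u} \<noteq> {}"
        and no: "\<not> (\<exists>x\<in>X. \<exists>y\<in>V - X - {u}. (x, y) \<in> R)" by blast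
      define Z where "Z = V - X - {u}"
      have sub: "\<exists>xs. set xs = U \<and> ncl R xs" if U: "U \<subset> V" for U
      proof -
        let ?R = "R \<inter> U \<times> U"
        have "card U < card V" using psubset_card_mono[OF fin U] .
        moreover have "finite U" using U fin by (auto intro: finite_subset)
        moreover have "sym ?R" "irrefl ?R" using sym irr by (auto simp: sym_def irrefl_def)
        moreover have "theta_free ?R" "K4_free ?R" using theta_free_mono[OF th] K4_free_mono[OF K4] by auto
        ultimately obtain xs where xs: "set xs = U" "ncl ?R xs" using less.hyps[of U ?R] by auto
        then show ?thesis using ncl_subset_edges[of ?R xs R] by auto
      qed
      have "insert u X \<subset> V" using X u Y by auto
      then obtain xs where xs: "set xs = insert u X" "ncl R xs" using sub by blast
      have "insert u Z \<subset> V" using X u by (auto simp: Z_def)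
      then obtain ys where ys: "set ys = insert u Z" "ncl R ys" using sub by blast
      obtain as bs where "xs = as @ u # bs" using xs(1) by (metis insertI1 split_list)
      then have xs': "ncl R ((bs @ as) @ [u])" "set ((bs @ as) @ [u]) = insert u X"
        using ncl_rotate[OF sym, of "as @ [u]" bs] xs by auto
      obtain cs ds where "ys = cs @ u # ds" using ys(1) by (metis insertI1 split_list)
      then have ys': "ncl R ([u] @ ds @ cs)" "set ([u] @ ds @ cs) = insert u Z"
        using ncl_rotate[OF sym, of cs "u # ds"] ys by auto
      have vx: "set (bs @ as) = X" using xs' X by (auto simp: ncl_def)
      have vz: "set (ds @ cs) = Z" using ys' by (auto simp: ncl_def Z_def)
      have "ncl R ((bs @ as) @ ([u] @ ds @ cs))"
      proof (rule ncl_append[OF xs'(1) ys'(1) refl _ refl _ _ sym])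
        show "set ((bs @ as) @ [u]) \<inter> set (ds @ cs) = {}" unfolding xs'(2) vz using X by (auto simp: Z_def)
        show "R \<inter> set (bs @ as) \<times> set (ds @ cs) = {}" unfolding vx vz using no by (auto simp: Z_def)
      qed simp
      moreover have "set ((bs @ as) @ ([u] @ ds @ cs)) = V" using vx vz u X by (auto simp: Z_def)
      ultimately show ?thesis by blast
    qed
  qed
qed

theorem outerplanar_ncl:
  fixes G :: "'a pair_pre_digraph"
  assumes G: "pair_graph G" and out: "outerplanar G"
  obtains xs where "set xs = pverts G" "ncl (parcs G) xs"
proof -
  interpret pair_graph G by fact
  obtain p \<gamma> where d: "plane_drawing G p \<gamma>"
    "\<forall>v\<in>pverts G. p v \<in> frontier (outside (drawing_points G p \<gamma>))"
    using out unfolding outerplanar_def by blast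
  interpret drawn_graph G p \<gamma> using d by unfold_locales auto
  have th: "theta_free (parcs G)" unfolding theta_free_def using theta_curves(1) by metis
  have K4: "K4_free (parcs G)" unfolding K4_free_def using no_K4 by blast
  have "sym (parcs G)" by (rule symI) (rule arcs_symmetric)
  moreover have "irrefl (parcs G)" unfolding irrefl_def using pair_no_loops by fastforce
  moreover have "parcs G \<subseteq> pverts G \<times> pverts G" using in_arcsD1 in_arcsD2 by auto
  ultimately show ?thesis using theta_K4_free_ncl[OF pair_finite_verts _ _ _ th K4] that by blast
qed

section \<open>Drawing a noncrossing order with chords of a parabola\<close>

text \<open>Points in convex position whose chords lie above the curve, so that every vertex can be
  approached from below.\<close>

definition parabola :: "nat \<Rightarrow> complex" where
  "parabola i = Complex (real i) ((real i)\<^sup>2)"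

lemma inj_parabola: "parabola i = parabola j \<longleftrightarrow> i = j"
  by (auto simp: parabola_def complex_eq_iff)

text \<open>At abscissa \<open>t\<close> the chord lies \<open>(t - i) * (j - t)\<close> above the
  parabola, so intersecting two chords means comparing two such products.\<close>

lemma parabola_segment:
  assumes ij: "i < j"
  shows "z \<in> closed_segment (parabola i) (parabola j) \<longleftrightarrow>
    i \<le> Re z \<and> Re z \<le> j \<and> Im z = (Re z)\<^sup>2 + (Re z - i) * (j - Re z)"
proof
  assume "z \<in> closed_segment (parabola i) (parabola j)"
  then obtain u where u: "0 \<le> u" "u \<le> 1" "z = (1 - u) *\<^sub>R parabola i + u *\<^sub>R parabola j"
    by (auto simp: closed_segment_def)
  have re: "Re z = i + u * (real j - i)" and im: "Im z = (real i)\<^sup>2 + u * ((real j)\<^sup>2 - (real i)\<^sup>2)"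
    unfolding u(3) by (simp_all add: parabola_def algebra_simps)
  have "u * (real j - i) \<le> 1 * (real j - i)" using u ij by (intro mult_right_mono) auto
  moreover have "0 \<le> u * (real j - i)" using u ij by (intro mult_nonneg_nonneg) auto
  ultimately show "i \<le> Re z \<and> Re z \<le> j \<and> Im z = (Re z)\<^sup>2 + (Re z - i) * (j - Re z)"
    unfolding re im by (auto simp: power2_eq_square algebra_simps)
next
  assume h: "i \<le> Re z \<and> Re z \<le> j \<and> Im z = (Re z)\<^sup>2 + (Re z - i) * (j - Re z)"
  define u where "u = (Re z - i) / (real j - i)"
  have d: "u * (real j - i) = Re z - i" using ij by (simp add: u_def)
  have "0 \<le> u" "u \<le> 1" using h ij by (auto simp: u_def divide_le_eq)
  moreover have "z = (1 - u) *\<^sub>R parabola i + u *\<^sub>R parabola j"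
  proof (rule complex_eqI)
    show "Re z = Re ((1 - u) *\<^sub>R parabola i + u *\<^sub>R parabola j)"
      using d by (simp add: parabola_def algebra_simps)
    have "Im ((1 - u) *\<^sub>R parabola i + u *\<^sub>R parabola j) = (real i)\<^sup>2 + (u * (real j - i)) * (real j + i)"
      by (simp add: parabola_def power2_eq_square algebra_simps)
    also have "\<dots> = Im z" unfolding d using h by (simp add: power2_eq_square algebra_simps)
    finally show "Im z = Im ((1 - u) *\<^sub>R parabola i + u *\<^sub>R parabola j)" ..
  qed
  ultimately show "z \<in> closed_segment (parabola i) (parabola j)" unfolding closed_segment_def by blast
qed

text \<open>The index intervals of two noncrossing chords overlap in at most an end or are nested.
  In the nested case the inner chord is strictly lower over the interior of its interval.\<close>

lemma parabola_segment_inter: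
  assumes "i < j" "k < l" "{i, j} \<noteq> {k, l}" and nc: "\<not> (i < k \<and> k < j \<and> j < l)" "\<not> (k < i \<and> i < l \<and> l < j)"
    and z: "z \<in> closed_segment (parabola i) (parabola j)" "z \<in> closed_segment (parabola k) (parabola l)"
  shows "z \<in> parabola ` ({i, j} \<inter> {k, l})"
proof -
  define t where "t = Re z"
  have a: "i \<le> t" "t \<le> j" "Im z = t\<^sup>2 + (t - i) * (j - t)"
    using z(1) unfolding parabola_segment[OF assms(1)] t_def by auto
  have b: "k \<le> t" "t \<le> l" "Im z = t\<^sup>2 + (t - k) * (l - t)"
    using z(2) unfolding parabola_segment[OF assms(2)] t_def by auto
  have eq: "(t - i) * (j - t) = (t - k) * (l - t)" using a(3) b(3) by simp
  have pt: "z = parabola m" if "t = real m" "m \<in> {i, j} \<or> m \<in> {k, l}" for m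
    using that a(3) b(3) by (auto simp: parabola_def t_def complex_eq_iff)
  have nested: "z \<in> parabola ` ({p, q} \<inter> {r, s})"
    if "p \<le> r" "r < s" "s \<le> q" "p \<noteq> r \<or> q \<noteq> s" and t: "real r \<le> t" "t \<le> real s"
      and eq: "(t - p) * (q - t) = (t - r) * (s - t)"
      and pt: "\<And>m. t = real m \<Longrightarrow> m \<in> {p, q} \<or> m \<in> {r, s} \<Longrightarrow> z = parabola m" for p q r s
  proof -
    consider "t = real r" | "t = real s" | "real r < t" "t < real s" using t by linarith
    then show ?thesis
    proof cases
      case 1
      then have "(t - p) * (q - t) = 0" using eq by simp
      then have "real p = t \<or> real q = t" by auto
      then have "p = r \<or> q = r" using 1 by auto
      then show ?thesis using pt[OF 1] by auto
    next
      case 2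
      then have "(t - p) * (q - t) = 0" using eq by simp
      then have "real p = t \<or> real q = t" by auto
      then have "p = s \<or> q = s" using 2 by auto
      then show ?thesis using pt[OF 2] by auto
    next
      case 3
      have "(t - r) * (s - t) < (t - p) * (q - t)"
      proof (cases "p = r")
        case True
        then have "s < q" using that by auto
        then show ?thesis unfolding True using 3 by (intro mult_strict_left_mono) auto
      next
        case False
        then have "t - r < t - p" using that by auto
        then have "(t - r) * (s - t) < (t - p) * (s - t)" using 3 by (intro mult_strict_right_mono) auto
        also have "\<dots> \<le> (t - p) * (q - t)" using 3 that by (intro mult_left_mono) auto
        finally show ?thesis .
      qed
      then show ?thesis using eq by simp
    qed
  qed
  consider "j \<le> k" | "l \<le> i" | "i \<le> k" "l \<le> j" | "k \<le> i" "j \<le> l" using nc assms(1,2) by linarith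
  then show ?thesis
  proof cases
    case 1
    then have "t = real j" "j = k" using a b by auto
    then show ?thesis using pt[of j] by auto
  next
    case 2
    then have "t = real i" "i = l" using a b by auto
    then show ?thesis using pt[of i] by auto
  next
    case 3
    have "i \<noteq> k \<or> j \<noteq> l" using assms(3) by auto
    then show ?thesis using nested[of i k l j] 3 b eq pt assms(2) by auto
  next
    case 4
    have "i \<noteq> k \<or> j \<noteq> l" using assms(3) by auto
    then have "z \<in> parabola ` ({k, l} \<inter> {i, j})" using nested[of k i j l] 4 a eq pt assms(1) by auto
    then show ?thesis by (simp add: Int_commute)
  qed
qed

text \<open>The vertical ray downwards from \<open>z\<close> is connected and unbounded and avoids
  \<open>D\<close>.\<close>

lemma below_parabola_outside:
  assumes D: "\<And>z. z \<in> D \<Longrightarrow> (Re z)\<^sup>2 \<le> Im z" and z: "Im z < (Re z)\<^sup>2"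
  shows "z \<in> outside D"
proof -
  define L where "L = (\<lambda>s. z - complex_of_real s * \<i>) ` {0..}"
  have "topological_space_class.connected L"
    unfolding L_def by (intro connected_continuous_image continuous_intros) auto
  moreover have "L \<subseteq> - D"
  proof
    fix w assume "w \<in> L"
    then obtain s where "s \<ge> 0" "w = z - complex_of_real s * \<i>" by (auto simp: L_def)
    then have "Im w < (Re w)\<^sup>2" using z by simp
    then show "w \<in> - D" using D[of w] by auto
  qed
  moreover have "z \<in> L" unfolding L_def by (rule image_eqI[of _ _ 0]) auto
  ultimately have "L \<subseteq> connected_component_set (- D) z"
    by (intro connected_component_maximal)
  moreover have "\<not> bounded L"
  proof
    assume "bounded L"
    then obtain B where B: "\<And>w. w \<in> L \<Longrightarrow> norm w \<le> B" unfolding bounded_iff by blast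
    define s where "s = \<bar>B\<bar> + \<bar>Im z\<bar> + 1"
    have "z - complex_of_real s * \<i> \<in> L" unfolding L_def by (rule imageI) (simp add: s_def)
    then have "\<bar>Im (z - complex_of_real s * \<i>)\<bar> \<le> B" using B abs_Im_le_cmod order_trans by blast
    then show False by (simp add: s_def)
  qed
  ultimately have "\<not> bounded (connected_component_set (- D) z)" using bounded_subset by blast
  then show ?thesis by (simp add: outside)
qed

lemma parabola_frontier:
  assumes D: "\<And>z. z \<in> D \<Longrightarrow> (Re z)\<^sup>2 \<le> Im z" and i: "parabola i \<in> D"
  shows "parabola i \<in> frontier (outside D)"
proof -
  let ?s = "\<lambda>n. parabola i - complex_of_real (inverse (real (Suc n))) * \<i>"
  have "?s n \<in> outside D" for n
    by (rule below_parabola_outside[OF D]) (auto simp: parabola_def)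
  moreover have "?s \<longlonglongrightarrow> parabola i - complex_of_real 0 * \<i>"
    by (intro tendsto_intros LIMSEQ_inverse_real_of_nat)
  ultimately have "parabola i \<in> closure (outside D)"
    unfolding closure_sequential by (intro exI[of _ ?s]) auto
  moreover have "parabola i \<notin> interior (outside D)"
    using i interior_subset[of "outside D"] outside_no_overlap[of D] by blast
  ultimately show ?thesis by (simp add: frontier_def)
qed

theorem ncl_outerplanar:
  fixes G :: "'a pair_pre_digraph"
  assumes G: "pair_graph G" and xs: "set xs = pverts G" and nc: "ncl (parcs G) xs"
  shows "outerplanar G"
proof -
  interpret pair_graph G by fact
  have dist: "distinct xs" using nc by (simp add: ncl_def)
  define ix where "ix v = (THE i. i < length xs \<and> xs ! i = v)" for v
  have ix: "ix v < length xs" "xs ! ix v = v" if "v \<in> pverts G" for v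
  proof -
    obtain i where i: "i < length xs" "xs ! i = v" using \<open>v \<in> pverts G\<close> xs in_set_conv_nth[of v xs] by auto
    have "ix v = i" unfolding ix_def using i dist by (auto intro!: the_equality simp: nth_eq_iff_index_eq)
    then show "ix v < length xs" "xs ! ix v = v" using i by auto
  qed
  define p where "p v = parabola (ix v)" for v
  define \<gamma> where "\<gamma> e = linepath (p (fst e)) (p (snd e))" for e :: "'a \<times> 'a"
  have sym: "(v, u) \<in> parcs G" if "(u, v) \<in> parcs G" for u v using that arcs_symmetric by blast
  have inj: "ix u = ix v \<longleftrightarrow> u = v" if "u \<in> pverts G" "v \<in> pverts G" for u v using ix that by metis
  have arcV: "u \<in> pverts G" "v \<in> pverts G" "ix u \<noteq> ix v" if "(u, v) \<in> parcs G" for u v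
  proof -
    show 1: "u \<in> pverts G" "v \<in> pverts G" using that in_arcsD1 in_arcsD2 by auto
    have "u \<noteq> v" using pair_no_loops[OF that] by simp
    then show "ix u \<noteq> ix v" using inj 1 by blast
  qed
  have im: "path_image (\<gamma> (u, v)) = closed_segment (p u) (p v)" for u v by (simp add: \<gamma>_def)
  have above: "(Re z)\<^sup>2 \<le> Im z" if "z \<in> closed_segment (parabola i) (parabola j)" "i \<noteq> j" for z i j
  proof -
    have *: "(Re z)\<^sup>2 \<le> Im z" if "z \<in> closed_segment (parabola i) (parabola j)" "i < j" for i j
      using that parabola_segment[of i j z] by simp
    have "i < j \<or> j < i" using that(2) by linarith
    moreover have "z \<in> closed_segment (parabola j) (parabola i)"
      using that(1) by (subst closed_segment_commute)
    ultimately show ?thesis using *[OF that(1)] *[of j i] by blast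
  qed
  have meet: "closed_segment (p u) (p v) \<inter> closed_segment (p x) (p y) \<subseteq> p ` ({u, v} \<inter> {x, y})"
    if uv: "(u, v) \<in> parcs G" and xy: "(x, y) \<in> parcs G" and ne: "{u, v} \<noteq> {x, y}" for u v x y
  proof -
    have main: "closed_segment (p u) (p v) \<inter> closed_segment (p x) (p y) \<subseteq> p ` ({u, v} \<inter> {x, y})"
      if uv: "(u, v) \<in> parcs G" "ix u < ix v" and xy: "(x, y) \<in> parcs G" "ix x < ix y" and ne: "{u, v} \<noteq> {x, y}" for u v x y
    proof
      fix z assume z: "z \<in> closed_segment (p u) (p v) \<inter> closed_segment (p x) (p y)"
      note V = arcV(1,2)[OF uv(1)] arcV(1,2)[OF xy(1)]
      have nc': "\<not> (ix a < ix c \<and> ix c < ix b \<and> ix b < ix d)" if "(a, b) \<in> parcs G" "(c, d) \<in> parcs G" for a b c d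
        using nc ix(1)[OF arcV(2)[OF that(2)]] ix(2)[OF arcV(1)[OF that(1)]] ix(2)[OF arcV(2)[OF that(1)]]
          ix(2)[OF arcV(1)[OF that(2)]] ix(2)[OF arcV(2)[OF that(2)]] that unfolding ncl_def by metis
      have "{ix u, ix v} \<noteq> {ix x, ix y}" using ne V inj by (auto simp: doubleton_eq_iff)
      then have "z \<in> parabola ` ({ix u, ix v} \<inter> {ix x, ix y})"
        using parabola_segment_inter[OF uv(2) xy(2) _ nc'[OF uv(1) xy(1)] nc'[OF xy(1) uv(1)]] z by (simp add: p_def)
      moreover have "{ix u, ix v} \<inter> {ix x, ix y} = ix ` ({u, v} \<inter> {x, y})" using V inj by auto
      ultimately show "z \<in> p ` ({u, v} \<inter> {x, y})" by (auto simp: p_def)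
    qed
    have "ix u < ix v \<or> ix v < ix u" "ix x < ix y \<or> ix y < ix x"
      using arcV(3)[OF uv] arcV(3)[OF xy] by auto
    then show ?thesis
      using main[of u v x y] main[of v u x y] main[of u v y x] main[of v u y x] uv xy sym[OF uv] sym[OF xy] ne
      by (auto simp: closed_segment_commute insert_commute)
  qed
  have drawing: "plane_drawing G p \<gamma>" unfolding plane_drawing_def
  proof (intro conjI ballI)
    show "inj_on p (pverts G)" using inj by (auto simp: inj_on_def p_def inj_parabola)
  next
    fix e assume e: "e \<in> parcs G"
    obtain u v where uv: "e = (u, v)" by fastforce
    note a = arcV[OF e[unfolded uv]]
    have pne: "p u \<noteq> p v" using a by (simp add: p_def inj_parabola)
    have "closed_segment (p u) (p v) \<inter> p ` pverts G \<subseteq> {p u, p v}"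
    proof
      fix z assume z: "z \<in> closed_segment (p u) (p v) \<inter> p ` pverts G"
      then obtain w where w: "w \<in> pverts G" "z = parabola (ix w)" by (auto simp: p_def)
      have *: "ix w = i \<or> ix w = j" if "parabola (ix w) \<in> closed_segment (parabola i) (parabola j)" "i < j" for i j
        using that parabola_segment[of i j "parabola (ix w)"] by (auto simp: parabola_def)
      have "ix w = ix u \<or> ix w = ix v"
        using *[of "ix u" "ix v"] *[of "ix v" "ix u"] z w a(3)
        by (auto simp: p_def closed_segment_commute neq_iff)
      then show "z \<in> {p u, p v}" using w by (auto simp: p_def)
    qed
    then have "path_image (\<gamma> (u, v)) \<inter> p ` pverts G = {p u, p v}" using a by (auto simp: im)
    then show "case e of (u, v) \<Rightarrow> Path_Connected.arc (\<gamma> (u, v)) \<and> pathstart (\<gamma> (u, v)) = p u \<and> pathfinish (\<gamma> (u, v)) = p v \<and>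
        \<gamma> (v, u) = reversepath (\<gamma> (u, v)) \<and> path_image (\<gamma> (u, v)) \<inter> p ` pverts G = {p u, p v}"
      using pne by (simp add: uv \<gamma>_def arc_linepath)
  next
    fix e assume e: "e \<in> parcs G"
    obtain u v where uv: "e = (u, v)" by fastforce
    show "case e of (u, v) \<Rightarrow> \<forall>f\<in>parcs G. case f of (x, y) \<Rightarrow> {u, v} \<noteq> {x, y} \<longrightarrow>
        path_image (\<gamma> (u, v)) \<inter> path_image (\<gamma> (x, y)) \<subseteq> p ` ({u, v} \<inter> {x, y})"
      unfolding uv prod.case im
    proof (intro ballI)
      fix f assume f: "f \<in> parcs G"
      obtain x y where xy: "f = (x, y)" by fastforce
      show "case f of (x, y) \<Rightarrow> {u, v} \<noteq> {x, y} \<longrightarrow>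
        closed_segment (p u) (p v) \<inter> closed_segment (p x) (p y) \<subseteq> p ` ({u, v} \<inter> {x, y})"
        unfolding xy prod.case using e f uv xy by (intro impI meet) auto
    qed
  qed
  have "p v \<in> frontier (outside (drawing_points G p \<gamma>))" if v: "v \<in> pverts G" for v
  proof -
    have "parabola (ix v) \<in> frontier (outside (drawing_points G p \<gamma>))"
  proof (rule parabola_frontier)
    show "parabola (ix v) \<in> drawing_points G p \<gamma>" using v by (auto simp: drawing_points_def p_def)
    fix z assume "z \<in> drawing_points G p \<gamma>"
    then consider w where "z = parabola (ix w)" | u w where "(u, w) \<in> parcs G" "z \<in> closed_segment (p u) (p w)"
      unfolding drawing_points_def by (auto simp: im p_def)
    then show "(Re z)\<^sup>2 \<le> Im z"
    proof cases
      case 1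
      then show ?thesis by (simp add: parabola_def)
    next
      case 2
      then show ?thesis using above[of z "ix u" "ix w"] arcV(3)[OF 2(1)] by (simp add: p_def)
    qed
  qed
    then show ?thesis by (simp only: p_def)
  qed
  then show ?thesis using drawing unfolding outerplanar_def by blast
qed

section \<open>Adjacency eigenvalues\<close>

text \<open>Vectors of length \<open>n\<close> are represented by functions on \<open>nat\<close>,
  of which only the first \<open>n\<close> values count.\<close>

definition ip :: "nat \<Rightarrow> (nat \<Rightarrow> real) \<Rightarrow> (nat \<Rightarrow> real) \<Rightarrow> real" where
  "ip n x y = (\<Sum>i<n. x i * y i)"

definition ap :: "nat \<Rightarrow> (nat \<Rightarrow> nat \<Rightarrow> real) \<Rightarrow> (nat \<Rightarrow> real) \<Rightarrow> nat \<Rightarrow> real" where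
  "ap n A x i = (\<Sum>j<n. A i j * x j)"

lemma ip_commute: "ip n x y = ip n y x"
  by (simp add: ip_def mult.commute)

lemma ip_diff:
  "ip n (\<lambda>i. x i - c * y i) z = ip n x z - c * ip n y z"
  "ip n z (\<lambda>i. x i - c * y i) = ip n z x - c * ip n z y"
  by (simp_all add: ip_def sum_distrib_left sum_subtractf algebra_simps)

lemma ap_diff: "ap n A (\<lambda>i. x i - c * y i) = (\<lambda>i. ap n A x i - c * ap n A y i)"
  by (rule ext) (simp add: ap_def sum_distrib_left sum_subtractf algebra_simps)

lemma ip_self_nonneg: "0 \<le> ip n x x"
  by (simp add: ip_def sum_nonneg)

lemma ip_self_zero: "ip n x x = 0 \<Longrightarrow> i < n \<Longrightarrow> x i = 0"
  unfolding ip_def by (subst (asm) sum_nonneg_eq_0_iff) auto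

lemma ip_ap_sym:
  assumes "\<And>i j. i < n \<Longrightarrow> j < n \<Longrightarrow> A i j = A j i"
  shows "ip n (ap n A x) y = ip n x (ap n A y)"
proof -
  have "ip n (ap n A x) y = (\<Sum>i<n. \<Sum>j<n. A i j * x j * y i)"
    by (simp add: ip_def ap_def sum_distrib_right)
  also have "\<dots> = (\<Sum>j<n. \<Sum>i<n. A i j * x j * y i)" by (rule sum.swap)
  also have "\<dots> = (\<Sum>j<n. \<Sum>i<n. x j * (A j i * y i))"
    using assms by (intro sum.cong) (auto simp: mult_ac)
  also have "\<dots> = ip n x (ap n A y)" by (simp add: ip_def ap_def sum_distrib_left)
  finally show ?thesis .
qed

text \<open>The \<open>k\<close> conditions, padded with zero rows, form a singular square matrix;
  \<open>y\<close> comes from its kernel.\<close>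

lemma exists_orthogonal:
  fixes v :: "nat \<Rightarrow> nat \<Rightarrow> real"
  assumes k: "k < n"
  shows "\<exists>y. (\<exists>i<n. y i \<noteq> 0) \<and> (\<forall>j<k. ip n (v j) y = 0)"
proof -
  define M where "M = Matrix.mat n n (\<lambda>(r, c). if r < k then v r c else 0)"
  have M: "M \<in> carrier_mat n n" by (simp add: M_def)
  have "M $$ (k, c) = 0" if "c < n" for c using that k by (simp add: M_def)
  then have "M = mat_of_row_fun n n (\<lambda>i. if i = k then 0\<^sub>v n else Matrix.row M i)"
    using M k by (intro eq_matI) (auto simp: M_def)
  then have "Determinant.det M = 0" using det_row_0[OF k, of "\<lambda>i. Matrix.row M i"] M by auto
  then obtain w where w: "w \<in> carrier_vec n" "w \<noteq> 0\<^sub>v n" "M *\<^sub>v w = 0\<^sub>v n"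
    using det_0_iff_vec_prod_zero_field[OF M] by blast
  have "\<exists>i<n. vec_index w i \<noteq> 0" using w(1,2) by (metis eq_vecI carrier_vecD index_zero_vec)
  moreover have "ip n (v j) (\<lambda>i. vec_index w i) = 0" if j: "j < k" for j
  proof -
    have "vec_index (M *\<^sub>v w) j = ip n (v j) (\<lambda>i. vec_index w i)"
      using j k w(1) M by (auto simp: ip_def scalar_prod_def M_def lessThan_atLeast0 intro!: sum.cong)
    then show ?thesis using w(3) j k by simp
  qed
  ultimately show ?thesis by blast
qed

text \<open>The cube \<open>B\<close> of functions with values in \<open>{-1..1}\<close> is compact
  in the product topology by Tychonoff, and the unit vectors in it that satisfy the orthogonality
  conditions form a closed part \<open>K\<close>. The continuous form attains its maximum
  there.\<close>

lemma exists_rayleigh_max: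
  fixes v :: "nat \<Rightarrow> nat \<Rightarrow> real"
  assumes k: "k < n"
  obtains x where "ip n x x = 1" "\<And>j. j < k \<Longrightarrow> ip n (v j) x = 0"
    "\<And>y. (\<And>j. j < k \<Longrightarrow> ip n (v j) y = 0) \<Longrightarrow> ip n y (ap n A y) \<le> ip n x (ap n A x) * ip n y y"
proof -
  define B :: "(nat \<Rightarrow> real) set" where "B = (\<Pi>\<^sub>E i\<in>UNIV. {-1..1})"
  define K where "K = B \<inter> {x. ip n x x = 1} \<inter> (\<Inter>j<k. {x. ip n (v j) x = 0})"
  have cB: "compact B"
  proof -
    have "compactin (product_topology (\<lambda>i::nat. euclidean :: real topology) UNIV) B"
      unfolding B_def by (subst compactin_PiE) auto
    then show ?thesis by (simp add: euclidean_product_topology)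
  qed
  have ci: "continuous_on UNIV (\<lambda>x::nat \<Rightarrow> real. x i)" for i by simp
  have "closed {x. ip n x x = 1}"
    unfolding ip_def by (intro closed_Collect_eq continuous_intros ci)
  moreover have "closed {x. ip n (v j) x = 0}" for j
    unfolding ip_def by (intro closed_Collect_eq continuous_intros ci)
  ultimately have cK: "compact K" unfolding K_def using cB
    by (intro compact_Int_closed closed_INT) (auto simp: Int_assoc)
  \<comment> \<open>Every nonzero vector satisfying the conditions has a multiple in
    \<open>K\<close> once it is cut off at \<open>n\<close>, so a maximum over \<open>K\<close>
    bounds all Rayleigh quotients.\<close>
  have norm: "\<exists>c>0. (\<lambda>i. if i < n then c * y i else 0) \<in> K \<and> c * c * ip n y y = 1"
    if y: "ip n y y \<noteq> 0" "\<And>j. j < k \<Longrightarrow> ip n (v j) y = 0" for y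
  proof -
    define c where "c = 1 / sqrt (ip n y y)"
    have p: "0 < ip n y y" using y(1) ip_self_nonneg[of n y] by simp
    then have c: "c > 0" "c * c * ip n y y = 1" by (auto simp: c_def)
    let ?x = "\<lambda>i. if i < n then c * y i else 0"
    have xx: "ip n ?x ?x = 1" using c(2) by (simp add: ip_def sum_distrib_left mult_ac)
    have "\<bar>?x i\<bar> \<le> 1" for i
    proof (cases "i < n")
      case True
      have "(?x i)\<^sup>2 \<le> ip n ?x ?x" unfolding ip_def power2_eq_square
        using True by (intro member_le_sum[of i "{..<n}" "\<lambda>i. ?x i * ?x i"]) auto
      then show ?thesis using xx by (simp add: abs_square_le_1)
    qed simp
    then have "?x \<in> B" by (auto simp: B_def abs_le_iff minus_le_iff)
    moreover have "ip n (v j) ?x = 0" if "j < k" for j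
    proof -
      have "ip n (v j) ?x = c * ip n (v j) y" by (simp add: ip_def sum_distrib_left mult_ac)
      then show ?thesis using y(2)[OF that] by simp
    qed
    ultimately have "?x \<in> K" using xx by (simp add: K_def)
    then show ?thesis using c by blast
  qed
  obtain y0 where y0: "\<exists>i<n. y0 i \<noteq> 0" "\<And>j. j < k \<Longrightarrow> ip n (v j) y0 = 0"
    using exists_orthogonal[OF k, of v] by blast
  have "ip n y0 y0 \<noteq> 0" using y0(1) ip_self_zero by blast
  from norm[OF this y0(2)] have "K \<noteq> {}" by blast
  moreover have "continuous_on K (\<lambda>x. ip n x (ap n A x))"
  proof (rule continuous_on_subset[OF _ subset_UNIV])
    show "continuous_on UNIV (\<lambda>x. ip n x (ap n A x))"
      unfolding ip_def ap_def by (intro continuous_on_sum continuous_on_mult continuous_on_const ci)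
  qed
  ultimately obtain x where x: "x \<in> K" "\<And>y. y \<in> K \<Longrightarrow> ip n y (ap n A y) \<le> ip n x (ap n A x)"
    using continuous_attains_sup[OF cK] by blast
  show ?thesis
  proof (rule that[of x])
    show "ip n (v j) x = 0" if "j < k" for j using x(1) that by (auto simp: K_def)
    show "ip n x x = 1" using x(1) by (auto simp: K_def)
    fix y assume y: "\<And>j. j < k \<Longrightarrow> ip n (v j) y = 0"
    show "ip n y (ap n A y) \<le> ip n x (ap n A x) * ip n y y"
    proof (cases "ip n y y = 0")
      case True
      then have "\<And>i. i < n \<Longrightarrow> y i = 0" using ip_self_zero by blast
      then show ?thesis using True by (simp add: ip_def)
    next
      case False
      obtain c where c: "c > 0" "(\<lambda>i. if i < n then c * y i else 0) \<in> K" "c * c * ip n y y = 1"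
        using norm[OF False y] by blast
      let ?x = "\<lambda>i. if i < n then c * y i else 0"
      have "ip n ?x (ap n A ?x) = c * c * ip n y (ap n A y)"
        by (simp add: ip_def ap_def sum_distrib_left mult_ac)
      then have "c * c * ip n y (ap n A y) \<le> ip n x (ap n A x) * (c * c * ip n y y)"
        using x(2)[OF c(2)] c(3) by simp
      then have "(c * c) * ip n y (ap n A y) \<le> (c * c) * (ip n x (ap n A x) * ip n y y)"
        by (simp add: mult_ac)
      then show ?thesis using c(1) by (simp add: mult_le_cancel_left)
    qed
  qed
qed

text \<open>First-order condition at a minimum: for nonzero \<open>b\<close> the value at
  \<open>t = - b / (1 + \<bar>a\<bar>)\<close> would be negative.\<close>

lemma nonneg_quadratic_linear_zero:
  fixes a b :: real
  assumes "\<And>t. 0 \<le> a * t * t + b * t"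
  shows "b = 0"
proof (rule ccontr)
  assume b: "b \<noteq> 0"
  define s where "s = - b / (1 + \<bar>a\<bar>)"
  have s: "s * (1 + \<bar>a\<bar>) = - b" by (simp add: s_def add_nonneg_eq_0_iff)
  have "a * s * s + b * s = s * (a * s - s * (1 + \<bar>a\<bar>))" using s by (simp add: algebra_simps)
  also have "\<dots> = s * s * (a - 1 - \<bar>a\<bar>)" by (simp add: algebra_simps)
  also have "\<dots> < 0"
  proof -
    have "s \<noteq> 0" using s b by auto
    then have "0 < s * s" by (cases "s < 0") (auto simp: zero_less_mult_iff)
    then show ?thesis by (intro mult_pos_neg) auto
  qed
  finally show False using assms[of s] by simp
qed

text \<open>A maximiser of the Rayleigh quotient on the orthogonal complement of eigenvectors is again an
  eigenvector.\<close>

lemma spectral_step: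
  assumes sym: "\<And>i j. i < n \<Longrightarrow> j < n \<Longrightarrow> A i j = A j i" and k: "k < n"
    and eig: "\<And>j i. j < k \<Longrightarrow> i < n \<Longrightarrow> ap n A (v j) i = e j * v j i"
    and ortho: "\<And>i j. i < k \<Longrightarrow> j < k \<Longrightarrow> ip n (v i) (v j) = (if i = j then 1 else 0)"
  obtains x \<mu> where "ip n x x = 1" "\<forall>j<k. ip n (v j) x = 0" "\<forall>i<n. ap n A x i = \<mu> * x i"
    "\<forall>y. (\<forall>j<k. ip n (v j) y = 0) \<longrightarrow> ip n y (ap n A y) \<le> \<mu> * ip n y y"
proof -
  obtain x where x: "ip n x x = 1" "\<And>j. j < k \<Longrightarrow> ip n (v j) x = 0"
    and max: "\<And>y. (\<And>j. j < k \<Longrightarrow> ip n (v j) y = 0) \<Longrightarrow> ip n y (ap n A y) \<le> ip n x (ap n A x) * ip n y y"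
    using exists_rayleigh_max[OF k, of v A] by metis
  define \<mu> where "\<mu> = ip n x (ap n A x)"
  define w where "w = (\<lambda>i. ap n A x i - \<mu> * x i)"
  have vA: "ip n (v j) (ap n A y) = e j * ip n (v j) y" if "j < k" for j y
  proof -
    have "ip n (v j) (ap n A y) = ip n (ap n A (v j)) y" using ip_ap_sym[OF sym] by simp
    also have "\<dots> = e j * ip n (v j) y" using eig[OF that] by (simp add: ip_def sum_distrib_left mult_ac)
    finally show ?thesis .
  qed
  have w0: "ip n (v j) w = 0" if "j < k" for j
    using vA[OF that, of x] x(2)[OF that] by (simp add: w_def ip_diff)
  have ww: "ip n w w = ip n w (ap n A x) - \<mu> * ip n w x"
    by (subst (2) w_def) (rule ip_diff)
  \<comment> \<open>The residual \<open>w\<close> is itself orthogonal to the earlier eigenvectors,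
    so moving from \<open>x\<close> in the direction of \<open>w\<close> is permitted; at a maximum
    the derivative, up to sign \<open>2 * ip n w w\<close>, must vanish.\<close>
  have "2 * ip n w w = 0"
  proof (rule nonneg_quadratic_linear_zero)
    fix t :: real
    define y where "y = (\<lambda>i. x i - t * w i)"
    have yo: "ip n (v j) y = 0" if "j < k" for j
      using x(2)[OF that] w0[OF that] by (simp add: y_def ip_diff)
    have "ip n y (ap n A y) \<le> \<mu> * ip n y y" unfolding \<mu>_def by (rule max[OF yo])
    moreover have "ip n y y = ip n x x - 2 * t * ip n w x + t * t * ip n w w"
      unfolding y_def ip_diff ip_commute[of n x w] by (simp add: algebra_simps)
    moreover have "ip n y (ap n A y) = ip n x (ap n A x) - 2 * t * ip n w (ap n A x) + t * t * ip n w (ap n A w)"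
    proof -
      have sw: "ip n x (ap n A w) = ip n w (ap n A x)"
        using ip_ap_sym[where x = x and y = w, OF sym] ip_commute[of n "ap n A x" w] by simp
      show ?thesis unfolding y_def ap_diff ip_diff sw by (simp add: algebra_simps)
    qed
    moreover have "ip n w (ap n A x) = ip n w w + \<mu> * ip n w x" using ww by simp
    ultimately have "\<mu> - 2 * t * (ip n w w + \<mu> * ip n w x) + t * t * ip n w (ap n A w)
        \<le> \<mu> * (1 - 2 * t * ip n w x + t * t * ip n w w)"
      using x(1) by (simp only: \<mu>_def[symmetric])
    then show "0 \<le> (\<mu> * ip n w w - ip n w (ap n A w)) * t * t + (2 * ip n w w) * t"
      by (simp add: algebra_simps)
  qed
  then have "w i = 0" if "i < n" for i using ip_self_zero[of n w i] that by simp
  then have ev: "ap n A x i = \<mu> * x i" if "i < n" for i using that by (simp add: w_def)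
  show ?thesis
  proof (rule that[of x \<mu>])
    show "\<forall>y. (\<forall>j<k. ip n (v j) y = 0) \<longrightarrow> ip n y (ap n A y) \<le> \<mu> * ip n y y"
      unfolding \<mu>_def using max by simp
  qed (use x ev in simp_all)
qed

text \<open>The maximality clause is carried through the induction because it yields both the
  decreasing order of the eigenvalues and the variational bounds for \<open>rho\<close> and
  \<open>lambda2\<close>.\<close>

lemma spectral_decomposition:
  assumes sym: "\<And>i j. i < n \<Longrightarrow> j < n \<Longrightarrow> A i j = A j i"
  shows "k \<le> n \<Longrightarrow> \<exists>e v. (\<forall>i<k. \<forall>j<k. ip n (v i) (v j) = (if i = j then 1 else (0::real))) \<and>
    (\<forall>j<k. \<forall>i<n. ap n A (v j) i = e j * v j i) \<and>
    (\<forall>j<k. \<forall>y. (\<forall>l<j. ip n (v l) y = 0) \<longrightarrow> ip n y (ap n A y) \<le> e j * ip n y y)"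
proof (induction k)
  case (Suc k)
  obtain e v where h: "(\<forall>i<k. \<forall>j<k. ip n (v i) (v j) = (if i = j then 1 else (0::real))) \<and>
    (\<forall>j<k. \<forall>i<n. ap n A (v j) i = e j * v j i) \<and>
    (\<forall>j<k. \<forall>y. (\<forall>l<j. ip n (v l) y = 0) \<longrightarrow> ip n y (ap n A y) \<le> e j * ip n y y)"
    using Suc.IH[OF Suc_leD[OF Suc.prems]] by (elim exE)
  have ev: "\<And>i j. i < k \<Longrightarrow> j < k \<Longrightarrow> ip n (v i) (v j) = (if i = j then 1 else (0::real))"
    "\<And>j i. j < k \<Longrightarrow> i < n \<Longrightarrow> ap n A (v j) i = e j * v j i"
    "\<And>j y. j < k \<Longrightarrow> (\<forall>l<j. ip n (v l) y = 0) \<Longrightarrow> ip n y (ap n A y) \<le> e j * ip n y y" using h by simp_all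
  have k: "k < n" using Suc.prems by simp
  obtain x \<mu> where x: "ip n x x = 1" "\<forall>j<k. ip n (v j) x = 0" "\<forall>i<n. ap n A x i = \<mu> * x i"
    "\<forall>y. (\<forall>j<k. ip n (v j) y = 0) \<longrightarrow> ip n y (ap n A y) \<le> \<mu> * ip n y y"
    by (rule spectral_step[OF sym k ev(2,1)])
  let ?v = "v(k := x)" let ?e = "e(k := \<mu>)"
  have "ip n (?v i) (?v j) = (if i = j then 1 else 0)" if "i < Suc k" "j < Suc k" for i j
    using that ev(1)[of i j] x(1,2) ip_commute[of n x "v j"] by (auto simp: less_Suc_eq)
  moreover have "ap n A (?v j) i = ?e j * ?v j i" if "j < Suc k" "i < n" for i j
    using that ev(2) x(3) by (auto simp: less_Suc_eq)
  moreover have "ip n y (ap n A y) \<le> ?e j * ip n y y" if "j < Suc k" "\<forall>l<j. ip n (?v l) y = 0" for j y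
    using that ev(3)[of j y] x(4) by (auto simp: less_Suc_eq)
  ultimately show ?case by (intro exI[of _ ?e] exI[of _ ?v]) blast
qed simp

text \<open>The matrix with the eigenvectors as columns has its transpose as inverse, so the given
  matrix is similar to the diagonal matrix of the \<open>e j\<close>.\<close>

lemma char_poly_spectral:
  assumes ortho: "\<And>i j. i < n \<Longrightarrow> j < n \<Longrightarrow> ip n (v i) (v j) = (if i = j then 1 else (0::real))"
    and eig: "\<And>j i. j < n \<Longrightarrow> i < n \<Longrightarrow> ap n A (v j) i = e j * v j i"
  shows "char_poly (Matrix.mat n n (\<lambda>(i, j). A i j)) = (\<Prod>j\<leftarrow>[0..<n]. [:- e j, 1:])"
proof -
  define M where "M = Matrix.mat n n (\<lambda>(i, j). A i j)"
  define P where "P = Matrix.mat n n (\<lambda>(i, j). v j i)"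
  define Q where "Q = Matrix.mat n n (\<lambda>(i, j). v i j)"
  define D where "D = Matrix.mat n n (\<lambda>(i, j). if i = j then e j else 0)"
  have car: "M \<in> carrier_mat n n" "P \<in> carrier_mat n n" "Q \<in> carrier_mat n n" "D \<in> carrier_mat n n"
    by (auto simp: M_def P_def Q_def D_def)
  have QP: "Q * P = 1\<^sub>m n"
    using ortho by (intro eq_matI) (auto simp: P_def Q_def scalar_prod_def ip_def lessThan_atLeast0)
  then have PQ: "P * Q = 1\<^sub>m n" using mat_mult_left_right_inverse[OF car(3,2)] by simp
  have MP: "M * P = P * D"
  proof (rule eq_matI)
    fix i j assume ij: "i < dim_row (P * D)" "j < dim_col (P * D)"
    then have "i < n" "j < n" using car by auto
    have "(M * P) $$ (i, j) = ap n A (v j) i"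
      using \<open>i < n\<close> \<open>j < n\<close> by (auto simp: M_def P_def scalar_prod_def ap_def lessThan_atLeast0)
    also have "\<dots> = e j * v j i" using eig \<open>i < n\<close> \<open>j < n\<close> by simp
    also have "\<dots> = (\<Sum>k<n. if k = j then e j * v j i else 0)" using \<open>j < n\<close> by simp
    also have "\<dots> = (\<Sum>k<n. v k i * (if k = j then e j else 0))" by (intro sum.cong) auto
    also have "\<dots> = (P * D) $$ (i, j)"
      using \<open>i < n\<close> \<open>j < n\<close> by (auto simp: P_def D_def scalar_prod_def lessThan_atLeast0)
    finally show "(M * P) $$ (i, j) = (P * D) $$ (i, j)" .
  qed (use car in auto)
  have "M = M * (P * Q)" using PQ car by simp
  also have "\<dots> = P * D * Q" using MP car by (simp add: assoc_mult_mat[OF car(1,2,3), symmetric])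
  finally have "similar_mat M D" using car PQ QP by (intro similar_matI[of _ _ P Q n]) auto
  then have "char_poly M = char_poly D" by (rule char_poly_similar)
  also have "\<dots> = (\<Prod>a\<leftarrow>diag_mat D. [:- a, 1:])"
    by (rule char_poly_upper_triangular[OF car(4)]) (auto simp: D_def upper_triangular_def)
  also have "diag_mat D = map e [0..<n]" by (auto simp: diag_mat_def D_def)
  finally show ?thesis by (simp add: M_def comp_def)
qed

lemma sorted_desc_unique:
  fixes es :: "real list"
  assumes "sorted_wrt (\<ge>) es"
  shows "rev (sorted_list_of_multiset (mset es)) = es"
proof -
  have "sorted (rev es)" using assms by (simp add: sorted_wrt_rev)
  then have "sorted_list_of_multiset (mset (rev es)) = rev es" by (simp add: sorted_list_of_multiset_mset sorted_sort_id del: mset_rev)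
  then show ?thesis by simp
qed

section \<open>Rayleigh quotients on graphs\<close>

definition nrm :: "'a set \<Rightarrow> ('a \<Rightarrow> real) \<Rightarrow> real" where
  "nrm V x = (\<Sum>v\<in>V. (x v)\<^sup>2)"

lemma nrm_nonneg: "0 \<le> nrm V x"
  by (simp add: nrm_def sum_nonneg)

lemma nrm_pos: "finite V \<Longrightarrow> v \<in> V \<Longrightarrow> x v \<noteq> 0 \<Longrightarrow> 0 < nrm V x"
  unfolding nrm_def by (rule sum_pos2) auto

lemma nrm_nonzeroD: "nrm V x \<noteq> 0 \<Longrightarrow> \<exists>u\<in>V. x u \<noteq> 0"
  unfolding nrm_def by (rule ccontr) simp

lemma pair_graph_arcs:
  assumes "pair_graph G"
  shows "finite (pverts G)" "parcs G \<subseteq> pverts G \<times> pverts G" "sym (parcs G)" "irrefl (parcs G)"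
proof -
  interpret pair_graph G by fact
  show "finite (pverts G)" by simp
  show "parcs G \<subseteq> pverts G \<times> pverts G" using in_arcsD1 in_arcsD2 by auto
  show "sym (parcs G)" by (rule symI) (rule arcs_symmetric)
  show "irrefl (parcs G)" unfolding irrefl_def using pair_no_loops by fastforce
qed

lemma pair_graphI:
  assumes "finite V" "R \<subseteq> V \<times> V" "sym R" "irrefl R"
  shows "pair_graph \<lparr> pverts = V, parcs = R \<rparr>"
proof
  show "finite (parcs \<lparr>pverts = V, parcs = R\<rparr>)" using assms(1,2) by (auto intro: finite_subset)
  show "symmetric (with_proj \<lparr>pverts = V, parcs = R\<rparr>)" using assms(3) by (simp add: symmetric_def)
  show "fst e \<noteq> snd e" if "e \<in> parcs \<lparr>pverts = V, parcs = R\<rparr>" for e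
    using assms(4) that by (cases e) (auto simp: irrefl_def)
qed (use assms in auto)

definition spectral_basis :: "'a pair_pre_digraph \<Rightarrow> (nat \<Rightarrow> real) \<Rightarrow> (nat \<Rightarrow> 'a \<Rightarrow> real) \<Rightarrow> bool" where
  "spectral_basis G e v \<longleftrightarrow> (let n = card (pverts G) in
    (\<forall>i<n. \<forall>j<n. (\<Sum>u\<in>pverts G. v i u * v j u) = (if i = j then 1 else 0)) \<and>
    (\<forall>j<n. \<forall>u\<in>pverts G. sum (v j) (parcs G `` {u}) = e j * v j u) \<and>
    (\<forall>j<n. \<forall>y. (\<forall>l<j. (\<Sum>u\<in>pverts G. v l u * y u) = 0) \<longrightarrow> qf (parcs G) y \<le> e j * nrm (pverts G) y) \<and>
    (\<forall>i j. i \<le> j \<longrightarrow> j < n \<longrightarrow> e j \<le> e i) \<and>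
    eigenvalues_desc G = map e [0..<n])"

lemma spectral_basisD:
  assumes "spectral_basis G e v"
  shows "i < card (pverts G) \<Longrightarrow> j < card (pverts G) \<Longrightarrow>
      (\<Sum>u\<in>pverts G. v i u * v j u) = (if i = j then 1 else 0)"
    and "j < card (pverts G) \<Longrightarrow> u \<in> pverts G \<Longrightarrow> sum (v j) (parcs G `` {u}) = e j * v j u"
    and "j < card (pverts G) \<Longrightarrow> \<forall>l<j. (\<Sum>u\<in>pverts G. v l u * y u) = 0 \<Longrightarrow>
      qf (parcs G) y \<le> e j * nrm (pverts G) y"
    and "i \<le> j \<Longrightarrow> j < card (pverts G) \<Longrightarrow> e j \<le> e i"
    and "eigenvalues_desc G = map e [0..<card (pverts G)]"
  using assms unfolding spectral_basis_def Let_def by simp_all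

theorem graph_spectrum:
  fixes G :: "'a pair_pre_digraph"
  assumes G: "pair_graph G"
  shows "\<exists>e v. spectral_basis G e v"
proof -
  define n where "n = card (pverts G)"
  note arcs = pair_graph_arcs[OF G]
  define xs where "xs = (SOME xs. distinct xs \<and> set xs = pverts G)"
  have "\<exists>xs. distinct xs \<and> set xs = pverts G" using finite_distinct_list[OF arcs(1)] by blast
  then have "distinct xs \<and> set xs = pverts G" unfolding xs_def by (rule someI_ex)
  then have xs: "distinct xs" "set xs = pverts G" by auto
  have len: "length xs = n" using xs distinct_card unfolding n_def by metis
  have bij: "bij_betw ((!) xs) {..<n} (pverts G)" using bij_betw_nth[OF xs(1)] len xs(2) by simp
  define A where "A i j = (if (xs ! i, xs ! j) \<in> parcs G then 1 else 0 :: real)" for i j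
  have sym: "A i j = A j i" for i j using arcs(3) by (auto simp: A_def sym_def)
  obtain e w where ew: "(\<forall>i<n. \<forall>j<n. ip n (w i) (w j) = (if i = j then 1 else (0::real))) \<and>
    (\<forall>j<n. \<forall>i<n. ap n A (w j) i = e j * w j i) \<and>
    (\<forall>j<n. \<forall>y. (\<forall>l<j. ip n (w l) y = 0) \<longrightarrow> ip n y (ap n A y) \<le> e j * ip n y y)"
    using spectral_decomposition[of n A n, OF sym] by blast
  define ix where "ix = the_inv_into {..<n} ((!) xs)"
  have ix: "ix (xs ! i) = i" if "i < n" for i
    unfolding ix_def using bij that by (simp add: the_inv_into_f_f bij_betw_def)
  define v where "v j u = w j (ix u)" for j u
  have tr: "(\<Sum>u\<in>pverts G. f u) = (\<Sum>i<n. f (xs ! i))" for f :: "'a \<Rightarrow> real"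
    using sum.reindex_bij_betw[OF bij, of f] by simp
  have vi: "v j (xs ! i) = w j i" if "i < n" for i j using ix[OF that] by (simp add: v_def)
  have ip_tr: "(\<Sum>u\<in>pverts G. v j u * y u) = ip n (w j) (\<lambda>i. y (xs ! i))" for j y
    unfolding tr ip_def using vi by (intro sum.cong) auto
  have ap_tr: "sum y (parcs G `` {xs ! i}) = ap n A (\<lambda>i. y (xs ! i)) i" if "i < n" for y i
  proof -
    have "parcs G `` {xs ! i} = {u \<in> pverts G. (xs ! i, u) \<in> parcs G}" using arcs(2) by auto
    then have "sum y (parcs G `` {xs ! i}) = (\<Sum>u\<in>pverts G. if (xs ! i, u) \<in> parcs G then y u else 0)"
      using sum.inter_filter[OF arcs(1), of y "\<lambda>u. (xs ! i, u) \<in> parcs G"] by simp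
    also have "\<dots> = ap n A (\<lambda>i. y (xs ! i)) i" unfolding tr ap_def A_def by (intro sum.cong) auto
    finally show ?thesis .
  qed
  have qf_tr: "qf (parcs G) y = ip n (\<lambda>i. y (xs ! i)) (ap n A (\<lambda>i. y (xs ! i)))" for y
    unfolding qf_eq[OF arcs(1,2)] tr ip_def using ap_tr by (intro sum.cong) auto
  have nrm_tr: "nrm (pverts G) y = ip n (\<lambda>i. y (xs ! i)) (\<lambda>i. y (xs ! i))" for y
    unfolding nrm_def tr ip_def by (simp add: power2_eq_square)
  have ortho: "\<forall>i<n. \<forall>j<n. (\<Sum>u\<in>pverts G. v i u * v j u) = (if i = j then 1 else 0)"
  proof (intro allI impI)
    fix i j assume "i < n" "j < n"
    have "(\<Sum>u\<in>pverts G. v i u * v j u) = ip n (w i) (w j)"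
      unfolding tr ip_def using vi by (intro sum.cong) auto
    then show "(\<Sum>u\<in>pverts G. v i u * v j u) = (if i = j then 1 else 0)" using ew \<open>i < n\<close> \<open>j < n\<close> by simp
  qed
  moreover have "\<forall>j<n. \<forall>u\<in>pverts G. sum (v j) (parcs G `` {u}) = e j * v j u"
  proof (intro allI impI ballI)
    fix j u assume j: "j < n" and "u \<in> pverts G"
    then obtain i where i: "i < n" "u = xs ! i" using bij by (auto simp: bij_betw_def)
    have "ap n A (\<lambda>i. v j (xs ! i)) i = ap n A (w j) i" unfolding ap_def using vi by (intro sum.cong) auto
    then show "sum (v j) (parcs G `` {u}) = e j * v j u" using ap_tr[OF i(1)] ew i j vi by simp
  qed
  moreover have max: "\<forall>j<n. \<forall>y. (\<forall>l<j. (\<Sum>u\<in>pverts G. v l u * y u) = 0) \<longrightarrow> qf (parcs G) y \<le> e j * nrm (pverts G) y"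
    unfolding ip_tr qf_tr nrm_tr using ew by blast
  moreover have dec: "\<forall>i j. i \<le> j \<longrightarrow> j < n \<longrightarrow> e j \<le> e i"
  proof (intro allI impI)
    fix i j assume ij: "i \<le> j" "j < n"
    have "ip n (w j) (ap n A (w j)) = e j * ip n (w j) (w j)"
      unfolding ip_def sum_distrib_left using ew ij(2) by (intro sum.cong) (auto simp: mult_ac)
    moreover have "\<forall>l<i. ip n (w l) (w j) = 0" using ew ij by simp
    then have "ip n (w j) (ap n A (w j)) \<le> e i * ip n (w j) (w j)"
      using conjunct2[OF conjunct2[OF ew]] ij by (meson le_less_trans)
    ultimately show "e j \<le> e i" using ew ij(2) by simp
  qed
  moreover have "eigenvalues_desc G = map e [0..<n]"
  proof -
    have "adj_matrix G xs = Matrix.mat n n (\<lambda>(i, j). A i j)" by (simp add: adj_matrix_def A_def len)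
    then have cp: "char_poly (adj_matrix G xs) = (\<Prod>j\<leftarrow>[0..<n]. [:- e j, 1:])"
      using char_poly_spectral[of n w A e] ew by simp
    have "proots (\<Prod>j\<leftarrow>is. [:- e j, 1:]) = mset (map e is)" for "is"
    proof (induction "is")
      case (Cons i "is")
      have "(\<Prod>j\<leftarrow>is. [:- e j, 1:]) \<noteq> 0" by (auto simp: prod_list_zero_iff simp del: mult_pCons_left)
      then show ?case using Cons by (simp add: proots_mult del: mult_pCons_left)
    qed simp
    then have "adj_spectrum G = mset (map e [0..<n])" unfolding adj_spectrum_def xs_def[symmetric] cp .
    moreover have "sorted_wrt (\<ge>) (map e [0..<n])"
      using dec by (auto simp: sorted_wrt_iff_nth_less)
    ultimately show ?thesis unfolding eigenvalues_desc_def using sorted_desc_unique by metis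
  qed
  ultimately have "spectral_basis G e v" unfolding spectral_basis_def Let_def n_def[symmetric] by blast
  then show ?thesis by blast
qed

lemma rho_bound:
  assumes G: "pair_graph G" and ne: "pverts G \<noteq> {}"
  shows "qf (parcs G) y \<le> rho G * nrm (pverts G) y"
proof -
  obtain e v where sp: "spectral_basis G e v" using graph_spectrum[OF G] by blast
  have n: "0 < card (pverts G)" using pair_graph_arcs(1)[OF G] ne by (simp add: card_gt_0_iff)
  then have "rho G = e 0" by (simp add: rho_def spectral_basisD(5)[OF sp])
  then show ?thesis using spectral_basisD(3)[OF sp n] by simp
qed

lemma rho_attained:
  assumes G: "pair_graph G" and ne: "pverts G \<noteq> {}"
  obtains x where "nrm (pverts G) x = 1" "\<forall>u\<in>pverts G. sum x (parcs G `` {u}) = rho G * x u"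
proof -
  obtain e v where sp: "spectral_basis G e v" using graph_spectrum[OF G] by blast
  have n: "0 < card (pverts G)" using pair_graph_arcs(1)[OF G] ne by (simp add: card_gt_0_iff)
  then have "rho G = e 0" by (simp add: rho_def spectral_basisD(5)[OF sp])
  moreover have "nrm (pverts G) (v 0) = 1"
    using spectral_basisD(1)[OF sp n n] by (simp add: nrm_def power2_eq_square)
  ultimately show ?thesis using spectral_basisD(2)[OF sp n] by (intro that[of "v 0"]) auto
qed

lemma lambda2_eigenvectors:
  assumes G: "pair_graph G" and n: "2 \<le> card (pverts G)"
  obtains x1 x2 where "nrm (pverts G) x1 = 1" "nrm (pverts G) x2 = 1" "(\<Sum>u\<in>pverts G. x1 u * x2 u) = 0"
    "\<forall>u\<in>pverts G. sum x1 (parcs G `` {u}) = rho G * x1 u"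
    "\<forall>u\<in>pverts G. sum x2 (parcs G `` {u}) = lambda2 G * x2 u"
proof -
  obtain e v where sp: "spectral_basis G e v" using graph_spectrum[OF G] by blast
  have n: "0 < card (pverts G)" "1 < card (pverts G)" using assms(2) by auto
  then have "rho G = e 0" "lambda2 G = e 1" by (simp_all add: rho_def lambda2_def spectral_basisD(5)[OF sp])
  moreover have "nrm (pverts G) (v 0) = 1" "nrm (pverts G) (v 1) = 1" "(\<Sum>u\<in>pverts G. v 0 u * v 1 u) = 0"
    using spectral_basisD(1)[OF sp n(1,1)] spectral_basisD(1)[OF sp n(2,2)] spectral_basisD(1)[OF sp n]
    by (auto simp: nrm_def power2_eq_square)
  ultimately show ?thesis using spectral_basisD(2)[OF sp n(1)] spectral_basisD(2)[OF sp n(2)]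
    by (intro that[of "v 0" "v 1"]) auto
qed

text \<open>Courant--Fischer: some nonzero vector of a plane is orthogonal to the top eigenvector.\<close>

lemma lambda2_plane:
  assumes G: "pair_graph G" and n: "2 \<le> card (pverts G)"
  obtains a b where "a \<noteq> 0 \<or> b \<noteq> 0"
    "qf (parcs G) (\<lambda>u. a * y u + b * z u) \<le> lambda2 G * nrm (pverts G) (\<lambda>u. a * y u + b * z u)"
proof -
  obtain e v where sp: "spectral_basis G e v" using graph_spectrum[OF G] by blast
  have n: "1 < card (pverts G)" using assms(2) by simp
  then have l2: "lambda2 G = e 1" by (simp add: lambda2_def spectral_basisD(5)[OF sp])
  define s t where "s = (\<Sum>u\<in>pverts G. v 0 u * y u)" and "t = (\<Sum>u\<in>pverts G. v 0 u * z u)"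
  have "\<exists>a b. (a \<noteq> 0 \<or> b \<noteq> 0) \<and> a * s + b * t = 0"
  proof (cases "s = 0 \<and> t = 0")
    case False
    then show ?thesis by (intro exI[of _ t] exI[of _ "- s"]) auto
  qed (intro exI[of _ 1], auto)
  then obtain a b where ab: "a \<noteq> 0 \<or> b \<noteq> 0" "a * s + b * t = 0" by blast
  have "(\<Sum>u\<in>pverts G. v 0 u * (a * y u + b * z u)) = a * s + b * t"
    by (simp add: s_def t_def sum_distrib_left sum.distrib algebra_simps)
  then have "qf (parcs G) (\<lambda>u. a * y u + b * z u) \<le> e 1 * nrm (pverts G) (\<lambda>u. a * y u + b * z u)"
    using spectral_basisD(3)[OF sp n] ab(2) by simp
  then show ?thesis using that[OF ab(1)] unfolding l2 by blast
qed

text \<open>Change the single entry at \<open>u\<close> by \<open>t\<close>: the form minus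
  \<open>c\<close> times the norm must not rise, and its linear term in \<open>t\<close> is twice
  the defect of the eigenvalue equation at \<open>u\<close>.\<close>

lemma rayleigh_attained_eigen:
  assumes fin: "finite V" and R: "R \<subseteq> V \<times> V" "sym R"
    and bound: "\<And>y. qf R y \<le> c * nrm V y" and x: "c * nrm V x \<le> qf R x" and u: "u \<in> V"
  shows "sum x (R `` {u}) = c * x u"
proof -
  define b where "b = sum x (R `` {u}) - c * x u"
  have finR: "finite R" using fin R(1) by (auto intro: finite_subset)
  have "-2 * b = 0"
  proof (rule nonneg_quadratic_linear_zero)
    fix t :: real
    define y where "y w = x w + t * (if w = u then 1 else 0)" for w
    define d where "d = (if (u, u) \<in> R then 1 else 0 :: real)"
    have n: "nrm V y = nrm V x + 2 * t * x u + t * t"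
    proof -
      have "nrm V y = (\<Sum>w\<in>V. (x w)\<^sup>2 + (if w = u then 2 * t * x u + t * t else 0))"
        unfolding nrm_def y_def by (intro sum.cong) (auto simp: power2_eq_square algebra_simps)
      then show ?thesis using fin u by (simp add: nrm_def sum.distrib)
    qed
    have S1: "(\<Sum>(v, w)\<in>R. if v = u then x w else 0) = sum x (R `` {u})"
    proof -
      have "(\<Sum>(v, w)\<in>R. if v = u then x w else 0) = (\<Sum>(v, w)\<in>{e\<in>R. fst e = u}. x w)"
        using finR by (subst sum.inter_filter) (auto intro!: sum.cong)
      also have "\<dots> = sum x (R `` {u})"
        by (rule sum.reindex_bij_witness[of _ "Pair u" snd]) auto
      finally show ?thesis .
    qed
    have S2: "(\<Sum>(v, w)\<in>R. if w = u then x v else 0) = sum x (R `` {u})"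
    proof -
      have "(\<Sum>(v, w)\<in>R. if w = u then x v else 0) = (\<Sum>(v, w)\<in>R. if v = u then x w else 0)"
        using R(2) by (intro sum.reindex_bij_witness[of _ prod.swap prod.swap]) (auto dest: symD)
      then show ?thesis using S1 by simp
    qed
    have S3: "(\<Sum>(v, w)\<in>R. if v = u \<and> w = u then 1 else 0 :: real) = d"
    proof -
      have "(\<Sum>(v, w)\<in>R. if v = u \<and> w = u then 1 else 0 :: real) = (\<Sum>e\<in>R. if e = (u, u) then 1 else 0)"
        by (intro sum.cong refl) (simp add: split_beta prod_eq_iff)
      then show ?thesis using finR by (simp add: d_def)
    qed
    have "qf R y = (\<Sum>e\<in>R. (case e of (v, w) \<Rightarrow> x v * x w) + t * (case e of (v, w) \<Rightarrow> if v = u then x w else 0)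
        + t * (case e of (v, w) \<Rightarrow> if w = u then x v else 0) + t * t * (case e of (v, w) \<Rightarrow> if v = u \<and> w = u then 1 else 0))"
      unfolding qf_def y_def by (intro sum.cong) (auto simp: algebra_simps)
    also have "\<dots> = qf R x + t * sum x (R `` {u}) + t * sum x (R `` {u}) + t * t * d"
      unfolding sum.distrib sum_distrib_left[symmetric] S1 S2 S3 by (simp add: qf_def)
    finally have q: "qf R y = qf R x + 2 * t * sum x (R `` {u}) + t * t * d" by simp
    have "qf R y \<le> c * nrm V y" by (rule bound)
    then show "0 \<le> (c - d) * t * t + (-2 * b) * t" using x unfolding n q b_def by (simp add: algebra_simps)
  qed
  then show ?thesis by (simp add: b_def)
qed

lemma eigen_qf:
  assumes "finite V" "R \<subseteq> V \<times> V" "\<forall>u\<in>V. sum x (R `` {u}) = c * x u"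
  shows "qf R x = c * nrm V x"
proof -
  have "(\<Sum>v\<in>V. x v * sum x (R `` {v})) = (\<Sum>v\<in>V. c * (x v)\<^sup>2)"
    using assms(3) by (intro sum.cong refl) (simp add: power2_eq_square)
  then show ?thesis unfolding qf_eq[OF assms(1,2)] nrm_def by (simp add: sum_distrib_left)
qed

lemma qf_abs: "finite R \<Longrightarrow> qf R x \<le> qf R (\<lambda>u. \<bar>x u\<bar>)"
  unfolding qf_def by (intro sum_mono) (auto simp flip: abs_mult)

lemma nrm_abs: "nrm V (\<lambda>u. \<bar>x u\<bar>) = nrm V x"
  by (simp add: nrm_def)

lemma rho_eqI:
  assumes G: "pair_graph G" and b: "\<And>y. qf (parcs G) y \<le> c * nrm (pverts G) y"
    and x: "x \<in> pverts G \<rightarrow> UNIV" "0 < nrm (pverts G) x" "c * nrm (pverts G) x \<le> qf (parcs G) x"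
  shows "rho G = c"
proof (rule antisym)
  have ne: "pverts G \<noteq> {}" using x(2) by (auto simp: nrm_def)
  show "rho G \<le> c"
    using rho_attained[OF G ne] eigen_qf[OF pair_graph_arcs(1,2)[OF G]] b by (metis mult.right_neutral)
  have "c * nrm (pverts G) x \<le> rho G * nrm (pverts G) x" using rho_bound[OF G ne, of x] x(3) by linarith
  then show "c \<le> rho G" using x(2) by simp
qed

section \<open>Connectivity and Perron vectors\<close>

text \<open>Connectivity stated by cuts: the arguments below spread a property of vertices along
  edges or glue connected parts.\<close>

definition cut_connected :: "'a set \<Rightarrow> ('a \<times> 'a) set \<Rightarrow> bool" where
  "cut_connected V R \<longleftrightarrow> (\<forall>X. X \<subseteq> V \<longrightarrow> X \<noteq> {} \<longrightarrow> X \<noteq> V \<longrightarrow> (\<exists>u\<in>X. \<exists>v\<in>V - X. (u, v) \<in> R))"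

lemma connected_iff_cut_connected:
  assumes G: "pair_graph G" and ne: "pverts G \<noteq> {}"
  shows "Digraph_Component.connected (with_proj G) \<longleftrightarrow> cut_connected (pverts G) (parcs G)"
proof -
  note arcs = pair_graph_arcs[OF G]
  have sc: "(parcs G)\<^sup>s = parcs G" using arcs(3) by (auto simp: symcl_def dest: symD)
  have conv: "Digraph_Component.connected (with_proj G) \<longleftrightarrow>
      (\<forall>u\<in>pverts G. \<forall>v\<in>pverts G. (u, v) \<in> rtrancl_on (pverts G) (parcs G))"
    using ne by (simp add: connected_conv sc)
  show ?thesis
  proof
    assume c: "Digraph_Component.connected (with_proj G)"
    show "cut_connected (pverts G) (parcs G)" unfolding cut_connected_def
    proof (intro allI impI, rule ccontr)
      fix X assume X: "X \<subseteq> pverts G" "X \<noteq> {}" "X \<noteq> pverts G" and no: "\<not> (\<exists>u\<in>X. \<exists>v\<in>pverts G - X. (u, v) \<in> parcs G)"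
      obtain u v where uv: "u \<in> X" "v \<in> pverts G - X" using X by blast
      have "(u, v) \<in> rtrancl_on (pverts G) (parcs G)" using c uv X conv by blast
      then have "v \<in> X"
        by (induction rule: rtrancl_on_induct) (use uv no arcs(2) in blast)+
      then show False using uv by simp
    qed
  next
    assume c: "cut_connected (pverts G) (parcs G)"
    show "Digraph_Component.connected (with_proj G)" unfolding conv
    proof (intro ballI)
      fix u v assume uv: "u \<in> pverts G" "v \<in> pverts G"
      define X where "X = {w \<in> pverts G. (u, w) \<in> rtrancl_on (pverts G) (parcs G)}"
      have "X = pverts G"
      proof (rule ccontr)
        assume "X \<noteq> pverts G"
        moreover have "u \<in> X" using uv by (auto simp: X_def intro: rtrancl_on_refl)
        ultimately obtain a b where "a \<in> X" "b \<in> pverts G - X" "(a, b) \<in> parcs G"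
          using c unfolding cut_connected_def X_def by (metis (no_types, lifting) empty_iff mem_Collect_eq subsetI)
        then show False unfolding X_def by (auto dest: rtrancl_on_into_rtrancl_on)
      qed
      then show "(u, v) \<in> rtrancl_on (pverts G) (parcs G)" using uv by (auto simp: X_def)
    qed
  qed
qed

text \<open>At a zero entry the eigenvalue equation makes a sum of nonnegative entries vanish, so
  the zero set has no edge to its complement.\<close>

lemma perron_positive:
  assumes fin: "finite V" and R: "R \<subseteq> V \<times> V" and con: "cut_connected V R"
    and x: "\<And>u. u \<in> V \<Longrightarrow> 0 \<le> x u" "\<exists>u\<in>V. x u \<noteq> 0" and eig: "\<forall>u\<in>V. sum x (R `` {u}) = c * x u" and sym: "sym R"
    and u: "u \<in> V"
  shows "0 < (x u :: real)"
proof (rule ccontr)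
  assume nu: "\<not> 0 < x u"
  define Z where "Z = {u \<in> V. x u = 0}"
  have "x u = 0" using nu x(1)[OF u] by simp
  then have "Z \<subseteq> V" "Z \<noteq> {}" "Z \<noteq> V" using u x(2) by (auto simp: Z_def)
  then obtain a b where ab: "a \<in> Z" "b \<in> V - Z" "(a, b) \<in> R" using con unfolding cut_connected_def by blast
  have f: "finite (R `` {a})" using R fin by (auto intro: finite_subset)
  have "sum x (R `` {a}) = 0" using eig ab(1) by (auto simp: Z_def)
  moreover have "\<And>w. w \<in> R `` {a} \<Longrightarrow> 0 \<le> x w" using x(1) R by auto
  ultimately have "x b = 0" using sum_nonneg_eq_0_iff[OF f, of x] ab(3) by auto
  then show False using ab(2) by (simp add: Z_def)
qed

text \<open>The second eigenvector is orthogonal to the positive Perron vector.\<close>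

lemma lambda2_signed_eigenvector:
  assumes G: "pair_graph G" and n: "2 \<le> card (pverts G)" and con: "cut_connected (pverts G) (parcs G)"
  obtains x where "\<forall>u\<in>pverts G. sum x (parcs G `` {u}) = lambda2 G * x u"
    "\<exists>u\<in>pverts G. 0 < x u" "\<exists>u\<in>pverts G. x u < 0"
proof -
  let ?V = "pverts G" and ?R = "parcs G"
  note arcs = pair_graph_arcs[OF G]
  have ne: "?V \<noteq> {}" using n by auto
  have finR: "finite ?R" using arcs(1,2) by (auto intro: finite_subset)
  obtain x1 x2 where x: "nrm ?V x1 = 1" "nrm ?V x2 = 1" "(\<Sum>u\<in>?V. x1 u * x2 u) = 0"
    "\<forall>u\<in>?V. sum x1 (?R `` {u}) = rho G * x1 u" "\<forall>u\<in>?V. sum x2 (?R `` {u}) = lambda2 G * x2 u"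
    using lambda2_eigenvectors[OF G n] by blast
  define y where "y = (\<lambda>u. \<bar>x1 u\<bar>)"
  have q1: "qf ?R x1 = rho G * nrm ?V x1" by (rule eigen_qf[OF arcs(1,2) x(4)])
  have yn: "nrm ?V y = 1" using nrm_abs[of ?V x1] x(1) by (simp add: y_def)
  have yq: "rho G * nrm ?V y \<le> qf ?R y"
    using qf_abs[OF finR, of x1] q1 yn x(1) unfolding y_def by simp
  have yeig: "\<forall>u\<in>?V. sum y (?R `` {u}) = rho G * y u"
    using rayleigh_attained_eigen[OF arcs(1,2,3) rho_bound[OF G ne] yq] by blast
  have "\<exists>u\<in>?V. y u \<noteq> 0" using yn by (intro nrm_nonzeroD) simp
  then have ypos: "0 < y u" if "u \<in> ?V" for u
    using perron_positive[OF arcs(1,2) con _ _ yeig arcs(3) that] by (auto simp: y_def)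
  \<comment> \<open>\<open>x1\<close> and its absolute value attain the same maximum, so no edge
    joins entries of opposite sign; by connectivity \<open>x1\<close> has constant sign.\<close>
  have same: "x1 u * x1 v = y u * y v" if "(u, v) \<in> ?R" for u v
  proof (rule ccontr)
    assume "\<not> ?thesis"
    moreover have le: "x1 a * x1 b \<le> y a * y b" for a b unfolding y_def by (metis abs_ge_self abs_mult)
    ultimately have "x1 u * x1 v < y u * y v" using less_le by blast
    then have "(\<Sum>(a, b)\<in>?R. x1 a * x1 b) < (\<Sum>(a, b)\<in>?R. y a * y b)"
      using that le by (intro sum_strict_mono_ex1[OF finR]) (auto intro!: bexI[of _ "(u, v)"])
    then have "qf ?R x1 < qf ?R y" by (simp add: qf_def)
    then show False using rho_bound[OF G ne, of y] q1 x(1) yn by simp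
  qed
  obtain u0 where u0: "u0 \<in> ?V" using ne by blast
  define S where "S = {u \<in> ?V. 0 < x1 u * x1 u0}"
  have x1nz: "x1 u \<noteq> 0" if "u \<in> ?V" for u using ypos[OF that] by (simp add: y_def)
  have "S = ?V"
  proof (rule ccontr)
    assume "S \<noteq> ?V"
    moreover have "u0 \<in> S" using u0 x1nz[OF u0] by (auto simp: S_def zero_less_mult_iff linorder_neq_iff)
    ultimately obtain a b where ab: "a \<in> S" "b \<in> ?V - S" "(a, b) \<in> ?R"
      using con unfolding cut_connected_def S_def by (metis (no_types, lifting) empty_iff mem_Collect_eq subsetI)
    have "0 < x1 a * x1 b" using same[OF ab(3)] ypos[of a] ypos[of b] ab by (auto simp: S_def)
    moreover have "0 < x1 a * x1 u0" using ab(1) by (simp add: S_def)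
    ultimately have "0 < x1 b * x1 u0" by (auto simp: zero_less_mult_iff)
    then show False using ab(2) by (simp add: S_def)
  qed
  then have pos: "0 < x1 u * x1 u0" if "u \<in> ?V" for u using that by (auto simp: S_def)
  \<comment> \<open>Multiplication by \<open>x1 u0\<close> turns the Perron vector into a positive
    one, whatever its sign is.\<close>
  have orth: "(\<Sum>u\<in>?V. (x1 u * x1 u0) * x2 u) = 0"
  proof -
    have "(\<Sum>u\<in>?V. (x1 u * x1 u0) * x2 u) = (\<Sum>u\<in>?V. x1 u * x2 u) * x1 u0"
      unfolding sum_distrib_right by (intro sum.cong) (simp_all add: mult_ac)
    then show ?thesis using x(3) by simp
  qed
  have nz: "\<exists>u\<in>?V. x2 u \<noteq> 0" using x(2) by (intro nrm_nonzeroD) simp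
  have "\<exists>u\<in>?V. 0 < x2 u"
  proof (rule ccontr)
    assume "\<not> ?thesis"
    then have le: "0 \<le> - ((x1 u * x1 u0) * x2 u)" if "u \<in> ?V" for u
      using pos[OF that] that by (simp add: mult_le_0_iff not_less)
    have "(\<Sum>u\<in>?V. - ((x1 u * x1 u0) * x2 u)) = 0" using orth by (simp add: sum_negf)
    then have "\<forall>u\<in>?V. - ((x1 u * x1 u0) * x2 u) = 0" using sum_nonneg_eq_0_iff[OF arcs(1) le] by auto
    then show False using nz pos by fastforce
  qed
  moreover have "\<exists>u\<in>?V. x2 u < 0"
  proof (rule ccontr)
    assume "\<not> ?thesis"
    then have le: "0 \<le> (x1 u * x1 u0) * x2 u" if "u \<in> ?V" for u
      using pos[OF that] that by (simp add: not_less)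
    then have "\<forall>u\<in>?V. (x1 u * x1 u0) * x2 u = 0" using sum_nonneg_eq_0_iff[OF arcs(1) le] orth by auto
    then show False using nz pos by fastforce
  qed
  ultimately show ?thesis using x(5) that by blast
qed

section \<open>The largest spectral radius\<close>

lemma qf_cong: "(\<And>u v. (u, v) \<in> R \<Longrightarrow> x u * x v = y u * y v) \<Longrightarrow> qf R x = qf R y"
  unfolding qf_def by (rule sum.cong) auto

lemma qf_map:
  assumes "inj_on h V" "R \<subseteq> V \<times> V"
  shows "qf (map_prod h h ` R) x = qf R (x \<circ> h)"
proof -
  have "inj_on (map_prod h h) R" by (rule inj_on_subset[OF map_prod_inj_on[OF assms(1,1)] assms(2)])
  then show ?thesis unfolding qf_def by (subst sum.reindex) (auto intro!: sum.cong)
qed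

lemma nrm_map: "inj_on h V \<Longrightarrow> nrm (h ` V) x = nrm V (x \<circ> h)"
  unfolding nrm_def by (subst sum.reindex) auto

lemma nrm_cong: "(\<And>u. u \<in> V \<Longrightarrow> x u = y u) \<Longrightarrow> nrm V x = nrm V y"
  unfolding nrm_def by (rule sum.cong) auto

lemma qf_sy:
  assumes "finite E" "\<And>a b. (a, b) \<in> E \<Longrightarrow> a < (b :: nat)"
  shows "qf (sy E) x = 2 * (\<Sum>(a, b)\<in>E. x a * x b)"
proof -
  have dis: "E \<inter> E\<inverse> = {}"
  proof (rule equals0I)
    fix e assume "e \<in> E \<inter> E\<inverse>"
    then obtain a b where "(a, b) \<in> E" "(b, a) \<in> E" by (cases e) auto
    then show False using assms(2)[of a b] assms(2)[of b a] by simp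
  qed
  have "(\<Sum>(u, v)\<in>E\<inverse>. x u * x v) = (\<Sum>(u, v)\<in>E. x u * x v)"
    by (rule sum.reindex_bij_witness[of _ prod.swap prod.swap]) (auto simp: mult.commute)
  then show ?thesis unfolding qf_def sy_def using assms(1) dis by (simp add: sum.union_disjoint)
qed

definition nat_graph :: "nat \<Rightarrow> (nat \<times> nat) set \<Rightarrow> nat pair_pre_digraph" where
  "nat_graph k E = \<lparr> pverts = {..<k}, parcs = sy E \<rparr>"

text \<open>Outerplanar graphs on \<open>k\<close> vertices, numbered along a noncrossing circular
  order. There are finitely many, so a largest spectral radius exists.\<close>

definition admissible :: "nat \<Rightarrow> (nat \<times> nat) set \<Rightarrow> bool" where
  "admissible k E \<longleftrightarrow> E \<subseteq> {(a, b). a < b \<and> b < k} \<and> noncross E"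

text \<open>The largest spectral radius of an outerplanar graph on \<open>k\<close> vertices.\<close>

definition rmax :: "nat \<Rightarrow> real" where
  "rmax k = Max ((\<lambda>E. rho (nat_graph k E)) ` {E. admissible k E})"

definition path_edge_set :: "nat \<Rightarrow> (nat \<times> nat) set" where
  "path_edge_set k = {(a, b). b = Suc a \<and> b < k}"

lemma nat_graph_simps [simp]: "pverts (nat_graph k E) = {..<k}" "parcs (nat_graph k E) = sy E"
  by (simp_all add: nat_graph_def)

lemma admissibleD: "admissible k E \<Longrightarrow> (a, b) \<in> E \<Longrightarrow> a < b \<and> b < k"
  unfolding admissible_def by auto

lemma admissible_finite: "admissible k E \<Longrightarrow> finite E"
proof -
  assume "admissible k E"
  then have "E \<subseteq> {..<k} \<times> {..<k}" by (auto simp: admissible_def)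
  then show ?thesis by (rule finite_subset) simp
qed

lemma sy_props:
  assumes "admissible k E"
  shows "sy E \<subseteq> {..<k} \<times> {..<k}" "sym (sy E)" "irrefl (sy E)" "finite (sy E)"
proof -
  show 1: "sy E \<subseteq> {..<k} \<times> {..<k}" using assms by (auto simp: admissible_def sy_def)
  show "sym (sy E)" by (auto simp: sym_def sy_def)
  show "irrefl (sy E)" using assms by (auto simp: admissible_def sy_def irrefl_def)
  show "finite (sy E)" using 1 by (rule finite_subset) simp
qed

lemma nat_graph_pair_graph: "admissible k E \<Longrightarrow> pair_graph (nat_graph k E)"
  unfolding nat_graph_def using sy_props by (intro pair_graphI) auto

lemma finite_admissible: "finite {E. admissible k E}"
proof -
  have "{E. admissible k E} \<subseteq> Pow ({..<k} \<times> {..<k})" by (auto simp: admissible_def)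
  then show ?thesis by (rule finite_subset) simp
qed

lemma rmax_bound:
  assumes E: "admissible k E" and k: "1 \<le> k"
  shows "qf (sy E) y \<le> rmax k * nrm {..<k} y"
proof -
  have ne: "pverts (nat_graph k E) \<noteq> {}" using k by (auto simp: lessThan_empty_iff)
  have "qf (sy E) y \<le> rho (nat_graph k E) * nrm {..<k} y"
    using rho_bound[OF nat_graph_pair_graph[OF E] ne, of y] by simp
  also have "rho (nat_graph k E) \<le> rmax k"
    unfolding rmax_def using E finite_admissible by (intro Max_ge) auto
  then have "rho (nat_graph k E) * nrm {..<k} y \<le> rmax k * nrm {..<k} y"
    by (rule mult_right_mono) (rule nrm_nonneg)
  finally show ?thesis .
qed

lemma noncross_path: "noncross E \<Longrightarrow> noncross (E \<union> path_edge_set k)"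
  unfolding noncross_def path_edge_set_def by auto

lemma admissible_path: "admissible k E \<Longrightarrow> admissible k (E \<union> path_edge_set k)"
  using noncross_path unfolding admissible_def by (auto simp: path_edge_set_def)

lemma path_cut_connected:
  assumes "path_edge_set k \<subseteq> E"
  shows "cut_connected {..<k} (sy E)"
  unfolding cut_connected_def
proof (intro allI impI)
  fix X assume X: "X \<subseteq> {..<k}" "X \<noteq> {}" "X \<noteq> {..<k}"
  have e: "(i, Suc i) \<in> sy E \<and> (Suc i, i) \<in> sy E" if "Suc i < k" for i
    using assms that by (auto simp: sy_def path_edge_set_def)
  show "\<exists>u\<in>X. \<exists>v\<in>{..<k} - X. (u, v) \<in> sy E"
  proof (rule ccontr)
    assume no: "\<not> ?thesis"
    have step: "i \<in> X \<longleftrightarrow> Suc i \<in> X" if "Suc i < k" for i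
      using no e[OF that] that X(1) by (meson DiffI Suc_lessD lessThan_iff)
    have all: "i \<in> X \<longleftrightarrow> 0 \<in> X" if "i < k" for i using that by (induction i) (use step in auto)
    then show False using X by blast
  qed
qed

text \<open>Taking absolute values and adding the edges between consecutive vertices does not lower
  the form and creates no crossing. So some maximiser contains the path, and the resulting
  connectivity makes its vector positive.\<close>

lemma rmax_eigenvector:
  assumes k: "1 \<le> k"
  obtains E y where "admissible k E" "path_edge_set k \<subseteq> E" "nrm {..<k} y = 1" "\<forall>v<k. 0 < y v"
    "qf (sy E) y = rmax k"
proof -
  have ne: "{..<k} \<noteq> {}" using k by (auto simp: lessThan_empty_iff)
  have "admissible k {}" by (simp add: admissible_def noncross_def)
  then have "rmax k \<in> (\<lambda>E. rho (nat_graph k E)) ` {E. admissible k E}"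
    unfolding rmax_def using finite_admissible by (intro Max_in) auto
  then obtain E0 where E0: "admissible k E0" "rho (nat_graph k E0) = rmax k" by auto
  obtain x where x: "nrm {..<k} x = 1" "\<forall>u\<in>{..<k}. sum x (sy E0 `` {u}) = rmax k * x u"
    using rho_attained[OF nat_graph_pair_graph[OF E0(1)]] ne E0(2) by auto
  define E where "E = E0 \<union> path_edge_set k"
  have E: "admissible k E" unfolding E_def by (rule admissible_path[OF E0(1)])
  define y where "y = (\<lambda>u. \<bar>x u\<bar>)"
  have yn: "nrm {..<k} y = 1" using nrm_abs[of "{..<k}" x] x(1) by (simp add: y_def)
  have "rmax k * nrm {..<k} y = qf (sy E0) x"
    using eigen_qf[OF _ sy_props(1)[OF E0(1)] x(2)] x(1) yn by simp
  also have "\<dots> \<le> qf (sy E0) y" unfolding y_def by (rule qf_abs[OF sy_props(4)[OF E0(1)]])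
  also have "\<dots> \<le> qf (sy E) y" unfolding qf_def
    using sy_props(4)[OF E] by (intro sum_mono2) (auto simp: E_def sy_def y_def)
  finally have q: "rmax k * nrm {..<k} y \<le> qf (sy E) y" .
  have eig: "\<forall>u\<in>{..<k}. sum y (sy E `` {u}) = rmax k * y u"
    using rayleigh_attained_eigen[OF _ sy_props(1,2)[OF E] rmax_bound[OF E k] q] by simp
  have con: "cut_connected {..<k} (sy E)" by (rule path_cut_connected) (simp add: E_def)
  have "\<exists>u\<in>{..<k}. y u \<noteq> 0"
    using yn by (intro nrm_nonzeroD) simp
  then have "0 < y v" if "v < k" for v
    using perron_positive[OF _ sy_props(1)[OF E] con _ _ eig sy_props(2)[OF E]] that by (simp add: y_def)
  moreover have "qf (sy E) y = rmax k" using q rmax_bound[OF E k, of y] yn by simp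
  ultimately show ?thesis using that[OF E _ yn] by (simp add: E_def)
qed

lemma rmax_nonneg: "1 \<le> k \<Longrightarrow> 0 \<le> rmax k"
proof -
  assume k: "1 \<le> k"
  obtain E y where E: "admissible k E" "path_edge_set k \<subseteq> E" "nrm {..<k} y = 1" "\<forall>v<k. 0 < y v"
    "qf (sy E) y = rmax k" using rmax_eigenvector[OF k] by blast
  have "0 \<le> qf (sy E) y" unfolding qf_def
    using E(4) sy_props(1)[OF E(1)] by (intro sum_nonneg) (auto intro!: mult_nonneg_nonneg less_imp_le)
  then show ?thesis using E(5) by simp
qed

text \<open>A pendant vertex with entry \<open>\<epsilon>\<close> attached at \<open>k - 1\<close>
  gains \<open>2 * c * \<epsilon>\<close> in the form and costs
  \<open>r * \<epsilon>\<^sup>2\<close> through the norm; with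
  \<open>(r + 1) * \<epsilon> = c\<close> the gain prevails.\<close>

lemma rmax_strict:
  assumes k: "1 \<le> k"
  shows "rmax k < rmax (Suc k)"
proof -
  obtain E y where E: "admissible k E" "path_edge_set k \<subseteq> E" "nrm {..<k} y = 1" "\<forall>v<k. 0 < y v"
    "qf (sy E) y = rmax k" using rmax_eigenvector[OF k] by blast
  define r where "r = rmax k"
  have r0: "0 \<le> r" unfolding r_def by (rule rmax_nonneg[OF k])
  define c where "c = y (k - 1)"
  have c: "0 < c" using E(4) k by (simp add: c_def)
  define \<epsilon> where "\<epsilon> = c / (r + 1)"
  have \<epsilon>: "0 < \<epsilon>" "(r + 1) * \<epsilon> = c" using c r0 by (auto simp: \<epsilon>_def)
  define z where "z v = (if v < k then y v else \<epsilon>)" for v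
  let ?E = "insert (k - 1, k) E"
  have adm: "admissible (Suc k) ?E"
    unfolding admissible_def noncross_def
  proof (intro conjI allI impI notI)
    show "?E \<subseteq> {(a, b). a < b \<and> b < Suc k}" using admissibleD[OF E(1)] k by fastforce
    fix a b c d assume h: "(a, c) \<in> ?E" "(b, d) \<in> ?E" "a < b" "b < c" "c < d"
    have "(a, c) \<noteq> (k - 1, k)" "(b, d) \<noteq> (k - 1, k)" using h(3-5) k by auto
    then have "(a, c) \<in> E" "(b, d) \<in> E" using h(1,2) by auto
    then show False using E(1) h(3-5) unfolding admissible_def noncross_def by blast
  qed
  have fin: "finite E" by (rule admissible_finite[OF E(1)])
  have nin: "(k - 1, k) \<notin> E" using admissibleD[OF E(1)] by blast
  have "qf (sy ?E) z = 2 * (\<Sum>(a, b)\<in>?E. z a * z b)"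
    using admissibleD[OF adm] fin by (intro qf_sy) auto
  also have "(\<Sum>(a, b)\<in>?E. z a * z b) = z (k - 1) * z k + (\<Sum>(a, b)\<in>E. z a * z b)"
    using fin nin by simp
  also have "(\<Sum>(a, b)\<in>E. z a * z b) = (\<Sum>(a, b)\<in>E. y a * y b)"
    using admissibleD[OF E(1)] by (intro sum.cong) (fastforce simp: z_def)+
  also have "2 * (z (k - 1) * z k + (\<Sum>(a, b)\<in>E. y a * y b)) = 2 * c * \<epsilon> + qf (sy E) y"
    using qf_sy[OF fin, of y] admissibleD[OF E(1)] k by (simp add: z_def c_def)
  also have "\<dots> = 2 * c * \<epsilon> + r" using E(5) by (simp add: r_def)
  finally have q: "qf (sy ?E) z = 2 * c * \<epsilon> + r" .
  have "{..<Suc k} = insert k {..<k}" by auto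
  then have n: "nrm {..<Suc k} z = \<epsilon>\<^sup>2 + 1"
    using E(3) nrm_cong[of "{..<k}" z y] by (simp add: nrm_def z_def)
  have "r * (\<epsilon>\<^sup>2 + 1) < 2 * c * \<epsilon> + r"
    using \<epsilon> r0 by (simp add: \<epsilon>(2)[symmetric] power2_eq_square algebra_simps add_strict_increasing)
  also have "\<dots> \<le> rmax (Suc k) * (\<epsilon>\<^sup>2 + 1)" using rmax_bound[OF adm, of z] q n by simp
  finally have "r * (\<epsilon>\<^sup>2 + 1) < rmax (Suc k) * (\<epsilon>\<^sup>2 + 1)" .
  moreover have "0 < \<epsilon>\<^sup>2 + 1" by (simp add: add_nonneg_pos)
  ultimately show ?thesis unfolding r_def by (simp add: mult_less_cancel_right)
qed

lemma rmax_mono: "1 \<le> j \<Longrightarrow> j \<le> k \<Longrightarrow> rmax j \<le> rmax k"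
proof (induction k)
  case (Suc k)
  then show ?case using rmax_strict[of k] by (cases "j = Suc k") auto
qed simp

lemma rmax_less: "1 \<le> j \<Longrightarrow> j < k \<Longrightarrow> rmax j < rmax k"
  using rmax_strict[of j] rmax_mono[of "Suc j" k] by simp

lemma tri_admissible: "tri 0 q T \<Longrightarrow> admissible (Suc q) T"
  using tri_bounds(2) tri_noncross unfolding admissible_def by fastforce

lemma tri_path_edges: "tri 0 q T \<Longrightarrow> path_edge_set (Suc q) \<subseteq> T"
  using tri_path[of 0 q T] by (auto simp: path_edge_set_def)

text \<open>Extend \<open>E\<close> to a triangulation \<open>T\<close>. The absolute value of
  \<open>y\<close> is then a maximiser on \<open>T\<close> as well, hence positive by Perron, and
  any edge of \<open>T\<close> missing from \<open>E\<close> would give \<open>T\<close> a strictly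
  larger value.\<close>

lemma maximiser_tri:
  assumes q: "1 \<le> q" and E: "admissible (Suc q) E" and y: "0 < nrm {..<Suc q} y"
    and max: "rmax (Suc q) * nrm {..<Suc q} y \<le> qf (sy E) y"
  obtains x where "tri 0 q E" "eigt q E (rmax (Suc q)) x"
proof -
  let ?k = "Suc q"
  have bd: "0 \<le> a \<and> a < b \<and> b \<le> q" if "(a, b) \<in> E" for a b using admissibleD[OF E that] by simp
  have nc: "noncross E" using E by (simp add: admissible_def)
  have q0: "0 < q" using q by simp
  obtain T where T: "E \<subseteq> T" "tri 0 q T" using tri_extend[OF q0 bd nc] by blast
  have aT: "admissible ?k T" by (rule tri_admissible[OF T(2)])
  define x where "x = (\<lambda>u. \<bar>y u\<bar>)"
  have xn: "nrm {..<?k} x = nrm {..<?k} y" using nrm_abs[of _ y] by (simp add: x_def)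
  have "qf (sy E) y \<le> qf (sy E) x" unfolding x_def by (rule qf_abs[OF sy_props(4)[OF E]])
  then have qE: "rmax ?k * nrm {..<?k} x \<le> qf (sy E) x" using max xn by simp
  have mono: "qf (sy E) x \<le> qf (sy T) x" unfolding qf_def
    using sy_props(4)[OF aT] T(1) by (intro sum_mono2) (auto simp: sy_def x_def)
  then have qT: "rmax ?k * nrm {..<?k} x \<le> qf (sy T) x" using qE by simp
  have eig: "\<forall>u\<in>{..<?k}. sum x (sy T `` {u}) = rmax ?k * x u"
    using rayleigh_attained_eigen[OF _ sy_props(1,2)[OF aT] rmax_bound[OF aT] qT] by simp
  have nz: "\<exists>u\<in>{..<?k}. x u \<noteq> 0"
    using y xn by (intro nrm_nonzeroD) simp
  have con: "cut_connected {..<?k} (sy T)" by (rule path_cut_connected[OF tri_path_edges[OF T(2)]])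
  have pos: "0 < x v" if "v < ?k" for v
    using perron_positive[OF _ sy_props(1)[OF aT] con _ nz eig sy_props(2)[OF aT]] that by (simp add: x_def)
  have "E = T"
  proof (rule ccontr)
    assume "E \<noteq> T"
    then obtain a b where ab: "(a, b) \<in> T" "(a, b) \<notin> E" using T(1) by auto
    have "(a, b) \<in> sy T - sy E" using ab admissibleD[OF aT ab(1)] admissibleD[OF E, of b a] by (auto simp: sy_def)
    then have "qf (sy E) x < qf (sy T) x" unfolding qf_def
      using sy_props(4)[OF aT] T(1) pos admissibleD[OF aT ab(1)]
      by (intro sum_strict_mono2[of _ _ "(a, b)"]) (auto simp: sy_def x_def)
    then show False using qE rmax_bound[OF aT, of x] by simp
  qed
  then have "eigt q E (rmax ?k) x"
    using eig nz by (auto simp: eigt_def Image_sy x_def less_Suc_eq_le Bex_def)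
  then show ?thesis using that T(2) \<open>E = T\<close> by simp
qed

theorem maximiser_fan:
  assumes q: "q \<noteq> 5" and E: "admissible (Suc q) E" and y: "0 < nrm {..<Suc q} y"
    and max: "rmax (Suc q) * nrm {..<Suc q} y \<le> qf (sy E) y"
  obtains h where "bij_betw h {..q} {..q}" "sy E = map_prod h h ` sy (fan_edges q)"
proof (cases "q = 0")
  case True
  then have "E = {}" using admissibleD[OF E] by fastforce
  moreover have "fan_edges q = {}" using True by (auto simp: fan_edges_def)
  ultimately show ?thesis by (intro that[of id]) (auto simp: sy_def)
next
  case False
  then have q1: "1 \<le> q" by simp
  obtain x where T: "tri 0 q E" and x: "eigt q E (rmax (Suc q)) x" using maximiser_tri[OF q1 E y max] by blast
  have "dominated q E"
  proof (rule ccontr)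
    assume nd: "\<not> dominated q E"
    obtain z where z: "rmax (Suc q) * (\<Sum>v\<le>q. (z v)\<^sup>2) < qf (sy (fan_edges q)) z"
      using not_dominated_below_fan[OF q1 q T x nd] by blast
    have "qf (sy (fan_edges q)) z \<le> rmax (Suc q) * nrm {..<Suc q} z"
      by (rule rmax_bound[OF tri_admissible[OF tri_fan[OF q1]]]) simp
    then show False using z by (simp add: nrm_def lessThan_Suc_atMost)
  qed
  then obtain h where h: "bij_betw h {..q} {..q}"
    "\<And>v w. v \<le> q \<Longrightarrow> w \<le> q \<Longrightarrow> (v, w) \<in> sy (fan_edges q) \<longleftrightarrow> (h v, h w) \<in> sy E"
    using dominated_iso_fan[OF T] by metis
  have sF: "sy (fan_edges q) \<subseteq> {..q} \<times> {..q}" "sy E \<subseteq> {..q} \<times> {..q}"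
    using sy_tri_sub[OF tri_fan[OF q1]] sy_tri_sub[OF T] by (auto simp: atLeast0AtMost)
  have "sy E = map_prod h h ` sy (fan_edges q)"
  proof (rule equalityI; rule subsetI)
    fix e assume e: "e \<in> sy E"
    then obtain a b where ab: "e = (a, b)" "a \<le> q" "b \<le> q" using sF(2) by auto
    then obtain v w where vw: "a = h v" "b = h w" "v \<le> q" "w \<le> q" using h(1) unfolding bij_betw_def by (metis atMost_iff imageE)
    then have "(v, w) \<in> sy (fan_edges q)" using h(2) e ab by simp
    then show "e \<in> map_prod h h ` sy (fan_edges q)" using ab vw by force
  next
    fix e assume "e \<in> map_prod h h ` sy (fan_edges q)"
    then obtain v w where "(v, w) \<in> sy (fan_edges q)" "e = (h v, h w)" by auto
    then show "e \<in> sy E" using h(2) sF(1) by auto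
  qed
  then show ?thesis using that h(1) by blast
qed

theorem maximiser_sun:
  assumes E: "admissible 6 E" and y: "0 < nrm {..<6} y" and max: "rmax 6 * nrm {..<6} y \<le> qf (sy E) y"
  shows "E = sun \<or> E = sun'"
proof (rule ccontr)
  assume ns: "\<not> ?thesis"
  obtain x where T: "tri 0 5 E" and x: "eigt 5 E (rmax 6) x"
    using maximiser_tri[of 5 E y] E y max by auto
  obtain z where z: "rmax 6 * (\<Sum>v\<le>5. (z v)\<^sup>2) < qf (sy sun) z"
    using not_sun_below_sun[OF T x] ns by blast
  have "admissible 6 sun"
    by (auto simp: admissible_def noncross_def sun_list_def)
  then have "qf (sy sun) z \<le> rmax 6 * nrm {..<6} z" by (rule rmax_bound) simp
  moreover have "{..<6::nat} = {..5}" by auto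
  ultimately show False using z by (simp add: nrm_def)
qed

section \<open>Graphs with large second eigenvalue\<close>

lemma ncl_remove1: "ncl R (as @ x # bs) \<Longrightarrow> ncl R (as @ bs)"
  unfolding ncl_def
proof (intro conjI allI impI notI; elim conjE)
  assume "distinct (as @ x # bs)"
  then show "distinct (as @ bs)" by simp
next
  fix i j k l
  assume d: "distinct (as @ x # bs)" and
    nc: "\<forall>i j k l. i < j \<longrightarrow> j < k \<longrightarrow> k < l \<longrightarrow> l < length (as @ x # bs) \<longrightarrow>
         ((as @ x # bs) ! i, (as @ x # bs) ! k) \<in> R \<longrightarrow> ((as @ x # bs) ! j, (as @ x # bs) ! l) \<notin> R"
    and h: "i < j" "j < k" "k < l" "l < length (as @ bs)"
      "((as @ bs) ! i, (as @ bs) ! k) \<in> R" "((as @ bs) ! j, (as @ bs) ! l) \<in> R"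
  define f where "f m = (if m < length as then m else Suc m)" for m
  have f: "(as @ bs) ! m = (as @ x # bs) ! f m" for m by (auto simp: f_def nth_append Suc_diff_le)
  have "f i < f j" "f j < f k" "f k < f l" "f l < length (as @ x # bs)" using h by (auto simp: f_def)
  then show False using nc h(5,6) unfolding f by blast
qed

lemma ncl_filter: "ncl R (as @ xs) \<Longrightarrow> ncl R (as @ filter P xs)"
proof (induction xs arbitrary: as)
  case (Cons x xs)
  show ?case
  proof (cases "P x")
    case True
    then show ?thesis using Cons.IH[of "as @ [x]"] Cons.prems by simp
  next
    case False
    then show ?thesis using Cons.IH[OF ncl_remove1[OF Cons.prems]] by simp
  qed
qed simp

lemma ncl_to_nat:
  assumes nc: "ncl R ys" and sym: "sym R" and irr: "irrefl R"
  obtains E where "admissible (length ys) E" "bij_betw ((!) ys) {..<length ys} (set ys)"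
    "R \<inter> set ys \<times> set ys = map_prod ((!) ys) ((!) ys) ` sy E"
proof -
  let ?g = "(!) ys"
  define E where "E = {(i, j). i < j \<and> j < length ys \<and> (ys ! i, ys ! j) \<in> R}"
  have "admissible (length ys) E"
    using nc unfolding admissible_def noncross_def E_def ncl_def by auto
  moreover have bij: "bij_betw ?g {..<length ys} (set ys)"
    using nc bij_betw_nth[of ys] by (simp add: ncl_def)
  moreover have "R \<inter> set ys \<times> set ys = map_prod ?g ?g ` sy E"
  proof (rule equalityI; rule subsetI)
    fix e assume e: "e \<in> R \<inter> set ys \<times> set ys"
    then obtain u v where uv: "e = (u, v)" "(u, v) \<in> R" "u \<in> set ys" "v \<in> set ys" by auto
    then obtain i j where ij: "i < length ys" "ys ! i = u" "j < length ys" "ys ! j = v"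
      by (metis in_set_conv_nth)
    have "i \<noteq> j" using irr uv(2) ij by (auto simp: irrefl_def)
    then have "(i, j) \<in> sy E" using uv(2) ij symD[OF sym uv(2)] by (auto simp: sy_def E_def)
    then show "e \<in> map_prod ?g ?g ` sy E" using ij uv(1) by force
  next
    fix e assume "e \<in> map_prod ?g ?g ` sy E"
    then obtain i j where ij: "(i, j) \<in> sy E" "e = (ys ! i, ys ! j)" by auto
    then show "e \<in> R \<inter> set ys \<times> set ys" using symD[OF sym] by (auto simp: sy_def E_def)
  qed
  ultimately show ?thesis by (rule that)
qed

lemma induced_to_nat:
  assumes nc: "ncl R xs" and sym: "sym R" and irr: "irrefl R" and S: "S \<subseteq> set xs"
  obtains E g where "admissible (card S) E" "bij_betw g {..<card S} S"
    "R \<inter> S \<times> S = map_prod g g ` sy E"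
    "\<forall>y. qf (R \<inter> S \<times> S) y = qf (sy E) (y \<circ> g)" "\<forall>y. nrm S y = nrm {..<card S} (y \<circ> g)"
proof -
  define ys where "ys = filter (\<lambda>v. v \<in> S) xs"
  have ys: "ncl R ys" using ncl_filter[of R "[]" xs] nc by (simp add: ys_def)
  have set: "set ys = S" using S by (auto simp: ys_def)
  have len: "length ys = card S" using ys distinct_card[of ys] unfolding set by (simp add: ncl_def)
  obtain E where E: "admissible (card S) E" "bij_betw ((!) ys) {..<card S} S"
    "R \<inter> S \<times> S = map_prod ((!) ys) ((!) ys) ` sy E"
    using ncl_to_nat[OF ys sym irr] unfolding set len by metis
  have "qf (R \<inter> S \<times> S) y = qf (sy E) (y \<circ> (!) ys)" for y
    unfolding E(3) using E(2) sy_props(1)[OF E(1)] by (intro qf_map) (auto simp: bij_betw_def)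
  moreover have "nrm S y = nrm {..<card S} (y \<circ> (!) ys)" for y
    using nrm_map[of "(!) ys" "{..<card S}" y] E(2) by (simp add: bij_betw_def)
  ultimately show ?thesis using that[OF E] by blast
qed

text \<open>A subsequence of a noncrossing order is noncrossing, so an induced part is, up to
  numbering, among the graphs over which \<open>rmax\<close> is taken.\<close>

lemma induced_bound:
  assumes nc: "ncl R xs" and sym: "sym R" and irr: "irrefl R" and S: "S \<subseteq> set xs" "S \<noteq> {}"
  shows "qf (R \<inter> S \<times> S) y \<le> rmax (card S) * nrm S y"
proof -
  have "finite S" using S(1) by (auto intro: finite_subset)
  then have k: "1 \<le> card S" using S(2) by (simp add: Suc_le_eq card_gt_0_iff)
  obtain E g where E: "admissible (card S) E" "bij_betw g {..<card S} S" "R \<inter> S \<times> S = map_prod g g ` sy E"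
    "\<forall>y. qf (R \<inter> S \<times> S) y = qf (sy E) (y \<circ> g)" "\<forall>y. nrm S y = nrm {..<card S} (y \<circ> g)"
    by (rule induced_to_nat[OF nc sym irr S(1)])
  show ?thesis unfolding E(4)[rule_format] E(5)[rule_format] by (rule rmax_bound[OF E(1) k])
qed

text \<open>Extremality of \<open>G\<close> speaks only of graphs on its own vertex type, hence the
  copy on a given set \<open>V\<close>. The conclusion is \<open>lambda2_plane\<close> pulled back
  to \<open>{..<n}\<close>, so that test vectors can be written on numbers.\<close>

lemma transfer_graph:
  fixes V :: "'a set"
  assumes E: "admissible n E" and path: "path_edge_set n \<subseteq> E" and n: "2 \<le> n" and V: "finite V" "card V = n"
  obtains C :: "'a pair_pre_digraph" where "connected_outerplanar_on n C"
    "\<And>y z. \<exists>a b. (a \<noteq> 0 \<or> b \<noteq> 0) \<and>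
       qf (sy E) (\<lambda>v. a * y v + b * z v) \<le> lambda2 C * nrm {..<n} (\<lambda>v. a * y v + b * z v)"
proof -
  obtain g where g: "bij_betw g {..<n} V" using ex_bij_betw_nat_finite[OF V(1)] V(2) by (auto simp: atLeast0LessThan)
  have inj: "inj_on g {..<n}" and im: "g ` {..<n} = V" using g by (auto simp: bij_betw_def)
  define R where "R = map_prod g g ` sy E"
  note s = sy_props[OF E]
  have gR: "(g i, g j) \<in> R \<longleftrightarrow> (i, j) \<in> sy E" if "i < n" "j < n" for i j
  proof
    assume "(g i, g j) \<in> R"
    then obtain a b where "(a, b) \<in> sy E" "g i = g a" "g j = g b" by (auto simp: R_def)
    moreover from this have "a < n" "b < n" using s(1) by auto
    ultimately show "(i, j) \<in> sy E" using inj_onD[OF inj] that by (metis lessThan_iff)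
  qed (auto simp: R_def)
  have RV: "R \<subseteq> V \<times> V" using s(1) im by (auto simp: R_def)
  have sR: "sym R" using s(2) by (auto simp: R_def sym_def)
  have iR: "irrefl R" unfolding irrefl_def
  proof (intro allI notI)
    fix a assume aa: "(a, a) \<in> R"
    then obtain i where "i < n" "a = g i" using RV im by auto
    then show False using gR[of i i] aa s(3) by (auto simp: irrefl_def)
  qed
  define C where "C = \<lparr>pverts = V, parcs = R\<rparr>"
  have C: "pair_graph C" unfolding C_def by (rule pair_graphI[OF V(1) RV sR iR])
  define xs where "xs = map g [0..<n]"
  have xs: "set xs = V" "length xs = n" "\<And>i. i < n \<Longrightarrow> xs ! i = g i"
    using im by (auto simp: xs_def atLeast0LessThan)
  have "ncl R xs" unfolding ncl_def
  proof (intro conjI allI impI notI)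
    show "distinct xs" using inj by (simp add: xs_def distinct_map atLeast0LessThan)
    fix i j k l assume h: "i < j" "j < k" "k < l" "l < length xs" "(xs ! i, xs ! k) \<in> R" "(xs ! j, xs ! l) \<in> R"
    have "(i, k) \<in> sy E" "(j, l) \<in> sy E" using h xs(2,3) gR by auto
    then have "(i, k) \<in> E" "(j, l) \<in> E" using admissibleD[OF E] h(1-3) by (fastforce simp: sy_def)+
    then show False using E h(1-3) unfolding admissible_def noncross_def by blast
  qed
  then have "outerplanar C" using ncl_outerplanar[OF C, of xs] xs(1) by (simp add: C_def)
  moreover have "cut_connected V R" unfolding cut_connected_def
  proof (intro allI impI)
    fix X assume X: "X \<subseteq> V" "X \<noteq> {}" "X \<noteq> V"
    define Y where "Y = {i\<in>{..<n}. g i \<in> X}"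
    have XY: "X = g ` Y" using X(1) im by (auto simp: Y_def)
    have "Y \<subseteq> {..<n}" by (auto simp: Y_def)
    moreover have "Y \<noteq> {}" using X(2) unfolding XY by simp
    moreover have "Y \<noteq> {..<n}" using X(3) im unfolding XY by metis
    ultimately obtain i j where ij: "i \<in> Y" "j \<in> {..<n} - Y" "(i, j) \<in> sy E"
      using path_cut_connected[OF path] unfolding cut_connected_def by blast
    have "(g i, g j) \<in> R" "g i \<in> X" "g j \<in> V - X" using ij im gR by (auto simp: Y_def)
    then show "\<exists>u\<in>X. \<exists>v\<in>V - X. (u, v) \<in> R" by blast
  qed
  then have "Digraph_Component.connected (with_proj C)"
    using connected_iff_cut_connected[OF C] V n by (force simp: C_def)
  ultimately have "connected_outerplanar_on n C" using C V(2) by (simp add: connected_outerplanar_on_def C_def)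
  moreover have "\<exists>a b. (a \<noteq> 0 \<or> b \<noteq> 0) \<and>
       qf (sy E) (\<lambda>v. a * y v + b * z v) \<le> lambda2 C * nrm {..<n} (\<lambda>v. a * y v + b * z v)" for y z
  proof -
    define f where "f = the_inv_into {..<n} g"
    have f: "f (g i) = i" if "i < n" for i unfolding f_def using inj that by (simp add: the_inv_into_f_f)
    have "2 \<le> card (pverts C)" using n V(2) by (simp add: C_def)
    from lambda2_plane[OF C this, of "y \<circ> f" "z \<circ> f"] obtain a b where ab: "a \<noteq> 0 \<or> b \<noteq> 0"
      "qf R (\<lambda>u. a * (y \<circ> f) u + b * (z \<circ> f) u) \<le> lambda2 C * nrm V (\<lambda>u. a * (y \<circ> f) u + b * (z \<circ> f) u)"
      by (auto simp: C_def)
    have "qf R (\<lambda>u. a * (y \<circ> f) u + b * (z \<circ> f) u) = qf (sy E) (\<lambda>v. a * y v + b * z v)"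
      unfolding R_def qf_map[OF inj s(1)] by (rule qf_cong) (use s(1) f in auto)
    moreover have "nrm V (\<lambda>u. a * (y \<circ> f) u + b * (z \<circ> f) u) = nrm {..<n} (\<lambda>v. a * y v + b * z v)"
      unfolding im[symmetric] nrm_map[OF inj] by (rule nrm_cong) (use f in auto)
    ultimately show ?thesis using ab by auto
  qed
  ultimately show ?thesis by (rule that)
qed

section \<open>Lower bounds for the second eigenvalue from two optimal copies\<close>

definition shift_edges :: "nat \<Rightarrow> (nat \<times> nat) set \<Rightarrow> (nat \<times> nat) set" where
  "shift_edges s E = (\<lambda>(a, b). (a + s, b + s)) ` E"

lemma double_admissible:
  assumes E: "admissible k E" and s: "k \<le> s" "s + k \<le> n"
  shows "admissible n (E \<union> shift_edges s E)"
  unfolding admissible_def noncross_def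
proof (intro conjI allI impI notI)
  show "E \<union> shift_edges s E \<subseteq> {(a, b). a < b \<and> b < n}"
    using admissibleD[OF E] s by (fastforce simp: shift_edges_def)
  fix a b c d assume h: "(a, c) \<in> E \<union> shift_edges s E" "(b, d) \<in> E \<union> shift_edges s E" "a < b" "b < c" "c < d"
  have nc: "\<not> ((a, c) \<in> E \<and> (b, d) \<in> E \<and> a < b \<and> b < c \<and> c < d)" for a b c d
    using E unfolding admissible_def noncross_def by blast
  have lo: "v < k" if "(u, v) \<in> E" for u v using admissibleD[OF E that] by simp
  have hi: "s \<le> u \<and> (u - s, v - s) \<in> E \<and> s \<le> v" if "(u, v) \<in> shift_edges s E" for u v
    using that by (auto simp: shift_edges_def)
  consider "(a, c) \<in> E" "(b, d) \<in> E" | "(a, c) \<in> E" "(b, d) \<in> shift_edges s E"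
    | "(a, c) \<in> shift_edges s E" "(b, d) \<in> E" | "(a, c) \<in> shift_edges s E" "(b, d) \<in> shift_edges s E"
    using h(1,2) by blast
  then show False
  proof cases
    case 1 then show ?thesis using nc h by blast
  next
    case 2 then show ?thesis using lo[of a c] hi[of b d] h s by simp
  next
    case 3 then show ?thesis using hi[of a c] lo[of b d] h s by simp
  next
    case 4
    then have "(a - s, c - s) \<in> E" "(b - s, d - s) \<in> E" "s \<le> a" using hi by auto
    then show ?thesis using nc[of "a - s" "c - s" "b - s" "d - s"] h by auto
  qed
qed

lemma double_sum:
  fixes f :: "nat \<times> nat \<Rightarrow> real"
  assumes E: "admissible k E" and s: "k \<le> s"
  shows "sum f (E \<union> shift_edges s E) = (\<Sum>(a, b)\<in>E. f (a, b)) + (\<Sum>(a, b)\<in>E. f (a + s, b + s))"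
proof -
  have fin: "finite E" by (rule admissible_finite[OF E])
  have "E \<inter> shift_edges s E = {}" using admissibleD[OF E] s by (fastforce simp: shift_edges_def)
  then have "sum f (E \<union> shift_edges s E) = sum f E + sum f (shift_edges s E)"
    using fin by (intro sum.union_disjoint) (auto simp: shift_edges_def)
  also have "sum f (shift_edges s E) = (\<Sum>(a, b)\<in>E. f (a + s, b + s))"
    unfolding shift_edges_def by (subst sum.reindex) (auto simp: inj_on_def split_beta comp_def)
  finally show ?thesis by simp
qed

text \<open>The copies occupy \<open>{..<m}\<close> and \<open>{m + 1..2 * m}\<close> and are linked
  through \<open>m\<close>. All vectors of the test plane vanish at \<open>m\<close>, so the linking
  edges contribute nothing and every quotient on the plane is \<open>rmax m\<close>.\<close>

lemma odd_lower:
  fixes V :: "'a set"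
  assumes m: "1 \<le> m" and V: "finite V" "card V = 2 * m + 1"
  obtains C :: "'a pair_pre_digraph" where "connected_outerplanar_on (2 * m + 1) C" "rmax m \<le> lambda2 C"
proof -
  obtain E y where E: "admissible m E" "path_edge_set m \<subseteq> E" "nrm {..<m} y = 1" "\<forall>v<m. 0 < y v"
    "qf (sy E) y = rmax m" using rmax_eigenvector[OF m] by blast
  define s where "s = m + 1"
  define D where "D = E \<union> shift_edges s E"
  define F where "F = D \<union> path_edge_set (2 * m + 1)"
  have aD: "admissible (2 * m + 1) D" unfolding D_def by (rule double_admissible[OF E(1)]) (auto simp: s_def)
  have aF: "admissible (2 * m + 1) F" unfolding F_def by (rule admissible_path[OF aD])
  \<comment> \<open>The optimal set contains its own path edges, so the path edges added to the two
    copies are those at \<open>m\<close>.\<close>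
  have new: "a = m \<or> b = m" if "(a, b) \<in> F - D" for a b
  proof (rule ccontr)
    assume nm: "\<not> ?thesis"
    have ab: "b = Suc a" "b < 2 * m + 1" "(a, b) \<notin> E" "(a, b) \<notin> shift_edges s E"
      using that by (auto simp: F_def D_def path_edge_set_def)
    have "\<not> b < m" using ab E(2) by (auto simp: path_edge_set_def)
    then have "a = (a - s) + s" "b = (b - s) + s" "(a - s, b - s) \<in> path_edge_set m"
      using ab nm by (auto simp: path_edge_set_def s_def)
    then have "(a, b) \<in> shift_edges s E" using E(2) unfolding shift_edges_def by (intro image_eqI[of _ _ "(a - s, b - s)"]) auto
    then show False using ab by simp
  qed
  have n2: "2 \<le> 2 * m + 1" using m by simp
  obtain C :: "'a pair_pre_digraph" where C: "connected_outerplanar_on (2 * m + 1) C"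
    "\<And>y z. \<exists>a b. (a \<noteq> 0 \<or> b \<noteq> 0) \<and>
       qf (sy F) (\<lambda>v. a * y v + b * z v) \<le> lambda2 C * nrm {..<2 * m + 1} (\<lambda>v. a * y v + b * z v)"
    using transfer_graph[OF aF _ n2 V] by (auto simp: F_def)
  define y1 where "y1 v = (if v < m then y v else 0)" for v
  define y2 where "y2 v = (if m < v then y (v - s) else 0)" for v
  obtain a b where ab: "a \<noteq> 0 \<or> b \<noteq> 0"
    "qf (sy F) (\<lambda>v. a * y1 v + b * y2 v) \<le> lambda2 C * nrm {..<2 * m + 1} (\<lambda>v. a * y1 v + b * y2 v)"
    using C(2) by blast
  define z where "z v = a * y1 v + b * y2 v" for v
  have z: "z v = a * y v" "z (v + s) = b * y v" if "v < m" for v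
    using that by (auto simp: z_def y1_def y2_def s_def)
  have zm: "z m = 0" by (simp add: z_def y1_def y2_def)
  define S where "S = (\<Sum>(u, v)\<in>E. y u * y v)"
  have S: "2 * S = rmax m" using qf_sy[of E y] admissibleD[OF E(1)] admissible_finite[OF E(1)] E(5) by (auto simp: S_def)
  have "qf (sy F) z = 2 * (\<Sum>(u, v)\<in>F. z u * z v)"
    using admissibleD[OF aF] admissible_finite[OF aF] by (intro qf_sy) auto
  also have "(\<Sum>(u, v)\<in>F. z u * z v) = (\<Sum>(u, v)\<in>D. z u * z v)"
  proof (rule sum.mono_neutral_right)
    show "finite F" by (rule admissible_finite[OF aF])
    show "D \<subseteq> F" by (simp add: F_def)
    show "\<forall>e\<in>F - D. (case e of (u, v) \<Rightarrow> z u * z v) = 0" using new zm by fastforce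
  qed
  also have "\<dots> = (\<Sum>(u, v)\<in>E. z u * z v) + (\<Sum>(u, v)\<in>E. z (u + s) * z (v + s))"
    unfolding D_def using double_sum[OF E(1), of s "\<lambda>(u, v). z u * z v"] by (simp add: s_def)
  also have "(\<Sum>(u, v)\<in>E. z u * z v) = a\<^sup>2 * S"
    unfolding S_def sum_distrib_left
    using admissibleD[OF E(1)] z(1) by (intro sum.cong) (fastforce simp: power2_eq_square algebra_simps)+
  also have "(\<Sum>(u, v)\<in>E. z (u + s) * z (v + s)) = b\<^sup>2 * S"
    unfolding S_def sum_distrib_left
    using admissibleD[OF E(1)] z(2) by (intro sum.cong) (fastforce simp: power2_eq_square algebra_simps)+
  finally have q: "qf (sy F) z = (a\<^sup>2 + b\<^sup>2) * rmax m" unfolding S[symmetric] by (simp add: algebra_simps)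
  have split: "{..<2 * m + 1} = insert m ({..<m} \<union> (\<lambda>v. v + s) ` {..<m})"
  proof (rule equalityI; rule subsetI)
    fix v assume v: "v \<in> {..<2 * m + 1}"
    show "v \<in> insert m ({..<m} \<union> (\<lambda>v. v + s) ` {..<m})"
    proof (cases "m < v")
      case True
      then have "v = (v - s) + s" "v - s < m" using v by (auto simp: s_def)
      then show ?thesis by blast
    qed auto
  qed (auto simp: s_def)
  have "nrm {..<2 * m + 1} z = (z m)\<^sup>2 + (\<Sum>v\<in>{..<m} \<union> (\<lambda>v. v + s) ` {..<m}. (z v)\<^sup>2)"
    unfolding nrm_def split by (subst sum.insert) (auto simp: s_def)
  also have "(\<Sum>v\<in>{..<m} \<union> (\<lambda>v. v + s) ` {..<m}. (z v)\<^sup>2) = (\<Sum>v<m. (z v)\<^sup>2) + (\<Sum>v<m. (z (v + s))\<^sup>2)"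
    by (subst sum.union_disjoint) (auto simp: s_def sum.reindex inj_on_def)
  also have "(\<Sum>v<m. (z v)\<^sup>2) = a\<^sup>2 * nrm {..<m} y"
    unfolding nrm_def sum_distrib_left using z(1) by (intro sum.cong) (auto simp: power_mult_distrib)
  also have "(\<Sum>v<m. (z (v + s))\<^sup>2) = b\<^sup>2 * nrm {..<m} y"
    unfolding nrm_def sum_distrib_left using z(2) by (intro sum.cong) (auto simp: power_mult_distrib)
  finally have n: "nrm {..<2 * m + 1} z = a\<^sup>2 + b\<^sup>2" using zm E(3) by simp
  have "qf (sy F) z \<le> lambda2 C * nrm {..<2 * m + 1} z" using ab(2) unfolding z_def .
  then have "(a\<^sup>2 + b\<^sup>2) * rmax m \<le> (a\<^sup>2 + b\<^sup>2) * lambda2 C" unfolding q n by (simp add: mult.commute)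
  moreover have "0 < a\<^sup>2 + b\<^sup>2" using ab(1) by (auto simp: add_pos_nonneg add_nonneg_pos)
  ultimately have "rmax m \<le> lambda2 C" by simp
  then show ?thesis using that C(1) by blast
qed

text \<open>The copies are linked by a path through \<open>k\<close> and \<open>k + 1\<close>, where
  the test vectors take the values \<open>a * \<epsilon>\<close> and \<open>b * \<epsilon>\<close>.
  The outer link edges gain at least \<open>2 * c * \<epsilon>\<close> per unit of
  \<open>a\<^sup>2 + b\<^sup>2\<close>, the middle one costs at most
  \<open>\<epsilon>\<^sup>2\<close>, and the norm grows by
  \<open>\<epsilon>\<^sup>2\<close>.\<close>

lemma even_lower:
  fixes V :: "'a set"
  assumes k: "1 \<le> k" and V: "finite V" "card V = 2 * k + 2"
  obtains C :: "'a pair_pre_digraph" where "connected_outerplanar_on (2 * k + 2) C" "rmax k < lambda2 C"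
proof -
  obtain E y where E: "admissible k E" "path_edge_set k \<subseteq> E" "nrm {..<k} y = 1" "\<forall>v<k. 0 < y v"
    "qf (sy E) y = rmax k" using rmax_eigenvector[OF k] by blast
  define r where "r = rmax k"
  have r0: "0 \<le> r" unfolding r_def by (rule rmax_nonneg[OF k])
  define s where "s = k + 2"
  define D where "D = E \<union> shift_edges s E"
  define N where "N = {(k - 1, k), (k, k + 1), (k + 1, k + 2)}"
  define F where "F = D \<union> path_edge_set (2 * k + 2)"
  have aD: "admissible (2 * k + 2) D" unfolding D_def by (rule double_admissible[OF E(1)]) (auto simp: s_def)
  have aF: "admissible (2 * k + 2) F" unfolding F_def by (rule admissible_path[OF aD])
  have sh: "shift_edges s (path_edge_set k) \<subseteq> shift_edges s E" unfolding shift_edges_def by (rule image_mono[OF E(2)])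
  have FN: "F = D \<union> N"
  proof (rule equalityI; rule subsetI)
    fix e assume e: "e \<in> F"
    show "e \<in> D \<union> N"
    proof (cases "e \<in> D")
      case False
      then obtain a where a: "e = (a, Suc a)" "Suc a < 2 * k + 2" using e by (auto simp: F_def path_edge_set_def)
      have "\<not> Suc a < k" using False a E(2) by (auto simp: D_def path_edge_set_def)
      moreover have "\<not> s \<le> a"
      proof
        assume sa: "s \<le> a"
        have "e \<in> shift_edges s (path_edge_set k)" unfolding shift_edges_def
          by (rule image_eqI[of _ _ "(a - s, Suc a - s)"]) (use sa a in \<open>auto simp: path_edge_set_def s_def\<close>)
        then show False using False sh by (auto simp: D_def)
      qed
      ultimately have "a = k - 1 \<or> a = k \<or> a = k + 1" by (auto simp: s_def)
      then show ?thesis using a k by (auto simp: N_def)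
    qed simp
  next
    fix e assume "e \<in> D \<union> N"
    then show "e \<in> F" using k by (auto simp: F_def N_def path_edge_set_def)
  qed
  have n2: "2 \<le> 2 * k + 2" by simp
  obtain C :: "'a pair_pre_digraph" where C: "connected_outerplanar_on (2 * k + 2) C"
    "\<And>y z. \<exists>a b. (a \<noteq> 0 \<or> b \<noteq> 0) \<and>
       qf (sy F) (\<lambda>v. a * y v + b * z v) \<le> lambda2 C * nrm {..<2 * k + 2} (\<lambda>v. a * y v + b * z v)"
    using transfer_graph[OF aF _ n2 V] by (auto simp: F_def)
  define c where "c = min (y (k - 1)) (y 0)"
  have c: "0 < c" "c \<le> y (k - 1)" "c \<le> y 0" using E(4) k by (auto simp: c_def)
  have k0: "0 < k" and k1: "k - 1 < k" using k by simp_all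
  \<comment> \<open>With \<open>r * \<epsilon> + \<epsilon> = c\<close> the total cost
    \<open>r * \<epsilon>\<^sup>2 + \<epsilon>\<^sup>2\<close> is half the gain
    \<open>2 * c * \<epsilon>\<close>.\<close>
  define \<epsilon> where "\<epsilon> = c / (r + 1)"
  have \<epsilon>: "0 < \<epsilon>" "(r + 1) * \<epsilon> = c" using c r0 by (auto simp: \<epsilon>_def)
  define y1 where "y1 v = (if v < k then y v else if v = k then \<epsilon> else 0)" for v
  define y2 where "y2 v = (if s \<le> v then y (v - s) else if v = k + 1 then \<epsilon> else 0)" for v
  obtain a b where ab: "a \<noteq> 0 \<or> b \<noteq> 0"
    "qf (sy F) (\<lambda>v. a * y1 v + b * y2 v) \<le> lambda2 C * nrm {..<2 * k + 2} (\<lambda>v. a * y1 v + b * y2 v)"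
    using C(2) by blast
  define z where "z v = a * y1 v + b * y2 v" for v
  have z: "z v = a * y v" "z (v + s) = b * y v" if "v < k" for v
    using that by (auto simp: z_def y1_def y2_def s_def)
  have zk: "z k = a * \<epsilon>" "z (k + 1) = b * \<epsilon>" by (auto simp: z_def y1_def y2_def s_def)
  define S where "S = (\<Sum>(u, v)\<in>E. y u * y v)"
  have S: "2 * S = r" using qf_sy[of E y] admissibleD[OF E(1)] admissible_finite[OF E(1)] E(5) by (auto simp: S_def r_def)
  have DN: "D \<inter> N = {}" using admissibleD[OF E(1)] by (fastforce simp: D_def N_def shift_edges_def s_def)
  have "qf (sy F) z = 2 * (\<Sum>(u, v)\<in>F. z u * z v)"
    using admissibleD[OF aF] admissible_finite[OF aF] by (intro qf_sy) auto
  also have "(\<Sum>(u, v)\<in>F. z u * z v) = (\<Sum>(u, v)\<in>D. z u * z v) + (\<Sum>(u, v)\<in>N. z u * z v)"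
    unfolding FN using admissible_finite[OF aD] DN by (intro sum.union_disjoint) (auto simp: N_def)
  also have "(\<Sum>(u, v)\<in>N. z u * z v) = z (k - 1) * z k + z k * z (k + 1) + z (k + 1) * z (0 + s)"
    using k by (auto simp: N_def s_def)
  also have "\<dots> = a\<^sup>2 * (\<epsilon> * y (k - 1)) + a * b * \<epsilon>\<^sup>2 + b\<^sup>2 * (\<epsilon> * y 0)"
    unfolding z(2)[OF k0] z(1)[OF k1] zk
    by (simp add: power2_eq_square algebra_simps)
  also have "(\<Sum>(u, v)\<in>D. z u * z v) = (\<Sum>(u, v)\<in>E. z u * z v) + (\<Sum>(u, v)\<in>E. z (u + s) * z (v + s))"
    unfolding D_def using double_sum[OF E(1), of s "\<lambda>(u, v). z u * z v"] by (simp add: s_def)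
  also have "(\<Sum>(u, v)\<in>E. z u * z v) = a\<^sup>2 * S"
    unfolding S_def sum_distrib_left
    using admissibleD[OF E(1)] z(1) by (intro sum.cong) (fastforce simp: power2_eq_square algebra_simps)+
  also have "(\<Sum>(u, v)\<in>E. z (u + s) * z (v + s)) = b\<^sup>2 * S"
    unfolding S_def sum_distrib_left
    using admissibleD[OF E(1)] z(2) by (intro sum.cong) (fastforce simp: power2_eq_square algebra_simps)+
  finally have q: "qf (sy F) z = (a\<^sup>2 + b\<^sup>2) * (2 * S) + 2 * (a\<^sup>2 * (\<epsilon> * y (k - 1)) + a * b * \<epsilon>\<^sup>2 + b\<^sup>2 * (\<epsilon> * y 0))"
    by (simp add: algebra_simps)
  have split: "{..<2 * k + 2} = insert k (insert (k + 1) ({..<k} \<union> (\<lambda>v. v + s) ` {..<k}))"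
  proof (rule equalityI; rule subsetI)
    fix v assume v: "v \<in> {..<2 * k + 2}"
    show "v \<in> insert k (insert (k + 1) ({..<k} \<union> (\<lambda>v. v + s) ` {..<k}))"
    proof (cases "k + 1 < v")
      case True
      then have "v = (v - s) + s" "v - s < k" using v by (auto simp: s_def)
      then show ?thesis by blast
    qed auto
  qed (auto simp: s_def)
  have "nrm {..<2 * k + 2} z = (z k)\<^sup>2 + ((z (k + 1))\<^sup>2 + (\<Sum>v\<in>{..<k} \<union> (\<lambda>v. v + s) ` {..<k}. (z v)\<^sup>2))"
    unfolding nrm_def split by (subst sum.insert, force, force simp: s_def, subst sum.insert) (auto simp: s_def)
  also have "(\<Sum>v\<in>{..<k} \<union> (\<lambda>v. v + s) ` {..<k}. (z v)\<^sup>2) = (\<Sum>v<k. (z v)\<^sup>2) + (\<Sum>v<k. (z (v + s))\<^sup>2)"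
    by (subst sum.union_disjoint) (auto simp: s_def sum.reindex inj_on_def)
  also have "(\<Sum>v<k. (z v)\<^sup>2) = a\<^sup>2 * nrm {..<k} y"
    unfolding nrm_def sum_distrib_left using z(1) by (intro sum.cong) (auto simp: power_mult_distrib)
  also have "(\<Sum>v<k. (z (v + s))\<^sup>2) = b\<^sup>2 * nrm {..<k} y"
    unfolding nrm_def sum_distrib_left using z(2) by (intro sum.cong) (auto simp: power_mult_distrib)
  finally have n: "nrm {..<2 * k + 2} z = (a\<^sup>2 + b\<^sup>2) * (1 + \<epsilon>\<^sup>2)"
    unfolding zk E(3) by (simp add: power_mult_distrib algebra_simps)
  have pos: "0 < a\<^sup>2 + b\<^sup>2" using ab(1) by (auto simp: add_pos_nonneg add_nonneg_pos)
  have "(a\<^sup>2 + b\<^sup>2) * \<epsilon> * (r * \<epsilon>) < (a\<^sup>2 + b\<^sup>2) * \<epsilon> * (2 * c - \<epsilon>)"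
  proof (intro mult_strict_left_mono mult_pos_pos pos \<epsilon>(1))
    have "r * \<epsilon> + \<epsilon> = c" using \<epsilon>(2) by (simp add: algebra_simps)
    then show "r * \<epsilon> < 2 * c - \<epsilon>" using c(1) by simp
  qed
  also have "\<dots> \<le> 2 * (a\<^sup>2 * (\<epsilon> * y (k - 1)) + a * b * \<epsilon>\<^sup>2 + b\<^sup>2 * (\<epsilon> * y 0))"
  proof -
    have "a\<^sup>2 * (\<epsilon> * c) \<le> a\<^sup>2 * (\<epsilon> * y (k - 1))" "b\<^sup>2 * (\<epsilon> * c) \<le> b\<^sup>2 * (\<epsilon> * y 0)"
      using c \<epsilon>(1) by (intro mult_left_mono; simp)+
    \<comment> \<open>\<open>a\<close> and \<open>b\<close> may have opposite signs; this limits the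
      damage done by the middle edge.\<close>
    moreover have "0 \<le> (a + b)\<^sup>2 * \<epsilon>\<^sup>2" by simp
    then have "- ((a\<^sup>2 + b\<^sup>2) * \<epsilon>\<^sup>2) \<le> 2 * (a * b * \<epsilon>\<^sup>2)" by (simp add: power2_eq_square algebra_simps)
    moreover have "2 * p + 2 * q - u \<le> 2 * (p' + t + q')"
      if "p \<le> p'" "q \<le> q'" "- u \<le> 2 * t" for p q u p' t q' :: real using that by (simp add: algebra_simps)
    ultimately have "2 * (a\<^sup>2 * (\<epsilon> * c)) + 2 * (b\<^sup>2 * (\<epsilon> * c)) - (a\<^sup>2 + b\<^sup>2) * \<epsilon>\<^sup>2
      \<le> 2 * (a\<^sup>2 * (\<epsilon> * y (k - 1)) + a * b * \<epsilon>\<^sup>2 + b\<^sup>2 * (\<epsilon> * y 0))" by blast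
    then show ?thesis by (simp add: power2_eq_square algebra_simps)
  qed
  finally have "(a\<^sup>2 + b\<^sup>2) * (1 + \<epsilon>\<^sup>2) * r < qf (sy F) z" unfolding q S by (simp add: power2_eq_square algebra_simps)
  also have "\<dots> \<le> lambda2 C * nrm {..<2 * k + 2} z" using ab(2) unfolding z_def .
  finally have "(a\<^sup>2 + b\<^sup>2) * (1 + \<epsilon>\<^sup>2) * r < (a\<^sup>2 + b\<^sup>2) * (1 + \<epsilon>\<^sup>2) * lambda2 C"
    unfolding n by (simp add: mult.commute)
  moreover have "0 < (a\<^sup>2 + b\<^sup>2) * (1 + \<epsilon>\<^sup>2)" using pos by (intro mult_pos_pos) (auto simp: add_pos_nonneg)
  ultimately have "r < lambda2 C" by (simp add: mult_less_cancel_left_pos)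
  then show ?thesis using that C(1) unfolding r_def by blast
qed

section \<open>Isomorphism with the optimal graphs\<close>

lemma digraph_iso_image:
  assumes "parcs A \<subseteq> pverts A \<times> pverts A" "inj_on f (pverts A)"
  shows "digraph_iso (with_proj A) (with_proj \<lparr> pverts = f ` pverts A, parcs = map_prod f f ` parcs A \<rparr>)"
proof -
  let ?iso = "\<lparr> iso_verts = f, iso_arcs = map_prod f f, iso_head = snd, iso_tail = fst \<rparr>"
  have "wf_digraph (with_proj A)" using assms(1) by unfold_locales auto
  moreover have "inj_on (map_prod f f) (parcs A)"
    by (rule inj_on_subset[OF map_prod_inj_on[OF assms(2,2)] assms(1)])
  ultimately have "pre_digraph.digraph_isomorphism (with_proj A) ?iso"
    using assms(2) by (auto simp: pre_digraph.digraph_isomorphism_def)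
  then show ?thesis unfolding digraph_iso_def
    by (intro exI[of _ ?iso]) (simp add: app_iso_def with_proj_def)
qed

lemma digraph_iso_comp_image:
  assumes "parcs A \<subseteq> pverts A \<times> pverts A" "inj_on f (pverts A)" "f ` pverts A = U"
    "map_prod f f ` parcs A = D" "bij_betw g U S" "R = map_prod g g ` D"
  shows "digraph_iso (with_proj A) (with_proj \<lparr> pverts = S, parcs = R \<rparr>)"
proof -
  have "inj_on (g \<circ> f) (pverts A)" using assms(2,3,5) by (auto simp: bij_betw_def intro: comp_inj_on)
  moreover have "(g \<circ> f) ` pverts A = S" using assms(3,5) unfolding bij_betw_def image_comp[symmetric] by simp
  moreover have "map_prod (g \<circ> f) (g \<circ> f) ` parcs A = R"
    unfolding assms(6) assms(4)[symmetric] image_comp by (simp add: map_prod_compose)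
  ultimately show ?thesis using digraph_iso_image[OF assms(1), of "g \<circ> f"] by simp
qed

definition fan_label :: "nat + nat \<Rightarrow> nat" where
  "fan_label = case_sum (\<lambda>_. 0) Suc"

abbreviation (input) fan_graph :: "nat \<Rightarrow> (nat + nat) pair_pre_digraph" where
  "fan_graph q \<equiv> graph_join (path_graph 1) (path_graph q)"

lemma fan_graph_label:
  shows "inj_on fan_label (pverts (fan_graph q))" "fan_label ` pverts (fan_graph q) = {..q}"
    "map_prod fan_label fan_label ` parcs (fan_graph q) = sy (fan_edges q)"
    "parcs (fan_graph q) \<subseteq> pverts (fan_graph q) \<times> pverts (fan_graph q)"
proof -
  show "inj_on fan_label (pverts (fan_graph q))"
    by (auto simp: inj_on_def fan_label_def graph_join_def path_graph_def)
  show "parcs (fan_graph q) \<subseteq> pverts (fan_graph q) \<times> pverts (fan_graph q)"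
    by (auto simp: graph_join_def path_graph_def)
  show "fan_label ` pverts (fan_graph q) = {..q}"
  proof (rule equalityI; rule subsetI)
    fix v assume "v \<in> {..q}"
    then show "v \<in> fan_label ` pverts (fan_graph q)"
      by (cases v) (force simp: fan_label_def graph_join_def path_graph_def)+
  qed (auto simp: fan_label_def graph_join_def path_graph_def)
  show "map_prod fan_label fan_label ` parcs (fan_graph q) = sy (fan_edges q)"
  proof (rule equalityI; rule subsetI)
    fix e assume e: "e \<in> sy (fan_edges q)"
    have *: "(a, b) \<in> map_prod fan_label fan_label ` parcs (fan_graph q) \<and>
        (b, a) \<in> map_prod fan_label fan_label ` parcs (fan_graph q)" if ab: "(a, b) \<in> fan_edges q" for a b
    proof (cases "a = 0")
      case True
      then obtain j where j: "b = Suc j" "j < q" using ab by (cases b) (auto simp: fan_edges_def)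
      have "(Inl 0, Inr j) \<in> parcs (fan_graph q)" "(Inr j, Inl 0) \<in> parcs (fan_graph q)"
        using j by (auto simp: graph_join_def path_graph_def)
      then show ?thesis using True j by (force simp: fan_label_def image_iff)
    next
      case False
      then obtain i where i: "a = Suc i" "b = Suc (Suc i)" "Suc i < q" using ab by (cases a) (auto simp: fan_edges_def)
      have "(Inr i, Inr (Suc i)) \<in> parcs (fan_graph q)" "(Inr (Suc i), Inr i) \<in> parcs (fan_graph q)"
        using i by (force simp: graph_join_def path_graph_def image_iff)+
      then show ?thesis using i by (force simp: fan_label_def image_iff)
    qed
    then show "e \<in> map_prod fan_label fan_label ` parcs (fan_graph q)" using e by (cases e) (auto simp: sy_def)
  qed (auto simp: fan_label_def graph_join_def path_graph_def sy_def fan_edges_def)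
qed

lemma fan_graph_pair_graph: "pair_graph (fan_graph q)"
proof -
  have "pair_graph \<lparr> pverts = pverts (fan_graph q), parcs = parcs (fan_graph q) \<rparr>"
    by (rule pair_graphI[OF _ fan_graph_label(4)]) (auto simp: graph_join_def path_graph_def sym_def irrefl_def)
  also have "\<lparr> pverts = pverts (fan_graph q), parcs = parcs (fan_graph q) \<rparr> = fan_graph q"
    by (simp add: graph_join_def)
  finally show ?thesis .
qed

text \<open>The hub and the two rim vertices of degree 3 in the fan form the inner triangle of the
  hexagon; here they are placed at 0, 2, 4.\<close>

definition sun_label :: "(nat + nat) option \<Rightarrow> nat" where
  "sun_label v = (case v of None \<Rightarrow> 3 | Some (Inl _) \<Rightarrow> 0 | Some (Inr i) \<Rightarrow> [1, 2, 4, 5] ! i)"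

text \<open>The other placement, with the inner triangle at 1, 3, 5.\<close>

definition sun_label' :: "(nat + nat) option \<Rightarrow> nat" where
  "sun_label' v = (case v of None \<Rightarrow> 4 | Some (Inl _) \<Rightarrow> 1 | Some (Inr i) \<Rightarrow> [2, 3, 5, 0] ! i)"

lemma sy_insert: "sy (insert (a, b) E) = insert (a, b) (insert (b, a) (sy E))" "sy {} = {}"
  by (auto simp: sy_def)

lemma times_singleton:
  "{a} \<times> insert b B = insert (a, b) ({a} \<times> B)" "insert b B \<times> {a} = insert (b, a) (B \<times> {a})"
  by auto

lemmas explicit_edges = sy_insert times_singleton image_Un insert_commute

lemma path_graph_1: "path_graph 1 = \<lparr> pverts = {0}, parcs = {} \<rparr>"
  unfolding path_graph_def by auto

lemma path_graph_4: "path_graph 4 =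
  \<lparr> pverts = {0, Suc 0, 2, 3}, parcs = {(0, Suc 0), (Suc 0, 0), (Suc 0, 2), (2, Suc 0), (2, 3), (3, 2)} \<rparr>"
  unfolding path_graph_def by auto

lemma fan_graph_4:
  "pverts (fan_graph 4) = {Inl 0, Inr 0, Inr (Suc 0), Inr 2, Inr 3}"
  "parcs (fan_graph 4) = sy {(Inl 0, Inr 0), (Inl 0, Inr (Suc 0)), (Inl 0, Inr 2), (Inl 0, Inr 3),
     (Inr 0, Inr (Suc 0)), (Inr (Suc 0), Inr 2), (Inr 2, Inr 3)}"
  unfolding path_graph_1 path_graph_4 graph_join_def by (auto simp: explicit_edges)

lemma fan_graph_4_degree:
  "{v \<in> pverts (fan_graph 4). out_degree (with_proj (fan_graph 4)) v = 3} = {Inr (Suc 0), Inr 2}"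
proof -
  define A where "A = parcs (fan_graph 4)"
  have o: "out_degree (with_proj (fan_graph 4)) v = card (A `` {v})" for v
  proof -
    have "out_arcs (with_proj (fan_graph 4)) v = Pair v ` (A `` {v})"
      by (auto simp: out_arcs_def A_def)
    then show ?thesis unfolding out_degree_def by (simp add: card_image inj_on_def)
  qed
  have "A `` {Inl 0} = {Inr 0, Inr (Suc 0), Inr 2, Inr 3}"
    "A `` {Inr 0} = {Inl 0, Inr (Suc 0)}"
    "A `` {Inr (Suc 0)} = {Inl 0, Inr 0, Inr 2}"
    "A `` {Inr 2} = {Inl 0, Inr (Suc 0), Inr 3}"
    "A `` {Inr 3} = {Inl 0, Inr 2}"
    unfolding A_def fan_graph_4(2) sy_def Image_singleton by force+
  then have "card (A `` {Inl 0}) = 4" "card (A `` {Inr 0}) = 2" "card (A `` {Inr (Suc 0)}) = 3"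
    "card (A `` {Inr 2}) = 3" "card (A `` {Inr 3}) = 2" by simp_all
  then show ?thesis unfolding o fan_graph_4(1) by auto
qed

lemma graph_H_eq:
  "pverts graph_H = {None, Some (Inl 0), Some (Inr 0), Some (Inr (Suc 0)), Some (Inr 2), Some (Inr 3)}"
  "parcs graph_H = sy {(Some (Inl 0), Some (Inr 0)), (Some (Inl 0), Some (Inr (Suc 0))),
     (Some (Inl 0), Some (Inr 2)), (Some (Inl 0), Some (Inr 3)), (Some (Inr 0), Some (Inr (Suc 0))),
     (Some (Inr (Suc 0)), Some (Inr 2)), (Some (Inr 2), Some (Inr 3)),
     (None, Some (Inr (Suc 0))), (None, Some (Inr 2))}"
proof -
  have H: "graph_H = add_vertex {Inr (Suc 0), Inr 2} (fan_graph 4)"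
    unfolding graph_H_def Let_def fan_graph_4_degree ..
  show "pverts graph_H = {None, Some (Inl 0), Some (Inr 0), Some (Inr (Suc 0)), Some (Inr 2), Some (Inr 3)}"
    unfolding H add_vertex_def pair_pre_digraph.simps fan_graph_4 by simp
  show "parcs graph_H = sy {(Some (Inl 0), Some (Inr 0)), (Some (Inl 0), Some (Inr (Suc 0))),
     (Some (Inl 0), Some (Inr 2)), (Some (Inl 0), Some (Inr 3)), (Some (Inr 0), Some (Inr (Suc 0))),
     (Some (Inr (Suc 0)), Some (Inr 2)), (Some (Inr 2), Some (Inr 3)),
     (None, Some (Inr (Suc 0))), (None, Some (Inr 2))}"
    unfolding H add_vertex_def pair_pre_digraph.simps fan_graph_4 by (simp add: explicit_edges)
qed

lemma map_prod_sy: "map_prod f f ` sy E = sy (map_prod f f ` E)"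
  unfolding sy_def by (auto simp: image_iff)

lemma sun_label:
  "inj_on sun_label (pverts graph_H)" "sun_label ` pverts graph_H = {..<6}"
  "map_prod sun_label sun_label ` parcs graph_H = sy sun"
proof -
  have six: "{..<6::nat} = {0, 1, 2, 3, 4, 5}" by auto
  show "inj_on sun_label (pverts graph_H)"
    by (simp add: graph_H_eq inj_on_def sun_label_def)
  show "sun_label ` pverts graph_H = {..<6}"
    unfolding six graph_H_eq by (simp add: sun_label_def insert_commute)
  have "sy sun = sy {(0,1), (0,2), (0,4), (0,5), (1,2), (2,4), (4,5), (3,2), (3,4)}"
    unfolding sun_list_def by (simp add: explicit_edges)
  then show "map_prod sun_label sun_label ` parcs graph_H = sy sun"
    unfolding graph_H_eq map_prod_sy by (simp add: sun_label_def)
qed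

lemma sun_label':
  "inj_on sun_label' (pverts graph_H)" "sun_label' ` pverts graph_H = {..<6}"
  "map_prod sun_label' sun_label' ` parcs graph_H = sy sun'"
proof -
  have six: "{..<6::nat} = {0, 1, 2, 3, 4, 5}" by auto
  show "inj_on sun_label' (pverts graph_H)"
    by (simp add: graph_H_eq inj_on_def sun_label'_def)
  show "sun_label' ` pverts graph_H = {..<6}"
    unfolding six graph_H_eq by (simp add: sun_label'_def insert_commute)
  have "sy sun' = sy {(1,2), (1,3), (1,5), (1,0), (2,3), (3,5), (5,0), (4,3), (4,5)}"
    unfolding sun_list'_def by (simp add: explicit_edges)
  then show "map_prod sun_label' sun_label' ` parcs graph_H = sy sun'"
    unfolding graph_H_eq map_prod_sy by (simp add: sun_label'_def)
qed

lemma graph_H_arcs: "parcs graph_H \<subseteq> pverts graph_H \<times> pverts graph_H"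
  unfolding graph_H_eq by (simp add: sy_insert)

theorem maximiser_iso:
  assumes nc: "ncl R xs" and sym: "sym R" and irr: "irrefl R" and S: "S \<subseteq> set xs"
    and y: "0 < nrm S y" and max: "rmax (card S) * nrm S y \<le> qf (R \<inter> S \<times> S) y"
  shows "card S \<noteq> 6 \<Longrightarrow> digraph_iso (with_proj (fan_graph (card S - 1))) (with_proj \<lparr> pverts = S, parcs = R \<inter> S \<times> S \<rparr>)"
    and "card S = 6 \<Longrightarrow> digraph_iso (with_proj graph_H) (with_proj \<lparr> pverts = S, parcs = R \<inter> S \<times> S \<rparr>)"
proof -
  obtain E g where E: "admissible (card S) E" "bij_betw g {..<card S} S" "R \<inter> S \<times> S = map_prod g g ` sy E"
    and q: "\<forall>y. qf (R \<inter> S \<times> S) y = qf (sy E) (y \<circ> g)" "\<forall>y. nrm S y = nrm {..<card S} (y \<circ> g)"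
    by (rule induced_to_nat[OF nc sym irr S])
  have max': "0 < nrm {..<card S} (y \<circ> g)" "rmax (card S) * nrm {..<card S} (y \<circ> g) \<le> qf (sy E) (y \<circ> g)"
    using y max unfolding q[rule_format] .
  show "digraph_iso (with_proj graph_H) (with_proj \<lparr> pverts = S, parcs = R \<inter> S \<times> S \<rparr>)" if "card S = 6"
  proof -
    have "E = sun \<or> E = sun'" using maximiser_sun[of E "y \<circ> g"] E(1) max' that by simp
    then show ?thesis
    proof
      assume "E = sun"
      then show ?thesis
        using E(2,3) that by (intro digraph_iso_comp_image[OF graph_H_arcs sun_label, of g]) simp_all
    next
      assume "E = sun'"
      then show ?thesis
        using E(2,3) that by (intro digraph_iso_comp_image[OF graph_H_arcs sun_label', of g]) simp_all
    qed
  qed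
  show "digraph_iso (with_proj (fan_graph (card S - 1))) (with_proj \<lparr> pverts = S, parcs = R \<inter> S \<times> S \<rparr>)" if "card S \<noteq> 6"
  proof -
    define q where "q = card S - 1"
    have "card S \<noteq> 0" using y S finite_subset[OF S] by (auto simp: nrm_def card_eq_0_iff)
    then have q: "card S = Suc q" "q \<noteq> 5" using that by (auto simp: q_def)
    obtain h where h: "bij_betw h {..q} {..q}" "sy E = map_prod h h ` sy (fan_edges q)"
      using maximiser_fan[of q E "y \<circ> g"] E(1) max' q by metis
    have "bij_betw (g \<circ> h) {..q} S" using h(1) E(2) q(1) by (auto simp: lessThan_Suc_atMost intro: bij_betw_trans)
    moreover have "R \<inter> S \<times> S = map_prod (g \<circ> h) (g \<circ> h) ` sy (fan_edges q)"
      unfolding E(3) h(2) image_comp by (simp add: map_prod_compose)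
    ultimately show ?thesis
      using digraph_iso_comp_image[OF fan_graph_label(4,1,2,3)] unfolding q_def by blast
  qed
qed

section \<open>The sign parts of a second eigenvector\<close>

lemma ncl_mono: "ncl R xs \<Longrightarrow> R' \<subseteq> R \<Longrightarrow> ncl R' xs"
  unfolding ncl_def by blast

lemma cut_connected_mono: "cut_connected V R \<Longrightarrow> R \<subseteq> R' \<Longrightarrow> cut_connected V R'"
  unfolding cut_connected_def by (meson subsetD)

lemma cut_connected_join:
  assumes P: "cut_connected P R" and N: "cut_connected N R" and ab: "a \<in> P" "b \<in> N" "P \<inter> N = {}"
    "(a, b) \<in> R" "(b, a) \<in> R"
  shows "cut_connected (P \<union> N) R"
  unfolding cut_connected_def
proof (intro allI impI)
  fix X assume X: "X \<subseteq> P \<union> N" "X \<noteq> {}" "X \<noteq> P \<union> N"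
  have part: "\<exists>u\<in>X. \<exists>v\<in>P \<union> N - X. (u, v) \<in> R"
    if Q: "cut_connected Q R" "Q \<subseteq> P \<union> N" "X \<inter> Q \<noteq> {}" "\<not> Q \<subseteq> X" for Q
  proof -
    have "X \<inter> Q \<subseteq> Q" "X \<inter> Q \<noteq> Q" using Q by auto
    then obtain u v where "u \<in> X \<inter> Q" "v \<in> Q - X \<inter> Q" "(u, v) \<in> R"
      using Q(1,3) unfolding cut_connected_def by metis
    then show ?thesis using Q(2) by blast
  qed
  show "\<exists>u\<in>X. \<exists>v\<in>P \<union> N - X. (u, v) \<in> R"
  proof (cases "(X \<inter> P \<noteq> {} \<and> \<not> P \<subseteq> X) \<or> (X \<inter> N \<noteq> {} \<and> \<not> N \<subseteq> X)")
    case True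
    then show ?thesis using part[OF P] part[OF N] by blast
  next
    case False
    then have "X = P \<or> X = N" using X by blast
    then show ?thesis using ab by blast
  qed
qed

text \<open>\<open>a\<close> and \<open>b\<close> are the weights of the two sign parts,
  \<open>s\<close> and \<open>s'\<close> the cross weights before and after a change of edges,
  \<open>d\<close> the gain inside one part. The expression is a sum of three nonnegative terms, not
  all zero.\<close>

lemma two_block_positive:
  fixes a b d s s' :: real
  assumes "0 \<le> d" "0 < s" "0 \<le> s'" "s' \<le> s" "s' < s \<or> 0 < d" "a \<noteq> 0 \<or> b \<noteq> 0"
  shows "0 < (d + s) * a\<^sup>2 + s * b\<^sup>2 - 2 * (a * b) * s'"
proof -
  have e: "(d + s) * a\<^sup>2 + s * b\<^sup>2 - 2 * (a * b) * s' = d * a\<^sup>2 + (s - s') * (a\<^sup>2 + b\<^sup>2) + s' * (a - b)\<^sup>2"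
    by (simp add: power2_eq_square algebra_simps)
  have nn: "0 \<le> d * a\<^sup>2" "0 \<le> (s - s') * (a\<^sup>2 + b\<^sup>2)" "0 \<le> s' * (a - b)\<^sup>2" using assms by simp_all
  show ?thesis
  proof (cases "s' < s")
    case True
    have "0 < a\<^sup>2 + b\<^sup>2" using assms(6) by (auto simp: add_pos_nonneg add_nonneg_pos)
    then have "0 < (s - s') * (a\<^sup>2 + b\<^sup>2)" using True by simp
    then show ?thesis unfolding e using nn by linarith
  next
    case False
    then have d: "0 < d" "s' = s" using assms by auto
    show ?thesis
    proof (cases "a = 0")
      case True
      then show ?thesis using assms d by simp
    next
      case False
      then have "0 < d * a\<^sup>2" using d by simp
      then show ?thesis unfolding e using nn by linarith
    qed
  qed
qed

locale signed_eigenvector =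
  fixes V :: "'a set" and R :: "('a \<times> 'a) set" and xs :: "'a list" and x :: "'a \<Rightarrow> real" and c :: real
  assumes fin: "finite V" and arcs: "R \<subseteq> V \<times> V" and symR: "sym R" and irr: "irrefl R"
    and nc: "ncl R xs" and verts: "set xs = V"
    and eig: "\<And>u. u \<in> V \<Longrightarrow> sum x (R `` {u}) = c * x u"
    and pos: "\<exists>u\<in>V. 0 < x u" and neg: "\<exists>u\<in>V. x u < 0"
    and con: "cut_connected V R"
begin

definition "P = {u \<in> V. 0 < x u}"
definition "N = {u \<in> V. x u < 0}"

lemma PN: "P \<subseteq> V" "N \<subseteq> V" "P \<inter> N = {}" "P \<noteq> {}" "N \<noteq> {}" "finite P" "finite N" "finite R"
  using pos neg fin arcs by (auto simp: P_def N_def intro: finite_subset)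

lemma swap: "(u, v) \<in> R \<longleftrightarrow> (v, u) \<in> R"
  using symR by (auto dest: symD)

text \<open>Multiply the eigenvalue equation at \<open>u\<close> by \<open>x u\<close>, sum over
  \<open>X\<close>, and separate the neighbours in \<open>X\<close> from the others.\<close>

lemma part_qf:
  assumes X: "X \<subseteq> V"
  shows "qf (R \<inter> X \<times> X) x = c * nrm X x - (\<Sum>(u, w)\<in>R \<inter> X \<times> (V - X). x u * x w)"
proof -
  have fX: "finite X" using X fin by (rule finite_subset)
  have "c * nrm X x = (\<Sum>u\<in>X. c * (x u)\<^sup>2)" by (simp add: nrm_def sum_distrib_left)
  also have "\<dots> = (\<Sum>u\<in>X. x u * sum x (R `` {u}))"
    using X eig by (intro sum.cong) (auto simp: power2_eq_square)
  also have "\<dots> = (\<Sum>u\<in>X. \<Sum>w\<in>R `` {u}. x u * x w)" by (simp add: sum_distrib_left)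
  also have "\<dots> = (\<Sum>(u, w)\<in>R \<inter> X \<times> V. x u * x w)"
  proof -
    have "finite (R `` {u})" for u using PN(8) by (rule finite_Image) 
    then have "(\<Sum>u\<in>X. \<Sum>w\<in>R `` {u}. x u * x w) = (\<Sum>(u, w)\<in>Sigma X (\<lambda>u. R `` {u}). x u * x w)"
      using fX by (intro sum.Sigma) auto
    also have "Sigma X (\<lambda>u. R `` {u}) = R \<inter> X \<times> V" using arcs by auto
    finally show ?thesis .
  qed
  also have "R \<inter> X \<times> V = (R \<inter> X \<times> X) \<union> (R \<inter> X \<times> (V - X))" using X by auto
  also have "(\<Sum>(u, w)\<in>(R \<inter> X \<times> X) \<union> (R \<inter> X \<times> (V - X)). x u * x w) =
      qf (R \<inter> X \<times> X) x + (\<Sum>(u, w)\<in>R \<inter> X \<times> (V - X). x u * x w)"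
    unfolding qf_def using PN(8) by (intro sum.union_disjoint) auto
  finally show ?thesis by simp
qed

lemma cross_nonpos:
  assumes X: "X \<subseteq> P" and cl: "\<And>u w. u \<in> X \<Longrightarrow> w \<in> P - X \<Longrightarrow> (u, w) \<notin> R"
    and uw: "(u, w) \<in> R \<inter> X \<times> (V - X)"
  shows "x u * x w \<le> 0"
proof -
  have "0 < x u" "w \<notin> P" "w \<in> V" using X uw cl by (auto simp: P_def)
  then show ?thesis by (auto simp: P_def intro: mult_nonneg_nonpos)
qed

text \<open>No edge leaves \<open>X\<close> towards another positive vertex, so the cross sum in
  \<open>part_qf\<close> is nonpositive and the quotient on \<open>X\<close> is at least
  \<open>c\<close>; by \<open>induced_bound\<close> it is at most \<open>rmax (card X)\<close>. If
  the bounds meet, all cross terms vanish, which excludes edges to negative vertices. Proper subsets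
  \<open>X\<close> of \<open>P\<close> serve to show that \<open>P\<close> is connected.\<close>

lemma closed_part:
  assumes X: "X \<subseteq> P" "X \<noteq> {}" and cl: "\<And>u w. u \<in> X \<Longrightarrow> w \<in> P - X \<Longrightarrow> (u, w) \<notin> R"
  shows "c \<le> rmax (card X)" "0 < nrm X x"
    and "rmax (card X) \<le> c \<Longrightarrow> rmax (card X) * nrm X x \<le> qf (R \<inter> X \<times> X) x"
    and "rmax (card X) \<le> c \<Longrightarrow> u \<in> X \<Longrightarrow> w \<in> N \<Longrightarrow> (u, w) \<notin> R"
proof -
  define k where "k = (\<Sum>(u, w)\<in>R \<inter> X \<times> (V - X). x u * x w)"
  have XV: "X \<subseteq> V" "finite X" using X PN by (auto intro: finite_subset)
  have k: "k \<le> 0" unfolding k_def using cross_nonpos[OF X(1) cl] by (intro sum_nonpos) auto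
  have q: "qf (R \<inter> X \<times> X) x = c * nrm X x - k" unfolding k_def by (rule part_qf[OF XV(1)])
  have b: "qf (R \<inter> X \<times> X) x \<le> rmax (card X) * nrm X x"
    using XV X(2) verts by (intro induced_bound[OF nc symR irr]) auto
  show n: "0 < nrm X x"
  proof -
    obtain u where "u \<in> X" using X by auto
    then show ?thesis using XV X(1) by (intro nrm_pos[of _ u]) (auto simp: P_def)
  qed
  have "c * nrm X x \<le> rmax (card X) * nrm X x" using q b k by linarith
  then show "c \<le> rmax (card X)" using n by simp
  assume t: "rmax (card X) \<le> c"
  have t': "rmax (card X) * nrm X x \<le> c * nrm X x" using t n by (intro mult_right_mono) auto
  then show "rmax (card X) * nrm X x \<le> qf (R \<inter> X \<times> X) x" using q k by linarith
  have k0: "k = 0" using q k b t' by linarith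
  assume u: "u \<in> X" and w: "w \<in> N"
  show "(u, w) \<notin> R"
  proof
    assume "(u, w) \<in> R"
    moreover have "w \<in> V - X" using w X(1) PN(2,3) by auto
    ultimately have uw: "(u, w) \<in> R \<inter> X \<times> (V - X)" using u by auto
    have "0 < x u" "x w < 0" using u w X(1) by (auto simp: P_def N_def)
    then have "x u * x w < 0" by (rule mult_pos_neg)
    moreover have "k \<le> (case (u, w) of (u, w) \<Rightarrow> x u * x w)"
      unfolding k_def using PN(8) cross_nonpos[OF X(1) cl] uw
      by (subst sum.remove[OF _ uw]) (auto intro!: sum_nonpos)
    ultimately show False using k0 by simp
  qed
qed

lemma P_part: "c \<le> rmax (card P)" "0 < nrm P x"
   "rmax (card P) \<le> c \<Longrightarrow> rmax (card P) * nrm P x \<le> qf (R \<inter> P \<times> P) x"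
   "rmax (card P) \<le> c \<Longrightarrow> u \<in> P \<Longrightarrow> w \<in> N \<Longrightarrow> (u, w) \<notin> R"
proof -
  note c = closed_part[OF order_refl PN(4)]
  show "c \<le> rmax (card P)" "0 < nrm P x" by (rule c(1), simp, rule c(2), simp)
  show "rmax (card P) * nrm P x \<le> qf (R \<inter> P \<times> P) x" if "rmax (card P) \<le> c"
    using that by (intro c(3)) simp_all
  show "(u, w) \<notin> R" if "rmax (card P) \<le> c" "u \<in> P" "w \<in> N"
    by (rule c(4)) (use that in simp_all)
qed

lemma card_P: "1 \<le> card P" "rmax k \<le> c \<Longrightarrow> 1 \<le> k \<Longrightarrow> k \<le> card P" "rmax k < c \<Longrightarrow> 1 \<le> k \<Longrightarrow> k < card P"
proof -
  show 1: "1 \<le> card P" using PN by (simp add: Suc_le_eq card_gt_0_iff)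
  show "k \<le> card P" if "rmax k \<le> c" "1 \<le> k"
    using rmax_less[OF 1, of k] that P_part(1) by (meson leD leI order_trans)
  show "k < card P" if "rmax k < c" "1 \<le> k"
    using rmax_mono[OF 1, of k] that P_part(1) by (meson leD leI order_trans)
qed


text \<open>Negating the eigenvector exchanges \<open>P\<close> and \<open>N\<close>, so every fact
  about \<open>P\<close> has a counterpart for \<open>N\<close>.\<close>

lemma minus: "signed_eigenvector V R xs (\<lambda>u. - x u) c"
proof
  show "sum (\<lambda>u. - x u) (R `` {u}) = c * - x u" if "u \<in> V" for u
    using eig[OF that] by (simp add: sum_negf)
qed (use fin arcs symR irr nc verts con pos neg in auto)

lemma minus_simps: "signed_eigenvector.P V (\<lambda>u. - x u) = N" "signed_eigenvector.N V (\<lambda>u. - x u) = P"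
  "nrm X (\<lambda>u. - x u) = nrm X x" "qf D (\<lambda>u. - x u) = qf D x"
  unfolding signed_eigenvector.P_def[OF minus] signed_eigenvector.N_def[OF minus]
  by (auto simp: P_def N_def nrm_def qf_def)

lemmas N_part = signed_eigenvector.P_part[OF minus, unfolded minus_simps]
lemmas card_N = signed_eigenvector.card_P[OF minus, unfolded minus_simps]
lemmas closed_part_N = signed_eigenvector.closed_part[OF minus, unfolded minus_simps]

lemma card_PN: "card P + card N = card (P \<union> N)" "card (P \<union> N) \<le> card V"
proof -
  show "card P + card N = card (P \<union> N)" using card_Un_disjoint[OF PN(6,7,3)] by simp
  show "card (P \<union> N) \<le> card V" using PN(1,2) by (intro card_mono fin) simp
qed

text \<open>Both parts have at least \<open>m\<close> of the \<open>2 * m + 1\<close> vertices, so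
  one has exactly \<open>m\<close>. For that part the bounds in \<open>closed_part\<close> meet,
  which rules out edges between the parts. Connectivity then requires a vertex outside both, and
  counting leaves room for one only.\<close>

theorem odd_structure:
  assumes n: "card V = 2 * m + 1" and m: "1 \<le> m" "rmax m \<le> c"
  obtains w where "w \<in> V" "V = insert w (P \<union> N)" "w \<notin> P \<union> N" "card P = m" "card N = m"
    "R \<inter> P \<times> N = {}" "R \<inter> N \<times> P = {}"
    "rmax m * nrm P x \<le> qf (R \<inter> P \<times> P) x" "rmax m * nrm N x \<le> qf (R \<inter> N \<times> N) x"
proof -
  have ge: "m \<le> card P" "m \<le> card N" using card_P(2) card_N(2) m by auto
  have PN0: "R \<inter> P \<times> N = {}" "R \<inter> N \<times> P = {}"
  proof -
    have "card P = m \<or> card N = m" using ge card_PN n by linarith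
    then have "\<forall>u\<in>P. \<forall>w\<in>N. (u, w) \<notin> R"
      using P_part(4) N_part(4) m(2) swap by blast
    then show "R \<inter> P \<times> N = {}" "R \<inter> N \<times> P = {}" using swap by blast+
  qed
  have "P \<union> N \<noteq> V"
  proof
    assume V: "P \<union> N = V"
    then have "P \<noteq> V" "V - P = N" using PN by auto
    then obtain u w where "u \<in> P" "w \<in> N" "(u, w) \<in> R" using con PN(1,4) unfolding cut_connected_def by metis
    then show False using PN0 by blast
  qed
  then obtain w where w: "w \<in> V" "w \<notin> P \<union> N" using PN by blast
  have "card (insert w (P \<union> N)) \<le> card V" using w PN fin by (intro card_mono) auto
  then have c: "card P = m" "card N = m" using ge card_PN n w PN by auto
  have "V = insert w (P \<union> N)"
    by (rule card_subset_eq[symmetric, OF fin]) (use w PN c n card_PN in auto)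
  then show ?thesis using that[OF w(1) _ w(2) c PN0] P_part(3) N_part(3) c m(2) by simp
qed

text \<open>On the plane spanned by the restrictions of \<open>x\<close> to \<open>P\<close> and
  \<open>N\<close>, the form minus \<open>c\<close> times the norm is a binary quadratic form in the
  weights. For \<open>R\<close> it is \<open>s * (a - b)\<^sup>2\<close>, which vanishes at
  \<open>x\<close>; losing a cross edge or gaining an edge inside \<open>P\<close> makes it positive
  definite.\<close>

lemma strict_gain:
  assumes V: "V = P \<union> N" and R': "R' \<subseteq> V \<times> V" "sym R'" "irrefl R'"
    and N: "R' \<inter> N \<times> N = R \<inter> N \<times> N" and P: "R \<inter> P \<times> P \<subseteq> R' \<inter> P \<times> P"
    and X: "R' \<inter> P \<times> N \<subseteq> R \<inter> P \<times> N" and ne: "R \<inter> P \<times> N \<noteq> {}"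
    and new: "R' \<inter> P \<times> N \<noteq> R \<inter> P \<times> N \<or> R' \<inter> P \<times> P \<noteq> R \<inter> P \<times> P"
  shows "c < lambda2 \<lparr> pverts = V, parcs = R' \<rparr>"
proof -
  have fR': "finite R'" using R'(1) fin by (auto intro: finite_subset)
  define k where "k D = (\<Sum>(u, w)\<in>D \<inter> P \<times> N. - (x u * x w))" for D :: "('a \<times> 'a) set"
  have pw: "0 < - (x u * x w)" if "u \<in> P" "w \<in> N" for u w
    using that by (simp add: P_def N_def mult_pos_neg)
  define s s' d where "s = k R" and "s' = k R'" and "d = qf (R' \<inter> P \<times> P) x - qf (R \<inter> P \<times> P) x"
  have qP: "qf (R \<inter> P \<times> P) x = c * nrm P x + s"
  proof -
    have "V - P = N" using V PN by auto
    then show ?thesis using part_qf[OF PN(1)] by (simp add: s_def k_def sum_negf split_beta)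
  qed
  have qN: "qf (R \<inter> N \<times> N) x = c * nrm N x + s"
  proof -
    have "V - N = P" using V PN by auto
    moreover have "(\<Sum>(u, w)\<in>R \<inter> N \<times> P. x u * x w) = (\<Sum>(u, w)\<in>R \<inter> P \<times> N. x u * x w)"
      by (rule sum.reindex_bij_witness[of _ prod.swap prod.swap]) (auto simp: swap)
    ultimately show ?thesis using part_qf[OF PN(2)] by (simp add: s_def k_def sum_negf split_beta)
  qed
  have d0: "0 \<le> d" unfolding d_def qf_def
    using P fR' by (simp, intro sum_mono2) (auto simp: P_def)
  have s0: "0 < s" unfolding s_def k_def using ne pw PN(8) by (intro sum_pos) auto
  have s'0: "0 \<le> s'" unfolding s'_def k_def using pw by (intro sum_nonneg) (auto intro: less_imp_le)
  have ss: "s' \<le> s" unfolding s_def s'_def k_def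
    using X PN(8) pw by (intro sum_mono2) (auto intro: less_imp_le)
  have strict: "s' < s \<or> 0 < d"
    using new
  proof
    assume "R' \<inter> P \<times> N \<noteq> R \<inter> P \<times> N"
    then obtain u w where uw: "(u, w) \<in> R \<inter> P \<times> N" "(u, w) \<notin> R' \<inter> P \<times> N" using X by auto
    have "s' < s" unfolding s_def s'_def k_def
      by (rule sum_strict_mono2[where b = "(u, w)"]) (use uw X PN(8) pw in \<open>auto intro: less_imp_le\<close>)
    then show ?thesis ..
  next
    assume "R' \<inter> P \<times> P \<noteq> R \<inter> P \<times> P"
    then obtain u w where uw: "(u, w) \<in> R' \<inter> P \<times> P" "(u, w) \<notin> R \<inter> P \<times> P" using P by auto
    have "qf (R \<inter> P \<times> P) x < qf (R' \<inter> P \<times> P) x" unfolding qf_def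
      by (rule sum_strict_mono2[where b = "(u, w)"]) (use uw P fR' in \<open>auto simp: P_def\<close>)
    then show ?thesis by (simp add: d_def)
  qed
  define y z where "y = (\<lambda>u. if u \<in> P then x u else 0)" and "z = (\<lambda>u. if u \<in> N then x u else 0)"
  have G': "pair_graph \<lparr> pverts = V, parcs = R' \<rparr>" by (rule pair_graphI[OF fin R'])
  have c2: "2 \<le> card V" using card_PN card_P(1) card_N(1) by linarith
  obtain a b where ab: "a \<noteq> 0 \<or> b \<noteq> 0"
    "qf R' (\<lambda>u. a * y u + b * z u) \<le> lambda2 \<lparr> pverts = V, parcs = R' \<rparr> * nrm V (\<lambda>u. a * y u + b * z u)"
    using lambda2_plane[OF G', of y z] c2 by auto
  define t where "t = (\<lambda>u. a * y u + b * z u)"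
  have tP: "t u = a * x u" if "u \<in> P" for u using that PN(3) by (auto simp: t_def y_def z_def)
  have tN: "t u = b * x u" if "u \<in> N" for u using that PN(3) by (auto simp: t_def y_def z_def)
  have "R' = ((R' \<inter> P \<times> P) \<union> (R' \<inter> N \<times> N)) \<union> ((R' \<inter> P \<times> N) \<union> (R' \<inter> N \<times> P))"
    using R'(1) V by auto
  then have "qf R' t = qf (((R' \<inter> P \<times> P) \<union> (R' \<inter> N \<times> N)) \<union> ((R' \<inter> P \<times> N) \<union> (R' \<inter> N \<times> P))) t" by simp
  also have "\<dots> = qf ((R' \<inter> P \<times> P) \<union> (R' \<inter> N \<times> N)) t + qf ((R' \<inter> P \<times> N) \<union> (R' \<inter> N \<times> P)) t"
    unfolding qf_def using fR' PN(3) by (intro sum.union_disjoint) auto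
  also have "qf ((R' \<inter> P \<times> P) \<union> (R' \<inter> N \<times> N)) t = qf (R' \<inter> P \<times> P) t + qf (R' \<inter> N \<times> N) t"
    unfolding qf_def using fR' PN(3) by (intro sum.union_disjoint) auto
  also have "qf ((R' \<inter> P \<times> N) \<union> (R' \<inter> N \<times> P)) t = qf (R' \<inter> P \<times> N) t + qf (R' \<inter> N \<times> P) t"
    unfolding qf_def using fR' PN(3) by (intro sum.union_disjoint) auto
  also have "qf (R' \<inter> N \<times> P) t = qf (R' \<inter> P \<times> N) t"
    unfolding qf_def using R'(2)
    by (intro sum.reindex_bij_witness[of _ prod.swap prod.swap]) (auto dest: symD)
  also have "qf (R' \<inter> P \<times> P) t = a\<^sup>2 * qf (R' \<inter> P \<times> P) x"
    unfolding qf_def sum_distrib_left using tP by (intro sum.cong) (auto simp: power2_eq_square)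
  also have "qf (R' \<inter> N \<times> N) t = b\<^sup>2 * qf (R' \<inter> N \<times> N) x"
    unfolding qf_def sum_distrib_left using tN by (intro sum.cong) (auto simp: power2_eq_square)
  also have "qf (R' \<inter> P \<times> N) t = - (a * b) * s'"
    unfolding qf_def s'_def k_def sum_distrib_left using tP tN by (intro sum.cong) auto
  finally have q: "qf R' t = a\<^sup>2 * (c * nrm P x + s + d) + b\<^sup>2 * (c * nrm N x + s) - 2 * (a * b) * s'"
    using qP qN unfolding N d_def by simp
  have "nrm V t = nrm (P \<union> N) t" by (rule arg_cong[OF V, of "\<lambda>X. nrm X t"])
  also have "\<dots> = nrm P t + nrm N t" unfolding nrm_def by (rule sum.union_disjoint[OF PN(6,7,3)])
  also have "nrm P t = a\<^sup>2 * nrm P x"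
    unfolding nrm_def sum_distrib_left using tP by (intro sum.cong) (auto simp: power_mult_distrib)
  also have "nrm N t = b\<^sup>2 * nrm N x"
    unfolding nrm_def sum_distrib_left using tN by (intro sum.cong) (auto simp: power_mult_distrib)
  finally have n: "nrm V t = a\<^sup>2 * nrm P x + b\<^sup>2 * nrm N x" .
  have "c * nrm V t < qf R' t"
    using two_block_positive[OF d0 s0 s'0 ss strict ab(1)] unfolding q n by (simp add: algebra_simps)
  also have "\<dots> \<le> lambda2 \<lparr> pverts = V, parcs = R' \<rparr> * nrm V t" using ab(2) unfolding t_def .
  finally show ?thesis using nrm_nonneg[of V t] by (simp add: mult_less_cancel_right)
qed

text \<open>By the strict lower bound every set whose form reaches \<open>c\<close> has at least
  \<open>m\<close> vertices, which fixes the sizes and excludes a splitting of \<open>P\<close> or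
  \<open>N\<close>; for \<open>m = 1\<close> nonemptiness is enough. The other claims are exchange
  arguments against \<open>maxi\<close>, where the work lies in keeping the changed graph connected
  and outerplanar.\<close>

theorem even_structure:
  assumes n: "card V = 2 * m" and m: "1 \<le> m" and low: "2 \<le> m \<Longrightarrow> rmax (m - 1) < c"
    and maxi: "\<And>R'. R' \<subseteq> V \<times> V \<Longrightarrow> sym R' \<Longrightarrow> irrefl R' \<Longrightarrow> cut_connected V R' \<Longrightarrow>
      outerplanar \<lparr> pverts = V, parcs = R' \<rparr> \<Longrightarrow> lambda2 \<lparr> pverts = V, parcs = R' \<rparr> \<le> c"
  shows "V = P \<union> N" "card P = m" "card N = m" "c \<le> rmax m"
    and "edge_maximal_outerplanar \<lparr> pverts = P, parcs = R \<inter> P \<times> P \<rparr>"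
    and "\<exists>a b. a \<in> P \<and> b \<in> N \<and> R \<inter> P \<times> N = {(a, b)}"
proof -
  have large: "m \<le> card X" if "X \<noteq> {}" "finite X" "c \<le> rmax (card X)" for X :: "'a set"
  proof (rule ccontr)
    assume "\<not> m \<le> card X"
    moreover have "1 \<le> card X" using that by (simp add: Suc_le_eq card_gt_0_iff)
    ultimately have "2 \<le> m" "rmax (card X) \<le> rmax (m - 1)" by (auto intro!: rmax_mono)
    then show False using low that(3) by simp
  qed
  have "m \<le> card P" "m \<le> card N" using large P_part(1) N_part(1) PN by simp_all
  then show cP: "card P = m" and cN: "card N = m" using card_PN n by linarith+
  show V: "V = P \<union> N"
    by (rule card_subset_eq[symmetric, OF fin]) (use PN cP cN card_PN n in auto)
  show "c \<le> rmax m" using P_part(1) cP by simp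
  have conP: "cut_connected P R"
    unfolding cut_connected_def
  proof (intro allI impI)
    fix X assume X: "X \<subseteq> P" "X \<noteq> {}" "X \<noteq> P"
    have fX: "finite X" using X(1) PN(6) by (rule finite_subset)
    show "\<exists>u\<in>X. \<exists>v\<in>P - X. (u, v) \<in> R"
    proof (rule ccontr)
      assume no: "\<not> ?thesis"
      have "c \<le> rmax (card X)" by (rule closed_part(1)[OF X(1,2)]) (use no in blast)
      then have "m \<le> card X" using large X(2) fX by blast
      then show False using X cP card_seteq[OF PN(6) X(1)] by simp
    qed
  qed
  have conN: "cut_connected N R"
    unfolding cut_connected_def
  proof (intro allI impI)
    fix X assume X: "X \<subseteq> N" "X \<noteq> {}" "X \<noteq> N"
    have fX: "finite X" using X(1) PN(7) by (rule finite_subset)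
    show "\<exists>u\<in>X. \<exists>v\<in>N - X. (u, v) \<in> R"
    proof (rule ccontr)
      assume no: "\<not> ?thesis"
      have "c \<le> rmax (card X)" by (rule closed_part_N(1)[OF X(1,2)]) (use no in blast)
      then have "m \<le> card X" using large X(2) fX by blast
      then show False using X cN card_seteq[OF PN(7) X(1)] by simp
    qed
  qed
  obtain a b where ab: "a \<in> P" "b \<in> N" "(a, b) \<in> R"
  proof -
    have "P \<noteq> V" "V - P = N" using V PN by auto
    then show ?thesis using con PN(1,4) that unfolding cut_connected_def by metis
  qed
  have gain: False if R': "R' \<subseteq> V \<times> V" "sym R'" "irrefl R'" "cut_connected V R'"
      "outerplanar \<lparr> pverts = V, parcs = R' \<rparr>"
    and eqs: "R' \<inter> N \<times> N = R \<inter> N \<times> N" "R \<inter> P \<times> P \<subseteq> R' \<inter> P \<times> P" "R' \<inter> P \<times> N \<subseteq> R \<inter> P \<times> N"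
      "R' \<inter> P \<times> N \<noteq> R \<inter> P \<times> N \<or> R' \<inter> P \<times> P \<noteq> R \<inter> P \<times> P" for R'
  proof -
    have "R \<inter> P \<times> N \<noteq> {}" using ab by auto
    then have "c < lambda2 \<lparr> pverts = V, parcs = R' \<rparr>" by (intro strict_gain[OF V R'(1-3) eqs(1-3) _ eqs(4)])
    then show False using maxi[OF R'] by simp
  qed
  have one: "R \<inter> P \<times> N = {(a, b)}"
  proof (rule ccontr)
    assume "\<not> ?thesis"
    then obtain p q where pq: "p \<in> P" "q \<in> N" "(p, q) \<in> R" "(p, q) \<noteq> (a, b)" using ab by auto
    \<comment> \<open>A second cross edge can be deleted: both parts are connected by themselves and
      remain joined through \<open>ab\<close>.\<close>
    define R' where "R' = R - {(p, q), (q, p)}"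
    have sub: "R' \<subseteq> R" "R' \<subseteq> V \<times> V" "sym R'" "irrefl R'"
      using arcs swap irr by (auto simp: R'_def sym_def irrefl_def)
    have in': "(u, v) \<in> R'" if "(u, v) \<in> R" "u \<in> P \<and> v \<in> P \<or> u \<in> N \<and> v \<in> N" for u v
      using that pq PN(3) by (auto simp: R'_def)
    have "cut_connected P R'" "cut_connected N R'"
      using conP conN in' unfolding cut_connected_def by (meson DiffD1 subsetD)+
    moreover have "(a, b) \<in> R'" "(b, a) \<in> R'" using ab pq PN(3) swap by (auto simp: R'_def)
    ultimately have "cut_connected (P \<union> N) R'" using ab PN(3) by (intro cut_connected_join[of P R' N a b])
    then have con': "cut_connected V R'" by (simp flip: V)
    have "outerplanar \<lparr> pverts = V, parcs = R' \<rparr>"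
      using ncl_outerplanar[OF pair_graphI[OF fin sub(2-4)], of xs] ncl_mono[OF nc sub(1)] verts by simp
    moreover have "R' \<inter> N \<times> N = R \<inter> N \<times> N" "R \<inter> P \<times> P \<subseteq> R' \<inter> P \<times> P" using in' sub(1) by auto
    moreover have "R' \<inter> P \<times> N \<noteq> R \<inter> P \<times> N" using pq by (auto simp: R'_def)
    ultimately show False using gain[OF sub(2-4) con'] sub(1) by blast
  qed
  then show "\<exists>a b. a \<in> P \<and> b \<in> N \<and> R \<inter> P \<times> N = {(a, b)}" using ab by blast
  have GP: "pair_graph \<lparr> pverts = P, parcs = R \<inter> P \<times> P \<rparr>"
    by (rule pair_graphI[OF PN(6)]) (use irr swap in \<open>auto simp: sym_def irrefl_def\<close>)
  have "outerplanar \<lparr> pverts = P, parcs = R \<inter> P \<times> P \<rparr>"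
  proof (rule ncl_outerplanar[OF GP])
    show "set (filter (\<lambda>v. v \<in> P) xs) = pverts \<lparr> pverts = P, parcs = R \<inter> P \<times> P \<rparr>" using verts PN(1) by auto
    show "ncl (parcs \<lparr> pverts = P, parcs = R \<inter> P \<times> P \<rparr>) (filter (\<lambda>v. v \<in> P) xs)"
      using ncl_mono[OF ncl_filter[of R "[]" xs "\<lambda>v. v \<in> P"], of "R \<inter> P \<times> P"] nc by simp
  qed
  moreover have "\<not> outerplanar (add_edge u v \<lparr> pverts = P, parcs = R \<inter> P \<times> P \<rparr>)"
    if uv: "u \<in> P" "v \<in> P" "u \<noteq> v" "(u, v) \<notin> R" for u v
  proof
    assume op: "outerplanar (add_edge u v \<lparr> pverts = P, parcs = R \<inter> P \<times> P \<rparr>)"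
    \<comment> \<open>The new edge need not fit into the order \<open>xs\<close>, so another order
      of \<open>V\<close> is built from one of \<open>P\<close> that ends in \<open>a\<close> and
      one of \<open>N\<close> that begins with \<open>b\<close>, joined across the bridge
      \<open>ab\<close>.\<close>
    define R' where "R' = R \<union> {(u, v), (v, u)}"
    have sub: "R \<subseteq> R'" "R' \<subseteq> V \<times> V" "sym R'" "irrefl R'"
      using arcs swap irr uv PN(1) by (auto simp: R'_def sym_def irrefl_def)
    have eq: "add_edge u v \<lparr> pverts = P, parcs = R \<inter> P \<times> P \<rparr> = \<lparr> pverts = P, parcs = R' \<inter> P \<times> P \<rparr>"
      using uv by (auto simp: add_edge_def R'_def)
    have "pair_graph \<lparr> pverts = P, parcs = R' \<inter> P \<times> P \<rparr>"
      by (rule pair_graphI[OF PN(6)]) (use sub in \<open>auto simp: sym_def irrefl_def\<close>)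
    from outerplanar_ncl[OF this op[unfolded eq]] obtain ps where ps: "set ps = P" "ncl (R' \<inter> P \<times> P) ps" by auto
    then have "ncl R' ps" using ncl_subset_edges[of "R' \<inter> P \<times> P" ps R'] by simp
    moreover obtain as bs where as: "ps = as @ a # bs" using split_list[of a ps, unfolded ps(1), OF ab(1)] by blast
    ultimately have n1: "ncl R' ((bs @ as) @ [a])" using ncl_rotate[OF sub(3), of "as @ [a]" bs] by simp
    define ns where "ns = filter (\<lambda>v. v \<in> N) xs"
    have ns: "set ns = N" using verts PN(2) by (auto simp: ns_def)
    have "ncl R ns" using ncl_filter[of R "[]" xs] nc by (simp add: ns_def)
    moreover have "R' \<inter> N \<times> N = R \<inter> N \<times> N" using uv PN(3) by (auto simp: R'_def)
    ultimately have "ncl R' ns" using ncl_subset_edges[of R ns R'] ns by auto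
    moreover obtain cs ds where cs: "ns = cs @ b # ds" using split_list[of b ns, unfolded ns, OF ab(2)] by blast
    ultimately have n2: "ncl R' (b # ds @ cs)" using ncl_rotate[OF sub(3), of cs "b # ds"] by simp
    have sets: "set (bs @ as) = P - {a}" "set (ds @ cs) = N - {b}"
      using n1 n2 ps(1) as ns cs by (auto simp: ncl_def)
    have cross: "R' \<inter> P \<times> N = {(a, b)}" using one uv PN(3) by (auto simp: R'_def)
    have dis: "set [a, b] \<inter> set (ds @ cs) = {}" "R' \<inter> set [a] \<times> set (ds @ cs) = {}"
        "set ((bs @ as) @ [a]) \<inter> set (b # ds @ cs) = {}" "R' \<inter> set (bs @ as) \<times> set (b # ds @ cs) = {}"
      using sets cross ab PN(3) by auto
    have "a \<noteq> b" using ab PN(3) by auto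
    then have "ncl R' [a, b]" by (simp add: ncl_def)
    \<comment> \<open>Two gluings: first the order \<open>[a, b]\<close> with that of
      \<open>N\<close> at \<open>b\<close>, then the order of \<open>P\<close> with the result at
      \<open>a\<close>.\<close>
    then have "ncl R' ([a] @ (b # ds @ cs))"
      using ncl_append[OF _ n2, where ws = "[b]" and zs = "ds @ cs" and vs = "[a]"] dis(1,2) sub(3) by simp
    then have "ncl R' ((bs @ as) @ ([a] @ (b # ds @ cs)))"
      using ncl_append[OF n1, where ws = "[a]" and zs = "b # ds @ cs" and vs = "bs @ as"] dis(3,4) sub(3) by simp
    moreover have "set ((bs @ as) @ ([a] @ (b # ds @ cs))) = V"
    proof -
      have "set ((bs @ as) @ ([a] @ (b # ds @ cs))) = P \<union> N" using sets ab by auto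
      then show ?thesis by (simp flip: V)
    qed
    ultimately have "outerplanar \<lparr> pverts = V, parcs = R' \<rparr>"
      by (intro ncl_outerplanar[OF pair_graphI[OF fin sub(2-4)]]) simp_all
    moreover have "cut_connected V R'" by (rule cut_connected_mono[OF con sub(1)])
    moreover have "R' \<inter> P \<times> P \<noteq> R \<inter> P \<times> P" using uv by (auto simp: R'_def)
    ultimately show False using gain[OF sub(2-4)] \<open>R' \<inter> N \<times> N = R \<inter> N \<times> N\<close> cross one sub(1) by blast
  qed
  ultimately show "edge_maximal_outerplanar \<lparr> pverts = P, parcs = R \<inter> P \<times> P \<rparr>"
    using GP by (simp add: edge_maximal_outerplanar_def)
qed

lemmas even_structure_N = signed_eigenvector.even_structure[OF minus, unfolded minus_simps]

end

section \<open>Extremal graphs\<close>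

text \<open>An optimal graph is the fan up to a relabelling \<open>h\<close>; both its bound and its
  maximiser are pulled back along \<open>h\<close>.\<close>

lemma rmax_fan:
  assumes q: "q \<noteq> 5"
  obtains y where "0 < nrm {..q} y" "qf (sy (fan_edges q)) y = rmax (Suc q) * nrm {..q} y"
    "\<And>z. qf (sy (fan_edges q)) z \<le> rmax (Suc q) * nrm {..q} z"
proof -
  have k: "1 \<le> Suc q" by simp
  obtain E x where E: "admissible (Suc q) E" "path_edge_set (Suc q) \<subseteq> E" "nrm {..<Suc q} x = 1"
    "\<forall>v<Suc q. 0 < x v" "qf (sy E) x = rmax (Suc q)" using rmax_eigenvector[OF k] by blast
  obtain h where h: "bij_betw h {..q} {..q}" "sy E = map_prod h h ` sy (fan_edges q)"
    using maximiser_fan[OF q E(1), of x] E(3,5) by auto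
  have inj: "inj_on h {..q}" and im: "h ` {..q} = {..q}" using h(1) by (auto simp: bij_betw_def)
  have sub: "sy (fan_edges q) \<subseteq> {..q} \<times> {..q}" by (auto simp: sy_def fan_edges_def)
  have qh: "qf (sy E) z = qf (sy (fan_edges q)) (z \<circ> h)" for z unfolding h(2) by (rule qf_map[OF inj sub])
  have nh: "nrm {..q} z = nrm {..q} (z \<circ> h)" for z using nrm_map[OF inj, of z] im by simp
  show ?thesis
  proof (rule that[of "x \<circ> h"])
    show "0 < nrm {..q} (x \<circ> h)" using E(3) nh[of x] by (simp add: lessThan_Suc_atMost)
    show "qf (sy (fan_edges q)) (x \<circ> h) = rmax (Suc q) * nrm {..q} (x \<circ> h)"
      using E(3,5) nh[of x] qh[of x] by (simp add: lessThan_Suc_atMost)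
    fix z :: "nat \<Rightarrow> real"
    define w where "w = z \<circ> the_inv_into {..q} h"
    have w: "(w \<circ> h) v = z v" if "v \<le> q" for v
      using that the_inv_into_f_f[OF inj, of v] by (simp add: w_def)
    have "qf (sy (fan_edges q)) z = qf (sy (fan_edges q)) (w \<circ> h)"
      by (rule qf_cong) (use w sub in auto)
    also have "\<dots> \<le> rmax (Suc q) * nrm {..q} w"
      using rmax_bound[OF E(1) k, of w] qh[of w] by (simp add: lessThan_Suc_atMost)
    also have "nrm {..q} w = nrm {..q} (w \<circ> h)" by (rule nh)
    also have "\<dots> = nrm {..q} z" by (rule nrm_cong) (use w in auto)
    finally show "qf (sy (fan_edges q)) z \<le> rmax (Suc q) * nrm {..q} z" .
  qed
qed

lemma rho_fan_graph:
  assumes q: "q \<noteq> 5"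
  shows "rho (fan_graph q) = rmax (Suc q)"
proof -
  obtain y where y: "0 < nrm {..q} y" "qf (sy (fan_edges q)) y = rmax (Suc q) * nrm {..q} y"
    "\<And>z. qf (sy (fan_edges q)) z \<le> rmax (Suc q) * nrm {..q} z" by (rule rmax_fan[OF q]) blast
  note l = fan_graph_label[of q]
  define f where "f = the_inv_into (pverts (fan_graph q)) fan_label"
  have f: "f (fan_label u) = u" if "u \<in> pverts (fan_graph q)" for u
    unfolding f_def by (rule the_inv_into_f_f[OF l(1) that])
  have qf: "qf (sy (fan_edges q)) z = qf (parcs (fan_graph q)) (z \<circ> fan_label)" for z
    unfolding l(3)[symmetric] by (rule qf_map[OF l(1,4)])
  have nr: "nrm {..q} z = nrm (pverts (fan_graph q)) (z \<circ> fan_label)" for z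
    unfolding l(2)[symmetric] by (rule nrm_map[OF l(1)])
  show ?thesis
  proof (rule rho_eqI[OF fan_graph_pair_graph, where x = "y \<circ> fan_label"])
    fix z :: "nat + nat \<Rightarrow> real"
    have "qf (parcs (fan_graph q)) z = qf (parcs (fan_graph q)) ((z \<circ> f) \<circ> fan_label)"
      by (rule qf_cong) (use f l(4) in auto)
    also have "\<dots> \<le> rmax (Suc q) * nrm (pverts (fan_graph q)) ((z \<circ> f) \<circ> fan_label)"
      using y(3)[of "z \<circ> f"] unfolding qf nr .
    also have "nrm (pverts (fan_graph q)) ((z \<circ> f) \<circ> fan_label) = nrm (pverts (fan_graph q)) z"
      by (rule nrm_cong) (use f in auto)
    finally show "qf (parcs (fan_graph q)) z \<le> rmax (Suc q) * nrm (pverts (fan_graph q)) z" .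
  next
    show "0 < nrm (pverts (fan_graph q)) (y \<circ> fan_label)" using y(1) unfolding nr .
    show "rmax (Suc q) * nrm (pverts (fan_graph q)) (y \<circ> fan_label) \<le> qf (parcs (fan_graph q)) (y \<circ> fan_label)"
      using y(2) unfolding nr qf by simp
  qed simp
qed

lemma rmax_upper:
  assumes q: "q \<noteq> 5" "1 \<le> q"
  shows "rmax (Suc q) \<le> 1 + sqrt (real q + 1)"
proof -
  obtain y where y: "0 < nrm {..q} y" "qf (sy (fan_edges q)) y = rmax (Suc q) * nrm {..q} y"
    "\<And>z. qf (sy (fan_edges q)) z \<le> rmax (Suc q) * nrm {..q} z" by (rule rmax_fan[OF q(1)]) blast
  have "rmax (Suc q) * nrm {..q} y \<le> (1 + sqrt (real q + 1)) * nrm {..q} y"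
    using fan_quad_upper[of q y] y(2) q(2) by (simp add: nrm_def)
  then show ?thesis using y(1) by simp
qed

text \<open>This \<open>r\<close> satisfies \<open>r * (r - 2) = q - 2\<close>, and
  \<open>t \<le> 1 / 2\<close> bounds the correction \<open>2 * (t / (1 - t))\<close> by 2. The
  assumption on \<open>q\<close> ensures \<open>5 / 2 \<le> r\<close>, which provides such a
  \<open>t\<close>.\<close>

lemma rmax_lower:
  assumes q: "4 \<le> q"
  shows "1 + sqrt (real q - 1) < rmax (Suc q)"
proof -
  define r where "r = 1 + sqrt (real q - 1)"
  have "sqrt ((3 / 2)\<^sup>2) \<le> sqrt (real q - 1)" using q by (intro real_sqrt_le_mono) (simp add: power2_eq_square)
  then have r: "5 / 2 \<le> r" unfolding r_def by simp
  obtain t where t: "0 < t" "t \<le> 1 / 2" "t * t + 1 = r * t" using ex_recip_sum[OF r] by blast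
  have "t / (1 - t) \<le> 1" using t by (simp add: field_simps)
  moreover have "r * (r - 2) = real q - 2"
  proof -
    have "r * (r - 2) = (sqrt (real q - 1))\<^sup>2 - 1" by (simp add: r_def power2_eq_square algebra_simps)
    also have "\<dots> = real q - 2" using q by simp
    finally show ?thesis .
  qed
  ultimately have "r * (r - 2) \<le> real q - 2 * (t / (1 - t))" by linarith
  moreover have "1 \<le> q" "2 < r" using q r by auto
  ultimately obtain z where z: "r * (\<Sum>v\<le>q. (z v)\<^sup>2) < qf (sy (fan_edges q)) z"
    using fan_quad_lower[of q r t] t by blast
  have "admissible (Suc q) (fan_edges q)" using tri_admissible[OF tri_fan] q by simp
  then have "qf (sy (fan_edges q)) z \<le> rmax (Suc q) * nrm {..<Suc q} z" by (rule rmax_bound) simp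
  then have "r * nrm {..q} z < rmax (Suc q) * nrm {..q} z" using z by (simp add: nrm_def lessThan_Suc_atMost)
  then show ?thesis unfolding r_def[symmetric] using nrm_nonneg[of "{..q}" z] by (simp add: mult_less_cancel_right)
qed

lemma extremal_eigenvector:
  assumes G: "lambda2_extremal n G" and n: "2 \<le> n"
  obtains xs x where "signed_eigenvector (pverts G) (parcs G) xs x (lambda2 G)"
proof -
  have g: "pair_graph G" "card (pverts G) = n" "Digraph_Component.connected (with_proj G)" "outerplanar G"
    using G by (auto simp: lambda2_extremal_def connected_outerplanar_on_def)
  have ne: "pverts G \<noteq> {}" using g(2) n by auto
  have con: "cut_connected (pverts G) (parcs G)" using connected_iff_cut_connected[OF g(1) ne] g(3) by simp
  obtain xs where xs: "set xs = pverts G" "ncl (parcs G) xs" by (rule outerplanar_ncl[OF g(1,4)])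
  obtain x where x: "\<forall>u\<in>pverts G. sum x (parcs G `` {u}) = lambda2 G * x u"
    "\<exists>u\<in>pverts G. 0 < x u" "\<exists>u\<in>pverts G. x u < 0"
    by (rule lambda2_signed_eigenvector[OF g(1) _ con]) (use g(2) n in simp)
  show ?thesis
  proof (rule that, unfold_locales)
    show "sum x (parcs G `` {u}) = lambda2 G * x u" if "u \<in> pverts G" for u using x(1) that by blast
  qed (use pair_graph_arcs[OF g(1)] xs x con in simp_all)
qed

lemma extremal_maximal:
  fixes G :: "'a pair_pre_digraph"
  assumes G: "lambda2_extremal n G" and n: "2 \<le> n"
    and R: "R \<subseteq> pverts G \<times> pverts G" "sym R" "irrefl R" "cut_connected (pverts G) R"
      "outerplanar \<lparr> pverts = pverts G, parcs = R \<rparr>"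
  shows "lambda2 \<lparr> pverts = pverts G, parcs = R \<rparr> \<le> lambda2 G"
proof -
  have g: "pair_graph G" "card (pverts G) = n"
    using G by (auto simp: lambda2_extremal_def connected_outerplanar_on_def)
  have R': "pair_graph \<lparr> pverts = pverts G, parcs = R \<rparr>"
    by (rule pair_graphI[OF pair_graph_arcs(1)[OF g(1)] R(1-3)])
  have "pverts G \<noteq> {}" using g(2) n by auto
  then have "Digraph_Component.connected (with_proj \<lparr> pverts = pverts G, parcs = R \<rparr>)"
    using connected_iff_cut_connected[OF R'] R(4) by simp
  then have "connected_outerplanar_on n \<lparr> pverts = pverts G, parcs = R \<rparr>"
    using R' g(2) R(5) by (simp add: connected_outerplanar_on_def)
  then show ?thesis using G by (simp add: lambda2_extremal_def)
qed

text \<open>The zero of the eigenvector is the added vertex of \<open>family_I\<close>, and the sign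
  parts are the two blocks; both attain \<open>rmax m\<close>, so \<open>maximiser_iso\<close>
  identifies them.\<close>

theorem extremal_odd:
  fixes G :: "'a pair_pre_digraph"
  assumes G: "lambda2_extremal (2 * m + 1) G" and m: "1 \<le> m"
  shows "m \<noteq> 6 \<Longrightarrow> G \<in> family_I (fan_graph (m - 1)) (fan_graph (m - 1))"
    and "m = 6 \<Longrightarrow> G \<in> family_I graph_H graph_H"
proof -
  have n2: "2 \<le> 2 * m + 1" using m by simp
  have g: "pair_graph G" "card (pverts G) = 2 * m + 1" "Digraph_Component.connected (with_proj G)"
    "\<And>C :: 'a pair_pre_digraph. connected_outerplanar_on (2 * m + 1) C \<Longrightarrow> lambda2 C \<le> lambda2 G"
    using G by (auto simp: lambda2_extremal_def connected_outerplanar_on_def)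
  obtain C :: "'a pair_pre_digraph" where C: "connected_outerplanar_on (2 * m + 1) C" "rmax m \<le> lambda2 C"
    by (rule odd_lower[OF m pair_graph_arcs(1)[OF g(1)] g(2)])
  have low: "rmax m \<le> lambda2 G" using C(2) g(4)[OF C(1)] by simp
  obtain xs x where "signed_eigenvector (pverts G) (parcs G) xs x (lambda2 G)"
    by (rule extremal_eigenvector[OF G n2])
  then interpret signed_eigenvector "pverts G" "parcs G" xs x "lambda2 G" .
  obtain w where w: "w \<in> pverts G" "pverts G = insert w (P \<union> N)" "w \<notin> P \<union> N" "card P = m" "card N = m"
    "parcs G \<inter> P \<times> N = {}" "parcs G \<inter> N \<times> P = {}"
    "rmax m * nrm P x \<le> qf (parcs G \<inter> P \<times> P) x" "rmax m * nrm N x \<le> qf (parcs G \<inter> N \<times> N) x"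
    by (rule odd_structure[OF g(2) m low])
  define A B where "A = \<lparr> pverts = P, parcs = parcs G \<inter> P \<times> P \<rparr>" and "B = \<lparr> pverts = N, parcs = parcs G \<inter> N \<times> N \<rparr>"
  define S T where "S = {u \<in> P. (w, u) \<in> parcs G}" and "T = {u \<in> N. (w, u) \<in> parcs G}"
  have "parcs G = parcs A \<union> parcs B \<union> {w} \<times> (S \<union> T) \<union> (S \<union> T) \<times> {w}"
  proof (rule equalityI; rule subsetI)
    fix e assume e: "e \<in> parcs G"
    obtain u v where uv: "e = (u, v)" by (cases e)
    have "(w, w) \<notin> parcs G" using irr by (auto simp: irrefl_def)
    moreover have "u = w \<or> u \<in> P \<or> u \<in> N" "v = w \<or> v \<in> P \<or> v \<in> N" using e uv arcs w(2) by blast+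
    moreover have "\<not> (u \<in> P \<and> v \<in> N)" "\<not> (u \<in> N \<and> v \<in> P)" using e uv w(6,7) by blast+
    moreover have "(u, v) \<in> parcs G" "(v, u) \<in> parcs G" using e swap uv by auto
    ultimately show "e \<in> parcs A \<union> parcs B \<union> {w} \<times> (S \<union> T) \<union> (S \<union> T) \<times> {w}"
      unfolding uv A_def B_def S_def T_def pair_pre_digraph.simps by blast
  next
    fix e assume "e \<in> parcs A \<union> parcs B \<union> {w} \<times> (S \<union> T) \<union> (S \<union> T) \<times> {w}"
    then show "e \<in> parcs G" using swap unfolding A_def B_def S_def T_def pair_pre_digraph.simps by blast
  qed
  then have Geq: "G = \<lparr> pverts = insert w (pverts A \<union> pverts B),
      parcs = parcs A \<union> parcs B \<union> {w} \<times> (S \<union> T) \<union> (S \<union> T) \<times> {w} \<rparr>"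
    using w(2) by (intro pair_pre_digraph.equality) (simp_all add: A_def B_def)
  have fam: "G \<in> family_I K K"
    if "digraph_iso (with_proj K) (with_proj A)" "digraph_iso (with_proj K) (with_proj B)"
    for K :: "'b pair_pre_digraph"
  proof -
    have "pverts A \<inter> pverts B = {}" "w \<notin> pverts A \<union> pverts B" "S \<subseteq> pverts A" "T \<subseteq> pverts B"
      using w(3) PN(3) by (auto simp: A_def B_def S_def T_def)
    then show ?thesis unfolding family_I_def using that Geq g(3) by blast
  qed
  have sub: "P \<subseteq> set xs" "N \<subseteq> set xs" using verts PN(1,2) by auto
  note iP = maximiser_iso[OF nc symR irr sub(1) P_part(2), unfolded w(4)]
  note iN = maximiser_iso[OF nc symR irr sub(2) N_part(2), unfolded w(5)]
  show "G \<in> family_I (fan_graph (m - 1)) (fan_graph (m - 1))" if "m \<noteq> 6"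
    using iP(1)[OF w(8) that] iN(1)[OF w(9) that] by (intro fam) (simp_all add: A_def B_def)
  show "G \<in> family_I graph_H graph_H" if "m = 6"
    using iP(2)[OF w(8) that] iN(2)[OF w(9) that] by (intro fam) (simp_all add: A_def B_def)
qed

lemma digraph_iso_refl: "parcs A \<subseteq> pverts A \<times> pverts A \<Longrightarrow> digraph_iso (with_proj A) (with_proj A)"
  using digraph_iso_image[of A id] by (cases A) (simp add: map_prod.id)

text \<open>The subgraphs induced on the sign parts serve as \<open>H1\<close> and
  \<open>H2\<close>, so that the isomorphisms required by \<open>family_E\<close> are
  identities.\<close>

theorem extremal_even:
  fixes G :: "'a pair_pre_digraph"
  assumes G: "lambda2_extremal (2 * m) G" and m: "1 \<le> m"
  shows "\<exists>(H1 :: 'a pair_pre_digraph) (H2 :: 'a pair_pre_digraph).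
      edge_maximal_outerplanar H1 \<and> card (pverts H1) = m \<and>
      edge_maximal_outerplanar H2 \<and> card (pverts H2) = m \<and> G \<in> family_E H1 H2"
    and "lambda2 G \<le> rmax m" and "2 \<le> m \<Longrightarrow> rmax (m - 1) < lambda2 G"
proof -
  have n2: "2 \<le> 2 * m" using m by simp
  have g: "pair_graph G" "card (pverts G) = 2 * m"
    "\<And>C :: 'a pair_pre_digraph. connected_outerplanar_on (2 * m) C \<Longrightarrow> lambda2 C \<le> lambda2 G"
    using G by (auto simp: lambda2_extremal_def connected_outerplanar_on_def)
  show low: "rmax (m - 1) < lambda2 G" if "2 \<le> m"
  proof -
    have k: "1 \<le> m - 1" "2 * m = 2 * (m - 1) + 2" using that by auto
    obtain C :: "'a pair_pre_digraph" where C: "connected_outerplanar_on (2 * (m - 1) + 2) C" "rmax (m - 1) < lambda2 C"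
      by (rule even_lower[OF k(1) pair_graph_arcs(1)[OF g(1)] g(2)[unfolded k(2)]])
    show ?thesis using C(2) g(3)[unfolded k(2), OF C(1)] by simp
  qed
  obtain xs x where "signed_eigenvector (pverts G) (parcs G) xs x (lambda2 G)"
    by (rule extremal_eigenvector[OF G n2])
  then interpret signed_eigenvector "pverts G" "parcs G" xs x "lambda2 G" .
  note maxi = extremal_maximal[OF G n2]
  have P: "pverts G = P \<union> N" "card P = m" "card N = m"
    "edge_maximal_outerplanar \<lparr> pverts = P, parcs = parcs G \<inter> P \<times> P \<rparr>"
    "\<exists>a b. a \<in> P \<and> b \<in> N \<and> parcs G \<inter> P \<times> N = {(a, b)}" and up: "lambda2 G \<le> rmax m"
    by (rule even_structure[OF g(2) m]; fact low maxi)+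
  have N: "edge_maximal_outerplanar \<lparr> pverts = N, parcs = parcs G \<inter> N \<times> N \<rparr>"
    by (rule even_structure_N(5)[OF g(2) m]; fact low maxi)
  show "lambda2 G \<le> rmax m" by (rule up)
  define A B where "A = \<lparr> pverts = P, parcs = parcs G \<inter> P \<times> P \<rparr>" and "B = \<lparr> pverts = N, parcs = parcs G \<inter> N \<times> N \<rparr>"
  obtain a b where ab: "a \<in> P" "b \<in> N" "parcs G \<inter> P \<times> N = {(a, b)}" using P(5) by blast
  have "parcs G = parcs A \<union> parcs B \<union> {(a, b), (b, a)}"
  proof (rule equalityI; rule subsetI)
    fix e assume e: "e \<in> parcs G"
    obtain u v where uv: "e = (u, v)" by (cases e)
    have "u \<in> P \<union> N" "v \<in> P \<union> N" using e uv arcs P(1) by blast+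
    moreover have "u \<in> P \<and> v \<in> N \<longrightarrow> u = a \<and> v = b" using ab(3) e uv by blast
    moreover have "v \<in> P \<and> u \<in> N \<longrightarrow> v = a \<and> u = b" using ab(3) e uv swap by blast
    moreover have "(u, v) \<in> parcs G" using e uv by simp
    ultimately show "e \<in> parcs A \<union> parcs B \<union> {(a, b), (b, a)}"
      unfolding uv A_def B_def pair_pre_digraph.simps by blast
  next
    fix e assume e: "e \<in> parcs A \<union> parcs B \<union> {(a, b), (b, a)}"
    have "(a, b) \<in> parcs G" "(b, a) \<in> parcs G" using ab(3) swap by blast+
    then show "e \<in> parcs G" using e unfolding A_def B_def pair_pre_digraph.simps by blast
  qed
  then have Geq: "G = add_edge a b \<lparr> pverts = pverts A \<union> pverts B, parcs = parcs A \<union> parcs B \<rparr>"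
    using P(1) by (intro pair_pre_digraph.equality) (simp_all add: A_def B_def add_edge_def)
  have "digraph_iso (with_proj A) (with_proj A)" "digraph_iso (with_proj B) (with_proj B)"
    by (rule digraph_iso_refl; auto simp: A_def B_def)+
  moreover have "pverts A \<inter> pverts B = {}" "a \<in> pverts A" "b \<in> pverts B"
    using PN(3) ab by (auto simp: A_def B_def)
  ultimately have "G \<in> family_E A B" unfolding family_E_def using Geq by blast
  then show "\<exists>(H1 :: 'a pair_pre_digraph) (H2 :: 'a pair_pre_digraph).
      edge_maximal_outerplanar H1 \<and> card (pverts H1) = m \<and>
      edge_maximal_outerplanar H2 \<and> card (pverts H2) = m \<and> G \<in> family_E H1 H2"
    using P(2-4) N by (intro exI[of _ A] exI[of _ B]) (simp add: A_def B_def)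
qed

text \<open>\<open>lambda2 G\<close> lies between \<open>rmax (m - 1)\<close> and
  \<open>rmax m\<close>, hence both it and \<open>rho\<close> lie between
  \<open>1 + sqrt (m - 3)\<close> and \<open>1 + sqrt m\<close>. The assumption
  \<open>7 \<le> m\<close> avoids \<open>m = 6\<close>, where the fan is not optimal.\<close>

lemma even_gap:
  fixes G :: "'a pair_pre_digraph"
  assumes G: "lambda2_extremal (2 * m) G" and m: "7 \<le> m"
  shows "\<bar>rho (fan_graph (m - 1)) - lambda2 G\<bar> \<le> 3 / sqrt (real m)"
proof -
  define q where "q = m - 2"
  have q: "m = Suc (Suc q)" "5 \<le> q" using m by (simp_all add: q_def)
  have "rho (fan_graph (m - 1)) = rmax m" using rho_fan_graph[of "Suc q"] q by simp
  moreover have "lambda2 G \<le> rmax m" "rmax (Suc q) < lambda2 G" using extremal_even(2,3)[OF G] q by simp_all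
  moreover have "rmax m \<le> 1 + sqrt (real m)" using rmax_upper[of "Suc q"] q by simp
  moreover have "1 + sqrt (real m - 3) < rmax (Suc q)" using rmax_lower[of q] q by simp
  moreover have "sqrt (real m) - sqrt (real m - 3) \<le> 3 / sqrt (real m)"
  proof -
    have pos: "0 < sqrt (real m)" "0 \<le> sqrt (real m - 3)" "sqrt (real m - 3) \<le> sqrt (real m)" using m by simp_all
    have "sqrt (real m) * (sqrt (real m) - sqrt (real m - 3)) \<le>
        (sqrt (real m) + sqrt (real m - 3)) * (sqrt (real m) - sqrt (real m - 3))"
      using pos by (intro mult_right_mono) simp_all
    also have "\<dots> = (sqrt (real m))\<^sup>2 - (sqrt (real m - 3))\<^sup>2" by (simp add: power2_eq_square algebra_simps)
    also have "\<dots> = 3" using m by simp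
    finally show ?thesis using pos(1) by (simp add: pos_le_divide_eq mult.commute)
  qed
  ultimately show ?thesis by linarith
qed

theorem theorem3p22:
  shows "(\<forall>n (G :: 'a pair_pre_digraph). n \<ge> 2 \<and> lambda2_extremal n G \<and> odd n \<longrightarrow>
            (if n \<noteq> 13
             then G \<in> family_I (graph_join (path_graph 1) (path_graph ((n - 1) div 2 - 1)))
                               (graph_join (path_graph 1) (path_graph ((n - 1) div 2 - 1)))
             else G \<in> family_I graph_H graph_H)) \<and>
         (\<exists>err :: nat \<Rightarrow> real. err \<in> o(\<lambda>_. 1) \<and>
           (\<forall>n (G :: 'a pair_pre_digraph). n \<ge> 2 \<and> lambda2_extremal n G \<and> even n \<longrightarrow>
              (\<exists>(H1 :: 'a pair_pre_digraph) (H2 :: 'a pair_pre_digraph).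
                 edge_maximal_outerplanar H1 \<and> card (pverts H1) = n div 2 \<and>
                 edge_maximal_outerplanar H2 \<and> card (pverts H2) = n div 2 \<and>
                 G \<in> family_E H1 H2) \<and>
              lambda2 G =
                rho (graph_join (path_graph 1) (path_graph (n div 2 - 1))) - err n))"
proof (intro conjI allI impI)
  fix n and G :: "'a pair_pre_digraph"
  assume h: "n \<ge> 2 \<and> lambda2_extremal n G \<and> odd n"
  then obtain m where n: "n = 2 * m + 1" by (auto elim: oddE)
  then have m: "1 \<le> m" "(n - 1) div 2 = m" "n = 13 \<longleftrightarrow> m = 6" using h by auto
  have "lambda2_extremal (2 * m + 1) G" using h n by simp
  from extremal_odd[OF this m(1)]
  show "if n \<noteq> 13 then G \<in> family_I (fan_graph ((n - 1) div 2 - 1)) (fan_graph ((n - 1) div 2 - 1))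
      else G \<in> family_I graph_H graph_H"
    unfolding m(2,3) by simp
next
  \<comment> \<open>The error has to depend on \<open>n\<close> alone. All extremal graphs on
    \<open>n\<close> vertices share their \<open>lambda2\<close>, so a chosen one,
    \<open>X n\<close>, represents them.\<close>
  define X where "X n = (SOME G :: 'a pair_pre_digraph. lambda2_extremal n G)" for n
  have X: "lambda2_extremal n (X n)" "lambda2 (X n) = lambda2 G" if "lambda2_extremal n G"
    for n and G :: "'a pair_pre_digraph"
  proof -
    show "lambda2_extremal n (X n)" unfolding X_def by (rule someI[of "lambda2_extremal n", OF that])
    then show "lambda2 (X n) = lambda2 G" using that by (auto simp: lambda2_extremal_def intro!: antisym)
  qed
  \<comment> \<open>The value 0 covers odd \<open>n\<close> and those \<open>n\<close> for which the
    vertex type carries no extremal graph.\<close>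
  define err where "err n = (if even n \<and> (\<exists>G :: 'a pair_pre_digraph. lambda2_extremal n G)
    then rho (fan_graph (n div 2 - 1)) - lambda2 (X n) else 0)" for n
  have "\<bar>err n\<bar> \<le> 3 / sqrt (real (n div 2))" if "14 \<le> n" for n
  proof (cases "even n \<and> (\<exists>G :: 'a pair_pre_digraph. lambda2_extremal n G)")
    case True
    then have "lambda2_extremal (2 * (n div 2)) (X n)" using X(1) by auto
    then show ?thesis using even_gap[of "n div 2" "X n"] that True by (simp add: err_def)
  next
    case False
    then have "err n = 0" unfolding err_def by (rule if_not_P)
    then show ?thesis by simp
  qed
  then have "\<forall>\<^sub>F n in sequentially. norm (err n) \<le> 3 / sqrt (real (n div 2))"
    by (auto simp: eventually_sequentially)
  moreover have "(\<lambda>n. 3 / sqrt (real (n div 2))) \<longlonglongrightarrow> 0"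
  proof -
    have "filterlim (\<lambda>n::nat. n div 2) at_top sequentially"
      unfolding filterlim_at_top eventually_sequentially
    proof
      fix Z :: nat
      show "\<exists>N. \<forall>n\<ge>N. Z \<le> n div 2" by (rule exI[of _ "2 * Z"]) auto
    qed
    then have "filterlim (\<lambda>n. sqrt (real (n div 2))) at_top sequentially"
      by (intro filterlim_compose[OF sqrt_at_top] filterlim_compose[OF filterlim_real_sequentially])
    then show ?thesis by (intro tendsto_divide_0[OF tendsto_const] filterlim_at_top_imp_at_infinity)
  qed
  ultimately have "err \<longlonglongrightarrow> 0" by (rule Lim_null_comparison)
  then have "err \<in> o(\<lambda>_. 1)" by (intro smalloI_tendsto) auto
  moreover have "lambda2 G = rho (fan_graph (n div 2 - 1)) - err n"
    if "lambda2_extremal n G" "even n" for n and G :: "'a pair_pre_digraph"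
  proof -
    have "\<exists>G :: 'a pair_pre_digraph. lambda2_extremal n G" using that(1) by blast
    then show ?thesis using that(2) X(2)[OF that(1)] by (simp add: err_def)
  qed
  moreover have "\<exists>(H1 :: 'a pair_pre_digraph) (H2 :: 'a pair_pre_digraph).
      edge_maximal_outerplanar H1 \<and> card (pverts H1) = n div 2 \<and>
      edge_maximal_outerplanar H2 \<and> card (pverts H2) = n div 2 \<and> G \<in> family_E H1 H2"
    if "2 \<le> n" "lambda2_extremal n G" "even n" for n and G :: "'a pair_pre_digraph"
  proof -
    have "lambda2_extremal (2 * (n div 2)) G" "1 \<le> n div 2" using that by auto
    then show ?thesis by (rule extremal_even(1))
  qed
  ultimately show "\<exists>err :: nat \<Rightarrow> real. err \<in> o(\<lambda>_. 1) \<and>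
      (\<forall>n (G :: 'a pair_pre_digraph). n \<ge> 2 \<and> lambda2_extremal n G \<and> even n \<longrightarrow>
         (\<exists>(H1 :: 'a pair_pre_digraph) (H2 :: 'a pair_pre_digraph).
            edge_maximal_outerplanar H1 \<and> card (pverts H1) = n div 2 \<and>
            edge_maximal_outerplanar H2 \<and> card (pverts H2) = n div 2 \<and> G \<in> family_E H1 H2) \<and>
         lambda2 G = rho (fan_graph (n div 2 - 1)) - err n)"
    by blast
qed

end
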